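(* Let $K$ be a field of characteristic different from $2$ and let $\{q_1,q_2\}$ be a nonsingular pair of quadratic forms on a finite-dimensional $K$-vector space $V$. Then the following conditions are equivalent: (a) $n\times\{q_i\}_{i=1,2}$ is hyperbolic for some $n\in\mathbb{N}$. (b$'$) For every ordering $P$ of $K$ and every $q\in\mathrm{Cl}\{(q_1)_{K_P},(q_2)_{K_P}\}$, we have $\mathrm{sgn}\,q=0$, where $K_P$ is the real closure of $K$ relative to $P$ and $(q_i)_{K_P}$ is the base change of $q_i$ to $V\otimes_K K_P$.
   Context: $\mathbb{N}$ denotes the positive integers. The same letter denotes a quadratic form $q:V\to K$ and its bilinear form $q(x,y)=\frac12(q(x+y)-q(x)-q(y))$; quadratic forms need not be unimodular (i.e. nondegenerate). $n\times q$ is the quadratic form $(v_1,\dots,v_n)\mapsto\sum_i q(v_i)$ on $V^n$, and $n\times\{q_i\}_{i\in I}=\{n\times q_i\}_{i\in I}$. A system $\{q_i\}_{i\in I}$ of quadratic forms on $V$ is hyperbolic if $V=U\oplus U'$ for $K$-subspaces $U,U'$ such that every $q_i$ vanishes on $U$ and on $U'$. It is nonsingular if there is a field extension $L/K$ such that $\mathrm{span}_L\{(q_i)_L : i\in I\}$ contains a unimodular quadratic form over $L$. For a system $\{q_i\}_{i\in I}$ of quadratic forms on a vector space $V$ over a field $K$, the algebra of adjoints $A(\{q_i\}_{i\in I})$ is the $K$-subalgebra of $\mathrm{End}_K(V)\times\mathrm{End}_K(V)^{\mathrm{op}}$ of pairs $(\phi,\psi^{\mathrm{op}})$ with $q_i(\psi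 x,y)=q_i(x,\phi y)$ for all $x,y\in V$, $i\in I$. $\mathrm{Cl}\{q_i : i\in I\}$ is the $K$-vector space of all quadratic forms $q:V\to K$ such that adjoining $q$ to the system does not change the algebra of adjoints, i.e. $q(\psi x,y)=q(x,\phi y)$ for all $x,y\in V$ and all $(\phi,\psi^{\mathrm{op}})\in A(\{q_i\}_{i\in I})$. In (b$'$) this is applied over the field $K_P$. The signature $\mathrm{sgn}\,q$ of a possibly degenerate quadratic form over the real closed field $K_P$ (which has a unique ordering) is the largest dimension of a subspace on which $q$ is positive definite minus the largest dimension of a subspace on which it is negative definite. *)

theory Defs
  imports
    "HOL-Library.FuncSet"
    "HOL-Library.Function_Algebras"
    "HOL-Algebra.Algebraic_Closure_Type"
begin

text \<open>
  The real closure of a field \<open>K\<close> depends on an ordering, so it cannot be a type; it is a subset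
  \<open>R\<close> of the type of the algebraic closure of \<open>K\<close>. Linear algebra is therefore relativised to a
  field given by a carrier set \<open>F\<close>, acting by \<open>s\<close> on a vector space given by a carrier set \<open>W\<close>.
\<close>

definition subfield_set :: "'a::field set \<Rightarrow> bool" where
  "subfield_set F \<longleftrightarrow> 0 \<in> F \<and> 1 \<in> F \<and>
     (\<forall>x\<in>F. \<forall>y\<in>F. x + y \<in> F \<and> x * y \<in> F) \<and> (\<forall>x\<in>F. - x \<in> F \<and> inverse x \<in> F)"

definition field_embedding :: "('a::field \<Rightarrow> 'b::field) \<Rightarrow> bool" where
  "field_embedding \<iota> \<longleftrightarrow> \<iota> 1 = 1 \<and> (\<forall>x y. \<iota> (x + y) = \<iota> x + \<iota> y \<and> \<iota> (x * y) = \<iota> x * \<iota> y)"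

definition subspace_on :: "'a::field set \<Rightarrow> ('a \<Rightarrow> 'w::ab_group_add \<Rightarrow> 'w) \<Rightarrow> 'w set \<Rightarrow> 'w set \<Rightarrow> bool" where
  "subspace_on F s W U \<longleftrightarrow> U \<subseteq> W \<and> 0 \<in> U \<and>
     (\<forall>x\<in>U. \<forall>y\<in>U. x + y \<in> U) \<and> (\<forall>a\<in>F. \<forall>x\<in>U. s a x \<in> U)"

definition linear_endo_on :: "'a::field set \<Rightarrow> ('a \<Rightarrow> 'w::ab_group_add \<Rightarrow> 'w) \<Rightarrow> 'w set \<Rightarrow> ('w \<Rightarrow> 'w) \<Rightarrow> bool" where
  "linear_endo_on F s W \<phi> \<longleftrightarrow> (\<forall>x\<in>W. \<phi> x \<in> W) \<and>
     (\<forall>x\<in>W. \<forall>y\<in>W. \<phi> (x + y) = \<phi> x + \<phi> y) \<and> (\<forall>a\<in>F. \<forall>x\<in>W. \<phi> (s a x) = s a (\<phi> x))"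

definition basis_on :: "'a::field set \<Rightarrow> ('a \<Rightarrow> 'w::ab_group_add \<Rightarrow> 'w) \<Rightarrow> 'w set \<Rightarrow> 'w set \<Rightarrow> bool" where
  "basis_on F s U B \<longleftrightarrow> finite B \<and> B \<subseteq> U \<and>
     (\<forall>u\<in>U. \<exists>!c. c \<in> B \<rightarrow>\<^sub>E F \<and> u = (\<Sum>b\<in>B. s (c b) b))"

definition dim_on :: "'a::field set \<Rightarrow> ('a \<Rightarrow> 'w::ab_group_add \<Rightarrow> 'w) \<Rightarrow> 'w set \<Rightarrow> nat" where
  "dim_on F s U = (THE n. \<exists>B. basis_on F s U B \<and> card B = n)"

definition polar :: "('w::ab_group_add \<Rightarrow> 'a::field) \<Rightarrow> 'w \<Rightarrow> 'w \<Rightarrow> 'a" where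
  "polar q x y = (q (x + y) - q x - q y) / 2"

text \<open>
  A function is only meaningful on \<open>W\<close>; its values outside \<open>W\<close> play no role below.
\<close>

definition quadratic_form_on ::
    "'a::field set \<Rightarrow> ('a \<Rightarrow> 'w::ab_group_add \<Rightarrow> 'w) \<Rightarrow> 'w set \<Rightarrow> ('w \<Rightarrow> 'a) \<Rightarrow> bool" where
  "quadratic_form_on F s W q \<longleftrightarrow>
     (\<forall>x\<in>W. q x \<in> F) \<and>
     (\<forall>a\<in>F. \<forall>x\<in>W. q (s a x) = a ^ 2 * q x) \<and>
     (\<forall>x\<in>W. \<forall>y\<in>W. \<forall>z\<in>W. polar q (x + y) z = polar q x z + polar q y z) \<and>
     (\<forall>a\<in>F. \<forall>x\<in>W. \<forall>y\<in>W. polar q (s a x) y = a * polar q x y)"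

definition unimodular_on :: "'w::ab_group_add set \<Rightarrow> ('w \<Rightarrow> 'a::field) \<Rightarrow> bool" where
  "unimodular_on W q \<longleftrightarrow> (\<forall>x\<in>W. (\<forall>y\<in>W. polar q x y = 0) \<longrightarrow> x = 0)"

definition hyperbolic_on ::
    "'a::field set \<Rightarrow> ('a \<Rightarrow> 'w::ab_group_add \<Rightarrow> 'w) \<Rightarrow> 'w set \<Rightarrow> ('w \<Rightarrow> 'a) set \<Rightarrow> bool" where
  "hyperbolic_on F s W Q \<longleftrightarrow>
     (\<exists>U U'. subspace_on F s W U \<and> subspace_on F s W U' \<and>
        U \<inter> U' = {0} \<and> {u + u' | u u'. u \<in> U \<and> u' \<in> U'} = W \<and>
        (\<forall>q\<in>Q. (\<forall>x\<in>U. q x = 0) \<and> (\<forall>x\<in>U'. q x = 0)))"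

definition adjoints_on ::
    "'a::field set \<Rightarrow> ('a \<Rightarrow> 'w::ab_group_add \<Rightarrow> 'w) \<Rightarrow> 'w set \<Rightarrow> ('w \<Rightarrow> 'a) set
     \<Rightarrow> (('w \<Rightarrow> 'w) \<times> ('w \<Rightarrow> 'w)) set" where
  "adjoints_on F s W Q =
     {(\<phi>, \<psi>). linear_endo_on F s W \<phi> \<and> linear_endo_on F s W \<psi> \<and>
        (\<forall>q\<in>Q. \<forall>x\<in>W. \<forall>y\<in>W. polar q (\<psi> x) y = polar q x (\<phi> y))}"

definition Cl_on ::
    "'a::field set \<Rightarrow> ('a \<Rightarrow> 'w::ab_group_add \<Rightarrow> 'w) \<Rightarrow> 'w set \<Rightarrow> ('w \<Rightarrow> 'a) set \<Rightarrow> ('w \<Rightarrow> 'a) set" where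
  "Cl_on F s W Q =
     {q. quadratic_form_on F s W q \<and> adjoints_on F s W (insert q Q) = adjoints_on F s W Q}"

text \<open>\<open>V\<^sup>n\<close> consists of the sequences in \<open>V\<close> that vanish from index \<open>n\<close> on.\<close>

definition power_space :: "nat \<Rightarrow> (nat \<Rightarrow> 'v::ab_group_add) set" where
  "power_space n = {f. \<forall>i\<ge>n. f i = 0}"

definition power_scale :: "('a \<Rightarrow> 'v \<Rightarrow> 'v) \<Rightarrow> 'a \<Rightarrow> (nat \<Rightarrow> 'v) \<Rightarrow> nat \<Rightarrow> 'v" where
  "power_scale s a f = (\<lambda>i. s a (f i))"

definition power_form :: "nat \<Rightarrow> ('v \<Rightarrow> 'a::field) \<Rightarrow> (nat \<Rightarrow> 'v) \<Rightarrow> 'a" where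
  "power_form n q f = (\<Sum>i<n. q (f i))"

text \<open>
  Base change. Let \<open>B\<close> be a basis of \<open>V\<close> and \<open>\<iota>\<close> an embedding of \<open>K\<close> into \<open>F\<close>. The vectors
  \<open>b \<otimes> 1\<close> with \<open>b \<in> B\<close> form a basis of \<open>V \<otimes>\<^sub>K F\<close>; an element of \<open>V \<otimes>\<^sub>K F\<close> is
  represented by its family of coordinates in this basis, extended by zero outside \<open>B\<close>.
\<close>

definition ext_space :: "'v set \<Rightarrow> 'b::field set \<Rightarrow> ('v \<Rightarrow> 'b) set" where
  "ext_space B F = {f. (\<forall>b\<in>B. f b \<in> F) \<and> (\<forall>b. b \<notin> B \<longrightarrow> f b = 0)}"

definition ext_scale :: "'b::field \<Rightarrow> ('v \<Rightarrow> 'b) \<Rightarrow> 'v \<Rightarrow> 'b" where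
  "ext_scale a f = (\<lambda>b. a * f b)"

definition ext_form ::
    "('a::field \<Rightarrow> 'b::field) \<Rightarrow> 'v::ab_group_add set \<Rightarrow> ('v \<Rightarrow> 'a) \<Rightarrow> ('v \<Rightarrow> 'b) \<Rightarrow> 'b" where
  "ext_form \<iota> B q f = (\<Sum>b\<in>B. \<Sum>c\<in>B. \<iota> (polar q b c) * f b * f c)"

text \<open>The map \<open>v \<mapsto> v \<otimes> 1\<close>.\<close>

definition ext_vec ::
    "('a::field \<Rightarrow> 'b::field) \<Rightarrow> ('a \<Rightarrow> 'v::ab_group_add \<Rightarrow> 'v) \<Rightarrow> 'v set \<Rightarrow> 'v \<Rightarrow> 'v \<Rightarrow> 'b" where
  "ext_vec \<iota> s B v = (\<lambda>b. \<iota> (module.representation s B v b))"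

text \<open>
  The extension field \<open>L\<close> of \<open>K\<close> is the whole type \<open>'l\<close>, through the embedding \<open>\<iota>\<close>. The existence
  of an extension cannot be quantified in the logic; in a hypothesis of a theorem, an arbitrary
  \<open>\<iota>\<close> into an arbitrary type amounts to the same.
\<close>

definition nonsingular_over ::
    "('k::field \<Rightarrow> 'l::field) \<Rightarrow> 'v::ab_group_add set \<Rightarrow> ('v \<Rightarrow> 'k) set \<Rightarrow> bool" where
  "nonsingular_over \<iota> B Q \<longleftrightarrow> field_embedding \<iota> \<and>
     (\<exists>q \<in> module.span (\<lambda>c h x. c * h x) (ext_form \<iota> B ` Q). unimodular_on (ext_space B UNIV) q)"

text \<open>An ordering is given by its set \<open>P\<close> of nonnegative elements.\<close>

definition field_ordering :: "'a::field set \<Rightarrow> 'a set \<Rightarrow> bool" where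
  "field_ordering F P \<longleftrightarrow> P \<subseteq> F \<and> (\<forall>x\<in>P. \<forall>y\<in>P. x + y \<in> P \<and> x * y \<in> P) \<and>
     (\<forall>x\<in>F. x \<in> P \<or> - x \<in> P) \<and> (\<forall>x\<in>P. - x \<in> P \<longrightarrow> x = 0)"

definition real_closed :: "'a::field set \<Rightarrow> 'a set \<Rightarrow> bool" where
  "real_closed R T \<longleftrightarrow> subfield_set R \<and> field_ordering R T \<and>
     (\<forall>x\<in>T. \<exists>y\<in>R. x = y ^ 2) \<and>
     (\<forall>p. (\<forall>i. poly.coeff p i \<in> R) \<and> odd (degree p) \<longrightarrow> (\<exists>x\<in>R. poly p x = 0))"

text \<open>
  \<open>R\<close> with nonnegative elements \<open>T\<close> is a real closure of \<open>K\<close> relative to \<open>P\<close>. Algebraicity over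
  \<open>K\<close> is automatic, and every real closure has a copy inside the algebraic closure.
\<close>

definition is_real_closure :: "'k::field set \<Rightarrow> 'k alg_closure set \<Rightarrow> 'k alg_closure set \<Rightarrow> bool" where
  "is_real_closure P R T \<longleftrightarrow> real_closed R T \<and> range to_ac \<subseteq> R \<and> (\<forall>a. a \<in> P \<longleftrightarrow> to_ac a \<in> T)"

definition signature_on ::
    "'a::field set \<Rightarrow> 'a set \<Rightarrow> ('a \<Rightarrow> 'w::ab_group_add \<Rightarrow> 'w) \<Rightarrow> 'w set \<Rightarrow> ('w \<Rightarrow> 'a) \<Rightarrow> int" where
  "signature_on R T s W q =
     int (Max {dim_on R s U | U. subspace_on R s W U \<and> (\<forall>x\<in>U. x \<noteq> 0 \<longrightarrow> q x \<in> T - {0})}) -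
     int (Max {dim_on R s U | U. subspace_on R s W U \<and> (\<forall>x\<in>U. x \<noteq> 0 \<longrightarrow> - q x \<in> T - {0})})"


lemma field_embedding_to_ac: "field_embedding to_ac"
  by (simp add: field_embedding_def)

lemma field_embedding_0:
  assumes "field_embedding \<iota>" shows "\<iota> 0 = 0"
proof -
  have "\<iota> (0 + 0) = \<iota> 0 + \<iota> 0" using assms unfolding field_embedding_def by blast
  then show ?thesis by (metis add_0 add_cancel_right_right)
qed

lemma field_embedding_sum:
  assumes "field_embedding \<iota>" shows "\<iota> (\<Sum>x\<in>A. f x) = (\<Sum>x\<in>A. \<iota> (f x))"
  using assms field_embedding_0[OF assms]
  by (induction A rule: infinite_finite_induct) (auto simp: field_embedding_def)

lemma polar_sym: "polar q x y = polar q y x"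
  by (simp add: polar_def add.commute)

lemma polar_self:
  fixes s :: "'k::field \<Rightarrow> 'v::ab_group_add \<Rightarrow> 'v"
  assumes "(2::'k) \<noteq> 0" "vector_space s" "quadratic_form_on UNIV s UNIV q"
  shows "polar q x x = q x"
proof -
  interpret vector_space s by fact
  have "x + x = s 2 x" using scale_left_distrib[of 1 1 x] by simp
  then have "q (x + x) = 2 ^ 2 * q x" using assms(3) by (simp add: quadratic_form_on_def)
  then have "polar q x x = (2 * q x) / 2" by (simp add: polar_def)
  then show ?thesis using assms(1) by simp
qed

text \<open>
  The following facts say that \<open>ext_form \<iota> B q\<close> is the base change of \<open>q\<close>: the \<open>K\<close>-linear map
  \<open>ext_vec\<close> carries \<open>B\<close> to the standard basis of coordinate families, and \<open>ext_form \<iota> B q\<close> is a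
  quadratic form whose restriction along this map is \<open>\<iota> \<circ> q\<close>.
\<close>

lemma ext_vec_basis:
  assumes "finite_dimensional_vector_space s B" "field_embedding \<iota>" "b \<in> B"
  shows "ext_vec \<iota> s B b = (\<lambda>c. if c = b then 1 else 0)"
proof -
  interpret finite_dimensional_vector_space s B by fact
  show ?thesis
    using assms field_embedding_0[OF assms(2)] independent_Basis
    by (auto simp: ext_vec_def representation_basis field_embedding_def)
qed

lemma ext_vec_linear:
  assumes "finite_dimensional_vector_space s B" "field_embedding \<iota>"
  shows "ext_vec \<iota> s B (v + w) = ext_vec \<iota> s B v + ext_vec \<iota> s B w"
    and "ext_vec \<iota> s B (s a v) = ext_scale (\<iota> a) (ext_vec \<iota> s B v)"
proof -
  interpret finite_dimensional_vector_space s B by fact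
  show "ext_vec \<iota> s B (v + w) = ext_vec \<iota> s B v + ext_vec \<iota> s B w"
    using assms(2) independent_Basis span_Basis
    by (auto simp: ext_vec_def representation_add field_embedding_def)
  show "ext_vec \<iota> s B (s a v) = ext_scale (\<iota> a) (ext_vec \<iota> s B v)"
    using assms(2) independent_Basis span_Basis
    by (auto simp: ext_vec_def ext_scale_def representation_scale field_embedding_def)
qed

lemma ext_form_ext_vec:
  fixes s :: "'k::field \<Rightarrow> 'v::ab_group_add \<Rightarrow> 'v"
  assumes "(2::'k) \<noteq> 0" "finite_dimensional_vector_space s B" "field_embedding \<iota>"
    and q: "quadratic_form_on UNIV s UNIV q"
  shows "ext_form \<iota> B q (ext_vec \<iota> s B v) = \<iota> (q v)"
proof -
  interpret finite_dimensional_vector_space s B by fact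
  have add: "polar q (x + y) z = polar q x z + polar q y z"
    and sc: "polar q (s a x) y = a * polar q x y" for x y z a
    using q by (auto simp: quadratic_form_on_def)
  have zero: "polar q 0 y = 0" for y using sc[of 0 0 y] by simp
  have sum: "polar q (\<Sum>b\<in>A. s (c b) b) y = (\<Sum>b\<in>A. c b * polar q b y)" for A c y
    by (induction A rule: infinite_finite_induct) (auto simp: zero add sc)
  define r where "r = representation B v"
  have v: "(\<Sum>b\<in>B. s (r b) b) = v"
    unfolding r_def using independent_Basis span_Basis finite_Basis
    by (intro sum_representation_eq) auto
  have "polar q v v = (\<Sum>b\<in>B. r b * polar q b v)"
    using sum[of r B v] v by simp
  also have "\<dots> = (\<Sum>b\<in>B. r b * (\<Sum>c\<in>B. r c * polar q b c))"
  proof (intro sum.cong refl arg_cong2[where f = "(*)"])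
    fix b
    have "polar q b v = polar q v b" by (rule polar_sym)
    also have "\<dots> = (\<Sum>c\<in>B. r c * polar q c b)" using sum[of r B b] v by simp
    finally show "polar q b v = (\<Sum>c\<in>B. r c * polar q b c)" by (simp add: polar_sym[of q b])
  qed
  finally have "q v = (\<Sum>b\<in>B. \<Sum>c\<in>B. polar q b c * r b * r c)"
    using polar_self[OF assms(1) vector_space_axioms q]
    by (simp add: sum_distrib_left mult_ac)
  moreover have "\<iota> (x * y) = \<iota> x * \<iota> y" for x y
    using assms(3) by (simp add: field_embedding_def)
  ultimately show ?thesis
    by (simp add: ext_form_def ext_vec_def r_def[symmetric] field_embedding_sum[OF assms(3)])
qed

lemma polar_ext_form:
  fixes q :: "'v::ab_group_add \<Rightarrow> 'k::field" and \<iota> :: "'k \<Rightarrow> 'b::field"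
  assumes "(2::'k) \<noteq> 0" "field_embedding \<iota>"
  shows "polar (ext_form \<iota> B q) f g = (\<Sum>b\<in>B. \<Sum>c\<in>B. \<iota> (polar q b c) * f b * g c)"
proof -
  have add: "\<iota> (x + y) = \<iota> x + \<iota> y" and mult: "\<iota> (x * y) = \<iota> x * \<iota> y" and one: "\<iota> 1 = 1" for x y
    using assms(2) by (simp_all add: field_embedding_def)
  have "\<iota> 2 * \<iota> (inverse 2) = 1"
    using assms(1) by (simp add: one flip: mult)
  moreover have "\<iota> 2 = 2"
    using add[of 1 1] by (simp add: one)
  ultimately have two: "(2::'b) \<noteq> 0" by auto
  let ?S = "\<lambda>f g. \<Sum>b\<in>B. \<Sum>c\<in>B. \<iota> (polar q b c) * f b * g c"
  have "?S g f = (\<Sum>c\<in>B. \<Sum>b\<in>B. \<iota> (polar q b c) * g b * f c)"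
    by (rule sum.swap)
  also have "\<dots> = ?S f g"
    by (intro sum.cong refl) (simp add: polar_sym[of q] mult_ac)
  finally have "?S g f = ?S f g" .
  moreover have "ext_form \<iota> B q (f + g) - ext_form \<iota> B q f - ext_form \<iota> B q g = ?S f g + ?S g f"
    by (simp add: ext_form_def algebra_simps sum.distrib)
  ultimately have "polar (ext_form \<iota> B q) f g = (2 * ?S f g) / 2"
    by (simp add: polar_def)
  then show ?thesis using two by simp
qed

lemma quadratic_form_on_ext_form:
  fixes q :: "'v::ab_group_add \<Rightarrow> 'k::field"
  assumes "(2::'k) \<noteq> 0" "field_embedding \<iota>" "subfield_set F" "range \<iota> \<subseteq> F"
  shows "quadratic_form_on F ext_scale (ext_space B F) (ext_form \<iota> B q)"
proof -
  have sum: "(\<Sum>x\<in>A. h x) \<in> F" if "\<And>x. x \<in> A \<Longrightarrow> h x \<in> F" for h and A :: "'v set"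
    using that assms(3)
    by (induction A rule: infinite_finite_induct) (auto simp: subfield_set_def)
  have "ext_form \<iota> B q f \<in> F" if "f \<in> ext_space B F" for f
    unfolding ext_form_def
  proof (intro sum)
    fix b c assume "b \<in> B" "c \<in> B"
    moreover have "\<iota> (polar q b c) \<in> F" using assms(4) by blast
    ultimately show "\<iota> (polar q b c) * f b * f c \<in> F"
      using that assms(3) by (simp add: subfield_set_def ext_space_def)
  qed
  then show ?thesis
    unfolding quadratic_form_on_def polar_ext_form[OF assms(1,2)]
    by (auto simp: ext_form_def ext_scale_def algebra_simps sum.distrib sum_distrib_left
        power2_eq_square)
qed

end

theory Submission
  imports Defs "HOL-Computational_Algebra.Polynomial"
begin

text \<open>
  Some multiple of the system is hyperbolic if and only if some multiple \<open>m \<times> {q\<^sub>i}\<close> has an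
  anti-isometry: the graphs of \<open>f\<close> and \<open>-f\<close> are complementary totally isotropic subspaces.

  A hyperbolic splitting of \<open>V\<^sup>n\<close> gives an involution of \<open>V\<^sup>n\<close> that is anti-adjoint to itself for
  every \<open>q\<^sub>i\<close>. Its matrix entries are pairs in the algebra of adjoints, so after base change it is
  also an anti-isometry of \<open>n \<times> q\<close> for every \<open>q\<close> in the closure, and the signature of \<open>q\<close> vanishes.

  Conversely, suppose that no multiple has an anti-isometry over \<open>K\<close>, and let \<open>L\<close> be maximal among
  the fields between \<open>K\<close> and its algebraic closure over which this remains true. Transfers from
  simple extensions of \<open>L\<close> show that \<open>L\<close> is real closed, so it is a real closure of \<open>K\<close>. Over \<open>L\<close>
  the system is equivalent to \<open>\<beta>(x, y)\<close>, \<open>\<beta>(x, A y)\<close> with \<open>\<beta>\<close> nondegenerate and \<open>A\<close> self-adjoint,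
  and the forms \<open>\<beta>(x, p(A) x)\<close> lie in the closure. As their signatures vanish, Jordan chains of \<open>A\<close>
  at the eigenvalues in \<open>L\<close> cancel in pairs of opposite sign; on the complement \<open>-1\<close> is a sum of
  squares of polynomials in \<open>A\<close>, which gives an anti-isometry of a multiple there. So \<open>L\<close> has one too.
\<close>

section \<open>Linear algebra over a field given by a carrier set\<close>

text \<open>Condition (a) behaves like torsion in a Witt group, but pairs of forms cannot in general
  be diagonalised simultaneously. Anti-isometries are the working notion because they add, tensor
  with diagonal forms and transfer along finite extensions by explicit formulas, and because one on
  an orthogonal summand can be cancelled at the price of doubling (\<open>anti_cancel\<close>). The
  maximal field replaces the construction of a real closure for a given ordering: no ordering is
  fixed beforehand. The squares of \<open>L\<close> turn out to be the nonnegative elements of an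
  ordering, and the ordering of \<open>K\<close> to which (b') is applied is read off from them.
  Nonsingularity only promises a regular combination over some extension. Failure of torsion forces
  characteristic 0, hence infinitely many scalars, and then a regular combination exists over
  \<open>K\<close> itself. It makes the operator \<open>A\<close> available over \<open>L\<close>.
  Every adjoint pair is compatible with \<open>A\<close>, which is why the forms \<beta>(x, p(A) x)
  belong to the closure.\<close>

locale field_carrier =
  fixes L :: "'c::field set"
  assumes subfield_L: "subfield_set L"
begin

lemma L_0 [simp]: "0 \<in> L" and L_1 [simp]: "1 \<in> L"
  and L_add: "x \<in> L \<Longrightarrow> y \<in> L \<Longrightarrow> x + y \<in> L"
  and L_mult: "x \<in> L \<Longrightarrow> y \<in> L \<Longrightarrow> x * y \<in> L"
  and L_minus: "x \<in> L \<Longrightarrow> - x \<in> L"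
  and L_inverse: "x \<in> L \<Longrightarrow> inverse x \<in> L"
  using subfield_L by (auto simp: subfield_set_def)

lemma L_diff: "x \<in> L \<Longrightarrow> y \<in> L \<Longrightarrow> x - y \<in> L"
  using L_add[of x "- y"] L_minus[of y] by simp

lemma L_divide: "x \<in> L \<Longrightarrow> y \<in> L \<Longrightarrow> x / y \<in> L"
  using L_mult[of x "inverse y"] L_inverse[of y] by (simp add: divide_inverse)

lemma L_power: "x \<in> L \<Longrightarrow> x ^ n \<in> L"
  by (induction n) (auto intro: L_mult)

lemma L_sum: "(\<And>i. i \<in> I \<Longrightarrow> g i \<in> L) \<Longrightarrow> sum g I \<in> L"
  by (induction I rule: infinite_finite_induct) (auto intro: L_add)

lemma L_of_nat: "of_nat n \<in> L"
  by (induction n) (auto intro: L_add)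

lemma L_numeral: "numeral n \<in> L"
  using L_of_nat[of "numeral n"] by simp

lemmas L_closed = L_add L_mult L_minus L_inverse L_diff L_divide L_power L_sum L_of_nat L_numeral

text \<open>Gaussian elimination, one equation per induction step. The dimension counts below,
  including those for signatures and for degrees of field extensions, come down to this.\<close>

lemma homogeneous_system:
  assumes "finite E" "finite Y" "card E < card Y" "\<And>e x. e \<in> E \<Longrightarrow> x \<in> Y \<Longrightarrow> A e x \<in> L"
  shows "\<exists>c. (\<forall>x. c x \<in> L) \<and> (\<exists>x\<in>Y. c x \<noteq> 0) \<and> (\<forall>e\<in>E. (\<Sum>x\<in>Y. A e x * c x) = 0)"
  using assms
proof (induction E arbitrary: Y A rule: finite_induct)
  case empty
  then obtain x where "x \<in> Y" by fastforce
  then show ?case by (intro exI[of _ "\<lambda>_. 1"]) auto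
next
  case (insert e E)
  show ?case
  proof (cases "\<forall>x\<in>Y. A e x = 0")
    case True
    have "card E < card Y" using insert by simp
    then obtain c where "\<forall>x. c x \<in> L" "\<exists>x\<in>Y. c x \<noteq> 0" "\<forall>e\<in>E. (\<Sum>x\<in>Y. A e x * c x) = 0"
      using insert.IH[of Y A] insert.prems by auto
    with True show ?thesis by (intro exI[of _ c]) auto
  next
    case False
    then obtain x0 where x0: "x0 \<in> Y" "A e x0 \<noteq> 0" by auto
    define Y' where "Y' = Y - {x0}"
    \<comment> \<open>Equation \<open>e\<close> is solved for the pivot unknown \<open>x0\<close>
      and substituted into the other equations; \<open>d\<close> below supplies the value at the
      pivot.\<close>
    define A' where "A' = (\<lambda>e' x. A e' x - A e' x0 * A e x / A e x0)"
    have Y': "finite Y'" "Y = insert x0 Y'" "x0 \<notin> Y'"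
      using x0 insert.prems by (auto simp: Y'_def)
    have "card E < card Y'" using Y' insert by simp
    moreover have "\<And>e x. e \<in> E \<Longrightarrow> x \<in> Y' \<Longrightarrow> A' e x \<in> L"
      unfolding A'_def using insert.prems Y' x0 by (intro L_diff L_divide L_mult) auto
    ultimately obtain c where c: "\<forall>x. c x \<in> L" "\<exists>x\<in>Y'. c x \<noteq> 0" "\<forall>e\<in>E. (\<Sum>x\<in>Y'. A' e x * c x) = 0"
      using insert.IH[of Y' A'] Y'(1) by auto
    define S where "S = (\<Sum>x\<in>Y'. A e x * c x)"
    define d where "d = c(x0 := - S / A e x0)"
    have SL: "S \<in> L" unfolding S_def using insert.prems Y' c by (intro L_sum L_mult) auto
    have dsum: "(\<Sum>x\<in>Y. A e' x * d x) = A e' x0 * (- S / A e x0) + (\<Sum>x\<in>Y'. A e' x * c x)" for e'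
    proof -
      have "(\<Sum>x\<in>Y'. A e' x * d x) = (\<Sum>x\<in>Y'. A e' x * c x)"
        using Y' by (intro sum.cong) (auto simp: d_def)
      then show ?thesis using Y' by (simp add: d_def)
    qed
    have "(\<Sum>x\<in>Y. A e' x * d x) = 0" if "e' \<in> insert e E" for e'
    proof (cases "e' = e")
      case True
      then show ?thesis using dsum[of e] x0 by (simp add: S_def)
    next
      case False
      then have "e' \<in> E" using that by simp
      then have "0 = (\<Sum>x\<in>Y'. A' e' x * c x)" using c by simp
      also have "\<dots> = (\<Sum>x\<in>Y'. A e' x * c x) - (\<Sum>x\<in>Y'. A e' x0 / A e x0 * (A e x * c x))"
        unfolding A'_def by (simp add: algebra_simps sum_subtractf)
      also have "\<dots> = (\<Sum>x\<in>Y'. A e' x * c x) - A e' x0 / A e x0 * S"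
        by (simp only: S_def sum_distrib_left)
      finally show ?thesis using dsum[of e'] by simp
    qed
    moreover have "\<forall>x. d x \<in> L"
      using c x0 SL insert.prems by (auto simp: d_def intro!: L_divide L_minus)
    moreover have "\<exists>x\<in>Y. d x \<noteq> 0" using c Y' by (auto simp: d_def)
    ultimately show ?thesis by blast
  qed
qed

end

text \<open>Generation is expressed by minimality among subspaces instead of by coefficients: a
  property is extended from \<open>S\<close> to \<open>W\<close> by checking that it cuts out a
  subspace. \<open>gen_repr\<close> recovers coefficients where they are wanted.\<close>

definition gen_on :: "'a::field set \<Rightarrow> ('a \<Rightarrow> 'w::ab_group_add \<Rightarrow> 'w) \<Rightarrow> 'w set \<Rightarrow> 'w set \<Rightarrow> bool" where
  "gen_on L s W S \<longleftrightarrow> finite S \<and> S \<subseteq> W \<and> (\<forall>U. subspace_on L s W U \<and> S \<subseteq> U \<longrightarrow> U = W)"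

text \<open>The type carries a vector space over the whole field \<open>'c\<close>, and
  \<open>W\<close> is only an \<open>L\<close>-subspace of it. Scalar identities hold without side
  conditions; only membership in \<open>W\<close> has to be tracked.\<close>

locale lspace = field_carrier L + vector_space s
  for L :: "'c::field set" and s :: "'c \<Rightarrow> 'w::ab_group_add \<Rightarrow> 'w" +
  fixes W :: "'w set"
  assumes W_0 [simp]: "0 \<in> W"
    and W_add: "x \<in> W \<Longrightarrow> y \<in> W \<Longrightarrow> x + y \<in> W"
    and W_scale: "a \<in> L \<Longrightarrow> x \<in> W \<Longrightarrow> s a x \<in> W"
begin

lemma W_minus: "x \<in> W \<Longrightarrow> - x \<in> W"
  using W_scale[of "- 1" x] L_minus[of 1] by simp

lemma W_diff: "x \<in> W \<Longrightarrow> y \<in> W \<Longrightarrow> x - y \<in> W"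
  using W_add[of x "- y"] W_minus[of y] by simp

lemma W_sum: "(\<And>i. i \<in> I \<Longrightarrow> g i \<in> W) \<Longrightarrow> sum g I \<in> W"
  by (induction I rule: infinite_finite_induct) (auto intro: W_add)

lemma subspace_lspace: "subspace_on L s W U \<Longrightarrow> lspace L s U"
  by unfold_locales (auto simp: subspace_on_def)

lemma endo_0: "linear_endo_on L s W \<phi> \<Longrightarrow> \<phi> 0 = 0"
  unfolding linear_endo_on_def using W_0 by (metis add_cancel_right_right add_0)

lemma endo_minus: "linear_endo_on L s W \<phi> \<Longrightarrow> x \<in> W \<Longrightarrow> \<phi> (- x) = - \<phi> x"
  unfolding linear_endo_on_def using L_minus[OF L_1] by (metis scale_minus_left scale_one)

lemma endo_diff: "linear_endo_on L s W \<phi> \<Longrightarrow> x \<in> W \<Longrightarrow> y \<in> W \<Longrightarrow> \<phi> (x - y) = \<phi> x - \<phi> y"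
  using endo_minus[of \<phi> y] W_minus[of y] unfolding linear_endo_on_def
  by (metis add_uminus_conv_diff)

lemma endo_sum:
  "linear_endo_on L s W \<phi> \<Longrightarrow> (\<And>i. i \<in> I \<Longrightarrow> g i \<in> W) \<Longrightarrow> \<phi> (sum g I) = (\<Sum>i\<in>I. \<phi> (g i))"
proof (induction I rule: infinite_finite_induct)
  case (insert x F)
  have "sum g F \<in> W" using insert by (intro W_sum) auto
  with insert show ?case by (auto simp: linear_endo_on_def)
qed (auto simp: endo_0)

lemma endo_pow:
  assumes "linear_endo_on L s W \<phi>" shows "linear_endo_on L s W (\<phi> ^^ n)"
  using assms by (induction n) (auto simp: linear_endo_on_def)

lemma gen_repr:
  assumes "gen_on L s W S" "x \<in> W"
  shows "\<exists>c. (\<forall>v. c v \<in> L) \<and> x = (\<Sum>v\<in>S. s (c v) v)"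
proof -
  define U where "U = {x. \<exists>c. (\<forall>v. c v \<in> L) \<and> x = (\<Sum>v\<in>S. s (c v) v)}"
  have S: "finite S" "S \<subseteq> W" using assms by (auto simp: gen_on_def)
  have "subspace_on L s W U"
    unfolding subspace_on_def
  proof (intro conjI ballI subsetI)
    show "x \<in> W" if "x \<in> U" for x
      using that S unfolding U_def by (auto intro!: W_sum W_scale)
    show "0 \<in> U" unfolding U_def by (auto intro!: exI[of _ "\<lambda>_. 0"])
    show "x + y \<in> U" if xy: "x \<in> U" "y \<in> U" for x y
    proof -
      obtain c d where "\<forall>v. c v \<in> L" "x = (\<Sum>v\<in>S. s (c v) v)" "\<forall>v. d v \<in> L" "y = (\<Sum>v\<in>S. s (d v) v)"
        using xy by (auto simp: U_def)
      then show ?thesis unfolding U_def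
        by (auto intro!: exI[of _ "\<lambda>v. c v + d v"] L_add simp: scale_left_distrib sum.distrib)
    qed
    show "s a x \<in> U" if ax: "a \<in> L" "x \<in> U" for a x
    proof -
      obtain c where "\<forall>v. c v \<in> L" "x = (\<Sum>v\<in>S. s (c v) v)"
        using ax by (auto simp: U_def)
      then show ?thesis unfolding U_def using ax
        by (auto intro!: exI[of _ "\<lambda>v. a * c v"] L_mult simp: scale_sum_right)
    qed
  qed
  moreover have "S \<subseteq> U"
  proof
    fix v assume "v \<in> S"
    then have "(\<Sum>u\<in>S. s (if u = v then 1 else 0) u) = v"
      using S by (simp add: if_distrib[of "\<lambda>a. s a _"] cong: if_cong)
    then show "v \<in> U" unfolding U_def by (auto intro!: exI[of _ "\<lambda>u. if u = v then 1 else 0"])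
  qed
  ultimately have "U = W" using assms by (auto simp: gen_on_def)
  then show ?thesis using assms(2) by (auto simp: U_def)
qed

text \<open>The vectors form an indexed family and may repeat, so that the iterates of an
  endomorphism, or a family not known to be injective, can be inserted directly.\<close>

lemma gen_dependent:
  assumes "gen_on L s W S" "finite Y" "card S < card Y" "\<And>x. x \<in> Y \<Longrightarrow> u x \<in> W"
  shows "\<exists>c. (\<forall>x. c x \<in> L) \<and> (\<exists>x\<in>Y. c x \<noteq> 0) \<and> (\<Sum>x\<in>Y. s (c x) (u x)) = 0"
proof -
  have "\<forall>x\<in>Y. \<exists>c. (\<forall>v. c v \<in> L) \<and> u x = (\<Sum>v\<in>S. s (c v) v)"
    using gen_repr assms by blast
  then obtain A where A: "\<And>x v. x \<in> Y \<Longrightarrow> A x v \<in> L" "\<And>x. x \<in> Y \<Longrightarrow> u x = (\<Sum>v\<in>S. s (A x v) v)"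
    by metis
  have "finite S" using assms by (auto simp: gen_on_def)
  then obtain c where c: "\<forall>x. c x \<in> L" "\<exists>x\<in>Y. c x \<noteq> 0" "\<forall>v\<in>S. (\<Sum>x\<in>Y. A x v * c x) = 0"
    using homogeneous_system[of S Y "\<lambda>v x. A x v"] A assms by auto
  have "(\<Sum>x\<in>Y. s (c x) (u x)) = (\<Sum>x\<in>Y. \<Sum>v\<in>S. s (A x v * c x) v)"
    by (intro sum.cong refl) (simp add: A scale_sum_right mult.commute)
  also have "\<dots> = (\<Sum>v\<in>S. \<Sum>x\<in>Y. s (A x v * c x) v)" by (rule sum.swap)
  also have "\<dots> = (\<Sum>v\<in>S. s (\<Sum>x\<in>Y. A x v * c x) v)" by (simp add: scale_sum_left)
  also have "\<dots> = 0" using c by simp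
  finally show ?thesis using c by blast
qed

text \<open>The iterates of \<open>y\<close> under \<phi> are linearly dependent. Injectivity
  cancels the lowest power of \<phi> that occurs, and then a nonzero multiple of \<open>y\<close>
  lies in the image.\<close>

lemma inj_imp_surj:
  assumes gen: "gen_on L s W S" and lin: "linear_endo_on L s W \<phi>"
    and inj: "\<And>x. x \<in> W \<Longrightarrow> \<phi> x = 0 \<Longrightarrow> x = 0" and y: "y \<in> W"
  shows "\<exists>x\<in>W. \<phi> x = y"
proof -
  have pw: "(\<phi> ^^ k) x \<in> W" if "x \<in> W" for k x
    using endo_pow[OF lin, of k] that by (auto simp: linear_endo_on_def)
  have pinj: "x = 0" if "x \<in> W" "(\<phi> ^^ k) x = 0" for k x
    using that by (induction k) (use inj pw in auto)
  obtain c where c: "\<forall>k. c k \<in> L" "\<exists>k\<in>{..card S}. c k \<noteq> 0" "(\<Sum>k\<in>{..card S}. s (c k) ((\<phi> ^^ k) y)) = 0"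
    using gen_dependent[OF gen, of "{..card S}" "\<lambda>k. (\<phi> ^^ k) y"] pw[OF y] by auto
  define m where "m = (LEAST k. k \<le> card S \<and> c k \<noteq> 0)"
  have "\<exists>k. k \<le> card S \<and> c k \<noteq> 0" using c by auto
  then have m: "m \<le> card S" "c m \<noteq> 0" and mmin: "\<And>k. k < m \<Longrightarrow> c k = 0"
    unfolding m_def using LeastI_ex[of "\<lambda>k. k \<le> card S \<and> c k \<noteq> 0"] not_less_Least[of _ "\<lambda>k. k \<le> card S \<and> c k \<noteq> 0"]
    by (blast, blast, metis (no_types, lifting) le_trans less_imp_le not_less_Least LeastI_ex)
  \<comment> \<open>The tail of the relation with \<phi> taken out \<open>Suc m\<close> times: the
    relation becomes \<open>(\<phi> ^^ m) (s (c m) y + \<phi> z) = 0\<close>.\<close>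
  define z where "z = (\<Sum>k\<in>{Suc m..card S}. s (c k) ((\<phi> ^^ (k - Suc m)) y))"
  have zW: "z \<in> W" unfolding z_def using pw[OF y] c by (intro W_sum W_scale) auto
  have z1: "\<phi> z = (\<Sum>k\<in>{Suc m..card S}. s (c k) ((\<phi> ^^ (k - m)) y))"
  proof -
    have "\<phi> z = (\<Sum>k\<in>{Suc m..card S}. \<phi> (s (c k) ((\<phi> ^^ (k - Suc m)) y)))"
      unfolding z_def using pw[OF y] c by (intro endo_sum[OF lin] W_scale) auto
    also have "\<dots> = (\<Sum>k\<in>{Suc m..card S}. s (c k) (\<phi> ((\<phi> ^^ (k - Suc m)) y)))"
      using lin pw[OF y] c by (intro sum.cong refl) (auto simp: linear_endo_on_def)
    also have "\<dots> = (\<Sum>k\<in>{Suc m..card S}. s (c k) ((\<phi> ^^ (k - m)) y))"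
    proof (intro sum.cong refl)
      fix k assume "k \<in> {Suc m..card S}"
      then have "k - m = Suc (k - Suc m)" by auto
      then show "s (c k) (\<phi> ((\<phi> ^^ (k - Suc m)) y)) = s (c k) ((\<phi> ^^ (k - m)) y)" by simp
    qed
    finally show ?thesis .
  qed
  have "(\<phi> ^^ m) (s (c m) y + \<phi> z) = (\<Sum>k\<in>{m..card S}. (\<phi> ^^ m) (s (c k) ((\<phi> ^^ (k - m)) y)))"
  proof -
    have "s (c m) y + \<phi> z = (\<Sum>k\<in>{m..card S}. s (c k) ((\<phi> ^^ (k - m)) y))"
      unfolding z1 using m by (simp add: sum.atLeast_Suc_atMost)
    then show ?thesis using pw[OF y] c by (simp add: endo_sum[OF endo_pow[OF lin]] W_scale)
  qed
  also have "\<dots> = (\<Sum>k\<in>{m..card S}. s (c k) ((\<phi> ^^ k) y))"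
  proof (intro sum.cong refl)
    fix k assume k: "k \<in> {m..card S}"
    have "(\<phi> ^^ m) (s (c k) ((\<phi> ^^ (k - m)) y)) = s (c k) ((\<phi> ^^ m) ((\<phi> ^^ (k - m)) y))"
      using endo_pow[OF lin, of m] pw[OF y] c by (auto simp: linear_endo_on_def)
    also have "(\<phi> ^^ m) ((\<phi> ^^ (k - m)) y) = (\<phi> ^^ (m + (k - m))) y" by (simp only: funpow_add o_apply)
    finally show "(\<phi> ^^ m) (s (c k) ((\<phi> ^^ (k - m)) y)) = s (c k) ((\<phi> ^^ k) y)" using k by simp
  qed
  also have "\<dots> = (\<Sum>k\<in>{..card S}. s (c k) ((\<phi> ^^ k) y))"
    using mmin by (intro sum.mono_neutral_left) (auto simp: not_le)
  finally have "(\<phi> ^^ m) (s (c m) y + \<phi> z) = 0" using c by simp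
  moreover have fz: "\<phi> z \<in> W" using lin zW by (auto simp: linear_endo_on_def)
  ultimately have e: "s (c m) y + \<phi> z = 0" using pinj y c by (metis W_add W_scale)
  define x where "x = s (- inverse (c m)) z"
  have "\<phi> x = s (- inverse (c m)) (\<phi> z)"
  proof -
    have "\<phi> (s a z) = s a (\<phi> z)" if "a \<in> L" for a
      using lin zW that by (simp add: linear_endo_on_def)
    moreover have "- inverse (c m) \<in> L" using c by (simp add: L_minus L_inverse)
    ultimately show ?thesis by (simp only: x_def)
  qed
  also have "\<phi> z = - s (c m) y" using e by (metis add.commute eq_neg_iff_add_eq_0)
  finally have "\<phi> x = y" using m by simp
  moreover have "x \<in> W" unfolding x_def using zW c by (intro W_scale L_minus L_inverse) auto
  ultimately show ?thesis by blast
qed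

text \<open>Independence of eigenvectors for distinct eigenvalues, for the pencil
  \<open>Z - \<mu> Y\<close>. Applying \<open>Z - \<nu> Y\<close> to the relation removes the term
  at \<nu> and acts on the others as \<open>(\<mu> - \<nu>) Y\<close>. Because \<open>Y\<close> and
  \<open>Z\<close> commute, the new vectors are again eigenvectors of the pencil.\<close>

lemma pencil_independent:
  assumes Y: "linear_endo_on L s W Y" and Z: "linear_endo_on L s W Z"
    and comm: "\<And>v. v \<in> W \<Longrightarrow> Y (Z v) = Z (Y v)"
    and inj: "\<And>v. v \<in> W \<Longrightarrow> Y v = 0 \<Longrightarrow> Z v = 0 \<Longrightarrow> v = 0"
    and "finite M" "M \<subseteq> L"
    and "\<And>\<mu>. \<mu> \<in> M \<Longrightarrow> v \<mu> \<in> W \<and> Z (v \<mu>) = s \<mu> (Y (v \<mu>))" "(\<Sum>\<mu>\<in>M. v \<mu>) = 0"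
  shows "\<forall>\<mu>\<in>M. v \<mu> = 0"
  using assms(5-)
proof (induction M arbitrary: v rule: finite_induct)
  case (insert \<nu> M)
  have XW: "x \<in> W \<Longrightarrow> Y x \<in> W" and ZW: "x \<in> W \<Longrightarrow> Z x \<in> W" for x
    using Y Z by (auto simp: linear_endo_on_def)
  have vW: "\<mu> \<in> insert \<nu> M \<Longrightarrow> v \<mu> \<in> W" for \<mu> using insert by auto
  have "0 = Z (\<Sum>\<mu>\<in>insert \<nu> M. v \<mu>) - s \<nu> (Y (\<Sum>\<mu>\<in>insert \<nu> M. v \<mu>))"
    using insert endo_0[OF Y] endo_0[OF Z] by simp
  also have "\<dots> = (\<Sum>\<mu>\<in>insert \<nu> M. s \<mu> (Y (v \<mu>)) - s \<nu> (Y (v \<mu>)))"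
  proof -
    have "Z (\<Sum>\<mu>\<in>insert \<nu> M. v \<mu>) = (\<Sum>\<mu>\<in>insert \<nu> M. s \<mu> (Y (v \<mu>)))"
      using insert.prems(2) by (intro trans[OF endo_sum[OF Z vW]] sum.cong) auto
    moreover have "s \<nu> (Y (\<Sum>\<mu>\<in>insert \<nu> M. v \<mu>)) = (\<Sum>\<mu>\<in>insert \<nu> M. s \<nu> (Y (v \<mu>)))"
    proof -
      have "Y (\<Sum>\<mu>\<in>insert \<nu> M. v \<mu>) = (\<Sum>\<mu>\<in>insert \<nu> M. Y (v \<mu>))" by (rule endo_sum[OF Y vW])
      then show ?thesis by (simp only: scale_sum_right)
    qed
    ultimately show ?thesis by (simp only: sum_subtractf)
  qed
  also have "\<dots> = (\<Sum>\<mu>\<in>insert \<nu> M. s (\<mu> - \<nu>) (Y (v \<mu>)))" by (simp add: scale_left_diff_distrib)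
  also have "\<dots> = (\<Sum>\<mu>\<in>M. s (\<mu> - \<nu>) (Y (v \<mu>)))" using insert by simp
  finally have 0: "(\<Sum>\<mu>\<in>M. s (\<mu> - \<nu>) (Y (v \<mu>))) = 0" by simp
  have "\<forall>\<mu>\<in>M. s (\<mu> - \<nu>) (Y (v \<mu>)) = 0"
  proof (rule insert.IH[OF _ _ 0])
    show "M \<subseteq> L" using insert by simp
    fix \<mu> assume \<mu>: "\<mu> \<in> M"
    then have d: "\<mu> - \<nu> \<in> L" "\<mu> \<in> L" using insert by (auto intro: L_diff)
    have v: "v \<mu> \<in> W" "Z (v \<mu>) = s \<mu> (Y (v \<mu>))" using \<mu> insert by auto
    have "Z (s (\<mu> - \<nu>) (Y (v \<mu>))) = s (\<mu> - \<nu>) (Y (Z (v \<mu>)))"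
      using Z d XW[OF v(1)] comm[OF v(1)] by (simp add: linear_endo_on_def)
    also have "Y (Z (v \<mu>)) = s \<mu> (Y (Y (v \<mu>)))"
      using Y d XW[OF v(1)] v(2) by (simp add: linear_endo_on_def)
    also have "s (\<mu> - \<nu>) (s \<mu> (Y (Y (v \<mu>)))) = s \<mu> (Y (s (\<mu> - \<nu>) (Y (v \<mu>))))"
      using Y d XW[OF v(1)] by (simp add: linear_endo_on_def mult.commute)
    finally show "s (\<mu> - \<nu>) (Y (v \<mu>)) \<in> W \<and> Z (s (\<mu> - \<nu>) (Y (v \<mu>))) = s \<mu> (Y (s (\<mu> - \<nu>) (Y (v \<mu>))))"
      using W_scale[OF d(1) XW[OF v(1)]] by simp
  qed
  then have "\<forall>\<mu>\<in>M. Y (v \<mu>) = 0" using insert by auto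
  then have "\<forall>\<mu>\<in>M. v \<mu> = 0" using inj vW insert.prems(2) by auto
  then show ?case using insert by simp
qed simp

text \<open>More singular values than generators would give too many independent eigenvectors. Two
  choices of a generic scalar rest on this: the rotation in \<open>anti_cancel\<close> and the
  coefficient in \<open>regular_member\<close>.\<close>

lemma pencil_regular_value:
  assumes "gen_on L s W S"
    and Y: "linear_endo_on L s W Y" and Z: "linear_endo_on L s W Z"
    and comm: "\<And>v. v \<in> W \<Longrightarrow> Y (Z v) = Z (Y v)"
    and inj: "\<And>v. v \<in> W \<Longrightarrow> Y v = 0 \<Longrightarrow> Z v = 0 \<Longrightarrow> v = 0"
    and M: "infinite M" "M \<subseteq> L"
  shows "\<exists>\<mu>\<in>M. \<forall>v\<in>W. Z v = s \<mu> (Y v) \<longrightarrow> v = 0"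
proof (rule ccontr)
  assume "\<not> ?thesis"
  then obtain v where v: "\<And>\<mu>. \<mu> \<in> M \<Longrightarrow> v \<mu> \<in> W \<and> Z (v \<mu>) = s \<mu> (Y (v \<mu>)) \<and> v \<mu> \<noteq> 0" by metis
  obtain N where N: "N \<subseteq> M" "finite N" "card N = Suc (card S)"
    using infinite_arbitrarily_large[OF M(1)] by blast
  then obtain c where c: "\<forall>x. c x \<in> L" "\<exists>x\<in>N. c x \<noteq> 0" "(\<Sum>x\<in>N. s (c x) (v x)) = 0"
    using gen_dependent[OF assms(1), of N v] v by auto
  have XW: "x \<in> W \<Longrightarrow> Y x \<in> W" for x using Y by (auto simp: linear_endo_on_def)
  have "\<forall>x\<in>N. s (c x) (v x) = 0"
  proof (rule pencil_independent[OF Y Z comm inj N(2) _ _ c(3)])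
    show "N \<subseteq> L" using N M by auto
    fix \<mu> assume "\<mu> \<in> N"
    then have \<mu>: "\<mu> \<in> L" "v \<mu> \<in> W" "Z (v \<mu>) = s \<mu> (Y (v \<mu>))" "c \<mu> \<in> L" using N M v c by auto
    then have "Z (s (c \<mu>) (v \<mu>)) = s \<mu> (Y (s (c \<mu>) (v \<mu>)))"
      using Y Z XW[OF \<mu>(2)] by (auto simp: linear_endo_on_def mult.commute)
    then show "s (c \<mu>) (v \<mu>) \<in> W \<and> Z (s (c \<mu>) (v \<mu>)) = s \<mu> (Y (s (c \<mu>) (v \<mu>)))"
      using \<mu> W_scale by auto
  qed
  then show False using c N v by auto
qed

end

section \<open>Diagonal multiples of a system of forms and anti-isometries\<close>

text \<open>A power of \<open>W\<close> over an arbitrary index type: products of index sets serve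
  for tensor products, disjoint unions for orthogonal sums and boolean lists for Clifford matrices.
  Coordinates outside \<open>I\<close> are fixed to 0 so that equality of functions is equality of
  vectors.\<close>

definition pspace :: "'i set \<Rightarrow> 'w::zero set \<Rightarrow> ('i \<Rightarrow> 'w) set" where
  "pspace I W = {x. (\<forall>i\<in>I. x i \<in> W) \<and> (\<forall>i. i \<notin> I \<longrightarrow> x i = 0)}"

definition pscale :: "('a \<Rightarrow> 'w \<Rightarrow> 'w) \<Rightarrow> 'a \<Rightarrow> ('i \<Rightarrow> 'w) \<Rightarrow> 'i \<Rightarrow> 'w" where
  "pscale s a x = (\<lambda>i. s a (x i))"

definition single :: "'i \<Rightarrow> 'w::zero \<Rightarrow> 'i \<Rightarrow> 'w" where
  "single i w = (\<lambda>j. if j = i then w else 0)"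

definition restr :: "'i set \<Rightarrow> ('i \<Rightarrow> 'w::zero) \<Rightarrow> 'i \<Rightarrow> 'w" where
  "restr I x = (\<lambda>i. if i \<in> I then x i else 0)"

text \<open>The tensor product of the diagonal form with entries \<open>a i\<close> and the system
  \<open>b\<close>, whose members are indexed by \<open>t\<close>.\<close>

definition dform :: "'i set \<Rightarrow> ('i \<Rightarrow> 'a::comm_ring_1) \<Rightarrow> ('t \<Rightarrow> 'w \<Rightarrow> 'w \<Rightarrow> 'a) \<Rightarrow> 't \<Rightarrow> ('i \<Rightarrow> 'w) \<Rightarrow> ('i \<Rightarrow> 'w) \<Rightarrow> 'a" where
  "dform I a b t x y = (\<Sum>i\<in>I. a i * b t (x i) (y i))"

text \<open>A single map reverses the sign of all members of the system at once. Where bijectivity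
  is wanted, it comes from the trivial joint radical and finite dimension, as in
  \<open>hyperbolic_of_anti\<close>.\<close>

definition anti_form :: "'a::field set \<Rightarrow> ('a \<Rightarrow> 'w::ab_group_add \<Rightarrow> 'w) \<Rightarrow> 'w set \<Rightarrow> ('t \<Rightarrow> 'w \<Rightarrow> 'w \<Rightarrow> 'a) \<Rightarrow> bool" where
  "anti_form L s W q \<longleftrightarrow> (\<exists>f. linear_endo_on L s W f \<and>
     (\<forall>t. \<forall>x\<in>W. \<forall>y\<in>W. q t (f x) (f y) = - q t x y))"

abbreviation anti :: "'a::field set \<Rightarrow> ('a \<Rightarrow> 'w::ab_group_add \<Rightarrow> 'w) \<Rightarrow> 'w set \<Rightarrow> ('t \<Rightarrow> 'w \<Rightarrow> 'w \<Rightarrow> 'a)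
    \<Rightarrow> 'i set \<Rightarrow> ('i \<Rightarrow> 'a) \<Rightarrow> bool" where
  "anti L s W b I a \<equiv> anti_form L (pscale s) (pspace I W) (dform I a b)"

definition linear_on :: "'a::field set \<Rightarrow> ('a \<Rightarrow> 'w::ab_group_add \<Rightarrow> 'w) \<Rightarrow> 'w set
    \<Rightarrow> ('a \<Rightarrow> 'x::ab_group_add \<Rightarrow> 'x) \<Rightarrow> 'x set \<Rightarrow> ('w \<Rightarrow> 'x) \<Rightarrow> bool" where
  "linear_on L s W s' W' f \<longleftrightarrow> (\<forall>x\<in>W. f x \<in> W') \<and> (\<forall>x\<in>W. \<forall>y\<in>W. f (x + y) = f x + f y) \<and>
     (\<forall>a\<in>L. \<forall>x\<in>W. f (s a x) = s' a (f x))"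

lemma linear_endo_on_iff: "linear_endo_on L s W f \<longleftrightarrow> linear_on L s W s W f"
  by (simp add: linear_endo_on_def linear_on_def)

lemma linear_on_comp:
  "linear_on L s W s' W' f \<Longrightarrow> linear_on L s' W' s'' W'' g \<Longrightarrow> linear_on L s W s'' W'' (\<lambda>x. g (f x))"
  by (auto simp: linear_on_def)

lemma anti_formD:
  "anti_form L s W q \<Longrightarrow> \<exists>f. linear_endo_on L s W f \<and> (\<forall>x\<in>W. f x \<in> W) \<and>
     (\<forall>t. \<forall>x\<in>W. \<forall>y\<in>W. q t (f x) (f y) = - q t x y)"
  unfolding anti_form_def linear_endo_on_def by blast

lemma anti_form_transport:
  assumes "anti_form L s W q" "linear_on L s' W' s W G" "linear_on L s W s' W' F"
    and G: "\<And>t x y. x \<in> W' \<Longrightarrow> y \<in> W' \<Longrightarrow> q t (G x) (G y) = q' t x y"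
    and F: "\<And>t x y. x \<in> W \<Longrightarrow> y \<in> W \<Longrightarrow> q' t (F x) (F y) = q t x y"
  shows "anti_form L s' W' q'"
proof -
  obtain f where f: "linear_endo_on L s W f" "\<And>x. x \<in> W \<Longrightarrow> f x \<in> W"
    "\<And>t x y. x \<in> W \<Longrightarrow> y \<in> W \<Longrightarrow> q t (f x) (f y) = - q t x y"
    using anti_formD[OF assms(1)] by blast
  have GW: "G x \<in> W" if "x \<in> W'" for x using assms(2) that by (auto simp: linear_on_def)
  show ?thesis unfolding anti_form_def
  proof (intro exI[of _ "\<lambda>x. F (f (G x))"] conjI allI ballI)
    show "linear_endo_on L s' W' (\<lambda>x. F (f (G x)))"
      using linear_on_comp[OF linear_on_comp[OF assms(2) f(1)[unfolded linear_endo_on_iff]] assms(3)]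
      by (simp add: linear_endo_on_iff)
    show "q' t (F (f (G x))) (F (f (G y))) = - q' t x y" if "x \<in> W'" "y \<in> W'" for t x y
      using that by (simp add: F G GW f)
  qed
qed

lemma vector_space_pscale: "vector_space s \<Longrightarrow> vector_space (pscale s)"
  unfolding vector_space_def pscale_def by (auto simp: fun_eq_iff)

lemma single_add: "single i (x + y) = single i x + single i (y :: 'w::ab_group_add)"
  by (auto simp: single_def fun_eq_iff)

lemma restr_add: "restr I (x + y) = restr I x + restr I (y :: 'i \<Rightarrow> 'w::ab_group_add)"
  by (auto simp: restr_def fun_eq_iff)

lemma restr_in: "x \<in> pspace J W \<Longrightarrow> I \<subseteq> J \<Longrightarrow> restr I x \<in> pspace I W"
  by (auto simp: restr_def pspace_def)

lemma pspace_eq_sum_single: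
  assumes "finite I" "x \<in> pspace I (W :: 'w::ab_group_add set)"
  shows "x = (\<Sum>i\<in>I. single i (x i))"
proof
  fix j
  have "(\<Sum>i\<in>I. single i (x i)) j = (\<Sum>i\<in>I. if j = i then x i else 0)"
    unfolding single_def by (induction I rule: infinite_finite_induct) auto
  also have "\<dots> = x j" using assms by (auto simp: pspace_def)
  finally show "x j = (\<Sum>i\<in>I. single i (x i)) j" by simp
qed

section \<open>Orthogonal sums, permutations and tensor products of anti-isometries\<close>

context lspace
begin

lemma lspace_pspace: "lspace L (pscale s) (pspace (I :: 'i set) W)"
proof -
  interpret p: vector_space "pscale s :: 'c \<Rightarrow> ('i \<Rightarrow> 'w) \<Rightarrow> _" by (intro vector_space_pscale vector_space_axioms)
  show ?thesis
    by unfold_locales (auto simp: pspace_def pscale_def W_add W_scale)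
qed

lemma single_in: "w \<in> W \<Longrightarrow> i \<in> I \<Longrightarrow> single i w \<in> pspace I W"
  by (auto simp: single_def pspace_def)

lemma gen_on_pspace:
  assumes gen: "gen_on L s W S" and I: "finite I"
  shows "gen_on L (pscale s) (pspace I W) (\<Union>i\<in>I. single i ` S)"
  unfolding gen_on_def
proof (intro conjI allI impI)
  have S: "finite S" "S \<subseteq> W" using gen by (auto simp: gen_on_def)
  show "finite (\<Union>i\<in>I. single i ` S)" using S I by auto
  show "(\<Union>i\<in>I. single i ` S) \<subseteq> pspace I W" using S by (auto intro: single_in)
  fix U assume U: "subspace_on L (pscale s) (pspace I W) U \<and> (\<Union>i\<in>I. single i ` S) \<subseteq> U"
  have sing: "single i w \<in> U" if i: "i \<in> I" and w: "w \<in> W" for i w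
  proof -
    let ?V = "{w\<in>W. single i w \<in> U}"
    have "single i (0 :: 'w) = 0" by (auto simp: single_def)
    moreover have "single i (s a x) = pscale s a (single i x)" for a x
      by (auto simp: single_def pscale_def)
    ultimately have "subspace_on L s W ?V"
      using U by (auto simp: subspace_on_def single_add W_add W_scale)
    moreover have "S \<subseteq> ?V" using U S i by auto
    ultimately have "?V = W" using gen by (auto simp: gen_on_def)
    then show ?thesis using w by blast
  qed
  interpret p: lspace L "pscale s" U
  proof -
    interpret p: lspace L "pscale s" "pspace I W" by (rule lspace_pspace)
    show "lspace L (pscale s) U" using U by (intro p.subspace_lspace) auto
  qed
  show "U = pspace I W"
  proof
    show "U \<subseteq> pspace I W" using U by (auto simp: subspace_on_def)
    show "pspace I W \<subseteq> U"
    proof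
      fix x assume x: "x \<in> pspace I W"
      have "(\<Sum>i\<in>I. single i (x i)) \<in> U"
        using x by (intro p.W_sum sing) (auto simp: pspace_def)
      then show "x \<in> U" using pspace_eq_sum_single[OF I x] by simp
    qed
  qed
qed

text \<open>Diagonal entries matter only up to squares: rescaling coordinate \<open>i\<close> by
  \<open>c i\<close> turns the entry \<open>a' (\<pi> i)\<close> into \<open>a i\<close>.\<close>

lemma anti_form_dform_reindex:
  assumes "anti L s W b J a'" and \<pi>: "bij_betw \<pi> I J"
    and c: "\<And>i. i \<in> I \<Longrightarrow> c i \<in> L \<and> c i \<noteq> 0 \<and> a i = (c i)\<^sup>2 * a' (\<pi> i)"
    and bs: "\<And>t e x y. e \<in> L \<Longrightarrow> x \<in> W \<Longrightarrow> y \<in> W \<Longrightarrow> b t (s e x) (s e y) = e\<^sup>2 * b t x y"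
  shows "anti L s W b I a"
proof (rule anti_form_transport[OF assms(1)])
  define \<rho> where "\<rho> = inv_into I \<pi>"
  have \<rho>: "\<And>j. j \<in> J \<Longrightarrow> \<rho> j \<in> I \<and> \<pi> (\<rho> j) = j" "\<And>i. i \<in> I \<Longrightarrow> \<rho> (\<pi> i) = i \<and> \<pi> i \<in> J"
    unfolding \<rho>_def using \<pi> by (auto simp: bij_betw_def inv_into_into f_inv_into_f)
  define G where "G = (\<lambda>x j. if j \<in> J then s (c (\<rho> j)) (x (\<rho> j)) else 0)"
  define F where "F = (\<lambda>y i. if i \<in> I then s (inverse (c i)) (y (\<pi> i)) else 0)"
  show "linear_on L (pscale s) (pspace I W) (pscale s) (pspace J W) G"
    unfolding linear_on_def pscale_def pspace_def G_def using \<rho> c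
    by (auto simp: fun_eq_iff scale_right_distrib W_scale mult.commute)
  show "linear_on L (pscale s) (pspace J W) (pscale s) (pspace I W) F"
    unfolding linear_on_def pscale_def pspace_def F_def using \<rho> c
    by (auto simp: fun_eq_iff scale_right_distrib W_scale L_inverse mult.commute)
  fix t
  show "dform J a' b t (G x) (G y) = dform I a b t x y" if "x \<in> pspace I W" "y \<in> pspace I W" for x y
  proof -
    have "dform J a' b t (G x) (G y) = (\<Sum>i\<in>I. a' (\<pi> i) * b t (G x (\<pi> i)) (G y (\<pi> i)))"
      unfolding dform_def by (rule sum.reindex_bij_betw[OF \<pi>, symmetric])
    also have "\<dots> = dform I a b t x y"
      unfolding dform_def using \<rho> c that by (intro sum.cong) (auto simp: G_def pspace_def bs)
    finally show ?thesis .
  qed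
  show "dform I a b t (F x) (F y) = dform J a' b t x y" if "x \<in> pspace J W" "y \<in> pspace J W" for x y
  proof -
    have "dform J a' b t x y = (\<Sum>i\<in>I. a' (\<pi> i) * b t (x (\<pi> i)) (y (\<pi> i)))"
      unfolding dform_def by (rule sum.reindex_bij_betw[OF \<pi>, symmetric])
    also have "\<dots> = dform I a b t (F x) (F y)"
      unfolding dform_def using \<rho> c that
      by (intro sum.cong) (auto simp: F_def pspace_def bs L_inverse power_inverse)
    finally show ?thesis by simp
  qed
qed

lemma anti_union:
  assumes "anti L s W b I a" "anti L s W b J a" and fin: "finite I" "finite J" and disj: "I \<inter> J = {}"
  shows "anti L s W b (I \<union> J) a"
proof -
  obtain f where f: "linear_endo_on L (pscale s) (pspace I W) f" "\<And>x. x \<in> pspace I W \<Longrightarrow> f x \<in> pspace I W"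
    "\<And>t x y. x \<in> pspace I W \<Longrightarrow> y \<in> pspace I W \<Longrightarrow> dform I a b t (f x) (f y) = - dform I a b t x y"
    using anti_formD[OF assms(1)] by blast
  obtain g where g: "linear_endo_on L (pscale s) (pspace J W) g" "\<And>x. x \<in> pspace J W \<Longrightarrow> g x \<in> pspace J W"
    "\<And>t x y. x \<in> pspace J W \<Longrightarrow> y \<in> pspace J W \<Longrightarrow> dform J a b t (g x) (g y) = - dform J a b t x y"
    using anti_formD[OF assms(2)] by blast
  define h where "h = (\<lambda>x. f (restr I x) + g (restr J x))"
  have r: "restr I x \<in> pspace I W" "restr J x \<in> pspace J W" if "x \<in> pspace (I \<union> J) W" for x
    using that restr_in by blast+
  have rs: "restr K (pscale s e x) = pscale s e (restr K x)" for K e and x :: "'i \<Rightarrow> 'w"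
    by (auto simp: restr_def pscale_def)
  have hI: "h x i = f (restr I x) i" if "x \<in> pspace (I \<union> J) W" "i \<in> I" for x i
    using g(2)[OF r(2)[OF that(1)]] that disj by (auto simp: h_def pspace_def)
  have hJ: "h x i = g (restr J x) i" if "x \<in> pspace (I \<union> J) W" "i \<in> J" for x i
    using f(2)[OF r(1)[OF that(1)]] that disj by (auto simp: h_def pspace_def)
  have sp: "dform (I \<union> J) a b t x y = dform I a b t x y + dform J a b t x y" for t x y
    unfolding dform_def using fin disj by (intro sum.union_disjoint) auto
  have dr: "dform K a b t (restr K x) (restr K y) = dform K a b t x y" for K t x y
    unfolding dform_def by (intro sum.cong) (auto simp: restr_def)
  show ?thesis unfolding anti_form_def
  proof (intro exI[of _ h] conjI allI ballI)
    show "linear_endo_on L (pscale s) (pspace (I \<union> J) W) h"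
      unfolding linear_endo_on_def
    proof (intro conjI ballI)
      fix x assume x: "x \<in> pspace (I \<union> J) W"
      show "h x \<in> pspace (I \<union> J) W"
        using f(2)[OF r(1)[OF x]] g(2)[OF r(2)[OF x]] disj by (auto simp: h_def pspace_def)
      show "h (x + y) = h x + h y" if "y \<in> pspace (I \<union> J) W" for y
        using f(1) g(1) r[OF x] r[OF that] by (simp add: h_def restr_add linear_endo_on_def)
      show "h (pscale s e x) = pscale s e (h x)" if "e \<in> L" for e
        using f(1) g(1) r[OF x] that
        by (simp add: h_def rs linear_endo_on_def) (simp add: pscale_def fun_eq_iff scale_right_distrib)
    qed
    fix t x y assume x: "x \<in> pspace (I \<union> J) W" and y: "y \<in> pspace (I \<union> J) W"
    have "dform I a b t (h x) (h y) = dform I a b t (f (restr I x)) (f (restr I y))"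
      unfolding dform_def using hI[OF x] hI[OF y] by (intro sum.cong) auto
    moreover have "dform J a b t (h x) (h y) = dform J a b t (g (restr J x)) (g (restr J y))"
      unfolding dform_def using hJ[OF x] hJ[OF y] by (intro sum.cong) auto
    ultimately show "dform (I \<union> J) a b t (h x) (h y) = - dform (I \<union> J) a b t x y"
      using f(3)[OF r(1)[OF x] r(1)[OF y]] g(3)[OF r(2)[OF x] r(2)[OF y]] by (simp add: sp dr)
  qed
qed

text \<open>Permuting the coordinates reverses the sign of the form, whatever the system
  \<open>b\<close> is. This supplies the anti-isometries on summands such as \<open><a, -a>\<close>
  that are to be cancelled.\<close>

lemma anti_permute:
  assumes \<pi>: "bij_betw \<pi> J J" and a: "\<And>j. j \<in> J \<Longrightarrow> a (\<pi> j) = - a j"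
  shows "anti L s W b J a"
  unfolding anti_form_def
proof (intro exI[of _ "\<lambda>x j. if j \<in> J then x (\<pi> j) else 0"] conjI allI ballI)
  have "\<And>j. j \<in> J \<Longrightarrow> \<pi> j \<in> J" using \<pi> by (auto simp: bij_betw_def)
  then show "linear_endo_on L (pscale s) (pspace J W) (\<lambda>x j. if j \<in> J then x (\<pi> j) else 0)"
    by (auto simp: linear_endo_on_def pspace_def pscale_def fun_eq_iff)
  fix t x y
  have "dform J a b t x y = (\<Sum>j\<in>J. a (\<pi> j) * b t (x (\<pi> j)) (y (\<pi> j)))"
    unfolding dform_def by (rule sum.reindex_bij_betw[OF \<pi>, symmetric])
  also have "\<dots> = - dform J a b t (\<lambda>j. if j \<in> J then x (\<pi> j) else 0) (\<lambda>j. if j \<in> J then y (\<pi> j) else 0)"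
    unfolding dform_def by (simp add: a sum_negf)
  finally show "dform J a b t (\<lambda>j. if j \<in> J then x (\<pi> j) else 0) (\<lambda>j. if j \<in> J then y (\<pi> j) else 0)
      = - dform J a b t x y" by simp
qed

text \<open>The anti-isometry acts on each slice \<open>j\<close> separately, and the factor
  \<open>c j\<close> passes through. With constant \<open>c\<close> this brings two multiples to a
  common number of copies.\<close>

lemma anti_tensor:
  assumes "anti L s W b I a" "finite I" "finite J"
  shows "anti L s W b (I \<times> J) (\<lambda>(i, j). a i * c j)"
proof -
  obtain f where f: "linear_endo_on L (pscale s) (pspace I W) f" "\<And>x. x \<in> pspace I W \<Longrightarrow> f x \<in> pspace I W"
    "\<And>t x y. x \<in> pspace I W \<Longrightarrow> y \<in> pspace I W \<Longrightarrow> dform I a b t (f x) (f y) = - dform I a b t x y"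
    using anti_formD[OF assms(1)] by blast
  define h where "h = (\<lambda>x (i, j). if j \<in> J then f (\<lambda>i. x (i, j)) i else 0)"
  have p: "(\<lambda>i. x (i, j)) \<in> pspace I W" if "x \<in> pspace (I \<times> J) W" "j \<in> J" for x j
    using that by (auto simp: pspace_def)
  have dj: "dform (I \<times> J) (\<lambda>(i, j). a i * c j) b t x y =
      (\<Sum>j\<in>J. c j * dform I a b t (\<lambda>i. x (i, j)) (\<lambda>i. y (i, j)))" for t x y
  proof -
    have "dform (I \<times> J) (\<lambda>(i, j). a i * c j) b t x y = (\<Sum>i\<in>I. \<Sum>j\<in>J. a i * c j * b t (x (i, j)) (y (i, j)))"
      unfolding dform_def by (simp add: sum.cartesian_product case_prod_beta)
    also have "\<dots> = (\<Sum>j\<in>J. \<Sum>i\<in>I. a i * c j * b t (x (i, j)) (y (i, j)))" by (rule sum.swap)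
    finally show ?thesis unfolding dform_def by (simp add: sum_distrib_left mult_ac)
  qed
  show ?thesis unfolding anti_form_def
  proof (intro exI[of _ h] conjI allI ballI)
    show "linear_endo_on L (pscale s) (pspace (I \<times> J) W) h"
      unfolding linear_endo_on_def
    proof (intro conjI ballI)
      fix x assume x: "x \<in> pspace (I \<times> J) W"
      show "h x \<in> pspace (I \<times> J) W"
        using f(2)[OF p[OF x]] by (auto simp: h_def pspace_def)
      show "h (x + y) = h x + h y" if "y \<in> pspace (I \<times> J) W" for y
      proof -
        have "f (\<lambda>i. (x + y) (i, j)) = f (\<lambda>i. x (i, j)) + f (\<lambda>i. y (i, j))" if "j \<in> J" for j
        proof -
          have "(\<lambda>i. (x + y) (i, j)) = (\<lambda>i. x (i, j)) + (\<lambda>i. y (i, j))" by auto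
          then show ?thesis using f(1) p[OF x that] p[OF \<open>y \<in> _\<close> that] by (simp add: linear_endo_on_def)
        qed
        then show ?thesis by (auto simp: h_def fun_eq_iff)
      qed
      show "h (pscale s e x) = pscale s e (h x)" if "e \<in> L" for e
      proof -
        have "f (\<lambda>i. pscale s e x (i, j)) = pscale s e (f (\<lambda>i. x (i, j)))" if "j \<in> J" for j
        proof -
          have "(\<lambda>i. pscale s e x (i, j)) = pscale s e (\<lambda>i. x (i, j))" by (auto simp: pscale_def)
          then show ?thesis using f(1) p[OF x that] \<open>e \<in> L\<close> by (simp add: linear_endo_on_def)
        qed
        then show ?thesis by (auto simp: h_def fun_eq_iff pscale_def)
      qed
    qed
    fix t x y assume x: "x \<in> pspace (I \<times> J) W" and y: "y \<in> pspace (I \<times> J) W"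
    have "dform I a b t (\<lambda>i. h x (i, j)) (\<lambda>i. h y (i, j)) = - dform I a b t (\<lambda>i. x (i, j)) (\<lambda>i. y (i, j))"
      if "j \<in> J" for j
      using f(3)[OF p[OF x that] p[OF y that]] that by (simp add: h_def)
    then show "dform (I \<times> J) (\<lambda>(i, j). a i * c j) b t (h x) (h y) = - dform (I \<times> J) (\<lambda>(i, j). a i * c j) b t x y"
      unfolding dj by (simp add: sum_negf)
  qed
qed

end

lemma (in lspace) inj_imp_right_inverse:
  assumes gen: "gen_on L s W S" and lin: "linear_endo_on L s W \<phi>"
    and inj: "\<And>x. x \<in> W \<Longrightarrow> \<phi> x = 0 \<Longrightarrow> x = 0"
  shows "\<exists>\<psi>. linear_endo_on L s W \<psi> \<and> (\<forall>y\<in>W. \<phi> (\<psi> y) = y)"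
proof -
  have "\<forall>y\<in>W. \<exists>x\<in>W. \<phi> x = y" using inj_imp_surj[OF assms] by blast
  then obtain \<psi> where \<psi>: "\<And>y. y \<in> W \<Longrightarrow> \<psi> y \<in> W \<and> \<phi> (\<psi> y) = y" by metis
  have eq: "x = y" if "x \<in> W" "y \<in> W" "\<phi> x = \<phi> y" for x y
    using inj[of "x - y"] that endo_diff[OF lin] W_diff by auto
  have "linear_endo_on L s W \<psi>"
    unfolding linear_endo_on_def
  proof (intro conjI ballI)
    have add: "\<phi> (x + y) = \<phi> x + \<phi> y" if "x \<in> W" "y \<in> W" for x y
      using lin that by (simp add: linear_endo_on_def)
    have scl: "\<phi> (s a x) = s a (\<phi> x)" if "a \<in> L" "x \<in> W" for a x
      using lin that by (simp add: linear_endo_on_def)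
    show "\<psi> x \<in> W" if "x \<in> W" for x using \<psi> that by blast
    show "\<psi> (x + y) = \<psi> x + \<psi> y" if x: "x \<in> W" and y: "y \<in> W" for x y
      using \<psi>[OF x] \<psi>[OF y] \<psi>[OF W_add[OF x y]] add W_add by (simp add: eq)
    show "\<psi> (s a x) = s a (\<psi> x)" if a: "a \<in> L" and x: "x \<in> W" for a x
      using \<psi>[OF x] \<psi>[OF W_scale[OF a x]] scl[OF a] W_scale[OF a] by (simp add: eq)
  qed
  then show ?thesis using \<psi> by blast
qed

locale formspace = lspace L s W
  for L :: "'c::field set" and s :: "'c \<Rightarrow> 'w::ab_group_add \<Rightarrow> 'w" and W :: "'w set" +
  fixes b :: "'t \<Rightarrow> 'w \<Rightarrow> 'w \<Rightarrow> 'c"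
  assumes b_sym: "b t x y = b t y x"
    and b_add_left: "b t (x + y) z = b t x z + b t y z"
    and b_scale_left: "b t (s a x) y = a * b t x y"
begin

lemma b_add_right: "b t x (y + z) = b t x y + b t x z"
  using b_add_left[of t y z x] by (simp add: b_sym)

lemma b_scale_right: "b t x (s a y) = a * b t x y"
  using b_scale_left[of t a y x] by (simp add: b_sym)

lemma b_zero_left [simp]: "b t 0 y = 0" and b_zero_right [simp]: "b t x 0 = 0"
  using b_scale_left[of t 0 0 y] b_scale_right[of t x 0 0] by simp_all

lemma b_minus_left: "b t (- x) y = - b t x y" and b_minus_right: "b t x (- y) = - b t x y"
  using b_scale_left[of t "-1" x y] b_scale_right[of t x "-1" y] by simp_all

lemma b_diff_left: "b t (x - y) z = b t x z - b t y z"
  using b_add_left[of t x "- y" z] by (simp add: b_minus_left)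

lemma b_diff_right: "b t x (y - z) = b t x y - b t x z"
  using b_add_right[of t x y "- z"] by (simp add: b_minus_right)

lemma b_sum_left: "b t (sum g I) y = (\<Sum>i\<in>I. b t (g i) y)"
  by (induction I rule: infinite_finite_induct) (auto simp: b_add_left)

lemma b_sum_right: "b t x (sum g I) = (\<Sum>i\<in>I. b t x (g i))"
  by (induction I rule: infinite_finite_induct) (auto simp: b_add_right)

lemmas b_simps = b_add_left b_add_right b_scale_left b_scale_right b_minus_left b_minus_right
  b_diff_left b_diff_right

lemma b_square: "b t (s e x) (s e y) = e\<^sup>2 * b t x y"
  by (simp add: b_simps power2_eq_square)

lemma anti_reindex:
  assumes "anti L s W b J a'" "bij_betw \<pi> I J"
    and "\<And>i. i \<in> I \<Longrightarrow> c i \<in> L \<and> c i \<noteq> 0 \<and> a i = (c i)\<^sup>2 * a' (\<pi> i)"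
  shows "anti L s W b I a"
  by (rule anti_form_dform_reindex[OF assms(1,2), where c = c]) (use assms(3) b_square in auto)

lemma formspace_dform: "formspace L (pscale s) (pspace I W) (dform I a b)"
proof -
  interpret p: lspace L "pscale s" "pspace I W" by (rule lspace_pspace)
  show ?thesis
    by unfold_locales
      (auto simp: dform_def pscale_def b_simps b_sym sum.distrib sum_distrib_left algebra_simps)
qed

text \<open>The rational points \<open>((1 - n^2) / (1 + n^2), 2 n / (1 + n^2))\<close> of the unit
  circle. In characteristic 0 infinitely many different traces \<open>2 * c\<close> occur, and the
  trace is what the choice in \<open>anti_cancel\<close> depends on.\<close>

lemma rational_rotations:
  assumes char0: "\<And>n. n > 0 \<Longrightarrow> of_nat n \<noteq> (0::'c)"
  shows "\<exists>M. infinite M \<and> M \<subseteq> L \<and> (\<forall>\<mu>\<in>M. \<exists>c\<in>L. \<exists>d\<in>L. c\<^sup>2 + d\<^sup>2 = 1 \<and> \<mu> = 2 * c)"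
proof -
  have inj: "m = n" if "of_nat m = (of_nat n :: 'c)" for m n
  proof (rule ccontr)
    assume "m \<noteq> n"
    then have "of_nat (m - n) = (0::'c) \<and> m > n \<or> of_nat (n - m) = (0::'c) \<and> n > m"
      using that by (cases "m > n") (auto simp: of_nat_diff)
    then show False using char0 by (metis zero_less_diff)
  qed
  define e :: "nat \<Rightarrow> 'c" where "e n = of_nat (1 + n * n)" for n
  have e0: "e n \<noteq> 0" for n unfolding e_def by (intro char0) simp
  have two: "(2::'c) \<noteq> 0" using char0[of 2] by simp
  define c d where "c n = (1 - of_nat (n * n)) / e n" and "d n = 2 * of_nat n / e n" for n
  have sq: "c n ^ 2 + d n ^ 2 = 1" for n
  proof -
    have "c n ^ 2 + d n ^ 2 = ((1 - of_nat (n * n))\<^sup>2 + (2 * of_nat n)\<^sup>2) / e n ^ 2"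
      unfolding c_def d_def by (simp add: power_divide add_divide_distrib)
    also have "(1 - of_nat (n * n))\<^sup>2 + (2 * of_nat n)\<^sup>2 = e n ^ 2"
      by (simp add: e_def power2_eq_square algebra_simps)
    finally show ?thesis using e0[of n] by simp
  qed
  have "inj (\<lambda>n. 2 * c n)"
  proof (rule injI)
    fix m n assume "2 * c m = 2 * c n"
    then have "c m = c n" using two by simp
    then have "(1 - of_nat (m * m)) * e n = (1 - of_nat (n * n)) * e m"
      unfolding c_def using e0 by (simp add: frac_eq_eq)
    then have "2 * of_nat (n * n) = (2 * of_nat (m * m) :: 'c)"
      unfolding e_def by (simp add: algebra_simps)
    then have "of_nat (n * n) = (of_nat (m * m) :: 'c)" using two mult_left_cancel by blast
    then have "n * n = m * m" using inj by blast
    then show "m = n" by (metis power2_eq_iff_nonneg power2_eq_square zero_le)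
  qed
  then have "infinite (range (\<lambda>n. 2 * c n))" using finite_imageD infinite_UNIV_nat by blast
  moreover have "c n \<in> L" "d n \<in> L" for n
    unfolding c_def d_def e_def by (intro L_divide L_diff L_mult L_of_nat L_numeral L_1)+
  ultimately show ?thesis
    using sq by (intro exI[of _ "range (\<lambda>n. 2 * c n)"] conjI) (blast intro: L_mult L_numeral)+
qed

text \<open>
  A twofold Witt cancellation. After doubling, the complementary form admits rational rotations
  \<open>\<rho>\<close> as isometries; for a suitable \<open>\<rho>\<close> the equation \<open>F2 (x + y) = \<rho> y\<close> determines \<open>y\<close> from \<open>x\<close>,
  and then the remaining component \<open>F1 (x + y)\<close> is the required map of \<open>x\<close>.
\<close>

lemma anti_cancel:
  fixes I J :: "'i set"
  assumes f: "anti L s W b (I \<union> J) a" and h: "anti L s W b J a"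
    and fin: "finite I" "finite J" and disj: "I \<inter> J = {}"
    and gen: "gen_on L s W S" and char0: "\<And>n. n > 0 \<Longrightarrow> of_nat n \<noteq> (0::'c)"
  shows "anti L s W b (I \<times> (UNIV :: bool set)) (\<lambda>(i, e). a i)"
proof -
  obtain f where f: "linear_endo_on L (pscale s) (pspace (I \<union> J) W) f" "\<And>x. x \<in> pspace (I \<union> J) W \<Longrightarrow> f x \<in> pspace (I \<union> J) W"
    "\<And>t x y. x \<in> pspace (I \<union> J) W \<Longrightarrow> y \<in> pspace (I \<union> J) W \<Longrightarrow> dform (I \<union> J) a b t (f x) (f y) = - dform (I \<union> J) a b t x y"
    using anti_formD[OF assms(1)] by blast
  obtain h where h: "linear_endo_on L (pscale s) (pspace J W) h" "\<And>x. x \<in> pspace J W \<Longrightarrow> h x \<in> pspace J W"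
    "\<And>t x y. x \<in> pspace J W \<Longrightarrow> y \<in> pspace J W \<Longrightarrow> dform J a b t (h x) (h y) = - dform J a b t x y"
    using anti_formD[OF assms(2)] by blast
  interpret I: formspace L "pscale s" "pspace I W" "dform I a b" by (rule formspace_dform)
  interpret J: formspace L "pscale s" "pspace J W" "dform J a b" by (rule formspace_dform)
  interpret U: formspace L "pscale s" "pspace (I \<union> J) W" "dform (I \<union> J) a b" by (rule formspace_dform)
  have sub: "x \<in> pspace (I \<union> J) W" if "x \<in> pspace I W \<or> x \<in> pspace J W" for x
    using that by (auto simp: pspace_def)
  have sp: "dform (I \<union> J) a b t x y = dform I a b t x y + dform J a b t x y" for t x y
    unfolding dform_def using fin disj by (intro sum.union_disjoint) auto
  have dr: "dform K a b t (restr K x) (restr K y) = dform K a b t x y" for K t x y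
    unfolding dform_def by (intro sum.cong) (auto simp: restr_def)
  have rs: "restr K (pscale s e x) = pscale s e (restr K x)" for K e and x :: "'i \<Rightarrow> 'w"
    by (auto simp: restr_def pscale_def)
  \<comment> \<open>Composing the second component of \<open>f\<close> with the anti-isometry
    \<open>h\<close> removes its sign: if \<open>F2\<close> acts on \<open>z\<close> and
    \<open>z'\<close> like an isometry of their \<open>J\<close>-components, the
    \<open>J\<close>-terms in \<open>key\<close> below cancel.\<close>
  define F1 F2 where "F1 z = restr I (f z)" and "F2 z = h (restr J (f z))" for z
  have F1W: "F1 z \<in> pspace I W" and F2W: "F2 z \<in> pspace J W" if "z \<in> pspace (I \<union> J) W" for z
    unfolding F1_def F2_def using f(2)[OF that] by (auto intro!: h(2) restr_in)
  have rJ: "restr J (f z) \<in> pspace J W" if "z \<in> pspace (I \<union> J) W" for z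
    using f(2)[OF that] restr_in by blast
  have F1lin: "F1 (x + y) = F1 x + F1 y" "e \<in> L \<Longrightarrow> F1 (pscale s e x) = pscale s e (F1 x)"
    if "x \<in> pspace (I \<union> J) W" "y \<in> pspace (I \<union> J) W" for x y e
    using f(1) that unfolding F1_def by (auto simp: linear_endo_on_def restr_add rs)
  have F2lin: "F2 (x + y) = F2 x + F2 y" "e \<in> L \<Longrightarrow> F2 (pscale s e x) = pscale s e (F2 x)"
    if "x \<in> pspace (I \<union> J) W" "y \<in> pspace (I \<union> J) W" for x y e
    using f(1) h(1) that rJ[OF that(1)] rJ[OF that(2)] unfolding F2_def
    by (auto simp: linear_endo_on_def restr_add rs)
  have key: "dform I a b t (F1 z) (F1 z') =
      dform J a b t (F2 z) (F2 z') - dform I a b t z z' - dform J a b t z z'"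
    if "z \<in> pspace (I \<union> J) W" "z' \<in> pspace (I \<union> J) W" for t z z'
    using f(3)[OF that, of t] h(3)[OF rJ[OF that(1)] rJ[OF that(2)], of t]
    unfolding F1_def F2_def dr sp by (simp add: dr algebra_simps) (simp add: eq_neg_iff_add_eq_0 ac_simps)
  have \<delta>lin: "linear_endo_on L (pscale s) (pspace J W) F2"
    unfolding linear_endo_on_def using F2W F2lin sub by blast
  have \<delta>\<delta>lin: "linear_endo_on L (pscale s) (pspace J W) (\<lambda>v. F2 (F2 v) + v)"
    using \<delta>lin unfolding linear_endo_on_def
    by (auto intro: J.W_add simp: I.scale_right_distrib)
  obtain M where M: "infinite M" "M \<subseteq> L" "\<forall>\<mu>\<in>M. \<exists>c\<in>L. \<exists>d\<in>L. c\<^sup>2 + d\<^sup>2 = 1 \<and> \<mu> = 2 * c"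
    using rational_rotations[OF char0] by blast
  \<comment> \<open>A rotation with trace \<mu> is a root of \<open>t^2 - \<mu> t + 1\<close>, so
    injectivity of \<open>F2^2 - \<mu> F2 + 1\<close> keeps \<open>F2\<close> and the rotation
    apart. The two maps of the pencil have no common kernel, since \<open>F2 v = 0\<close> reduces
    the other one to \<open>v\<close>.\<close>
  have "\<exists>\<mu>\<in>M. \<forall>v\<in>pspace J W. F2 (F2 v) + v = pscale s \<mu> (F2 v) \<longrightarrow> v = 0"
  proof (rule J.pencil_regular_value[OF gen_on_pspace[OF gen fin(2)] \<delta>lin \<delta>\<delta>lin _ _ M(1,2)])
    fix v assume v: "v \<in> pspace J W"
    show "F2 (F2 (F2 v) + v) = F2 (F2 (F2 v)) + F2 v"
      using v \<delta>lin by (auto simp: linear_endo_on_def)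
    show "F2 v = 0 \<Longrightarrow> F2 (F2 v) + v = 0 \<Longrightarrow> v = 0"
      using J.endo_0[OF \<delta>lin] by (metis add_0)
  qed
  then obtain \<mu> where \<mu>: "\<mu> \<in> M" and reg\<mu>: "\<forall>v\<in>pspace J W. F2 (F2 v) + v = pscale s \<mu> (F2 v) \<longrightarrow> v = 0" ..
  obtain c d where cd: "c \<in> L" "d \<in> L" "c\<^sup>2 + d\<^sup>2 = 1" and c: "\<mu> = 2 * c"
    using M(3) \<mu> by auto
  have reg: "v = 0" if "v \<in> pspace J W" "F2 (F2 v) + v = pscale s (2 * c) (F2 v)" for v
    using reg\<mu> that unfolding c by simp
  let ?P = "pscale s"
  let ?J2 = "pspace (UNIV :: bool set) (pspace J W)"
  interpret J2: lspace L "pscale ?P" ?J2 by (rule J.lspace_pspace)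
  \<comment> \<open>\<open>F2\<close> on both copies minus the rotation with entries
    \<open>c\<close> and \<open>d\<close>; the boolean distinguishes the copies.\<close>
  define \<Delta> where "\<Delta> y = (\<lambda>e. if e then F2 (y True) - ?P d (y False) - ?P c (y True)
      else F2 (y False) - ?P c (y False) + ?P d (y True))" for y
  have yJ: "y e \<in> pspace J W" if "y \<in> ?J2" for y e using that by (auto simp: pspace_def)
  have \<Delta>lin: "linear_endo_on L (pscale ?P) ?J2 \<Delta>"
    unfolding linear_endo_on_def
  proof (intro conjI ballI)
    fix y assume y: "y \<in> ?J2"
    note yJ' = yJ
    note yJ = yJ[OF y]
    have "\<Delta> y e \<in> pspace J W" for e
      using yJ[of True] yJ[of False] F2W[OF sub] cd
      by (auto simp: \<Delta>_def intro!: J.W_diff J.W_add J.W_scale)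
    then show "\<Delta> y \<in> ?J2" by (auto simp: pspace_def)
    show "\<Delta> (y + z) = \<Delta> y + \<Delta> z" if "z \<in> ?J2" for z
      using F2lin(1)[OF sub sub] yJ yJ'[OF that]
      by (auto simp: \<Delta>_def fun_eq_iff I.scale_right_distrib scale_right_distrib pscale_def)
    show "\<Delta> (pscale ?P e y) = pscale ?P e (\<Delta> y)" if "e \<in> L" for e
    proof
      fix v
      have "F2 (?P e (y v)) = ?P e (F2 (y v))" for v using F2lin(2)[OF sub sub] yJ that by blast
      then show "\<Delta> (pscale ?P e y) v = pscale ?P e (\<Delta> y) v"
        unfolding \<Delta>_def by (simp add: pscale_def[of ?P] I.scale_right_distrib I.scale_right_diff_distrib mult.commute)
    qed
  qed
  have \<Delta>inj: "y = 0" if y: "y \<in> ?J2" and 0: "\<Delta> y = 0" for y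
  proof -
    let ?u = "y False" and ?v = "y True"
    note yJ = yJ[OF y]
    have 1: "F2 ?u = ?P c ?u - ?P d ?v" using fun_cong[OF 0, of False] by (simp add: \<Delta>_def algebra_simps eq_neg_iff_add_eq_0)
    have 2: "F2 ?v = ?P d ?u + ?P c ?v" using fun_cong[OF 0, of True] by (simp add: \<Delta>_def algebra_simps)
    have lin: "F2 (?P p x + ?P q y) = ?P p (F2 x) + ?P q (F2 y)"
      if "x \<in> pspace J W" "y \<in> pspace J W" "p \<in> L" "q \<in> L" for x y p q
      using \<delta>lin that by (auto simp: linear_endo_on_def J.W_scale)
    have cd': "?P (c * c) x + ?P (d * d) x = x" for x :: "'i \<Rightarrow> 'w"
      using cd(3) by (simp add: power2_eq_square flip: I.scale_left_distrib)
    have two: "?P (2 * c) x = ?P c x + ?P c x" for x :: "'i \<Rightarrow> 'w"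
      unfolding mult_2 by (rule I.scale_left_distrib)
    \<comment> \<open>On the kernel of \<Delta> the map \<open>F2\<close> coincides with the
      rotation and hence satisfies its quadratic equation.\<close>
    have "F2 (F2 ?u) + ?u = F2 (?P c ?u + ?P (- d) ?v) + ?u" unfolding 1 by simp
    also have "\<dots> = ?P c (F2 ?u) - ?P d (F2 ?v) + (?P (c * c) ?u + ?P (d * d) ?u)"
      using lin[OF yJ[of False] yJ[of True] cd(1) L_minus[OF cd(2)]] by (simp add: cd')
    also have "\<dots> = ?P (2 * c) (F2 ?u)"
      unfolding 1 2 two
      by (simp add: I.scale_right_distrib I.scale_right_diff_distrib mult.commute)
    finally have u: "?u = 0" using reg yJ by blast
    have "F2 (F2 ?v) + ?v = ?P d (F2 ?u) + ?P c (F2 ?v) + (?P (c * c) ?v + ?P (d * d) ?v)"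
      unfolding 2 using lin[OF yJ[of False] yJ[of True] cd(2,1)] by (simp add: cd' 2)
    also have "\<dots> = ?P (2 * c) (F2 ?v)"
      unfolding 1 2 two
      by (simp add: I.scale_right_distrib I.scale_right_diff_distrib mult.commute)
    finally have "?v = 0" using reg yJ by blast
    with u show ?thesis by (auto simp: fun_eq_iff) (metis (full_types) zero_fun_apply)
  qed
  obtain D where D: "linear_endo_on L (pscale ?P) ?J2 D" "\<And>w. w \<in> ?J2 \<Longrightarrow> \<Delta> (D w) = w"
    using J2.inj_imp_right_inverse[OF J.gen_on_pspace[OF gen_on_pspace[OF gen fin(2)] finite_UNIV] \<Delta>lin \<Delta>inj]
    by blast
  have DW: "D w \<in> ?J2" if "w \<in> ?J2" for w using D(1) that by (auto simp: linear_endo_on_def)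
  let ?I2 = "pspace (I \<times> (UNIV::bool set)) W"
  define p where "p x = (\<lambda>e i. x (i, e))" for x :: "'i \<times> bool \<Rightarrow> 'w"
  \<comment> \<open>\<open>D (w x)\<close> solves \<open>\<Delta> y = - F2 x\<close>, that is,
    \<open>F2 (x + y) = \<rho> y\<close> with \<rho> the rotation.\<close>
  define w where "w x = (\<lambda>e. - F2 (p x e))" for x
  define g where "g x = (\<lambda>(i, e). F1 (p x e + D (w x) e) i)" for x
  have pI: "p x e \<in> pspace I W" if "x \<in> ?I2" for x e
    using that by (auto simp: pspace_def p_def)
  have wJ: "w x \<in> ?J2" if "x \<in> ?I2" for x
    using F2W[OF sub] pI[OF that] J.W_minus by (auto simp: pspace_def[of "UNIV::bool set"] w_def)
  have z: "p x e + D (w x) e \<in> pspace (I \<union> J) W" if "x \<in> ?I2" for x e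
    using sub pI[OF that, of e] yJ[OF DW[OF wJ[OF that]], of e] by (intro U.W_add) auto
  have Dlin: "D (w (x + y)) = D (w x) + D (w y)" "e \<in> L \<Longrightarrow> D (w (?P e x)) = pscale ?P e (D (w x))"
    if x: "x \<in> ?I2" and y: "y \<in> ?I2" for x y e
  proof -
    have "w (x + y) = w x + w y"
    proof
      fix e
      have "p (x + y) e = p x e + p y e" by (auto simp: p_def)
      then show "w (x + y) e = (w x + w y) e"
        using F2lin(1)[OF sub sub] pI[OF x] pI[OF y] by (simp add: w_def)
    qed
    then show "D (w (x + y)) = D (w x) + D (w y)"
      using D(1) wJ x y by (auto simp: linear_endo_on_def)
    assume e: "e \<in> L"
    have "w (?P e x) = pscale ?P e (w x)"
    proof
      fix v
      have "p (?P e x) v = ?P e (p x v)" by (auto simp: p_def pscale_def)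
      then show "w (?P e x) v = pscale ?P e (w x) v"
        using F2lin(2)[OF sub[OF disjI1[OF pI[OF x]]] sub[OF disjI1[OF pI[OF x]]] e, of v]
        by (simp add: w_def pscale_def[of ?P])
    qed
    then show "D (w (?P e x)) = pscale ?P e (D (w x))"
      using D(1) wJ x e by (auto simp: linear_endo_on_def)
  qed
  have D2: "F2 (p x False + D (w x) False) = ?P c (D (w x) False) - ?P d (D (w x) True)"
    "F2 (p x True + D (w x) True) = ?P d (D (w x) False) + ?P c (D (w x) True)" if x: "x \<in> ?I2" for x
  proof -
    have F: "F2 (p x e + D (w x) e) = F2 (p x e) + F2 (D (w x) e)" for e
      using F2lin(1)[OF sub sub] pI[OF x] yJ[OF DW[OF wJ[OF x]]] by blast
    show "F2 (p x False + D (w x) False) = ?P c (D (w x) False) - ?P d (D (w x) True)"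
      using fun_cong[OF D(2)[OF wJ[OF x]], of False] unfolding F by (simp add: \<Delta>_def w_def algebra_simps)
    show "F2 (p x True + D (w x) True) = ?P d (D (w x) False) + ?P c (D (w x) True)"
      using fun_cong[OF D(2)[OF wJ[OF x]], of True] unfolding F by (simp add: \<Delta>_def w_def algebra_simps)
  qed
  show ?thesis unfolding anti_form_def
  proof (intro exI[of _ g] conjI allI ballI)
    show "linear_endo_on L ?P ?I2 g"
      unfolding linear_endo_on_def
    proof (intro conjI ballI)
      fix x assume x: "x \<in> ?I2"
      show "g x \<in> ?I2" using F1W[OF z[OF x]] by (auto simp: g_def pspace_def)
      show "g (x + y) = g x + g y" if y: "y \<in> ?I2" for y
      proof -
        have eq: "p (x + y) e + D (w (x + y)) e = (p x e + D (w x) e) + (p y e + D (w y) e)" for e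
          unfolding Dlin(1)[OF x y] by (auto simp: p_def)
        show ?thesis by (intro ext) (simp add: g_def eq F1lin(1)[OF z[OF x] z[OF y]] split: prod.split)
      qed
      show "g (?P e x) = ?P e (g x)" if e: "e \<in> L" for e
      proof -
        have eq: "p (?P e x) v + D (w (?P e x)) v = ?P e (p x v + D (w x) v)" for v
          unfolding Dlin(2)[OF x x e] by (auto simp: p_def pscale_def scale_right_distrib)
        show ?thesis
          by (intro ext) (simp add: g_def eq F1lin(2)[OF z[OF x] z[OF x] e], simp add: pscale_def split: prod.split)
      qed
    qed
    fix t x y assume x: "x \<in> ?I2" and y: "y \<in> ?I2"
    have split: "dform (I \<times> (UNIV::bool set)) (\<lambda>(i, e). a i) b t u v
       = dform I a b t (p u False) (p v False) + dform I a b t (p u True) (p v True)" for u v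
    proof -
      have "dform (I \<times> (UNIV::bool set)) (\<lambda>(i, e). a i) b t u v
        = (\<Sum>i\<in>I. \<Sum>e\<in>UNIV. a i * b t (u (i, e)) (v (i, e)))"
        unfolding dform_def by (simp add: sum.cartesian_product case_prod_beta)
      then show ?thesis by (simp add: UNIV_bool sum.distrib dform_def p_def)
    qed
    have pg: "p (g u) e = F1 (p u e + D (w u) e)" for u e by (auto simp: p_def g_def)
    have Iz: "dform I a b t (p x e + D (w x) e) (p y e + D (w y) e) = dform I a b t (p x e) (p y e)" for e
    proof -
      have "D (w x) e i = 0" "D (w y) e i = 0" if "i \<in> I" for i
        using yJ[OF DW[OF wJ[OF x]], of e] yJ[OF DW[OF wJ[OF y]], of e] disj that by (auto simp: pspace_def)
      then show ?thesis unfolding dform_def by simp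
    qed
    have Jz: "dform J a b t (p x e + D (w x) e) (p y e + D (w y) e) = dform J a b t (D (w x) e) (D (w y) e)" for e
    proof -
      have "p x e i = 0" "p y e i = 0" if "i \<in> J" for i
        using pI[OF x, of e] pI[OF y, of e] disj that by (auto simp: pspace_def)
      then show ?thesis unfolding dform_def by simp
    qed
    have rot: "dform J a b t (?P c u - ?P d v) (?P c u' - ?P d v') + dform J a b t (?P d u + ?P c v) (?P d u' + ?P c v')
      = (c\<^sup>2 + d\<^sup>2) * (dform J a b t u u' + dform J a b t v v')" for u v u' v'
      by (simp add: J.b_simps power2_eq_square algebra_simps)
    have "dform (I \<times> (UNIV::bool set)) (\<lambda>(i, e). a i) b t (g x) (g y)
      = dform I a b t (F1 (p x False + D (w x) False)) (F1 (p y False + D (w y) False))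
       + dform I a b t (F1 (p x True + D (w x) True)) (F1 (p y True + D (w y) True))"
      unfolding split pg ..
    also have "\<dots> = - (dform I a b t (p x False) (p y False) + dform I a b t (p x True) (p y True))"
      unfolding key[OF z[OF x] z[OF y]] Iz Jz D2[OF x] D2[OF y]
      using rot[of "D (w x) False" "D (w x) True" "D (w y) False" "D (w y) True"] cd(3)
      by (simp add: algebra_simps)
    finally show "dform (I \<times> (UNIV::bool set)) (\<lambda>(i, e). a i) b t (g x) (g y)
      = - dform (I \<times> (UNIV::bool set)) (\<lambda>(i, e). a i) b t x y"
      unfolding split .
  qed
qed

end

text \<open>
  The recursion \<open>N' = [[N, c], [-c, N\<^sup>*]]\<close> gives \<open>N\<^sup>* N = c\<^sub>1\<^sup>2 + \<dots> + c\<^sub>m\<^sup>2\<close> for commuting self-adjoint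
  \<open>c\<^sub>i\<close>, without the divisions in Pfister's multiplicativity. The flag selects \<open>N\<close> or \<open>N\<^sup>*\<close>.
\<close>

fun clifford :: "bool \<Rightarrow> ('w::ab_group_add \<Rightarrow> 'w) list \<Rightarrow> (bool list \<Rightarrow> 'w) \<Rightarrow> bool list \<Rightarrow> 'w" where
  "clifford e [] x = (\<lambda>_. 0)"
| "clifford e (c # cs) x = (\<lambda>l. case l of [] \<Rightarrow> 0 | v # vs \<Rightarrow>
     if v then clifford (\<not> e) cs (\<lambda>us. x (True # us)) vs - (if e then c (x (False # vs)) else - c (x (False # vs)))
     else clifford e cs (\<lambda>us. x (False # us)) vs + (if e then c (x (True # vs)) else - c (x (True # vs))))"

lemma additive_facts:
  assumes "\<And>x y. c (x + y) = c x + c (y :: 'w::ab_group_add)"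
  shows "c 0 = (0::'w)" "c (- x) = - c x" "c (x - y) = c x - c y"
proof -
  show 0: "c 0 = 0" using assms[of 0 0] by simp
  have n: "c (- x) = - c x" for x using assms[of x "- x"] 0 by (simp add: eq_neg_iff_add_eq_0 add.commute)
  show "c (- x) = - c x" by (rule n)
  show "c (x - y) = c x - c y" using assms[of x "- y"] n by simp
qed

lemma clifford_additive:
  assumes "\<And>c x y. c \<in> set cs \<Longrightarrow> c (x + y) = c x + c (y :: 'w::ab_group_add)"
  shows "clifford e cs (\<lambda>l. x l + y l) l = clifford e cs x l + clifford e cs y l"
  using assms by (induction cs arbitrary: e x y l) (auto split: list.split simp: algebra_simps)

lemma clifford_commute:
  assumes "\<And>c x. c \<in> set cs \<Longrightarrow> d (c x) = c (d x)" and d: "\<And>x y. d (x + y) = d x + d (y :: 'w::ab_group_add)"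
  shows "clifford e cs (\<lambda>l. d (x l)) l = d (clifford e cs x l)"
  using assms(1)
  by (induction cs arbitrary: e x l) (auto split: list.split simp: d additive_facts[where c = d, OF d])

lemma clifford_minus:
  assumes "\<And>c x y. c \<in> set cs \<Longrightarrow> c (x + y) = c x + c (y :: 'w::ab_group_add)"
  shows "clifford e cs (\<lambda>l. - x l) l = - clifford e cs x l"
  by (rule clifford_commute) (auto simp: additive_facts(2)[OF assms])

text \<open>The off-diagonal blocks cancel since \<open>c\<close> commutes with the smaller matrix.
  On the diagonal the smaller matrix meets its adjoint in both orders, hence the statement for
  either value of the flag.\<close>

lemma clifford_square:
  assumes "\<And>c x y. c \<in> set cs \<Longrightarrow> c (x + y) = c x + c (y :: 'w::ab_group_add)"
    and "\<And>c d x. c \<in> set cs \<Longrightarrow> d \<in> set cs \<Longrightarrow> d (c x) = c (d x)"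
    and "length l = length cs"
  shows "clifford (\<not> e) cs (clifford e cs x) l = (\<Sum>c\<leftarrow>cs. c (c (x l)))"
  using assms
proof (induction cs arbitrary: e x l)
  case (Cons c cs)
  obtain v vs where l: "l = v # vs" "length vs = length cs" using Cons.prems(3) by (cases l) auto
  have add: "\<And>c x y. c \<in> set cs \<Longrightarrow> c (x + y) = c x + c y" and cadd: "\<And>x y. c (x + y) = c x + c y"
    using Cons.prems(1) by auto
  have comm: "\<And>d x. d \<in> set cs \<Longrightarrow> c (d x) = d (c x)" using Cons.prems(2) by simp
  have IH: "clifford (\<not> e) cs (clifford e cs x) vs = (\<Sum>c\<leftarrow>cs. c (c (x vs)))" for e x
    using Cons.IH[of vs e x] Cons.prems l by auto
  have IH': "clifford e cs (clifford (\<not> e) cs x) vs = (\<Sum>c\<leftarrow>cs. c (c (x vs)))" for e x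
    using IH[of "\<not> e" x] by simp
  note A = clifford_additive[OF add] clifford_commute[where d = c, OF comm cadd]
    clifford_minus[OF add] additive_facts[where c = c, OF cadd] cadd
  have B: "clifford e' cs (\<lambda>us. y us - z us) vs = clifford e' cs y vs - clifford e' cs z vs" for e' y z
    using clifford_additive[OF add, where e = e' and x = y and y = "\<lambda>l. - z l" and l = vs] A(3) by simp
  show ?case
    unfolding l(1) by (cases v; cases e) (simp_all add: A B IH[of True, simplified] IH[of False, simplified] algebra_simps)
qed auto

lemma Suc_lists_eq:
  "{l :: bool list. length l = Suc n} = (#) False ` {l. length l = n} \<union> (#) True ` {l. length l = n}"
proof (intro equalityI subsetI)
  fix l :: "bool list" assume "l \<in> {l. length l = Suc n}"
  then obtain v vs where "l = v # vs" "length vs = n" by (cases l) auto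
  then show "l \<in> (#) False ` {l. length l = n} \<union> (#) True ` {l. length l = n}" by (cases v) auto
qed auto

lemma sum_Suc_lists:
  "(\<Sum>l | length l = Suc n. g l) = (\<Sum>l | length l = n. g (False # l)) + (\<Sum>l | length l = n. g (True # l))"
proof -
  have fin: "finite {l :: bool list. length l = n}"
    using finite_lists_length_eq[of "UNIV :: bool set" n] by simp
  show ?thesis
    unfolding Suc_lists_eq
    by (subst sum.union_disjoint) (use fin in \<open>auto simp: sum.reindex\<close>)
qed

section \<open>Anti-isometries from sums of squares\<close>

context formspace
begin

text \<open>Flipping the flag is passing to the adjoint for the orthogonal sum of copies of
  \<open>b t\<close>, by induction over the two-by-two block form.\<close>

lemma clifford_adjoint:
  assumes "\<And>t c x y. c \<in> set cs \<Longrightarrow> b t (c x) y = b t x (c y)"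
  shows "(\<Sum>l | length l = length cs. b t (clifford e cs x l) (y l)) =
    (\<Sum>l | length l = length cs. b t (x l) (clifford (\<not> e) cs y l))"
  using assms
proof (induction cs arbitrary: e x y)
  case (Cons c cs)
  have c: "b t (c x) y = b t x (c y)" for x y using Cons.prems by simp
  have IH: "(\<Sum>l | length l = length cs. b t (clifford e cs x l) (y l)) =
    (\<Sum>l | length l = length cs. b t (x l) (clifford (\<not> e) cs y l))" for e x y
    using Cons.IH[of e x y] Cons.prems by simp
  have IH': "(\<Sum>l | length l = length cs. b t (clifford (\<not> e) cs x l) (y l)) =
    (\<Sum>l | length l = length cs. b t (x l) (clifford e cs y l))" for e x y
    using IH[of "\<not> e" x y] by simp
  show ?case
    by (cases e) (simp_all add: sum_Suc_lists b_simps sum.distrib sum_subtractf sum_negf c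
        IH[of _ "\<lambda>us. x (True # us)" "\<lambda>us. y (True # us)"] IH[of _ "\<lambda>us. x (False # us)" "\<lambda>us. y (False # us)"]
        IH'[of _ "\<lambda>us. x (True # us)" "\<lambda>us. y (True # us)"] IH'[of _ "\<lambda>us. x (False # us)" "\<lambda>us. y (False # us)"])
qed auto

lemma clifford_in:
  assumes "\<And>c x y. c \<in> set cs \<Longrightarrow> c (x + y) = c x + c y" "\<And>c x. c \<in> set cs \<Longrightarrow> x \<in> W \<Longrightarrow> c x \<in> W"
    and "x \<in> pspace {l. length l = length cs} W"
  shows "clifford e cs x \<in> pspace {l. length l = length cs} W"
  using assms
proof (induction cs arbitrary: e x)
  case Nil
  then show ?case by (auto simp: pspace_def)
next
  case (Cons c cs)
  have add: "c (x + y) = c x + c y" for x y using Cons.prems by simp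
  have x: "(\<lambda>us. x (v # us)) \<in> pspace {l. length l = length cs} W" for v
    using Cons.prems(3) by (auto simp: pspace_def)
  have IH: "clifford e cs (\<lambda>us. x (v # us)) \<in> pspace {l. length l = length cs} W" for e v
    using x[of v] Cons.prems by (intro Cons.IH) auto
  have c: "c (x (v # vs)) \<in> W" if "length vs = length cs" for v vs
    using Cons.prems(2)[of c] x[of v] that by (auto simp: pspace_def)
  have c0: "c (x (v # vs)) = 0" if "length vs \<noteq> length cs" for v vs
    using additive_facts(1)[of c, OF add] x[of v] that by (auto simp: pspace_def)
  show ?case
    using IH c c0 by (auto simp: pspace_def W_add W_diff W_minus split: list.split)
qed

text \<open>For the Clifford matrix \<open>N\<close> with adjoint \<open>N'\<close>,
  \<open>b(N x, N y) = b(x, N' N y)\<close> and \<open>N' N = -1\<close>. The entries are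
  self-adjoint for every member \<open>t\<close>, so one matrix serves the whole system, at the cost
  of \<open>2^m\<close> copies for \<open>m\<close> squares.\<close>

lemma anti_sum_of_squares:
  assumes add: "\<And>c x y. c \<in> set cs \<Longrightarrow> c (x + y) = c x + c y"
    and scl: "\<And>c a x. c \<in> set cs \<Longrightarrow> c (s a x) = s a (c x)"
    and cW: "\<And>c x. c \<in> set cs \<Longrightarrow> x \<in> W \<Longrightarrow> c x \<in> W"
    and comm: "\<And>c d x. c \<in> set cs \<Longrightarrow> d \<in> set cs \<Longrightarrow> d (c x) = c (d x)"
    and adj: "\<And>t c x y. c \<in> set cs \<Longrightarrow> b t (c x) y = b t x (c y)"
    and sq: "\<And>x. x \<in> W \<Longrightarrow> (\<Sum>c\<leftarrow>cs. c (c x)) = - x"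
  shows "anti L s W b {l :: bool list. length l = length cs} (\<lambda>_. 1)"
  unfolding anti_form_def
proof (intro exI[of _ "clifford True cs"] conjI allI ballI)
  let ?I = "{l :: bool list. length l = length cs}"
  show "linear_endo_on L (pscale s) (pspace ?I W) (clifford True cs)"
    unfolding linear_endo_on_def
  proof (intro conjI ballI)
    show "clifford True cs x \<in> pspace ?I W" if "x \<in> pspace ?I W" for x
      using that by (intro clifford_in) (auto simp: add cW)
    show "clifford True cs (x + y) = clifford True cs x + clifford True cs y" for x y
      using clifford_additive[OF add, where e = True and x = x and y = y] by (auto simp: fun_eq_iff plus_fun_def)
    show "clifford True cs (pscale s a x) = pscale s a (clifford True cs x)" for a x
      unfolding pscale_def
      by (rule ext, rule clifford_commute[where d = "s a"]) (simp_all add: scl scale_right_distrib)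
  qed
  fix t x y assume x: "x \<in> pspace ?I W" and y: "y \<in> pspace ?I W"
  have "dform ?I (\<lambda>_. 1) b t (clifford True cs x) (clifford True cs y)
     = (\<Sum>l\<in>?I. b t (x l) (clifford False cs (clifford True cs y) l))"
    unfolding dform_def using clifford_adjoint[OF adj, where e = True and y = "clifford True cs y" and x = x and t = t] by simp
  also have "\<dots> = (\<Sum>l\<in>?I. b t (x l) (- y l))"
  proof (intro sum.cong refl)
    fix l assume l: "l \<in> ?I"
    then have "y l \<in> W" using y by (auto simp: pspace_def)
    moreover have "clifford False cs (clifford True cs y) l = (\<Sum>c\<leftarrow>cs. c (c (y l)))"
      using clifford_square[where cs = cs and e = True and l = l and x = y] add comm l by simp
    ultimately show "b t (x l) (clifford False cs (clifford True cs y) l) = b t (x l) (- y l)"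
      using sq by simp
  qed
  also have "\<dots> = - dform ?I (\<lambda>_. 1) b t x y"
    unfolding dform_def by (simp add: b_simps sum_negf)
  finally show "dform ?I (\<lambda>_. 1) b t (clifford True cs x) (clifford True cs y) = - dform ?I (\<lambda>_. 1) b t x y" .
qed

end

section \<open>Simple extensions of a field given by a carrier set\<close>

context field_carrier
begin

definition Lpoly :: "'c poly \<Rightarrow> bool" where
  "Lpoly p \<longleftrightarrow> (\<forall>i. poly.coeff p i \<in> L)"

lemma Lpoly_0 [simp]: "Lpoly 0" and Lpoly_1 [simp]: "Lpoly 1"
  by (auto simp: Lpoly_def coeff_1)

lemma Lpoly_pCons: "Lpoly (pCons a p) \<longleftrightarrow> a \<in> L \<and> Lpoly p"
  by (auto simp: Lpoly_def coeff_pCons split: nat.split)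

lemma Lpoly_add: "Lpoly p \<Longrightarrow> Lpoly q \<Longrightarrow> Lpoly (p + q)"
  and Lpoly_minus: "Lpoly p \<Longrightarrow> Lpoly (- p)"
  and Lpoly_diff: "Lpoly p \<Longrightarrow> Lpoly q \<Longrightarrow> Lpoly (p - q)"
  and Lpoly_smult: "a \<in> L \<Longrightarrow> Lpoly p \<Longrightarrow> Lpoly (Polynomial.smult a p)"
  and Lpoly_monom: "a \<in> L \<Longrightarrow> Lpoly (Polynomial.monom a n)"
  by (auto simp: Lpoly_def L_closed)

lemma Lpoly_mult: "Lpoly p \<Longrightarrow> Lpoly q \<Longrightarrow> Lpoly (p * q)"
  unfolding Lpoly_def coeff_mult by (auto intro!: L_sum L_mult)

lemma Lpoly_power: "Lpoly p \<Longrightarrow> Lpoly (p ^ n)"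
  by (induction n) (auto intro: Lpoly_mult)

lemma Lpoly_sum: "(\<And>i. i \<in> I \<Longrightarrow> Lpoly (g i)) \<Longrightarrow> Lpoly (sum g I)"
  by (induction I rule: infinite_finite_induct) (auto intro: Lpoly_add)

lemma Lpoly_pcompose: "Lpoly p \<Longrightarrow> Lpoly q \<Longrightarrow> Lpoly (pcompose p q)"
  by (induction p) (auto simp: pcompose_pCons Lpoly_pCons intro!: Lpoly_add Lpoly_mult)

lemma Lpoly_pderiv: "Lpoly p \<Longrightarrow> Lpoly (pderiv p)"
  by (auto simp: Lpoly_def coeff_pderiv L_closed simp del: of_nat_Suc)

lemma poly_in_L: "Lpoly p \<Longrightarrow> x \<in> L \<Longrightarrow> poly p x \<in> L"
  unfolding poly_altdef Lpoly_def by (intro L_sum L_mult L_power) auto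

lemma lead_in_L: "Lpoly p \<Longrightarrow> lead_coeff p \<in> L"
  by (simp add: Lpoly_def)

text \<open>Long division carried out over \<open>L\<close>: each subtracted monomial has a quotient
  of leading coefficients as its coefficient, so quotient and remainder never leave
  \<open>L\<close>.\<close>

lemma Lpoly_division:
  assumes "Lpoly f" "Lpoly p" "p \<noteq> 0"
  shows "\<exists>q r. Lpoly q \<and> Lpoly r \<and> f = p * q + r \<and> (r = 0 \<or> degree r < degree p)"
  using assms(1)
\<comment> \<open>The zero polynomial gets a smaller measure than the nonzero constants: division by
  a constant takes \<open>f\<close> from degree 0 to zero.\<close>
proof (induction "if f = 0 then 0 else Suc (degree f)" arbitrary: f rule: less_induct)
  case less
  show ?case
  proof (cases "f = 0 \<or> degree f < degree p")
    case True
    then show ?thesis using less.prems by (intro exI[of _ 0] exI[of _ f]) auto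
  next
    case False
    define m where "m = Polynomial.monom (lead_coeff f / lead_coeff p) (degree f - degree p)"
    have m: "Lpoly m" unfolding m_def
      using less.prems assms by (intro Lpoly_monom L_divide lead_in_L)
    have m0: "m \<noteq> 0" using False assms by (simp add: m_def)
    have dm1: "degree (p * m) = degree f"
      using False assms m0 by (auto simp: degree_mult_eq m_def degree_monom_eq)
    have dm2: "lead_coeff (p * m) = lead_coeff f"
      unfolding lead_coeff_mult using False assms by (simp add: m_def degree_monom_eq)
    note dm = dm1 dm2[unfolded dm1]
    define g where "g = f - p * m"
    have gL: "Lpoly g" unfolding g_def using less.prems m assms by (intro Lpoly_diff Lpoly_mult)
    have "g = 0 \<or> degree g < degree f"
    proof -
      have "degree g \<le> degree f" unfolding g_def using dm by (intro degree_diff_le) auto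
      moreover have "poly.coeff g (degree f) = 0" unfolding g_def using dm by simp
      ultimately show ?thesis by (metis eq_zero_or_degree_less leading_coeff_0_iff le_neq_implies_less)
    qed
    then have "(if g = 0 then 0 else Suc (degree g)) < (if f = 0 then 0 else Suc (degree f))"
      using False by auto
    from less.hyps[OF this gL] obtain q r where "Lpoly q" "Lpoly r" "g = p * q + r" "r = 0 \<or> degree r < degree p"
      by blast
    then show ?thesis using m
      by (intro exI[of _ "q + m"] exI[of _ r]) (auto simp: g_def algebra_simps Lpoly_add)
  qed
qed

text \<open>The product is divided by \<open>p\<close> over \<open>L\<close>; by degree the quotient
  so obtained can only be \<open>g\<close>.\<close>

lemma Lpoly_cofactor:
  assumes "Lpoly (p * g)" "Lpoly p" "p \<noteq> 0" shows "Lpoly g"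
proof -
  obtain q r where q: "Lpoly q" "p * g = p * q + r" "r = 0 \<or> degree r < degree p"
    using Lpoly_division[OF assms] by blast
  have "p * (g - q) = r" using q(2) by (simp add: algebra_simps)
  then have "g - q = 0" using q(3) assms(3) by (metis degree_mult_right_le mult_eq_0_iff not_le)
  then show ?thesis using q(1) by simp
qed

text \<open>The polynomials over \<open>L\<close> that annihilate \<theta> are the multiples of
  \<open>p\<close>; this takes the place of irreducibility.\<close>

definition is_minpoly :: "'c poly \<Rightarrow> 'c \<Rightarrow> bool" where
  "is_minpoly p \<theta> \<longleftrightarrow> Lpoly p \<and> lead_coeff p = 1 \<and> poly p \<theta> = 0 \<and>
     (\<forall>g. Lpoly g \<and> poly g \<theta> = 0 \<longrightarrow> (\<exists>h. Lpoly h \<and> g = p * h))"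

lemma minpoly_exists:
  assumes "Lpoly f" "f \<noteq> 0" "poly f \<theta> = 0"
  shows "\<exists>p. is_minpoly p \<theta>"
proof -
  let ?P = "\<lambda>g. Lpoly g \<and> g \<noteq> 0 \<and> poly g \<theta> = 0"
  obtain g where g: "Lpoly g" "g \<noteq> 0" "poly g \<theta> = 0" and min: "\<And>h. ?P h \<Longrightarrow> degree g \<le> degree h"
    using ex_has_least_nat[of ?P f degree] assms by blast
  define p where "p = Polynomial.smult (inverse (lead_coeff g)) g"
  have p: "Lpoly p" "lead_coeff p = 1" "poly p \<theta> = 0" "degree p = degree g"
    using g by (auto simp: p_def intro!: Lpoly_smult L_inverse lead_in_L)
  have "\<exists>h. Lpoly h \<and> f = p * h" if f: "Lpoly f" "poly f \<theta> = 0" for f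
  proof -
    obtain q r where q: "Lpoly q" "Lpoly r" "f = p * q + r" "r = 0 \<or> degree r < degree p"
      using Lpoly_division[OF f(1) p(1)] p(2) by fastforce
    have "poly r \<theta> = 0" using q(3) f(2) p(3) by simp
    then have "r = 0" using min[of r] q p(4) by fastforce
    then show ?thesis using q by auto
  qed
  then show ?thesis using p unfolding is_minpoly_def by blast
qed

text \<open>A linear \<open>p\<close> would put \<theta> into \<open>L\<close>. A root in
  \<open>L\<close> would split off a linear factor and leave a polynomial of smaller degree that
  still annihilates \<theta>.\<close>

lemma minpoly_not_in_L:
  assumes "is_minpoly p \<theta>" "\<theta> \<notin> L"
  shows "2 \<le> degree p" "\<And>a. a \<in> L \<Longrightarrow> poly p a \<noteq> 0"
proof -
  have p: "Lpoly p" "lead_coeff p = 1" "poly p \<theta> = 0" "p \<noteq> 0"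
    and min: "\<And>g. Lpoly g \<Longrightarrow> poly g \<theta> = 0 \<Longrightarrow> \<exists>h. Lpoly h \<and> g = p * h"
    using assms by (auto simp: is_minpoly_def)
  have "degree p \<noteq> 0"
  proof
    assume "degree p = 0"
    then obtain a where "p = [:a:]" using degree_eq_zeroE by blast
    with p show False by auto
  qed
  moreover have "degree p \<noteq> 1"
  proof
    assume d: "degree p = 1"
    then have "p = [:poly.coeff p 0, poly.coeff p 1:]"
      by (intro poly_eqI) (auto simp: coeff_pCons coeff_eq_0 split: nat.split)
    then have "poly p \<theta> = poly.coeff p 0 + \<theta>"
    proof -
      have "poly [:poly.coeff p 0, poly.coeff p 1:] \<theta> = poly.coeff p 0 + \<theta>" using p(2) d by simp
      moreover have "poly p \<theta> = poly [:poly.coeff p 0, poly.coeff p 1:] \<theta>"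
        using \<open>p = _\<close> by (rule arg_cong)
      ultimately show ?thesis by simp
    qed
    then have "\<theta> = - poly.coeff p 0" using p(3) by (simp add: eq_neg_iff_add_eq_0 add.commute)
    then show False using p(1) assms(2) by (auto simp: Lpoly_def L_minus)
  qed
  ultimately show deg: "2 \<le> degree p" by linarith
  show "poly p a \<noteq> 0" if a: "a \<in> L" for a
  proof
    assume "poly p a = 0"
    then obtain g where g: "p = [:- a, 1:] * g" using poly_eq_0_iff_dvd by (auto simp: dvd_def)
    have "Lpoly ([:- a, 1:] * g)" using p(1) by (simp only: g[symmetric])
    then have "Lpoly g"
      by (rule Lpoly_cofactor) (use a in \<open>auto simp: Lpoly_pCons L_minus\<close>)
    moreover have "\<theta> \<noteq> a" using a assms(2) by auto
    then have "poly g \<theta> = 0" using p(3) unfolding g by simp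
    ultimately obtain h where h: "g = p * h" using min by blast
    have "g \<noteq> 0" using g p(4) by auto
    then have "degree p \<le> degree g" using h by (metis degree_mult_right_le mult_not_zero)
    moreover have "degree p = degree g + 1"
      unfolding g using \<open>g \<noteq> 0\<close> by (subst degree_mult_eq) auto
    ultimately show False by simp
  qed
qed

end

lemma vector_space_times: "vector_space ((*) :: 'a::field \<Rightarrow> 'a \<Rightarrow> 'a)"
  by unfold_locales (auto simp: algebra_simps)

context field_carrier
begin

text \<open>
  Interpreting \<^locale>\<open>lspace\<close> for multiplication itself would turn \<open>a * (b * x) = a * b * x\<close> into a
  simplification rule; hence the facts about such spaces are used without interpretation.
\<close>

lemma lspace_times:
  assumes "0 \<in> W" "\<And>x y. x \<in> W \<Longrightarrow> y \<in> W \<Longrightarrow> x + y \<in> W" "\<And>a x. a \<in> L \<Longrightarrow> x \<in> W \<Longrightarrow> a * x \<in> W"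
  shows "lspace L (*) W"
proof -
  interpret vector_space "(*) :: 'c \<Rightarrow> 'c \<Rightarrow> 'c" by (rule vector_space_times)
  show "lspace L (*) W" using assms by unfold_locales auto
qed

lemma lspace_self: "lspace L (*) L"
  by (intro lspace_times) (auto intro: L_add L_mult)

end

locale simple_extension = field_carrier L for L :: "'c::field set" +
  fixes \<theta> :: 'c and p :: "'c poly"
  assumes minpoly: "is_minpoly p \<theta>"
begin

lemma p_facts: "Lpoly p" "lead_coeff p = 1" "poly p \<theta> = 0" "p \<noteq> 0"
  and p_min: "\<And>g. Lpoly g \<Longrightarrow> poly g \<theta> = 0 \<Longrightarrow> \<exists>h. Lpoly h \<and> g = p * h"
  using minpoly by (auto simp: is_minpoly_def)

lemma degree_p_pos: "0 < degree p"
proof (rule ccontr)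
  assume "\<not> 0 < degree p"
  then obtain a where "p = [:a:]" using degree_eq_zeroE by blast
  with p_facts show False by auto
qed

definition E :: "'c set" where "E = {poly g \<theta> | g. Lpoly g}"

lemma E_poly: "Lpoly g \<Longrightarrow> poly g \<theta> \<in> E"
  by (auto simp: E_def)

lemma E_theta: "\<theta> \<in> E"
  using E_poly[of "[:0, 1:]"] by (simp add: Lpoly_pCons)

lemma L_subset_E: "L \<subseteq> E"
proof
  fix a assume "a \<in> L"
  then show "a \<in> E" using E_poly[of "[:a:]"] by (simp add: Lpoly_pCons)
qed

lemma E_reduced: "u \<in> E \<Longrightarrow> \<exists>!g. Lpoly g \<and> degree g < degree p \<and> poly g \<theta> = u"
proof (rule ex_ex1I)
  assume "u \<in> E"
  then obtain f where f: "Lpoly f" "u = poly f \<theta>" by (auto simp: E_def)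
  obtain q r where q: "Lpoly r" "f = p * q + r" "r = 0 \<or> degree r < degree p"
    using Lpoly_division[OF f(1) p_facts(1,4)] by blast
  then show "\<exists>g. Lpoly g \<and> degree g < degree p \<and> poly g \<theta> = u"
    using f p_facts(3) degree_p_pos by (intro exI[of _ r]) auto
next
  fix g g' assume g: "Lpoly g \<and> degree g < degree p \<and> poly g \<theta> = u"
    and g': "Lpoly g' \<and> degree g' < degree p \<and> poly g' \<theta> = u"
  have "\<exists>h. Lpoly h \<and> g - g' = p * h"
    using g g' by (intro p_min Lpoly_diff) auto
  then obtain h where h: "g - g' = p * h" by blast
  have "degree (g - g') < degree p" using g g' by (intro degree_diff_less) auto
  then have "g - g' = 0" using h by (metis degree_mult_right_le leD mult_eq_0_iff)
  then show "g = g'" by simp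
qed

definition red :: "'c \<Rightarrow> 'c poly" where
  "red u = (THE g. Lpoly g \<and> degree g < degree p \<and> poly g \<theta> = u)"

lemma red: "u \<in> E \<Longrightarrow> Lpoly (red u) \<and> degree (red u) < degree p \<and> poly (red u) \<theta> = u"
  unfolding red_def by (rule theI') (rule E_reduced)

lemma red_eqI: "Lpoly g \<Longrightarrow> degree g < degree p \<Longrightarrow> red (poly g \<theta>) = g"
  unfolding red_def by (rule the1_equality[OF E_reduced]) (auto simp: E_poly)

lemma red_add: "u \<in> E \<Longrightarrow> v \<in> E \<Longrightarrow> red (u + v) = red u + red v"
  using red_eqI[of "red u + red v"] red[of u] red[of v] by (simp add: Lpoly_add degree_add_less)

lemma red_scale: "a \<in> L \<Longrightarrow> u \<in> E \<Longrightarrow> red (a * u) = Polynomial.smult a (red u)"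
  using red_eqI[of "Polynomial.smult a (red u)"] red[of u]
  by (simp add: Lpoly_smult le_less_trans[OF degree_smult_le])

lemma E_closed:
  "0 \<in> E" "1 \<in> E" "u \<in> E \<Longrightarrow> v \<in> E \<Longrightarrow> u + v \<in> E" "u \<in> E \<Longrightarrow> v \<in> E \<Longrightarrow> u * v \<in> E" "u \<in> E \<Longrightarrow> - u \<in> E"
proof -
  show "0 \<in> E" "1 \<in> E" using L_subset_E by auto
  show "u \<in> E \<Longrightarrow> v \<in> E \<Longrightarrow> u + v \<in> E"
    unfolding E_def by clarsimp (metis Lpoly_add poly_add)
  show "u \<in> E \<Longrightarrow> v \<in> E \<Longrightarrow> u * v \<in> E"
    unfolding E_def by clarsimp (metis Lpoly_mult poly_mult)
  show "u \<in> E \<Longrightarrow> - u \<in> E"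
    unfolding E_def by clarsimp (metis Lpoly_minus poly_minus)
qed

lemma lspace_E: "lspace L (*) E"
  using E_closed L_subset_E by (intro lspace_times) auto

lemma E_expand: "u \<in> E \<Longrightarrow> u = (\<Sum>i<degree p. poly.coeff (red u) i * \<theta> ^ i)"
proof -
  assume u: "u \<in> E"
  have "u = (\<Sum>i\<le>degree (red u). poly.coeff (red u) i * \<theta> ^ i)"
    using red[OF u] by (simp add: poly_altdef)
  also have "\<dots> = (\<Sum>i<degree p. poly.coeff (red u) i * \<theta> ^ i)"
    using red[OF u] by (intro sum.mono_neutral_left) (auto simp: coeff_eq_0)
  finally show ?thesis .
qed

lemma gen_E: "gen_on L (*) E ((\<lambda>i. \<theta> ^ i) ` {..<degree p})"
  unfolding gen_on_def
proof (intro conjI allI impI)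
  have pw: "\<theta> ^ i \<in> E" for i by (induction i) (auto simp: E_closed E_theta)
  then show "(\<lambda>i. \<theta> ^ i) ` {..<degree p} \<subseteq> E" by auto
  fix U assume U: "subspace_on L (*) E U \<and> (\<lambda>i. \<theta> ^ i) ` {..<degree p} \<subseteq> U"
  have U_lspace: "lspace L (*) U" using U by (intro lspace.subspace_lspace[OF lspace_E]) auto
  show "U = E"
  proof
    show "U \<subseteq> E" using U by (auto simp: subspace_on_def)
    show "E \<subseteq> U"
    proof
      fix u assume u: "u \<in> E"
      have "(\<Sum>i<degree p. poly.coeff (red u) i * \<theta> ^ i) \<in> U"
        using U red[OF u] by (intro lspace.W_sum[OF U_lspace] lspace.W_scale[OF U_lspace]) (auto simp: Lpoly_def)
      then show "u \<in> U" using E_expand[OF u] by simp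
    qed
  qed
qed auto

text \<open>Multiplication by a nonzero element is an injective endomorphism of a finite-dimensional
  space, so 1 lies in its image.\<close>

lemma subfield_E: "subfield_set E"
proof -
  have "inverse u \<in> E" if u: "u \<in> E" for u
  proof (cases "u = 0")
    case False
    have "\<exists>x\<in>E. u * x = 1"
    proof (rule lspace.inj_imp_surj[OF lspace_E gen_E])
      show "linear_endo_on L (*) E ((*) u)"
        unfolding linear_endo_on_def using E_closed(4)[OF u] by (simp add: distrib_left mult.left_commute)
    qed (use False E_closed(2) in auto)
    then show ?thesis using False by (metis inverse_unique)
  qed (simp add: E_closed)
  then show ?thesis using E_closed by (auto simp: subfield_set_def)
qed

lemma power_combination_nonzero:
  assumes "\<And>i. i < degree p \<Longrightarrow> c i \<in> L" "(\<Sum>i<degree p. c i * \<theta> ^ i) = 0" "i < degree p"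
  shows "c i = 0"
proof -
  define g where "g = (\<Sum>i<degree p. Polynomial.monom (c i) i)"
  have co: "poly.coeff g i = (if i < degree p then c i else 0)" for i
    unfolding g_def by (simp add: coeff_sum)
  have gL: "Lpoly g" unfolding g_def using assms by (intro Lpoly_sum Lpoly_monom) auto
  have "degree g < degree p"
  proof (cases "g = 0")
    case False
    then have "poly.coeff g (degree g) \<noteq> 0" by simp
    then show ?thesis using co[of "degree g"] by (simp split: if_splits)
  qed (simp add: degree_p_pos)
  moreover have "poly g \<theta> = 0" using assms(2) by (simp add: g_def poly_sum poly_monom)
  ultimately have "g = 0" using red_eqI[OF gL] red_eqI[of 0] degree_p_pos by simp
  then show ?thesis using co[of i] assms(3) by simp
qed

end

section \<open>Systems given by Gram matrices\<close>

text \<open>The Gram matrix stays fixed while the field of coordinates varies: base change to a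
  larger field enlarges the space of coordinate vectors and leaves the form as it is.\<close>

definition gform :: "'v set \<Rightarrow> ('t \<Rightarrow> 'v \<Rightarrow> 'v \<Rightarrow> 'c::comm_ring_1) \<Rightarrow> 't \<Rightarrow> ('v \<Rightarrow> 'c) \<Rightarrow> ('v \<Rightarrow> 'c) \<Rightarrow> 'c" where
  "gform B G t x y = (\<Sum>b\<in>B. \<Sum>c\<in>B. G t b c * x b * y c)"

lemma (in field_carrier) gen_self: "gen_on L (*) L {1}"
  unfolding gen_on_def subspace_on_def by (auto) (metis mult.right_neutral)

text \<open>A longest orthonormal family spans. Every scalar is a square up to sign, so a vector
  orthogonal to the family with nonzero value could be normalised and added. Hence all values on the
  complement are 0, by polarisation the form vanishes there, and nondegeneracy leaves no
  complement.\<close>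

lemma (in lspace) orthonormal_basis:
  fixes \<phi> :: "'w \<Rightarrow> 'w \<Rightarrow> 'c"
  assumes gen: "gen_on L s W S" and two: "(2::'c) \<noteq> 0"
    and euclid: "\<And>a. a \<in> L \<Longrightarrow> \<exists>c\<in>L. a = c\<^sup>2 \<or> a = - c\<^sup>2"
    and \<phi>L: "\<And>x y. x \<in> W \<Longrightarrow> y \<in> W \<Longrightarrow> \<phi> x y \<in> L"
    and sym: "\<And>x y. \<phi> x y = \<phi> y x"
    and add: "\<And>x y z. x \<in> W \<Longrightarrow> y \<in> W \<Longrightarrow> z \<in> W \<Longrightarrow> \<phi> (x + y) z = \<phi> x z + \<phi> y z"
    and scl: "\<And>a x y. a \<in> L \<Longrightarrow> x \<in> W \<Longrightarrow> y \<in> W \<Longrightarrow> \<phi> (s a x) y = a * \<phi> x y"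
    and nondeg: "\<And>x. x \<in> W \<Longrightarrow> (\<And>y. y \<in> W \<Longrightarrow> \<phi> x y = 0) \<Longrightarrow> x = 0"
  shows "\<exists>(k::nat) \<epsilon> \<eta>. k \<le> card S \<and> (\<forall>i<k. \<epsilon> i \<in> W \<and> (\<eta> i = 1 \<or> \<eta> i = - 1)) \<and>
    (\<forall>i<k. \<forall>j<k. \<phi> (\<epsilon> i) (\<epsilon> j) = (if i = j then \<eta> i else 0)) \<and>
    (\<forall>x\<in>W. x = (\<Sum>i<k. s (\<eta> i * \<phi> x (\<epsilon> i)) (\<epsilon> i)))"
proof -
  define orth where "orth k \<epsilon> \<eta> \<longleftrightarrow> (\<forall>i<k. \<epsilon> i \<in> W \<and> (\<eta> i = 1 \<or> \<eta> i = - 1)) \<and>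
    (\<forall>i<k. \<forall>j<k. \<phi> (\<epsilon> i) (\<epsilon> j) = (if i = j then \<eta> i else 0))" for k :: nat and \<epsilon> and \<eta> :: "nat \<Rightarrow> 'c"
  have zero: "\<phi> 0 y = 0" if "y \<in> W" for y using scl[of 0 0 y] that by simp
  have sum: "\<phi> (\<Sum>i\<in>I. s (c i) (u i)) y = (\<Sum>i\<in>I. c i * \<phi> (u i) y)"
    if "\<And>i. i \<in> I \<Longrightarrow> c i \<in> L \<and> u i \<in> W" "y \<in> W" for I :: "nat set" and c u y
    using that
  proof (induction I rule: infinite_finite_induct)
    case (insert i I)
    have "(\<Sum>i\<in>I. s (c i) (u i)) \<in> W" using insert by (intro W_sum W_scale) auto
    then show ?case using insert by (simp add: add scl W_scale)
  qed (auto simp: zero)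
  have bound: "k \<le> card S" if "orth k \<epsilon> \<eta>" for k \<epsilon> \<eta>
  proof (rule ccontr)
    assume "\<not> k \<le> card S"
    then have "card S < card {..<k}" by simp
    moreover have "\<And>x. x \<in> {..<k} \<Longrightarrow> \<epsilon> x \<in> W" using that by (auto simp: orth_def)
    ultimately obtain c where c: "\<forall>x. c x \<in> L" "\<exists>x\<in>{..<k}. c x \<noteq> 0" "(\<Sum>x\<in>{..<k}. s (c x) (\<epsilon> x)) = 0"
      using gen_dependent[OF gen, of "{..<k}" \<epsilon>] by blast
    then obtain j where j: "j < k" "c j \<noteq> 0" by auto
    have "0 = (\<Sum>x<k. c x * \<phi> (\<epsilon> x) (\<epsilon> j))"
    proof -
      have "\<And>x. x \<in> {..<k} \<Longrightarrow> c x \<in> L \<and> \<epsilon> x \<in> W" "\<epsilon> j \<in> W" using c(1) that j(1) by (auto simp: orth_def)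
      then show ?thesis using sum[of "{..<k}" c \<epsilon> "\<epsilon> j"] c(3) zero by simp
    qed
    also have "\<dots> = (\<Sum>x<k. if x = j then c x * \<eta> j else 0)"
    proof (intro sum.cong refl)
      fix x assume "x \<in> {..<k}"
      then have "\<phi> (\<epsilon> x) (\<epsilon> j) = (if x = j then \<eta> x else 0)" using that j(1) unfolding orth_def by blast
      then show "c x * \<phi> (\<epsilon> x) (\<epsilon> j) = (if x = j then c x * \<eta> j else 0)" by simp
    qed
    also have "\<dots> = c j * \<eta> j" using j(1) by simp
    finally have "\<eta> j = 0" using j(2) by simp
    moreover have "\<eta> j = 1 \<or> \<eta> j = - 1" using that j(1) by (auto simp: orth_def)
    ultimately show False by auto
  qed
  define Q where "Q k \<longleftrightarrow> (\<exists>\<epsilon> \<eta>. orth k \<epsilon> \<eta>)" for k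
  have "Q 0" unfolding Q_def orth_def by simp
  moreover have "\<forall>k. Q k \<longrightarrow> k \<le> card S" using bound unfolding Q_def by blast
  ultimately obtain k where "Q k" and maxQ: "\<forall>k'. Q k' \<longrightarrow> k' \<le> k"
    using Nat.ex_has_greatest_nat[of Q 0 "card S"] by blast
  then have k: "\<exists>\<epsilon> \<eta>. orth k \<epsilon> \<eta>" and max: "\<And>k' \<epsilon> \<eta>. orth k' \<epsilon> \<eta> \<Longrightarrow> k' \<le> k"
    unfolding Q_def by blast+
  then obtain \<epsilon> \<eta> where o: "orth k \<epsilon> \<eta>" by blast
  then have \<epsilon>: "\<And>i. i < k \<Longrightarrow> \<epsilon> i \<in> W" and \<eta>: "\<And>i. i < k \<Longrightarrow> \<eta> i = 1 \<or> \<eta> i = - 1"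
    and ort: "\<And>i j. i < k \<Longrightarrow> j < k \<Longrightarrow> \<phi> (\<epsilon> i) (\<epsilon> j) = (if i = j then \<eta> i else 0)"
    by (auto simp: orth_def)
  have \<eta>L: "\<eta> i \<in> L" if "i < k" for i using \<eta>[OF that] L_minus[OF L_1] by auto
  let ?C = "{x\<in>W. \<forall>i<k. \<phi> x (\<epsilon> i) = 0}"
  \<comment> \<open>Orthogonal projection onto the span of the family; each \<open>\<eta> i\<close>
    is its own inverse.\<close>
  define pr where "pr x = (\<Sum>i<k. s (\<eta> i * \<phi> x (\<epsilon> i)) (\<epsilon> i))" for x
  have prW: "pr x \<in> W" if "x \<in> W" for x
    unfolding pr_def using that \<epsilon> \<eta>L \<phi>L by (intro W_sum W_scale L_mult) auto
  have diff: "\<phi> (x - y) z = \<phi> x z - \<phi> y z" if "x \<in> W" "y \<in> W" "z \<in> W" for x y z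
    using add[of x "- y" z] scl[of "- 1" y z] that L_minus[of 1] W_minus by simp
  have compl: "x - pr x \<in> ?C" if x: "x \<in> W" for x
  proof -
    have "\<phi> (pr x) (\<epsilon> j) = \<phi> x (\<epsilon> j)" if j: "j < k" for j
    proof -
      have "\<phi> (pr x) (\<epsilon> j) = (\<Sum>i<k. \<eta> i * \<phi> x (\<epsilon> i) * \<phi> (\<epsilon> i) (\<epsilon> j))"
        unfolding pr_def using x j \<epsilon> \<eta>L \<phi>L by (intro sum) (auto intro: L_mult)
      also have "\<dots> = (\<Sum>i<k. if i = j then \<phi> x (\<epsilon> j) else 0)"
      proof (intro sum.cong refl)
        fix i assume i: "i \<in> {..<k}"
        have "\<eta> i * \<eta> i = 1" using \<eta>[of i] i by auto
        then have "\<eta> i * \<phi> x (\<epsilon> i) * \<eta> i = \<phi> x (\<epsilon> i)" by (metis mult.commute mult.left_commute mult_1)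
        then show "\<eta> i * \<phi> x (\<epsilon> i) * \<phi> (\<epsilon> i) (\<epsilon> j) = (if i = j then \<phi> x (\<epsilon> j) else 0)"
          using ort[of i j] i j by auto
      qed
      finally show ?thesis using j by simp
    qed
    then show ?thesis using x prW \<epsilon> by (auto simp: diff W_diff)
  qed
  have iso: "\<phi> x x = 0" if xC: "x \<in> ?C" for x
  proof (rule ccontr)
    assume nz: "\<phi> x x \<noteq> 0"
    obtain c where c: "c \<in> L" "\<phi> x x = c\<^sup>2 \<or> \<phi> x x = - c\<^sup>2" using euclid[of "\<phi> x x"] \<phi>L[of x x] xC by auto
    then have c0: "c \<noteq> 0" using nz by auto
    define x' where "x' = s (inverse c) x"
    have x': "x' \<in> W" unfolding x'_def using xC c by (auto intro: W_scale L_inverse)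
    have "\<phi> x' x' = inverse c * (inverse c * \<phi> x x)"
    proof -
      have i: "inverse c \<in> L" "x \<in> W" using c xC by (auto intro: L_inverse)
      have "\<phi> x' x' = inverse c * \<phi> x (s (inverse c) x)"
        unfolding x'_def using i by (intro scl W_scale)
      then show ?thesis using scl[OF i i(2)] sym by metis
    qed
    moreover have "inverse c * (inverse c * c\<^sup>2) = 1" using c0 by (simp add: power2_eq_square field_simps)
    ultimately have x'x': "\<phi> x' x' = 1 \<or> \<phi> x' x' = - 1" using c(2) by auto
    have x'e: "\<phi> x' (\<epsilon> i) = 0" "\<phi> (\<epsilon> i) x' = 0" if "i < k" for i
      using xC that c scl[of "inverse c" x "\<epsilon> i"] L_inverse \<epsilon> sym[of "\<epsilon> i"] by (auto simp: x'_def)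
    have "orth (Suc k) (\<epsilon>(k := x')) (\<eta>(k := \<phi> x' x'))"
      using \<epsilon> \<eta> ort x' x'x' x'e unfolding orth_def by (auto simp: less_Suc_eq)
    then show False using max by fastforce
  qed
  have C0: "x = 0" if x: "x \<in> ?C" for x
  proof (rule nondeg)
    show "x \<in> W" using x by simp
    fix y assume y: "y \<in> W"
    define z where "z = y - pr y"
    have z: "z \<in> ?C" unfolding z_def by (rule compl[OF y])
    have zW: "z \<in> W" and xW: "x \<in> W" using z x by auto
    have "\<phi> (x + z) (x + z) = 0"
      using x z add \<epsilon> by (intro iso) (auto simp: W_add)
    then have "2 * \<phi> x z = 0"
      using iso[OF x] iso[OF z] add[OF xW zW W_add[OF xW zW]]
        add[OF xW zW xW] add[OF xW zW zW] sym[of x "x + z"] sym[of z "x + z"] sym[of z x] by simp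
    then have "\<phi> x z = 0" using two by simp
    moreover have "\<phi> x (pr y) = 0"
    proof -
      have "\<phi> (pr y) x = (\<Sum>i<k. \<eta> i * \<phi> y (\<epsilon> i) * \<phi> (\<epsilon> i) x)"
        unfolding pr_def using xW y \<epsilon> \<eta>L \<phi>L by (intro sum) (auto intro: L_mult)
      also have "\<dots> = 0" using x sym by (intro sum.neutral) auto
      finally show ?thesis using sym by metis
    qed
    ultimately show "\<phi> x y = 0"
      using diff[OF y prW[OF y] xW] sym[of x] by (simp add: z_def)
  qed
  have "x = pr x" if "x \<in> W" for x using C0[OF compl[OF that]] by simp
  then show ?thesis using o bound[OF o] unfolding orth_def pr_def by blast
qed

locale gram =
  fixes B :: "'v set" and G :: "'t \<Rightarrow> 'v \<Rightarrow> 'v \<Rightarrow> 'c::field" and K0 :: "'c set"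
  assumes finite_B: "finite B"
    and G_sym: "b \<in> B \<Longrightarrow> c \<in> B \<Longrightarrow> G t b c = G t c b"
    and G_K0: "b \<in> B \<Longrightarrow> c \<in> B \<Longrightarrow> G t b c \<in> K0"
    and subfield_K0: "subfield_set K0"
begin

abbreviation "sc \<equiv> pscale ((*) :: 'c \<Rightarrow> 'c \<Rightarrow> 'c)"
abbreviation "V L \<equiv> pspace B (L :: 'c set)"
abbreviation "bf \<equiv> gform B G"

text \<open>Torsion of the system over \<open>L\<close>: some multiple has an anti-isometry. The
  indices are natural numbers only to fix a type; \<open>tor_of_anti\<close> accepts any finite
  index set.\<close>

definition tor :: "'c set \<Rightarrow> bool" where
  "tor L \<longleftrightarrow> (\<exists>I::nat set. finite I \<and> I \<noteq> {} \<and> anti L sc (V L) bf I (\<lambda>_. 1))"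

lemma formspace_V: "subfield_set L \<Longrightarrow> formspace L sc (V L) bf"
proof -
  assume L: "subfield_set L"
  interpret field_carrier L by unfold_locales (rule L)
  interpret p: lspace L sc "V L" by (rule lspace.lspace_pspace[OF lspace_self])
  have sym: "gform B G t x y = gform B G t y x" for t x y
  proof -
    have "gform B G t y x = (\<Sum>b\<in>B. \<Sum>c\<in>B. G t c b * y c * x b)"
      unfolding gform_def by (rule sum.swap)
    also have "\<dots> = gform B G t x y"
      unfolding gform_def
    proof (intro sum.cong refl)
      fix b c assume "b \<in> B" "c \<in> B"
      then have eq: "G t c b = G t b c" by (simp only: G_sym[of b c])
      show "G t c b * y c * x b = G t b c * x b * y c"
        unfolding eq mult.assoc mult.commute[of "y c" "x b"] ..
    qed
    finally show ?thesis by simp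
  qed
  show ?thesis
  proof unfold_locales
    fix t x y z and a :: 'c
    show "bf t x y = bf t y x" by (rule sym)
    show "bf t (x + y) z = bf t x z + bf t y z"
      by (simp add: gform_def distrib_left distrib_right sum.distrib)
    show "bf t (sc a x) y = a * bf t x y"
      by (simp add: gform_def pscale_def sum_distrib_left mult_ac)
  qed
qed

lemma gen_V: "subfield_set L \<Longrightarrow> gen_on L sc (V L) (\<Union>b\<in>B. single b ` {1})"
proof -
  assume L: "subfield_set L"
  interpret field_carrier L by unfold_locales (rule L)
  show ?thesis by (rule lspace.gen_on_pspace[OF lspace_self gen_self finite_B])
qed

lemma tor_of_anti:
  fixes I :: "'i set"
  assumes L: "subfield_set L" and "anti L sc (V L) bf I a" "finite I" "I \<noteq> {}" "\<And>i. i \<in> I \<Longrightarrow> a i = 1"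
  shows "tor L"
proof -
  interpret formspace L sc "V L" bf by (rule formspace_V[OF L])
  obtain h where h: "bij_betw h {0..<card I} I" using ex_bij_betw_nat_finite[OF assms(3)] by blast
  have "anti L sc (V L) bf {0..<card I} (\<lambda>_. 1)"
    by (rule anti_reindex[OF assms(2) h, where c = "\<lambda>_. 1"]) (use bij_betwE[OF h] assms(5) in auto)
  then show ?thesis unfolding tor_def using assms(3,4) by (intro exI[of _ "{0..<card I}"]) auto
qed

text \<open>Scharlau's transfer along an \<open>L\<close>-linear functional \<open>st\<close> on
  \<open>E\<close>. The Gram matrix and the entries \<open>a\<close> lie in \<open>L\<close>, so the
  transfer of the system over \<open>E\<close> is the transferred unit form, diagonalised as \<eta>,
  tensored over \<open>L\<close> with the system. An anti-isometry over \<open>E\<close> stays one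
  when read over \<open>L\<close>.\<close>

lemma anti_transfer:
  fixes I :: "'i set"
  assumes L: "subfield_set L" and E: "subfield_set E" and "L \<subseteq> E" "K0 \<subseteq> L" "finite I"
    and st: "linear_endo_on L (*) E st"
    and cf: "\<And>k. k < r \<Longrightarrow> linear_endo_on L (*) E (cf k)" "\<And>k u. k < r \<Longrightarrow> u \<in> E \<Longrightarrow> cf k u \<in> L"
    and \<epsilon>: "\<And>k. k < r \<Longrightarrow> \<epsilon> k \<in> E"
    and orth: "\<And>u v. u \<in> E \<Longrightarrow> v \<in> E \<Longrightarrow> st (u * v) = (\<Sum>k<r. \<eta> k * cf k u * cf k v)"
    and dual: "\<And>c k. (\<And>j. j < r \<Longrightarrow> c j \<in> L) \<Longrightarrow> k < r \<Longrightarrow> cf k (\<Sum>j<r. c j * \<epsilon> j) = c k"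
    and a: "\<And>i. i \<in> I \<Longrightarrow> a i \<in> L"
    and anti: "anti E sc (V E) bf I a"
  shows "anti L sc (V L) bf ({..<r::nat} \<times> I) (\<lambda>(k, i). \<eta> k * a i)"
proof -
  interpret L: field_carrier L by unfold_locales (rule L)
  interpret E: field_carrier E by unfold_locales (rule E)
  have EL: "lspace L (*) E" using assms(3) by (intro L.lspace_times) (auto intro: E.L_add E.L_mult)
  interpret VE: formspace E sc "V E" bf by (rule formspace_V[OF E])
  obtain f where f: "linear_endo_on E (pscale sc) (pspace I (V E)) f" "\<And>x. x \<in> pspace I (V E) \<Longrightarrow> f x \<in> pspace I (V E)"
    "\<And>t x y. x \<in> pspace I (V E) \<Longrightarrow> y \<in> pspace I (V E) \<Longrightarrow> dform I a bf t (f x) (f y) = - dform I a bf t x y"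
    using anti_formD[OF anti] by blast
  let ?I = "{..<r} \<times> I"
  \<comment> \<open>\<open>up\<close> assembles a vector over \<open>E\<close> from coordinates with
    respect to \<epsilon>, and \<open>dn\<close> takes coordinates by means of the functionals
    \<open>cf k\<close> dual to \<epsilon>.\<close>
  define up where "up x = (\<lambda>i b. \<Sum>k<r. x (k, i) b * \<epsilon> k)" for x :: "nat \<times> 'i \<Rightarrow> 'v \<Rightarrow> 'c"
  define dn where "dn y = (\<lambda>(k, i) b. if k < r then cf k (y i b) else 0)" for y :: "'i \<Rightarrow> 'v \<Rightarrow> 'c"
  have st_scl: "st (a * u) = a * st u" if "a \<in> L" "u \<in> E" for u a
    using st that by (auto simp: linear_endo_on_def)
  have cf_add: "cf k (u + v) = cf k u + cf k v" and cf_scl: "a \<in> L \<Longrightarrow> cf k (a * u) = a * cf k u" and cf0: "cf k 0 = 0"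
    if "u \<in> E" "v \<in> E" "k < r" for u v a k
    using cf(1)[OF that(3)] that lspace.endo_0[OF EL cf(1)[OF that(3)]] by (auto simp: linear_endo_on_def)
  have G: "G t b c \<in> L" if "b \<in> B" "c \<in> B" for t b c using G_K0[OF that] assms(4) by auto
  have inE: "y i b \<in> E" if "y \<in> pspace I (V E)" for y i b
    using that by (cases "i \<in> I"; cases "b \<in> B") (auto simp: pspace_def)
  have bfE: "bf t x y \<in> E" if "x \<in> V E" "y \<in> V E" for t x y
    unfolding gform_def using that G assms(3) by (intro E.L_sum E.L_mult) (auto simp: pspace_def)
  have st_bf: "st (bf t x y) = (\<Sum>k<r. \<eta> k * bf t (\<lambda>b. cf k (x b)) (\<lambda>b. cf k (y b)))" if "x \<in> V E" "y \<in> V E" for t x y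
  proof -
    have xy: "x b \<in> E" "y b \<in> E" if "b \<in> B" for b using that \<open>x \<in> V E\<close> \<open>y \<in> V E\<close> by (auto simp: pspace_def)
    have GE: "G t b c * (x b * y c) \<in> E" if "b \<in> B" "c \<in> B" for b c
      using that xy G assms(3) by (intro E.L_mult) auto
    have "st (bf t x y) = (\<Sum>b\<in>B. \<Sum>c\<in>B. st (G t b c * (x b * y c)))"
    proof -
      have "st (\<Sum>b\<in>B. \<Sum>c\<in>B. G t b c * (x b * y c)) = (\<Sum>b\<in>B. st (\<Sum>c\<in>B. G t b c * (x b * y c)))"
        using GE by (intro lspace.endo_sum[OF EL st] E.L_sum)
      also have "\<dots> = (\<Sum>b\<in>B. \<Sum>c\<in>B. st (G t b c * (x b * y c)))"
        using GE by (intro sum.cong refl lspace.endo_sum[OF EL st])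
      finally show ?thesis unfolding gform_def mult.assoc .
    qed
    also have "\<dots> = (\<Sum>b\<in>B. \<Sum>c\<in>B. \<Sum>k<r. \<eta> k * (G t b c * cf k (x b) * cf k (y c)))"
    proof (intro sum.cong refl)
      fix b c assume bc: "b \<in> B" "c \<in> B"
      have "st (G t b c * (x b * y c)) = G t b c * st (x b * y c)"
        using xy bc G by (intro st_scl) (auto intro: E.L_mult)
      also have "\<dots> = (\<Sum>k<r. \<eta> k * (G t b c * cf k (x b) * cf k (y c)))"
        unfolding orth[OF xy(1)[OF bc(1)] xy(2)[OF bc(2)]] sum_distrib_left by (simp add: mult_ac)
      finally show "st (G t b c * (x b * y c)) = (\<Sum>k<r. \<eta> k * (G t b c * cf k (x b) * cf k (y c)))" .
    qed
    also have "\<dots> = (\<Sum>b\<in>B. \<Sum>k<r. \<Sum>c\<in>B. \<eta> k * (G t b c * cf k (x b) * cf k (y c)))"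
      by (intro sum.cong refl sum.swap)
    also have "\<dots> = (\<Sum>k<r. \<Sum>b\<in>B. \<Sum>c\<in>B. \<eta> k * (G t b c * cf k (x b) * cf k (y c)))" by (rule sum.swap)
    finally show ?thesis unfolding gform_def by (simp add: sum_distrib_left)
  qed
  have st_dform: "st (dform I a bf t u v) = dform ?I (\<lambda>(k, i). \<eta> k * a i) bf t (dn u) (dn v)"
    if u: "u \<in> pspace I (V E)" and v: "v \<in> pspace I (V E)" for t u v
  proof -
    have ui: "u i \<in> V E" "v i \<in> V E" if "i \<in> I" for i using u v that by (auto simp: pspace_def)
    have aE: "a i * bf t (u i) (v i) \<in> E" if "i \<in> I" for i
      using bfE[OF ui[OF that]] a[OF that] assms(3) by (auto intro: E.L_mult)
    have "st (dform I a bf t u v) = (\<Sum>i\<in>I. st (a i * bf t (u i) (v i)))"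
      unfolding dform_def by (rule lspace.endo_sum[OF EL st aE])
    also have "\<dots> = (\<Sum>i\<in>I. \<Sum>k<r. \<eta> k * a i * bf t (\<lambda>b. cf k (u i b)) (\<lambda>b. cf k (v i b)))"
    proof (intro sum.cong refl)
      fix i assume i: "i \<in> I"
      have "st (a i * bf t (u i) (v i)) = a i * st (bf t (u i) (v i))"
        using a[OF i] bfE[OF ui[OF i]] by (intro st_scl) auto
      then show "st (a i * bf t (u i) (v i)) = (\<Sum>k<r. \<eta> k * a i * bf t (\<lambda>b. cf k (u i b)) (\<lambda>b. cf k (v i b)))"
        unfolding st_bf[OF ui[OF i]] by (simp add: sum_distrib_left mult_ac)
    qed
    also have "\<dots> = (\<Sum>k<r. \<Sum>i\<in>I. \<eta> k * a i * bf t (\<lambda>b. cf k (u i b)) (\<lambda>b. cf k (v i b)))" by (rule sum.swap)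
    also have "\<dots> = dform ?I (\<lambda>(k, i). \<eta> k * a i) bf t (dn u) (dn v)"
      unfolding dform_def sum.cartesian_product by (intro sum.cong) (auto simp: dn_def)
    finally show ?thesis .
  qed
  have up_in: "up x \<in> pspace I (V E)" if "x \<in> pspace ?I (V L)" for x
  proof -
    have "x (k, i) b \<in> E" if "k < r" "i \<in> I" "b \<in> B" for k :: nat and i b
      using \<open>x \<in> _\<close> that assms(3) by (auto simp: pspace_def)
    moreover have "x (k, i) b = 0" if "i \<notin> I \<or> b \<notin> B" for k :: nat and i b
      using \<open>x \<in> _\<close> that by (cases "k < r \<and> i \<in> I") (auto simp: pspace_def)
    ultimately show ?thesis using \<epsilon>
      by (auto simp: pspace_def up_def fun_eq_iff intro!: E.L_sum E.L_mult sum.neutral)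
  qed
  have dn_in: "dn y \<in> pspace ?I (V L)" if y: "y \<in> pspace I (V E)" for y
  proof -
    have "dn y (k, i) \<in> V L" if "k < r" "i \<in> I" for k i
      using inE[OF y, of i] cf(2)[OF that(1)] cf0[OF E.L_0 E.L_0 that(1)] y that by (auto simp: dn_def pspace_def)
    moreover have "dn y (k, i) = 0" if "k \<ge> r \<or> i \<notin> I" for k i
      using y that cf0[OF E.L_0 E.L_0] by (cases "k < r") (auto simp: dn_def pspace_def fun_eq_iff)
    ultimately show ?thesis unfolding pspace_def by force
  qed
  have dn_up: "dn (up x) = x" if x: "x \<in> pspace ?I (V L)" for x
  proof (intro ext)
    fix ki :: "nat \<times> 'i" and b :: 'v
    obtain k i where ki: "ki = (k, i)" by (cases ki)
    have "x (k, i) b \<in> L" for k :: nat and i b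
      using x by (cases "k < r \<and> i \<in> I"; cases "b \<in> B") (auto simp: pspace_def)
    then have "k < r \<Longrightarrow> cf k (\<Sum>j<r. x (j, i) b * \<epsilon> j) = x (k, i) b" by (intro dual) auto
    moreover have "\<not> k < r \<Longrightarrow> x (k, i) b = 0" using x by (auto simp: pspace_def)
    ultimately show "dn (up x) ki b = x ki b" unfolding ki dn_def up_def by auto
  qed
  show ?thesis unfolding anti_form_def
  proof (intro exI[of _ "\<lambda>x. dn (f (up x))"] conjI allI ballI)
    show "linear_endo_on L (pscale sc) (pspace ?I (V L)) (\<lambda>x. dn (f (up x)))"
      unfolding linear_endo_on_def
    proof (intro conjI ballI)
      fix x assume x: "x \<in> pspace ?I (V L)"
      show "dn (f (up x)) \<in> pspace ?I (V L)" by (intro dn_in f(2) up_in x)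
      show "dn (f (up (x + y))) = dn (f (up x)) + dn (f (up y))" if y: "y \<in> pspace ?I (V L)" for y
      proof -
        have "up (x + y) = up x + up y" by (auto simp: up_def fun_eq_iff algebra_simps sum.distrib)
        then have "f (up (x + y)) = f (up x) + f (up y)"
          using f(1) up_in[OF x] up_in[OF y] by (simp add: linear_endo_on_def)
        then show ?thesis
          using cf_add[OF inE[OF f(2)[OF up_in[OF x]]] inE[OF f(2)[OF up_in[OF y]]]]
          by (simp add: dn_def fun_eq_iff)
      qed
      show "dn (f (up (pscale sc e x))) = pscale sc e (dn (f (up x)))" if e: "e \<in> L" for e
      proof -
        have "up (pscale sc e x) = pscale sc e (up x)"
          by (auto simp: up_def fun_eq_iff pscale_def sum_distrib_left mult_ac)
        moreover have "e \<in> E" using e assms(3) by auto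
        ultimately have "f (up (pscale sc e x)) = pscale sc e (f (up x))"
          using f(1) up_in[OF x] by (simp add: linear_endo_on_def)
        then show ?thesis
          using cf_scl[OF inE[OF f(2)[OF up_in[OF x]]] E.L_0 _ e]
          by (simp add: dn_def fun_eq_iff pscale_def)
      qed
    qed
    fix t x y assume x: "x \<in> pspace ?I (V L)" and y: "y \<in> pspace ?I (V L)"
    note ux = up_in[OF x] and uy = up_in[OF y]
    have "dform I a bf t (up x) (up y) \<in> E"
      unfolding dform_def using a assms(3) ux uy by (intro E.L_sum E.L_mult bfE) (auto simp: pspace_def)
    then have "st (- dform I a bf t (up x) (up y)) = - st (dform I a bf t (up x) (up y))"
      by (rule lspace.endo_minus[OF EL st])
    then show "dform ?I (\<lambda>(k, i). \<eta> k * a i) bf t (dn (f (up x))) (dn (f (up y)))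
      = - dform ?I (\<lambda>(k, i). \<eta> k * a i) bf t x y"
      using st_dform[OF f(2)[OF ux] f(2)[OF uy], of t] f(3)[OF ux uy, of t] st_dform[OF ux uy, of t]
      unfolding dn_up[OF x] dn_up[OF y] by simp
  qed
qed

end

context simple_extension
begin

definition cf :: "nat \<Rightarrow> 'c \<Rightarrow> 'c" where "cf k u = poly.coeff (red u) k"

lemma cf_in_L: "u \<in> E \<Longrightarrow> cf k u \<in> L"
  using red[of u] by (simp add: cf_def Lpoly_def)

lemma cf_endo: "linear_endo_on L (*) E (cf k)"
  unfolding linear_endo_on_def using cf_in_L L_subset_E by (auto simp: cf_def red_add red_scale)

lemma cf_dual:
  assumes "\<And>j. j < degree p \<Longrightarrow> c j \<in> L" "k < degree p"
  shows "cf k (\<Sum>j<degree p. c j * \<theta> ^ j) = c k"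
proof -
  define g where "g = (\<Sum>i<degree p. Polynomial.monom (c i) i)"
  have co: "poly.coeff g i = (if i < degree p then c i else 0)" for i
    unfolding g_def by (simp add: coeff_sum)
  have gL: "Lpoly g" unfolding g_def using assms by (intro Lpoly_sum Lpoly_monom) auto
  have "degree g < degree p"
  proof (cases "g = 0")
    case False
    then have "poly.coeff g (degree g) \<noteq> 0" by simp
    then show ?thesis using co[of "degree g"] by (simp split: if_splits)
  qed (simp add: degree_p_pos)
  moreover have "poly g \<theta> = (\<Sum>j<degree p. c j * \<theta> ^ j)" by (simp add: g_def poly_sum poly_monom)
  ultimately show ?thesis using red_eqI[OF gL] co[of k] assms(2) by (simp add: cf_def)
qed

text \<open>Translation by \<open>a\<close> turns the value of \<open>p\<close> at \<open>a\<close>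
  into a constant term, which is what the transfer along the zeroth coordinate controls.\<close>

lemma shift_minpoly:
  assumes "a \<in> L" shows "is_minpoly (pcompose p [:a, 1:]) (\<theta> - a)"
  unfolding is_minpoly_def
proof (intro conjI allI impI)
  show "Lpoly (pcompose p [:a, 1:])" using p_facts(1) assms by (intro Lpoly_pcompose) (auto simp: Lpoly_pCons)
  show "lead_coeff (pcompose p [:a, 1:]) = 1" using lead_coeff_comp[of "[:a, 1:]" p] p_facts(2) by simp
  show "poly (pcompose p [:a, 1:]) (\<theta> - a) = 0" using p_facts(3) by (simp add: poly_pcompose)
  fix g assume g: "Lpoly g \<and> poly g (\<theta> - a) = 0"
  have "\<exists>h. Lpoly h \<and> pcompose g [:- a, 1:] = p * h"
    using g assms by (intro p_min Lpoly_pcompose) (auto simp: Lpoly_pCons L_minus poly_pcompose algebra_simps)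
  then obtain h where h: "Lpoly h" "pcompose g [:- a, 1:] = p * h" by blast
  have "pcompose (pcompose g [:- a, 1:]) [:a, 1:] = g"
    by (simp add: pcompose_assoc[symmetric] pcompose_pCons pcompose_idR)
  then have "g = pcompose p [:a, 1:] * pcompose h [:a, 1:]" unfolding h(2) pcompose_mult by simp
  moreover have "Lpoly (pcompose h [:a, 1:])" using h(1) assms by (intro Lpoly_pcompose) (auto simp: Lpoly_pCons)
  ultimately show "\<exists>h. Lpoly h \<and> g = pcompose p [:a, 1:] * h" by blast
qed

end

section \<open>The maximal field is formally real and Euclidean\<close>

locale maximal_nontorsion = gram B G K0
  for B :: "'v set" and G :: "'t \<Rightarrow> 'v \<Rightarrow> 'v \<Rightarrow> 'c::alg_closed_field" and K0 :: "'c set" +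
  fixes L :: "'c set"
  assumes subfield_L': "subfield_set L" and K0_L: "K0 \<subseteq> L" and two: "(2::'c) \<noteq> 0"
    and not_tor: "\<not> tor L"
    and max_tor: "\<And>E. subfield_set E \<Longrightarrow> L \<subset> E \<Longrightarrow> tor E"
begin

sublocale field_carrier L
  by unfold_locales (rule subfield_L')

lemma VL: "formspace L sc (V L) bf"
  by (rule formspace_V[OF subfield_L'])

text \<open>Scalars commute and are self-adjoint for every member of the system, so their Clifford
  matrix would be an anti-isometry of a multiple over \<open>L\<close>.\<close>

lemma minus_one_not_sum_of_squares:
  assumes "set xs \<subseteq> L"
  shows "(\<Sum>x\<leftarrow>xs. x * x) \<noteq> - 1"
proof
  assume eq: "(\<Sum>x\<leftarrow>xs. x * x) = - 1"
  interpret V: formspace L sc "V L" bf by (rule VL)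
  define cs :: "(('v \<Rightarrow> 'c) \<Rightarrow> 'v \<Rightarrow> 'c) list" where "cs = map sc xs"
  have sum: "(\<Sum>c\<leftarrow>map sc ys. c (c x)) = sc (\<Sum>y\<leftarrow>ys. y * y) x" for ys x
    by (induction ys) (auto simp: pscale_def fun_eq_iff algebra_simps)
  have "anti L sc (V L) bf {l :: bool list. length l = length (cs)} (\<lambda>_. 1)"
  proof (rule V.anti_sum_of_squares)
    fix c assume "c \<in> set (cs)"
    then obtain a where a: "c = sc a" "a \<in> L" using assms by (auto simp: cs_def)
    show "c (x + y) = c x + c y" for x y using a by (simp add: V.scale_right_distrib)
    show "c (sc e x) = sc e (c x)" for e x using a by (simp add: mult.commute)
    show "x \<in> V L \<Longrightarrow> c x \<in> V L" for x using a by (simp add: V.W_scale)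
    show "bf t (c x) y = bf t x (c y)" for t x y using a by (simp add: V.b_simps)
    show "d (c x) = c (d x)" if "d \<in> set (cs)" for d x using a that by (auto simp: cs_def mult.commute)
  next
    show "(\<Sum>c\<leftarrow>cs. c (c x)) = - x" for x unfolding cs_def sum eq by simp
  qed
  moreover have "finite {l :: bool list. length l = length (cs)}"
    using finite_lists_length_eq[of "UNIV :: bool set"] by simp
  moreover have "replicate (length cs) True \<in> {l :: bool list. length l = length (cs)}" by simp
  ultimately have "tor L" by (intro tor_of_anti[OF subfield_L']) blast+
  then show False using not_tor by simp
qed

text \<open>Division by the square of a nonzero \<open>f j\<close> would express -1 as a sum of
  squares.\<close>

lemma sum_squares_eq_0:
  assumes "finite A" "\<And>i. i \<in> A \<Longrightarrow> f i \<in> L" "(\<Sum>i\<in>A. (f i)\<^sup>2) = 0" "j \<in> A"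
  shows "f j = 0"
proof (rule ccontr)
  assume j: "f j \<noteq> 0"
  obtain js where js: "set js = A - {j}" "distinct js" using assms(1) finite_distinct_list by (metis finite_Diff)
  have "(\<Sum>x\<leftarrow>map (\<lambda>i. f i / f j) js. x * x) = (\<Sum>i\<in>A - {j}. (f i / f j) * (f i / f j))"
    using js by (simp add: sum_list_distinct_conv_sum_set o_def)
  also have "\<dots> = (\<Sum>i\<in>A - {j}. (f i)\<^sup>2) / (f j)\<^sup>2"
    by (simp add: power2_eq_square sum_divide_distrib)
  also have "(\<Sum>i\<in>A - {j}. (f i)\<^sup>2) = - (f j)\<^sup>2"
    using assms sum.remove[OF assms(1,4), of "\<lambda>i. (f i)\<^sup>2"] by (simp add: eq_neg_iff_add_eq_0 add.commute)
  finally have "(\<Sum>x\<leftarrow>map (\<lambda>i. f i / f j) js. x * x) = - 1" using j by simp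
  moreover have "set (map (\<lambda>i. f i / f j) js) \<subseteq> L" using js assms by (auto intro: L_divide)
  ultimately show False using minus_one_not_sum_of_squares by blast
qed

lemma char_0: "n > 0 \<Longrightarrow> of_nat n \<noteq> (0::'c)"
  using sum_squares_eq_0[of "{..<n}" "\<lambda>_. 1" 0] by auto

lemma anti_cancel_tor:
  assumes "anti L sc (V L) bf (I \<union> J) a" "anti L sc (V L) bf J a" "finite I" "finite J" "I \<inter> J = {}"
    "I \<noteq> {}" "\<And>i. i \<in> I \<Longrightarrow> a i = 1"
  shows "tor L"
proof -
  interpret V: formspace L sc "V L" bf by (rule VL)
  have "anti L sc (V L) bf (I \<times> (UNIV :: bool set)) (\<lambda>(i, e). a i)"
    by (rule V.anti_cancel[OF assms(1-5) gen_V[OF subfield_L'] char_0])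
  then show ?thesis by (rule tor_of_anti[OF subfield_L']) (use assms in auto)
qed

lemma ext_field:
  assumes "is_minpoly p \<theta>" "\<theta> \<notin> L"
  shows "tor (simple_extension.E L \<theta>)"
proof -
  interpret F: simple_extension L \<theta> p by unfold_locales (rule assms(1))
  show ?thesis using F.subfield_E F.L_subset_E F.E_theta assms(2) by (intro max_tor) auto
qed

text \<open>For \<open>\<alpha>^2 = a\<close>, the functional taking the coefficient of 1 sends
  \<open>(x + y \<alpha>)^2\<close> to \<open>x^2 + a y^2\<close>: the transferred unit form is
  \<open><1, a>\<close>. Maximality supplies torsion over \<open>L(\<alpha>)\<close>.\<close>

lemma anti_quadratic_transfer:
  assumes a: "a \<in> L" and nsq: "\<And>c. c \<in> L \<Longrightarrow> a \<noteq> c\<^sup>2"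
  shows "\<exists>I::nat set. finite I \<and> I \<noteq> {} \<and> anti L sc (V L) bf ({..<2::nat} \<times> I) (\<lambda>(k, i). (if k = 0 then 1 else a) * 1)"
proof -
  obtain \<alpha> where \<alpha>: "\<alpha> ^ 2 = a" using nth_root_exists[of 2 a] by auto
  have \<alpha>L: "\<alpha> \<notin> L" using \<alpha> nsq by auto
  have f: "Lpoly [:- a, 0, 1:]" "poly [:- a, 0, 1:] \<alpha> = 0"
    using a \<alpha> by (auto simp: Lpoly_pCons L_minus power2_eq_square)
  then obtain p where p: "is_minpoly p \<alpha>" using minpoly_exists[of "[:- a, 0, 1:]" \<alpha>] by auto
  interpret F: simple_extension L \<alpha> p by unfold_locales (rule p)
  have d: "degree p = 2"
  proof -
    obtain h where h: "[:- a, 0, 1:] = p * h" using F.p_min[OF f] by blast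
    have "h \<noteq> 0" using h by auto
    have "degree p \<le> degree (p * h)" using \<open>h \<noteq> 0\<close> by (rule degree_mult_right_le)
    then have "degree p \<le> 2" unfolding h[symmetric] by simp
    then show ?thesis using minpoly_not_in_L(1)[OF p \<alpha>L] by simp
  qed
  obtain I :: "nat set" where I: "finite I" "I \<noteq> {}" "anti F.E sc (V F.E) bf I (\<lambda>_. 1)"
    using ext_field[OF p \<alpha>L] by (auto simp: tor_def)
  have "anti L sc (V L) bf ({..<2::nat} \<times> I) (\<lambda>(k, i). (if k = 0 then 1 else a) * 1)"
  proof (rule anti_transfer[OF subfield_L' F.subfield_E F.L_subset_E K0_L I(1) F.cf_endo[of 0] F.cf_endo F.cf_in_L _ _ _ _ I(3)])
    show "\<And>k. k < 2 \<Longrightarrow> \<alpha> ^ k \<in> F.E"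
      using F.E_theta F.E_closed(2) by (auto simp: less_2_cases_iff)
    fix c :: "nat \<Rightarrow> 'c" and k :: nat assume "\<And>j. j < 2 \<Longrightarrow> c j \<in> L" "k < 2"
    then show "F.cf k (\<Sum>j<2. c j * \<alpha> ^ j) = c k" using F.cf_dual[of c k] d by simp
  next
    fix u v assume u: "u \<in> F.E" and v: "v \<in> F.E"
    have ex: "w = F.cf 0 w + F.cf 1 w * \<alpha>" if "w \<in> F.E" for w
      using F.E_expand[OF that] unfolding d by (simp add: numeral_2_eq_2 F.cf_def)
    define c where "c = (\<lambda>j::nat. if j = 0 then F.cf 0 u * F.cf 0 v + a * F.cf 1 u * F.cf 1 v
      else F.cf 0 u * F.cf 1 v + F.cf 1 u * F.cf 0 v)"
    have "u * v = (\<Sum>j<degree p. c j * \<alpha> ^ j)"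
      unfolding d c_def by (subst ex[OF u], subst ex[OF v])
        (simp add: numeral_2_eq_2 algebra_simps flip: \<alpha>)
    moreover have "c j \<in> L" for j unfolding c_def using F.cf_in_L[OF u] F.cf_in_L[OF v] a by (auto intro!: L_add L_mult)
    ultimately have "F.cf 0 (u * v) = c 0" using F.cf_dual[of c 0] d by simp
    then show "F.cf 0 (u * v) = (\<Sum>k<(2::nat). (if k = 0 then 1 else a) * F.cf k u * F.cf k v)"
      by (simp add: c_def numeral_2_eq_2)
  qed auto
  then show ?thesis using I by blast
qed

text \<open>If neither \<open>a\<close> nor \<open>- a\<close> were a square, both
  \<open><1, a>\<close> and \<open><1, - a>\<close> would give anti-isometries of multiples. Their
  sum is \<open><1, 1>\<close> plus \<open><a, - a>\<close>, and the second summand can be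
  cancelled, so the system would be torsion over \<open>L\<close>.\<close>

lemma euclidean:
  assumes a: "a \<in> L" shows "\<exists>c\<in>L. a = c\<^sup>2 \<or> a = - c\<^sup>2"
proof (rule ccontr)
  assume n: "\<not> ?thesis"
  interpret V: formspace L sc "V L" bf by (rule VL)
  obtain I :: "nat set" where I: "finite I" "I \<noteq> {}"
    "anti L sc (V L) bf ({..<2::nat} \<times> I) (\<lambda>(k, i). (if k = 0 then 1 else a) * 1)"
    using anti_quadratic_transfer[OF a] n by blast
  have "\<And>c. c \<in> L \<Longrightarrow> - a \<noteq> c\<^sup>2" using n by (metis minus_minus)
  then obtain J :: "nat set" where J: "finite J" "J \<noteq> {}"
    "anti L sc (V L) bf ({..<2::nat} \<times> J) (\<lambda>(k, i). (if k = 0 then 1 else - a) * 1)"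
    using anti_quadratic_transfer[OF L_minus[OF a]] by blast
  \<comment> \<open>In the index \<open>(u, v, i, j)\<close>, \<open>u\<close> chooses between the
    two binary forms and \<open>v\<close> between their entries. The product of \<open>I\<close> and
    \<open>J\<close> gives both forms the same multiplicity.\<close>
  let ?\<omega> = "\<lambda>(u, v, i::nat, j::nat). if \<not> v then 1 else if u then a else - a"
  let ?S = "\<lambda>u v. {u :: bool} \<times> (v :: bool set) \<times> I \<times> J"
  have 1: "anti L sc (V L) bf (?S True UNIV) ?\<omega>"
  proof (rule V.anti_reindex[OF V.anti_tensor[OF I(3) _ J(1), where c = "\<lambda>_. 1"],
        where \<pi> = "\<lambda>(u, v, i, j). ((if v then 1 else 0, i), j)" and c = "\<lambda>_. 1"])
    show "bij_betw (\<lambda>(u, v, i, j). ((if v then 1 else 0, i), j)) (?S True UNIV) (({..<2::nat} \<times> I) \<times> J)"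
      by (rule bij_betw_byWitness[where f' = "\<lambda>((k, i), j). (True, k = 1, i, j)"])
        (auto split: if_splits simp: less_2_cases_iff)
  qed (use I in \<open>auto split: if_splits\<close>)
  have 2: "anti L sc (V L) bf (?S False UNIV) ?\<omega>"
  proof (rule V.anti_reindex[OF V.anti_tensor[OF J(3) _ I(1), where c = "\<lambda>_. 1"],
        where \<pi> = "\<lambda>(u, v, i, j). ((if v then 1 else 0, j), i)" and c = "\<lambda>_. 1"])
    show "bij_betw (\<lambda>(u, v, i, j). ((if v then 1 else 0, j), i)) (?S False UNIV) (({..<2::nat} \<times> J) \<times> I)"
      by (rule bij_betw_byWitness[where f' = "\<lambda>((k, j), i). (False, k = 1, i, j)"])
        (auto split: if_splits simp: less_2_cases_iff)
  qed (use J in \<open>auto split: if_splits\<close>)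
  \<comment> \<open>Regrouping by \<open>v\<close>: the entries 1 form \<open>?I\<close>, the
    entries \<open>a\<close> and \<open>- a\<close> form \<open>?J\<close>, where negating
    \<open>u\<close> exchanges them.\<close>
  let ?I = "(UNIV :: bool set) \<times> {False} \<times> I \<times> J" and ?J = "(UNIV :: bool set) \<times> {True} \<times> I \<times> J"
  have "anti L sc (V L) bf (?S True UNIV \<union> ?S False UNIV) ?\<omega>"
    by (rule V.anti_union[OF 1 2]) (use I J in auto)
  moreover have "?S True UNIV \<union> ?S False UNIV = ?I \<union> ?J" by auto
  ultimately have 3: "anti L sc (V L) bf (?I \<union> ?J) ?\<omega>" by simp
  have 4: "anti L sc (V L) bf ?J ?\<omega>"
  proof (rule V.anti_permute[where \<pi> = "\<lambda>(u, v, i, j). (\<not> u, v, i, j)"])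
    show "bij_betw (\<lambda>(u, v, i, j). (\<not> u, v, i, j)) ?J ?J"
      by (rule bij_betw_byWitness[where f' = "\<lambda>(u, v, i, j). (\<not> u, v, i, j)"]) auto
  qed auto
  have "tor L" by (rule anti_cancel_tor[OF 3 4]) (use I J in auto)
  then show False using not_tor by simp
qed

text \<open>A surplus of entries \<epsilon> would survive the cancellation of opposite pairs. The
  additional factor \<epsilon> makes the surplus entries equal to 1, so that \<open>L\<close> would
  be torsion; one argument thus treats both signs.\<close>

lemma unbalanced_aux:
  fixes I :: "'i set"
  assumes anti: "anti L sc (V L) bf ({..<r::nat} \<times> I) (\<lambda>(k, i). \<eta> k * (\<epsilon> :: 'c))" and I: "finite I" "I \<noteq> {}"
    and \<eta>: "\<And>k. k < r \<Longrightarrow> \<eta> k = 1 \<or> \<eta> k = - 1" and \<epsilon>: "\<epsilon> = 1 \<or> \<epsilon> = - 1"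
  shows "card {k. k < r \<and> \<eta> k = \<epsilon>} \<le> card {k. k < r \<and> \<eta> k \<noteq> \<epsilon>}"
proof (rule ccontr)
  interpret V: formspace L sc "V L" bf by (rule VL)
  let ?P = "{k. k < r \<and> \<eta> k = \<epsilon>}" and ?M = "{k. k < r \<and> \<eta> k \<noteq> \<epsilon>}"
  assume "\<not> card ?P \<le> card ?M"
  then have c: "card ?M < card ?P" by simp
  then obtain P' where P': "P' \<subseteq> ?P" "card P' = card ?M" "finite P'"
    by (metis (no_types, lifting) less_imp_le obtain_subset_with_card_n)
  then obtain g where g: "bij_betw g P' ?M" using finite_same_card_bij[of P' ?M] by auto
  define g' where "g' = inv_into P' g"
  have gg: "k \<in> P' \<Longrightarrow> g k \<in> ?M \<and> g' (g k) = k" "k \<in> ?M \<Longrightarrow> g' k \<in> P' \<and> g (g' k) = k" for k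
    unfolding g'_def using g by (auto simp: bij_betw_def inv_into_into f_inv_into_f dest: imageI)
  define \<pi> where "\<pi> = (\<lambda>(k, i::'i). (if k \<in> P' then g k else g' k, i))"
  let ?J = "(P' \<union> ?M) \<times> I" and ?I = "(?P - P') \<times> I"
  have dis: "k \<notin> P'" if "k \<in> ?M" for k using P'(1) that by auto
  have "bij_betw \<pi> ?J ?J"
  proof -
    have "\<pi> x \<in> ?J \<and> \<pi> (\<pi> x) = x" if x: "x \<in> ?J" for x
    proof -
      obtain k i where ki: "x = (k, i)" "k \<in> P' \<union> ?M" "i \<in> I" using x by blast
      show ?thesis
      proof (cases "k \<in> P'")
        case True
        then show ?thesis using gg(1)[OF True] dis ki by (simp add: \<pi>_def)
      next
        case False
        then have "k \<in> ?M" using ki by blast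
        then show ?thesis using gg(2)[of k] False ki by (simp add: \<pi>_def)
      qed
    qed
    then show ?thesis by (intro bij_betw_byWitness[where f' = \<pi>]) blast+
  qed
  moreover have "\<eta> (g k) * \<epsilon> = - (\<eta> k * \<epsilon>)" if "k \<in> P'" for k
    using gg(1)[OF that] P'(1) that \<eta>[of "g k"] \<epsilon> by auto
  moreover have "\<eta> (g' k) * \<epsilon> = - (\<eta> k * \<epsilon>)" if "k \<in> ?M" for k
    using gg(2)[OF that] P'(1) that \<eta>[of k] \<epsilon> by auto
  ultimately have 1: "anti L sc (V L) bf ?J (\<lambda>(k, i). \<eta> k * \<epsilon>)"
    by (intro V.anti_permute[where \<pi> = \<pi>]) (auto simp: \<pi>_def)
  have "{..<r} \<times> I = ?I \<union> ?J" using P'(1) by auto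
  then have 2: "anti L sc (V L) bf (?I \<union> ?J) (\<lambda>(k, i). \<eta> k * \<epsilon>)" using anti by simp
  have "?P - P' \<noteq> {}" using P' c by (metis Diff_eq_empty_iff card_mono finite_Collect_conjI finite_Collect_less_nat not_le)
  then have ne: "?I \<noteq> {}" using I by auto
  have "tor L" by (rule anti_cancel_tor[OF 2 1 _ _ _ ne]) (use I P' \<epsilon> in auto)
  then show False using not_tor by simp
qed

text \<open>Both signs of \<epsilon> are used: an anti-isometry of a form is also one of its
  negative.\<close>

lemma balanced:
  assumes anti: "anti L sc (V L) bf ({..<r::nat} \<times> I) (\<lambda>(k, i). \<eta> k * 1)" and I: "finite I" "I \<noteq> {}"
    and \<eta>: "\<And>k. k < r \<Longrightarrow> \<eta> k = 1 \<or> \<eta> k = - (1 :: 'c)"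
  shows "card {k. k < r \<and> \<eta> k = 1} = card {k. k < r \<and> \<eta> k \<noteq> 1}"
proof -
  have ne: "(1::'c) \<noteq> - 1" using two by (metis add.right_inverse one_add_one)
  have "anti L sc (V L) bf ({..<r::nat} \<times> I) (\<lambda>(k, i). \<eta> k * - 1)"
  proof -
    have neg: "dform ({..<r} \<times> I) (\<lambda>(k, i). \<eta> k * - 1) bf t x y = - dform ({..<r} \<times> I) (\<lambda>(k, i). \<eta> k * 1) bf t x y" for t x y
      by (simp add: dform_def case_prod_beta sum_negf)
    show ?thesis using anti unfolding anti_form_def neg by (simp only: neg_equal_iff_equal)
  qed
  then have "card {k. k < r \<and> \<eta> k = - 1} \<le> card {k. k < r \<and> \<eta> k \<noteq> - 1}"
    by (intro unbalanced_aux[OF _ I]) (use \<eta> in auto)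
  moreover have "{k. k < r \<and> \<eta> k = - 1} = {k. k < r \<and> \<eta> k \<noteq> 1}" "{k. k < r \<and> \<eta> k \<noteq> - 1} = {k. k < r \<and> \<eta> k = 1}"
    using \<eta> ne by auto
  ultimately show ?thesis using unbalanced_aux[where \<epsilon> = 1, OF anti I] \<eta> by auto
qed

end

section \<open>Degree and sign of minimal polynomials over the maximal field\<close>

context maximal_nontorsion
begin

text \<open>
  The transfer along \<open>s(\<Sum> c\<^sub>i \<theta>\<^sup>i) = c\<^sub>0\<close> of the unit form of \<open>L(\<theta>)\<close> must have as many
  positive as negative entries. Its dimension is the degree, which is therefore even; and if \<open>p(0)\<close>
  were negative, it would be nonnegative on the span of \<open>1, \<dots>, \<theta>\<^sup>m\<close>, more than half of the space.
\<close>

lemma minpoly_degree_and_sign: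
  assumes p: "is_minpoly p \<theta>" and \<theta>: "\<theta> \<notin> L"
  shows "even (degree p) \<and> (\<exists>c\<in>L. poly p 0 = c\<^sup>2)"
proof -
  interpret F: simple_extension L \<theta> p by unfold_locales (rule p)
  let ?n = "degree p"
  define \<phi> where "\<phi> u v = F.cf 0 (u * v)" for u v
  have \<phi>sym: "\<phi> u v = \<phi> v u" for u v by (simp add: \<phi>_def mult.commute)
  have cf_add: "F.cf k (u + v) = F.cf k u + F.cf k v" and cf_scl: "e \<in> L \<Longrightarrow> F.cf k (e * u) = e * F.cf k u"
    if "u \<in> F.E" "v \<in> F.E" for u v k e
    using F.cf_endo[of k] that by (auto simp: linear_endo_on_def)
  \<comment> \<open>This makes the transferred form nondegenerate: \<phi> takes the value 1 on
    \<open>x\<close> and its inverse.\<close>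
  have one: "F.cf 0 1 = 1"
    using F.red_eqI[of 1] F.degree_p_pos by (simp add: F.cf_def)
  have \<phi>endo: "linear_endo_on L (*) F.E (\<lambda>u. \<phi> u v)" if v: "v \<in> F.E" for v
    unfolding linear_endo_on_def
  proof (intro conjI ballI)
    fix x assume x: "x \<in> F.E"
    show "\<phi> x v \<in> F.E" unfolding \<phi>_def using F.cf_in_L[OF F.E_closed(4)[OF x v]] F.L_subset_E by blast
    show "\<phi> (x + y) v = \<phi> x v + \<phi> y v" if y: "y \<in> F.E" for y
      unfolding \<phi>_def distrib_right by (rule cf_add[OF F.E_closed(4)[OF x v] F.E_closed(4)[OF y v]])
    show "\<phi> (e * x) v = e * \<phi> x v" if e: "e \<in> L" for e
      unfolding \<phi>_def mult.assoc by (rule cf_scl[OF F.E_closed(4)[OF x v] F.E_closed(4)[OF x v] e])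
  qed
  have "\<exists>(k::nat) \<epsilon> \<eta>. k \<le> card ((\<lambda>i. \<theta> ^ i) ` {..<?n}) \<and> (\<forall>i<k. \<epsilon> i \<in> F.E \<and> (\<eta> i = 1 \<or> \<eta> i = - 1)) \<and>
    (\<forall>i<k. \<forall>j<k. \<phi> (\<epsilon> i) (\<epsilon> j) = (if i = j then \<eta> i else 0)) \<and>
    (\<forall>x\<in>F.E. x = (\<Sum>i<k. (\<eta> i * \<phi> x (\<epsilon> i)) * (\<epsilon> i)))"
  proof (rule lspace.orthonormal_basis[OF F.lspace_E F.gen_E two euclidean _ \<phi>sym])
    show "\<phi> u v \<in> L" if "u \<in> F.E" "v \<in> F.E" for u v
      unfolding \<phi>_def using that by (intro F.cf_in_L F.E_closed)
    show "\<phi> (x + y) z = \<phi> x z + \<phi> y z" if "x \<in> F.E" "y \<in> F.E" "z \<in> F.E" for x y z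
      using \<phi>endo[OF that(3)] that by (auto simp: linear_endo_on_def)
    show "\<phi> (a * x) y = a * \<phi> x y" if "a \<in> L" "x \<in> F.E" "y \<in> F.E" for a x y
      using \<phi>endo[OF that(3)] that by (auto simp: linear_endo_on_def)
    fix x assume x: "x \<in> F.E" "\<And>y. y \<in> F.E \<Longrightarrow> \<phi> x y = 0"
    show "x = 0"
    proof (rule ccontr)
      assume "x \<noteq> 0"
      moreover have "inverse x \<in> F.E" using F.subfield_E x(1) by (auto simp: subfield_set_def)
      ultimately show False using x(2)[of "inverse x"] one by (simp add: \<phi>_def)
    qed
  qed auto
  then obtain k :: nat and \<epsilon> \<eta> where k: "k \<le> card ((\<lambda>i. \<theta> ^ i) ` {..<?n})"
    and \<epsilon>: "\<And>i. i < k \<Longrightarrow> \<epsilon> i \<in> F.E" and \<eta>: "\<And>i. i < k \<Longrightarrow> \<eta> i = 1 \<or> \<eta> i = - 1"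
    and orth: "\<And>i j. i < k \<Longrightarrow> j < k \<Longrightarrow> \<phi> (\<epsilon> i) (\<epsilon> j) = (if i = j then \<eta> i else 0)"
    and expand: "\<And>x. x \<in> F.E \<Longrightarrow> x = (\<Sum>i<k. (\<eta> i * \<phi> x (\<epsilon> i)) * \<epsilon> i)"
    by blast
  have \<phi>L: "\<phi> u v \<in> L" if "u \<in> F.E" "v \<in> F.E" for u v
    unfolding \<phi>_def using that by (intro F.cf_in_L F.E_closed)
  have \<eta>\<eta>: "\<eta> i * \<eta> i = 1" and \<eta>L: "\<eta> i \<in> L" if "i < k" for i
    using \<eta>[OF that] L_minus[OF L_1] by auto
  have \<phi>sum: "\<phi> (\<Sum>i<k. c i * \<epsilon> i) v = (\<Sum>i<k. c i * \<phi> (\<epsilon> i) v)"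
    if "\<And>i. i < k \<Longrightarrow> c i \<in> L" "v \<in> F.E" for c v
  proof -
    have cE: "c i * \<epsilon> i \<in> F.E" if "i \<in> {..<k}" for i
      using that \<epsilon> \<open>\<And>i. i < k \<Longrightarrow> c i \<in> L\<close> F.L_subset_E by (intro F.E_closed) auto
    have "\<phi> (\<Sum>i<k. c i * \<epsilon> i) v = (\<Sum>i<k. \<phi> (c i * \<epsilon> i) v)"
      by (rule lspace.endo_sum[OF F.lspace_E \<phi>endo[OF that(2)] cE])
    also have "\<dots> = (\<Sum>i<k. c i * \<phi> (\<epsilon> i) v)"
      using \<phi>endo[OF that(2)] that(1) \<epsilon> by (intro sum.cong) (auto simp: linear_endo_on_def)
    finally show ?thesis .
  qed
  have \<phi>expand: "\<phi> u v = (\<Sum>i<k. \<eta> i * \<phi> u (\<epsilon> i) * \<phi> v (\<epsilon> i))" if u: "u \<in> F.E" and v: "v \<in> F.E" for u v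
  proof -
    have "\<phi> u v = \<phi> (\<Sum>i<k. (\<eta> i * \<phi> u (\<epsilon> i)) * \<epsilon> i) v" using expand[OF u] by simp
    also have "\<dots> = (\<Sum>i<k. (\<eta> i * \<phi> u (\<epsilon> i)) * \<phi> (\<epsilon> i) v)"
      using u v \<epsilon> \<eta>L \<phi>L by (intro \<phi>sum) (auto intro: L_mult)
    finally show ?thesis by (simp add: \<phi>sym[of "\<epsilon> _" v])
  qed
  \<comment> \<open>fewer equations \<open>\<phi>(v, \<epsilon>\<^sub>j) = 0\<close> than powers of \<open>\<theta>\<close> leave a nonzero solution \<open>v\<close>\<close>
  have solve: "\<exists>y. (\<forall>i. y i \<in> L) \<and> (\<Sum>i<N. y i * \<theta> ^ i) \<noteq> 0 \<and> (\<forall>j\<in>Q. \<phi> (\<Sum>i<N. y i * \<theta> ^ i) (\<epsilon> j) = 0)"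
    if Q: "Q \<subseteq> {..<k}" "card Q < N" "N \<le> ?n" for Q N
  proof -
    have pw: "\<theta> ^ i \<in> F.E" for i by (induction i) (auto simp: F.E_closed F.E_theta)
    have Qf: "finite Q" using Q(1) finite_subset by blast
    obtain y where y: "\<forall>i. y i \<in> L" "\<exists>i\<in>{..<N}. y i \<noteq> 0" "\<forall>j\<in>Q. (\<Sum>i<N. \<phi> (\<theta> ^ i) (\<epsilon> j) * y i) = 0"
    proof -
      have "\<phi> (\<theta> ^ i) (\<epsilon> j) \<in> L" if jQ: "j \<in> Q" for i j
        using jQ Q(1) by (intro \<phi>L pw \<epsilon>) auto
      then show thesis
        using homogeneous_system[of Q "{..<N}" "\<lambda>j i. \<phi> (\<theta> ^ i) (\<epsilon> j)"] Qf Q(2) that by auto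
    qed
    have "(\<Sum>i<N. y i * \<theta> ^ i) \<noteq> 0"
    proof
      assume 0: "(\<Sum>i<N. y i * \<theta> ^ i) = 0"
      let ?y = "\<lambda>i. if i < N then y i else 0"
      have "(\<Sum>i<?n. ?y i * \<theta> ^ i) = (\<Sum>i<N. y i * \<theta> ^ i)"
        using Q(3) by (intro sum.mono_neutral_cong_right) auto
      then have "?y i = 0" if "i < ?n" for i
        using F.power_combination_nonzero[of ?y i] y(1) that 0 by auto
      then show False using y(2) Q(3) by (metis lessThan_iff less_le_trans)
    qed
    moreover have "\<phi> (\<Sum>i<N. y i * \<theta> ^ i) (\<epsilon> j) = 0" if j: "j \<in> Q" for j
    proof -
      have ej: "\<epsilon> j \<in> F.E" using j Q(1) \<epsilon> by auto
      have yE: "y i * \<theta> ^ i \<in> F.E" for i using y(1) pw F.L_subset_E by (intro F.E_closed) auto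
      have "\<phi> (\<Sum>i<N. y i * \<theta> ^ i) (\<epsilon> j) = (\<Sum>i<N. \<phi> (y i * \<theta> ^ i) (\<epsilon> j))"
        by (rule lspace.endo_sum[OF F.lspace_E \<phi>endo[OF ej] yE])
      also have "\<dots> = (\<Sum>i<N. \<phi> (\<theta> ^ i) (\<epsilon> j) * y i)"
        using \<phi>endo[OF ej] y(1) pw by (intro sum.cong) (auto simp: linear_endo_on_def)
      finally show ?thesis using y(3) j by simp
    qed
    ultimately show ?thesis using y(1) by blast
  qed
  have sumE: "(\<Sum>i<N. y i * \<theta> ^ i) \<in> F.E" if "\<forall>i. y i \<in> L" for y N
    using F.E_poly[of "\<Sum>i<N. Polynomial.monom (y i) i"] that
    by (simp add: poly_sum poly_monom Lpoly_sum Lpoly_monom)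
  \<comment> \<open>Otherwise a nonzero combination of powers of \<theta> would be orthogonal to all
    \<open>\<epsilon> j\<close>, and \<open>expand\<close> would make it 0.\<close>
  have kn: "k = ?n"
  proof (rule ccontr)
    assume "k \<noteq> ?n"
    then have "k < ?n" using k card_image_le[of "{..<?n}" "\<lambda>i. \<theta> ^ i"] by simp
    then obtain y where y: "\<forall>i. y i \<in> L" "(\<Sum>i<?n. y i * \<theta> ^ i) \<noteq> 0" "\<forall>j\<in>{..<k}. \<phi> (\<Sum>i<?n. y i * \<theta> ^ i) (\<epsilon> j) = 0"
      using solve[of "{..<k}" ?n] by auto
    then show False using expand[OF sumE[OF y(1), of ?n]] by simp
  qed
  obtain I :: "nat set" where I: "finite I" "I \<noteq> {}" "anti F.E sc (V F.E) bf I (\<lambda>_. 1)"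
    using ext_field[OF p \<theta>] by (auto simp: tor_def)
  have "anti L sc (V L) bf ({..<k} \<times> I) (\<lambda>(k, i). \<eta> k * 1)"
  proof (rule anti_transfer[OF subfield_L' F.subfield_E F.L_subset_E K0_L I(1) F.cf_endo[of 0],
        where cf = "\<lambda>i u. \<eta> i * \<phi> u (\<epsilon> i)" and \<epsilon> = \<epsilon>])
    fix i assume i: "i < k"
    show "\<epsilon> i \<in> F.E" by (rule \<epsilon>[OF i])
    show "\<eta> i * \<phi> u (\<epsilon> i) \<in> L" if "u \<in> F.E" for u by (intro L_mult \<eta>L \<phi>L i \<epsilon> that)
    then show "linear_endo_on L (*) F.E (\<lambda>u. \<eta> i * \<phi> u (\<epsilon> i))"
      using \<phi>endo[OF \<epsilon>[OF i]] F.L_subset_E by (auto simp: linear_endo_on_def distrib_left)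
    fix c :: "nat \<Rightarrow> 'c" assume c: "\<And>j. j < k \<Longrightarrow> c j \<in> L"
    have "\<phi> (\<Sum>j<k. c j * \<epsilon> j) (\<epsilon> i) = (\<Sum>j<k. if j = i then c i * \<eta> i else 0)"
    proof -
      have "\<phi> (\<Sum>j<k. c j * \<epsilon> j) (\<epsilon> i) = (\<Sum>j<k. c j * \<phi> (\<epsilon> j) (\<epsilon> i))"
        using c \<epsilon>[OF i] by (intro \<phi>sum)
      also have "\<dots> = (\<Sum>j<k. if j = i then c i * \<eta> i else 0)"
        using orth i by (intro sum.cong) auto
      finally show ?thesis .
    qed
    then show "\<eta> i * \<phi> (\<Sum>j<k. c j * \<epsilon> j) (\<epsilon> i) = c i" using i \<eta>\<eta>[OF i] by (simp add: mult.left_commute)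
  next
    fix u v assume u: "u \<in> F.E" and v: "v \<in> F.E"
    have "F.cf 0 (u * v) = \<phi> u v" by (simp add: \<phi>_def)
    also have "\<dots> = (\<Sum>i<k. \<eta> i * (\<eta> i * \<phi> u (\<epsilon> i)) * (\<eta> i * \<phi> v (\<epsilon> i)))"
      unfolding \<phi>expand[OF u v]
    proof (intro sum.cong refl)
      fix i assume "i \<in> {..<k}"
      then have "\<eta> i * \<eta> i = 1" using \<eta>\<eta> by simp
      then show "\<eta> i * \<phi> u (\<epsilon> i) * \<phi> v (\<epsilon> i) = \<eta> i * (\<eta> i * \<phi> u (\<epsilon> i)) * (\<eta> i * \<phi> v (\<epsilon> i))"
        by (metis mult.assoc mult.left_commute mult_1)
    qed
    finally show "F.cf 0 (u * v) = (\<Sum>k<k. \<eta> k * (\<eta> k * \<phi> u (\<epsilon> k)) * (\<eta> k * \<phi> v (\<epsilon> k)))" .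
  qed (use I in auto)
  then have bal: "card {i. i < k \<and> \<eta> i = 1} = card {i. i < k \<and> \<eta> i \<noteq> 1}"
    by (rule balanced) (use I \<eta> in auto)
  let ?P = "{i. i < k \<and> \<eta> i = 1}" and ?M = "{i. i < k \<and> \<eta> i \<noteq> 1}"
  define m where "m = card ?P"
  have "card (?P \<union> ?M) = card ?P + card ?M" by (intro card_Un_disjoint) auto
  moreover have "?P \<union> ?M = {..<k}" by auto
  ultimately have n: "?n = 2 * m" using bal kn by (simp add: m_def)
  have m0: "0 < m" using n F.degree_p_pos by simp
  have "\<exists>c\<in>L. poly p 0 = c\<^sup>2"
  proof (rule ccontr)
    assume nsq: "\<not> ?thesis"
    have "poly p 0 \<in> L" using F.p_facts(1) by (intro poly_in_L) auto
    then obtain c where c: "c \<in> L" "poly p 0 = - c\<^sup>2" using euclidean nsq by blast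
    \<comment> \<open>There are \<open>m\<close> conditions on the \<open>m + 1\<close> powers with
      exponents up to \<open>m\<close>: some nonzero \<open>v\<close> is orthogonal to all positive
      basis vectors.\<close>
    obtain y where y: "\<forall>i. y i \<in> L" "(\<Sum>i<Suc m. y i * \<theta> ^ i) \<noteq> 0" "\<forall>j\<in>?P. \<phi> (\<Sum>i<Suc m. y i * \<theta> ^ i) (\<epsilon> j) = 0"
      using solve[of ?P "Suc m"] n m0 by (auto simp: m_def)
    define v where "v = (\<Sum>i<Suc m. y i * \<theta> ^ i)"
    define g where "g = (\<Sum>i<Suc m. Polynomial.monom (y i) i)"
    have vE: "v \<in> F.E" unfolding v_def by (rule sumE[OF y(1)])
    have gv: "poly g \<theta> = v" by (simp add: g_def v_def poly_sum poly_monom)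
    have co: "poly.coeff g i = (if i < Suc m then y i else 0)" for i
      unfolding g_def by (simp add: coeff_sum del: sum.lessThan_Suc)
    have dg: "degree g \<le> m" by (intro degree_le) (simp add: co)
    have gL: "Lpoly g" using y(1) co by (simp add: Lpoly_def)
    \<comment> \<open>The reduction of \<open>g^2\<close> modulo \<open>p\<close>: as
      \<open>p\<close> has degree \<open>2 m\<close>, only the top coefficient
      \<open>(y m)^2\<close> has to be removed. This adds
      \<open>- (y m)^2 p(0) = (y m * c)^2\<close> to the constant term, so \<open>\<phi> v v\<close>
      is a sum of two squares.\<close>
    define h where "h = g * g - Polynomial.smult (y m ^ 2) p"
    have hL: "Lpoly h" unfolding h_def using gL y(1) F.p_facts(1) by (intro Lpoly_diff Lpoly_mult Lpoly_smult L_power) auto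
    have top: "poly.coeff (g * g) (2 * m) = y m ^ 2"
    proof -
      have "poly.coeff (g * g) (2 * m) = (\<Sum>i\<le>2 * m. if i = m then y m ^ 2 else 0)"
        unfolding coeff_mult by (intro sum.cong) (auto simp: co power2_eq_square)
      then show ?thesis by simp
    qed
    have "degree h \<le> ?n" unfolding h_def
      using degree_mult_le[of g g] dg n by (intro degree_diff_le) auto
    moreover have "poly.coeff h ?n = 0"
      using top n F.p_facts(2) by (simp add: h_def)
    ultimately have dh: "degree h < ?n"
      using F.degree_p_pos by (metis degree_0 leading_coeff_0_iff le_neq_implies_less)
    have "poly h \<theta> = v * v" using F.p_facts(3) by (simp add: h_def gv)
    then have "red0": "\<phi> v v = poly.coeff h 0" using F.red_eqI[OF hL dh] by (simp add: \<phi>_def F.cf_def)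
    have "poly.coeff h 0 = (y 0)\<^sup>2 + (y m * c)\<^sup>2"
      using c(2) by (simp add: h_def coeff_mult co poly_0_coeff_0 power2_eq_square)
    then have 1: "\<phi> v v = (y 0)\<^sup>2 + (y m * c)\<^sup>2" using red0 by simp
    have "\<phi> v v = (\<Sum>i<k. \<eta> i * \<phi> v (\<epsilon> i) * \<phi> v (\<epsilon> i))" by (rule \<phi>expand[OF vE vE])
    also have "\<dots> = (\<Sum>i\<in>?M. - (\<phi> v (\<epsilon> i))\<^sup>2)"
    proof (intro sum.mono_neutral_cong_right)
      show "\<forall>i\<in>{..<k} - ?M. \<eta> i * \<phi> v (\<epsilon> i) * \<phi> v (\<epsilon> i) = 0"
        using y(3) unfolding v_def[symmetric] by auto
      fix i assume "i \<in> ?M"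
      then have "\<eta> i = - 1" using \<eta>[of i] by blast
      then show "\<eta> i * \<phi> v (\<epsilon> i) * \<phi> v (\<epsilon> i) = - (\<phi> v (\<epsilon> i))\<^sup>2" by (simp add: power2_eq_square)
    qed auto
    finally have 2: "(\<Sum>i\<in>?M. (\<phi> v (\<epsilon> i))\<^sup>2) + ((y 0)\<^sup>2 + (y m * c)\<^sup>2) = 0"
      using 1 by (simp add: sum_negf)
    \<comment> \<open>\<open>\<phi> v v\<close> is also minus a sum of squares over the negative
      basis vectors. The indices \<open>k\<close> and \<open>Suc k\<close> hold the two other
      squares, so that all of them form one vanishing sum.\<close>
    define f where "f i = (if i < k then \<phi> v (\<epsilon> i) else if i = k then y 0 else y m * c)" for i
    have M: "finite ?M" "k \<notin> ?M" "Suc k \<notin> insert k ?M" by auto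
    have "(\<Sum>i\<in>insert (Suc k) (insert k ?M). (f i)\<^sup>2) = (y m * c)\<^sup>2 + ((y 0)\<^sup>2 + (\<Sum>i\<in>?M. (f i)\<^sup>2))"
      using M by (simp add: f_def)
    also have "(\<Sum>i\<in>?M. (f i)\<^sup>2) = (\<Sum>i\<in>?M. (\<phi> v (\<epsilon> i))\<^sup>2)" by (intro sum.cong) (auto simp: f_def)
    finally have "(\<Sum>i\<in>insert (Suc k) (insert k ?M). (f i)\<^sup>2) = 0" using 2 by (simp add: ac_simps)
    moreover have "f i \<in> L" for i unfolding f_def using \<phi>L[OF vE \<epsilon>] y(1) c(1) by (auto intro: L_mult)
    ultimately have "f i = 0" if "i \<in> ?M" for i
      using sum_squares_eq_0[of "insert (Suc k) (insert k ?M)" f i] that by auto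
    then have "\<phi> v (\<epsilon> i) = 0" if "i < k" for i
      using that y(3) unfolding v_def[symmetric] f_def by (cases "\<eta> i = 1") auto
    then have "v = 0" using expand[OF vE] by simp
    then show False using y(2) by (simp add: v_def)
  qed
  then show ?thesis using n by simp
qed

lemma minpoly_positive:
  assumes "is_minpoly p \<theta>" "\<theta> \<notin> L" "a \<in> L"
  shows "\<exists>c\<in>L. c \<noteq> 0 \<and> poly p a = c\<^sup>2"
proof -
  interpret F: simple_extension L \<theta> p by unfold_locales (rule assms(1))
  have "\<theta> - a \<notin> L" using assms(2,3) L_add[of "\<theta> - a" a] by auto
  then obtain c where "c \<in> L" "poly (pcompose p [:a, 1:]) 0 = c\<^sup>2"
    using minpoly_degree_and_sign[OF F.shift_minpoly[OF assms(3)]] by blast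
  then show ?thesis using minpoly_not_in_L(2)[OF assms] by (intro bexI[of _ c]) (auto simp: poly_pcompose)
qed

end

section \<open>Real closed fields: intermediate values and sums of squares\<close>

text \<open>The last assumption replaces continuity: minimal polynomials of elements outside
  \<open>L\<close> are positive on all of \<open>L\<close>, so the sign of a monic polynomial over
  \<open>L\<close> is decided by its linear factors.\<close>

locale rc_field = field_carrier L for L :: "'c::alg_closed_field set" +
  assumes two: "(2::'c) \<noteq> 0"
    and sum_squares_eq_0: "\<And>A f (j::nat). finite A \<Longrightarrow> (\<And>i. i \<in> A \<Longrightarrow> f i \<in> L) \<Longrightarrow> (\<Sum>i\<in>A. (f i)\<^sup>2) = 0 \<Longrightarrow> j \<in> A \<Longrightarrow> f j = 0"
    and euclid: "\<And>a. a \<in> L \<Longrightarrow> \<exists>c\<in>L. a = c\<^sup>2 \<or> a = - c\<^sup>2"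
    and minpoly_even: "\<And>p \<theta>. is_minpoly p \<theta> \<Longrightarrow> \<theta> \<notin> L \<Longrightarrow> even (degree p)"
    and minpoly_pos: "\<And>p \<theta> a. is_minpoly p \<theta> \<Longrightarrow> \<theta> \<notin> L \<Longrightarrow> a \<in> L \<Longrightarrow> \<exists>c\<in>L. c \<noteq> 0 \<and> poly p a = c\<^sup>2"
begin

text \<open>The nonnegative elements: a Euclidean formally real field has exactly one ordering,
  given by its squares.\<close>

definition T :: "'c set" where "T = {c\<^sup>2 | c. c \<in> L}"
definition P :: "'c set" where "P = T - {0}"

lemma T_L: "x \<in> T \<Longrightarrow> x \<in> L" by (auto simp: T_def L_power)
lemma P_T: "x \<in> P \<Longrightarrow> x \<in> T" and P_L: "x \<in> P \<Longrightarrow> x \<in> L" and P_0: "x \<in> P \<Longrightarrow> x \<noteq> 0"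
  by (auto simp: P_def T_L)
lemma T_sq: "x \<in> L \<Longrightarrow> x\<^sup>2 \<in> T" by (auto simp: T_def)
lemma T_sq': "x \<in> L \<Longrightarrow> x * x \<in> T" using T_sq[of x] by (simp add: power2_eq_square)
lemma T_0 [simp]: "0 \<in> T" and T_1: "1 \<in> T" using T_sq[of 0] T_sq[of 1] by auto

lemma T_total: "x \<in> L \<Longrightarrow> x \<in> T \<or> - x \<in> T"
  using euclid[of x] by (auto simp: T_def)

lemma three_squares:
  assumes "x \<in> L" "y \<in> L" "z \<in> L" "x\<^sup>2 + y\<^sup>2 + z\<^sup>2 = 0" shows "x = 0 \<and> y = 0 \<and> z = 0"
proof -
  let ?f = "\<lambda>i::nat. if i = 0 then x else if i = 1 then y else z"
  have s: "(\<Sum>i\<in>{0,1,2}. (?f i)\<^sup>2) = 0" using assms by (simp add: add.assoc)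
  have "\<And>i. i \<in> {0,1,2} \<Longrightarrow> ?f i \<in> L" using assms by auto
  then have "\<And>i. i \<in> {0,1,2} \<Longrightarrow> ?f i = 0" using sum_squares_eq_0[of "{0,1,2}" ?f, OF _ _ s] by blast
  from this[of 0] this[of 1] this[of 2] show ?thesis by simp
qed

lemma T_antisym: "x \<in> T \<Longrightarrow> - x \<in> T \<Longrightarrow> x = 0"
proof -
  assume "x \<in> T" "- x \<in> T"
  then obtain a c where a: "a \<in> L" "x = a\<^sup>2" "c \<in> L" "- x = c\<^sup>2" by (auto simp: T_def)
  have "a\<^sup>2 + c\<^sup>2 + 0\<^sup>2 = 0" using a(2,4) by (simp flip: a(2) a(4))
  from three_squares[OF a(1,3) L_0 this] show ?thesis using a by simp
qed

lemma T_add: "x \<in> T \<Longrightarrow> y \<in> T \<Longrightarrow> x + y \<in> T"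
proof -
  assume "x \<in> T" "y \<in> T"
  then obtain a c where a: "a \<in> L" "x = a\<^sup>2" "c \<in> L" "y = c\<^sup>2" by (auto simp: T_def)
  then obtain d where d: "d \<in> L" "x + y = d\<^sup>2 \<or> x + y = - d\<^sup>2" using euclid[of "x + y"] by (auto intro: L_add L_power)
  show ?thesis
  proof (cases "x + y = d\<^sup>2")
    case False
    then have "a\<^sup>2 + c\<^sup>2 + d\<^sup>2 = 0" using d a by simp
    from three_squares[OF a(1,3) d(1) this] show ?thesis using a by simp
  qed (use d in \<open>auto simp: T_def\<close>)
qed

lemma T_mult: "x \<in> T \<Longrightarrow> y \<in> T \<Longrightarrow> x * y \<in> T"
  unfolding T_def by (auto simp: power_mult_distrib[symmetric] intro: L_mult)

lemma P_mult: "x \<in> P \<Longrightarrow> y \<in> P \<Longrightarrow> x * y \<in> P"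
  using T_mult by (auto simp: P_def)

lemma P_add_T: "x \<in> P \<Longrightarrow> y \<in> T \<Longrightarrow> x + y \<in> P"
proof -
  assume x: "x \<in> P" and y: "y \<in> T"
  have "x + y \<noteq> 0"
  proof
    assume "x + y = 0"
    then have "- x = y" by (rule minus_unique)
    then show False using T_antisym[of x] x y by (auto simp: P_def)
  qed
  then show ?thesis using x y T_add by (auto simp: P_def)
qed

lemma T_add_P: "x \<in> T \<Longrightarrow> y \<in> P \<Longrightarrow> x + y \<in> P"
  using P_add_T[of y x] by (simp add: add.commute)

lemma not_T: "x \<in> L \<Longrightarrow> x \<notin> T \<Longrightarrow> - x \<in> P"
  using T_total[of x] by (auto simp: P_def)

lemma P_not: "x \<in> P \<Longrightarrow> - x \<notin> T"
  using T_antisym[of x] by (auto simp: P_def)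

lemma P_cases: "x \<in> L \<Longrightarrow> x \<noteq> 0 \<Longrightarrow> x \<in> P \<or> - x \<in> P"
  using T_total[of x] by (auto simp: P_def)

lemma P_1: "1 \<in> P" using T_1 by (auto simp: P_def)

lemma P_inverse: "x \<in> P \<Longrightarrow> inverse x \<in> P"
proof -
  assume x: "x \<in> P"
  have "inverse x = x * (inverse x)\<^sup>2" using P_0[OF x] by (simp add: power2_eq_square)
  moreover have "(inverse x)\<^sup>2 \<in> P" using T_sq[OF L_inverse[OF P_L[OF x]]] P_0[OF x] by (auto simp: P_def)
  ultimately show ?thesis using P_mult[OF x] by metis
qed

lemma P_of_nat: "n > 0 \<Longrightarrow> of_nat n \<in> P"
proof (induction n)
  case (Suc n)
  then show ?case using P_add_T[OF P_1, of "of_nat n"] P_T by (cases "n = 0") (auto simp: P_1)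
qed simp

lemma mult_P_cancel: "x * y \<in> T \<Longrightarrow> x \<in> P \<Longrightarrow> y \<in> T"
proof -
  assume xy: "x * y \<in> T" and x: "x \<in> P"
  have "inverse x * (x * y) \<in> T" by (rule T_mult[OF P_T[OF P_inverse[OF x]] xy])
  moreover have "inverse x * (x * y) = y" using P_0[OF x] by (simp flip: mult.assoc)
  ultimately show ?thesis by simp
qed

lemma ordering: "field_ordering L T"
  unfolding field_ordering_def using T_add T_mult T_total T_antisym T_L by blast

lemma linear_factor:
  assumes "Lpoly f" "f \<noteq> 0" "a \<in> L" "poly f a = 0"
  obtains g where "f = [:- a, 1:] * g" "Lpoly g" "lead_coeff g = lead_coeff f" "degree f = Suc (degree g)"
proof -
  obtain g where g: "f = [:- a, 1:] * g" using assms(4) poly_eq_0_iff_dvd by (auto simp: dvd_def)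
  have "Lpoly ([:- a, 1:] * g)" using assms(1) by (simp only: g[symmetric])
  then have gL: "Lpoly g"
    by (rule Lpoly_cofactor) (use assms(3) in \<open>auto simp: Lpoly_pCons L_minus\<close>)
  have "lead_coeff g = lead_coeff f" unfolding g lead_coeff_mult by simp
  moreover have "g \<noteq> 0" using assms(2) unfolding g by auto
  then have "degree f = Suc (degree g)" unfolding g by (subst degree_mult_eq) auto
  ultimately show thesis using that g gL by blast
qed

text \<open>Factorisation over \<open>L\<close> as an induction rule: a root is taken in the
  algebraically closed ambient field, and its linear factor or its minimal polynomial is split
  off.\<close>

lemma monic_induct [consumes 2, case_names one linear minimal]:
  assumes "Lpoly f" "lead_coeff f = 1" and one: "Q 1"
    and lin: "\<And>a g. a \<in> L \<Longrightarrow> Lpoly g \<Longrightarrow> lead_coeff g = 1 \<Longrightarrow> Q g \<Longrightarrow> Q ([:- a, 1:] * g)"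
    and min: "\<And>p \<theta> g. is_minpoly p \<theta> \<Longrightarrow> \<theta> \<notin> L \<Longrightarrow> Lpoly g \<Longrightarrow> lead_coeff g = 1 \<Longrightarrow> Q g \<Longrightarrow> Q (p * g)"
  shows "Q f"
  using assms(1,2)
proof (induction "degree f" arbitrary: f rule: less_induct)
  case less
  have f0: "f \<noteq> 0" using less.prems by auto
  show ?case
  proof (cases "degree f = 0")
    case True
    then obtain c where "f = [:c:]" using degree_eq_zeroE by blast
    then have "f = 1" using less.prems by (simp add: one_pCons)
    then show ?thesis using one by simp
  next
    case False
    then obtain \<theta> where \<theta>: "poly f \<theta> = 0" using alg_closed_imp_poly_has_root[of f] by auto
    show ?thesis
    proof (cases "\<theta> \<in> L")
      case True
      obtain g where g: "f = [:- \<theta>, 1:] * g" "Lpoly g" "lead_coeff g = lead_coeff f" "degree f = Suc (degree g)"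
        by (rule linear_factor[OF less.prems(1) f0 True \<theta>])
      have lg: "lead_coeff g = 1" using g(3) less.prems(2) by simp
      have dg: "degree g < degree f" using g(4) by simp
      show ?thesis unfolding g(1) by (rule lin[OF True g(2) lg less.hyps[OF dg g(2) lg]])
    next
      case False
      obtain p where p: "is_minpoly p \<theta>" using minpoly_exists[OF less.prems(1) f0 \<theta>] by blast
      then obtain h where h: "Lpoly h" "f = p * h" using less.prems(1) \<theta> unfolding is_minpoly_def by blast
      have "degree p \<ge> 2" by (rule minpoly_not_in_L[OF p False])
      moreover have "h \<noteq> 0" using f0 h by auto
      ultimately have d: "degree h < degree f" using h(2) f0 by (subst h(2), subst degree_mult_eq) auto
      have lh: "lead_coeff h = 1" using less.prems(2) p unfolding h(2) lead_coeff_mult is_minpoly_def by simp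
      show ?thesis unfolding h(2) by (rule min[OF p False h(1) lh less.hyps[OF d h(1) lh]])
    qed
  qed
qed

text \<open>Minimal polynomials of elements outside \<open>L\<close> have even degree, so an odd
  degree forces a linear factor.\<close>

lemma odd_root:
  assumes "Lpoly f" "odd (degree f)" shows "\<exists>x\<in>L. poly f x = 0"
proof -
  define c where "c = lead_coeff f"
  have c0: "c \<noteq> 0" using assms(2) by (auto simp: c_def)
  define g where "g = Polynomial.smult (inverse c) f"
  have "Lpoly g" "lead_coeff g = 1" "degree g = degree f"
    using assms c0 by (auto simp: g_def c_def intro!: Lpoly_smult L_inverse lead_in_L)
  then have "Lpoly g" "lead_coeff g = 1" "odd (degree g)" using assms(2) by auto
  then have "\<exists>x\<in>L. poly g x = 0"
  proof (induction g rule: monic_induct)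
    case (minimal p \<theta> g)
    have ne: "p \<noteq> 0" "g \<noteq> 0" using minimal(1,4) by (auto simp: is_minpoly_def)
    then have "odd (degree g)"
      using minimal(6) minpoly_even[OF minimal(1,2)] by (simp add: degree_mult_eq)
    then show ?case using minimal(5) by auto
  qed auto
  then show ?thesis using c0 by (auto simp: g_def)
qed

text \<open>To the right of all roots in \<open>L\<close> every linear factor is positive; the
  remaining factors are positive everywhere.\<close>

lemma monic_pos:
  assumes "Lpoly f" "lead_coeff f = 1" "x \<in> L" "\<And>z. z \<in> L \<Longrightarrow> z - x \<in> T \<Longrightarrow> poly f z \<noteq> 0"
  shows "poly f x \<in> P"
  using assms(1,2,4)
proof (induction f rule: monic_induct)
  case one
  show ?case by (simp add: P_1)
next
  case (linear a g)
  have "a - x \<notin> T" using linear(5)[OF linear(1)] by auto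
  then have "x - a \<in> P" using not_T[of "a - x"] linear(1) assms(3) by (auto intro: L_diff)
  moreover have "poly g x \<in> P" using linear(5) by (intro linear(4)) auto
  ultimately have "(x - a) * poly g x \<in> P" by (rule P_mult)
  then show ?case by (simp add: algebra_simps)
next
  case (minimal p \<theta> g)
  have "poly p x \<in> P" using minpoly_pos[OF minimal(1,2) assms(3)] T_sq by (auto simp: P_def)
  moreover have "poly g x \<in> P" using minimal(6) by (intro minimal(5)) auto
  ultimately show ?case unfolding poly_mult by (rule P_mult)
qed

text \<open>The intermediate value theorem factor by factor: a linear factor whose root lies outside
  the interval has the same sign at both ends.\<close>

lemma monic_ivt:
  assumes "Lpoly f" "lead_coeff f = 1" and x: "x \<in> L" and y: "y \<in> L" and xy: "y - x \<in> T"
    and "\<And>z. z \<in> L \<Longrightarrow> z - x \<in> T \<Longrightarrow> y - z \<in> T \<Longrightarrow> poly f z \<noteq> 0"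
  shows "poly f x * poly f y \<in> P"
  using assms(1,2,6)
proof (induction f rule: monic_induct)
  case one
  show ?case by (simp add: P_1)
next
  case (linear a g)
  have n: "\<not> (a - x \<in> T \<and> y - a \<in> T)" using linear(5)[OF linear(1)] by auto
  have "(x - a) * (y - a) \<in> P"
  proof (cases "a - x \<in> T")
    case True
    then have "- (y - a) \<in> P" using n not_T[of "y - a"] linear(1) y by (auto intro: L_diff)
    then have 1: "a - y \<in> P" by simp
    have 2: "a - x \<in> P" using P_add_T[OF 1 xy] by simp
    show ?thesis using P_mult[OF 2 1] by (simp add: algebra_simps)
  next
    case False
    then have 1: "x - a \<in> P" using not_T[of "a - x"] linear(1) x by (auto intro: L_diff)
    have 2: "y - a \<in> P" using P_add_T[OF 1 xy] by simp
    show ?thesis using P_mult[OF 1 2] .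
  qed
  moreover have "poly g x * poly g y \<in> P" using linear(5) by (intro linear(4)) auto
  ultimately have "((x - a) * (y - a)) * (poly g x * poly g y) \<in> P" by (rule P_mult)
  moreover have "poly ([:- a, 1:] * g) x * poly ([:- a, 1:] * g) y = ((x - a) * (y - a)) * (poly g x * poly g y)"
    by (simp add: algebra_simps)
  ultimately show ?case by simp
next
  case (minimal p \<theta> g)
  have "poly p x \<in> P" "poly p y \<in> P"
    using minpoly_pos[OF minimal(1,2) x] minpoly_pos[OF minimal(1,2) y] T_sq by (auto simp: P_def)
  then have 1: "poly p x * poly p y \<in> P" by (rule P_mult)
  have "poly g x * poly g y \<in> P" using minimal(6) by (intro minimal(5)) auto
  from P_mult[OF 1 this] show ?case by (simp add: mult_ac)
qed

lemma ivt:
  assumes f: "Lpoly f" "f \<noteq> 0" and x: "x \<in> L" and y: "y \<in> L" and xy: "y - x \<in> T"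
    and nr: "\<And>z. z \<in> L \<Longrightarrow> z - x \<in> T \<Longrightarrow> y - z \<in> T \<Longrightarrow> poly f z \<noteq> 0"
  shows "poly f x * poly f y \<in> P"
proof -
  define c where "c = lead_coeff f"
  have c0: "c \<noteq> 0" "c \<in> L" using f by (auto simp: c_def lead_in_L)
  define g where "g = Polynomial.smult (inverse c) f"
  have g: "Lpoly g" "lead_coeff g = 1" "poly f z = c * poly g z" for z
    using f c0 by (auto simp: g_def c_def intro!: Lpoly_smult L_inverse)
  have "poly g x * poly g y \<in> P" using nr g by (intro monic_ivt[OF g(1,2) x y xy]) auto
  moreover have "c * c \<in> P" using c0 T_sq' by (auto simp: P_def)
  ultimately have "(c * c) * (poly g x * poly g y) \<in> P" by (rule P_mult[rotated])
  then show ?thesis unfolding g(3) by (simp add: mult_ac)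
qed

lemma finite_min:
  assumes "finite Z" "Z \<noteq> {}" "\<And>z. z \<in> Z \<Longrightarrow> h z \<in> L"
  shows "\<exists>z0\<in>Z. \<forall>z\<in>Z. h z - h z0 \<in> T"
  using assms
proof (induction Z rule: finite_ne_induct)
  case (insert z F)
  then obtain z0 where z0: "z0 \<in> F" "\<forall>z\<in>F. h z - h z0 \<in> T" by auto
  show ?case
  proof (cases "h z - h z0 \<in> T")
    case True
    then show ?thesis using z0 by auto
  next
    case False
    then have 1: "h z0 - h z \<in> T" using T_total[of "h z - h z0"] insert z0 by (auto intro: L_diff)
    have "h w - h z \<in> T" if "w \<in> F" for w using T_add[OF z0(2)[rule_format, OF that] 1] by simp
    then show ?thesis by auto
  qed
qed auto

text \<open>Continuity without limits: were \<open>g\<close> negative at \<open>a\<close>, it would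
  keep its sign up to some \<open>y\<close> before the next root, against its nonnegativity at
  \<open>y\<close>.\<close>

lemma nonneg_right_limit:
  assumes g: "Lpoly g" and a: "a \<in> L" and nn: "\<And>x. x \<in> L \<Longrightarrow> x - a \<in> P \<Longrightarrow> poly g x \<in> T"
  shows "poly g a \<in> T"
proof (rule ccontr)
  assume "poly g a \<notin> T"
  then have neg: "- poly g a \<in> P" using not_T poly_in_L[OF g a] by blast
  then have g0: "g \<noteq> 0" using P_0[OF neg] by auto
  define Z where "Z = {z\<in>L. poly g z = 0 \<and> z - a \<in> T}"
  have "finite Z" unfolding Z_def using poly_roots_finite[OF g0] by (rule rev_finite_subset) auto
  have half: "inverse 2 \<in> P" using P_inverse[OF P_of_nat[of 2]] by simp
  have "\<exists>y\<in>L. y - a \<in> P \<and> (\<forall>z\<in>L. z - a \<in> T \<and> y - z \<in> T \<longrightarrow> poly g z \<noteq> 0)"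
  proof (cases "Z = {}")
    case True
    then show ?thesis using a P_1 by (intro bexI[of _ "a + 1"]) (auto simp: Z_def intro: L_add)
  next
    case False
    obtain z0 where z0: "z0 \<in> Z" "\<forall>z\<in>Z. z - z0 \<in> T"
      using finite_min[OF \<open>finite Z\<close> False, of "\<lambda>z. z"] by (auto simp: Z_def)
    have "poly g a \<noteq> 0" using P_0[OF neg] by simp
    then have "z0 \<noteq> a" using z0 by (auto simp: Z_def)
    then have z0a: "z0 - a \<in> P" using z0 by (auto simp: Z_def P_def)
    \<comment> \<open>The midpoint between \<open>a\<close> and the next root
      \<open>z0\<close>.\<close>
    define y where "y = a + inverse 2 * (z0 - a)"
    have ya: "y - a \<in> P" unfolding y_def using P_mult[OF half z0a] by simp
    have "z0 - y = inverse 2 * (z0 - a)"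
      unfolding y_def using two by (simp add: field_simps)
    then have zy: "z0 - y \<in> P" using P_mult[OF half z0a] by (simp only:)
    have "y \<in> L" using ya a L_add[OF P_L[OF ya] a] by simp
    moreover have "poly g z \<noteq> 0" if "z \<in> L" "z - a \<in> T" "y - z \<in> T" for z
    proof
      assume "poly g z = 0"
      then have "z - z0 \<in> T" using z0 that by (auto simp: Z_def)
      then have "y - z0 \<in> T" using T_add[OF that(3), of "z - z0"] by simp
      then show False using P_not[OF zy] by simp
    qed
    ultimately show ?thesis using ya by blast
  qed
  then obtain y where y: "y \<in> L" "y - a \<in> P" "\<And>z. z \<in> L \<Longrightarrow> z - a \<in> T \<Longrightarrow> y - z \<in> T \<Longrightarrow> poly g z \<noteq> 0"
    by blast
  have "poly g a * poly g y \<in> P" using ivt[OF g g0 a y(1) P_T[OF y(2)] y(3)] by blast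
  moreover have "(- poly g a) * poly g y \<in> T" using T_mult[OF P_T[OF neg] nn[OF y(1,2)]] .
  ultimately show False using P_not by fastforce
qed

lemma nonneg_left_limit:
  assumes g: "Lpoly g" and a: "a \<in> L" and nn: "\<And>x. x \<in> L \<Longrightarrow> a - x \<in> P \<Longrightarrow> poly g x \<in> T"
  shows "poly g a \<in> T"
proof -
  have "poly (pcompose g [:0, - 1:]) (- a) \<in> T"
  proof (rule nonneg_right_limit)
    show "Lpoly (pcompose g [:0, - 1:])" using g by (intro Lpoly_pcompose) (auto simp: Lpoly_pCons L_minus)
    show "- a \<in> L" by (rule L_minus[OF a])
    show "poly (pcompose g [:0, - 1:]) x \<in> T" if "x \<in> L" "x - - a \<in> P" for x
      using nn[of "- x"] that by (simp add: poly_pcompose L_minus add.commute)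
  qed
  then show ?thesis by (simp add: poly_pcompose)
qed

text \<open>Once one factor is removed, the cofactor is nonnegative to the right of \<open>a\<close>
  and nonpositive to the left. So it vanishes at \<open>a\<close>, and a second factor comes
  off.\<close>

lemma nonneg_double_root:
  assumes f: "Lpoly f" "lead_coeff f = 1" and nn: "\<And>x. x \<in> L \<Longrightarrow> poly f x \<in> T" and a: "a \<in> L" "poly f a = 0"
  obtains t where "f = [:- a, 1:] * ([:- a, 1:] * t)" "Lpoly t" "lead_coeff t = 1" "degree f = Suc (Suc (degree t))"
    "\<And>x. x \<in> L \<Longrightarrow> poly t x \<in> T"
proof -
  have f0: "f \<noteq> 0" using f by auto
  obtain g where g: "f = [:- a, 1:] * g" "Lpoly g" "lead_coeff g = lead_coeff f" "degree f = Suc (degree g)"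
    by (rule linear_factor[OF f(1) f0 a])
  have fx: "poly f x = (x - a) * poly g x" for x unfolding g(1) by (simp add: algebra_simps)
  have "poly g a \<in> T"
    by (rule nonneg_right_limit[OF g(2) a(1)]) (use nn fx mult_P_cancel in metis)
  moreover have "poly (- g) a \<in> T"
  proof (rule nonneg_left_limit[OF Lpoly_minus[OF g(2)] a(1)])
    fix x assume x: "x \<in> L" "a - x \<in> P"
    have "(a - x) * poly (- g) x = poly f x" unfolding fx by (simp add: algebra_simps)
    then show "poly (- g) x \<in> T" using nn[OF x(1)] mult_P_cancel[OF _ x(2)] by metis
  qed
  ultimately have ga: "poly g a = 0" using T_antisym by simp
  have g0: "g \<noteq> 0" using f0 g(1) by auto
  obtain t where t: "g = [:- a, 1:] * t" "Lpoly t" "lead_coeff t = lead_coeff g" "degree g = Suc (degree t)"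
    by (rule linear_factor[OF g(2) g0 a(1) ga])
  have fx2: "poly f x = (x - a)\<^sup>2 * poly t x" for x unfolding fx t(1) by (simp add: power2_eq_square algebra_simps)
  have tx: "poly t x \<in> T" if "x \<in> L" "x \<noteq> a" for x
  proof -
    have "(x - a)\<^sup>2 \<in> P" using that a(1) by (auto simp: P_def intro!: T_sq L_diff)
    then show ?thesis using nn[OF that(1)] fx2 mult_P_cancel by metis
  qed
  have "poly t a \<in> T"
  proof (rule nonneg_right_limit[OF t(2) a(1)])
    fix x assume x: "x \<in> L" "x - a \<in> P"
    then have "x \<noteq> a" using P_0[OF x(2)] by auto
    then show "poly t x \<in> T" by (rule tx[OF x(1)])
  qed
  then have "\<And>x. x \<in> L \<Longrightarrow> poly t x \<in> T" using tx by metis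
  then show thesis using that g t f by metis
qed

text \<open>
  The minimum over the finitely many critical points is global: if \<open>f\<close> took a smaller value
  \<open>v\<close>, then \<open>f - v\<close> would have only simple roots, at least two, and Rolle's theorem between
  the two largest gives a critical point with a value below \<open>v\<close>.
\<close>

lemma global_minimum:
  assumes f: "Lpoly f" "lead_coeff f = 1" and deg: "degree f > 0" and ev: "even (degree f)"
  shows "\<exists>a\<in>L. \<forall>x\<in>L. poly f x - poly f a \<in> T"
proof -
  have n0: "of_nat (degree f) \<noteq> (0::'c)" using P_0[OF P_of_nat[OF deg]] .
  have df: "degree (pderiv f) = degree f - 1"
  proof (rule antisym)
    show "degree (pderiv f) \<le> degree f - 1"
      by (intro degree_le) (auto simp: coeff_pderiv coeff_eq_0)
    have "poly.coeff (pderiv f) (degree f - 1) = of_nat (degree f)"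
      using deg f(2) by (simp add: coeff_pderiv del: of_nat_Suc)
    then show "degree f - 1 \<le> degree (pderiv f)" using n0 by (intro le_degree) simp
  qed
  have f'0: "pderiv f \<noteq> 0"
  proof
    assume "pderiv f = 0"
    then have "poly.coeff (pderiv f) (degree f - 1) = 0" by simp
    then show False using deg f(2) n0 by (simp add: coeff_pderiv del: of_nat_Suc)
  qed
  define Z where "Z = {z\<in>L. poly (pderiv f) z = 0}"
  have "finite Z" unfolding Z_def using poly_roots_finite[OF f'0] by (rule rev_finite_subset) auto
  moreover have "odd (degree (pderiv f))" using df deg ev by simp
  then have "Z \<noteq> {}" using odd_root[OF Lpoly_pderiv[OF f(1)]] by (auto simp: Z_def)
  ultimately obtain a where a: "a \<in> Z" "\<forall>z\<in>Z. poly f z - poly f a \<in> T"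
    using finite_min[of Z "poly f"] poly_in_L[OF f(1)] by (auto simp: Z_def)
  have aL: "a \<in> L" using a by (simp add: Z_def)
  have "poly f c - poly f a \<in> T" if c: "c \<in> L" for c
  proof (rule ccontr)
    assume "poly f c - poly f a \<notin> T"
    moreover define v where "v = poly f c"
    moreover have "poly f c - poly f a \<in> L" by (intro L_diff poly_in_L f(1) c aL)
    ultimately have "- (v - poly f a) \<in> P" using not_T by blast
    then have va: "poly f a - v \<in> P" by simp
    have vL: "v \<in> L" unfolding v_def by (rule poly_in_L[OF f(1) c])
    \<comment> \<open>The level \<open>v\<close> lies below all critical values, so the roots of
      \<open>f - v\<close> are simple.\<close>
    have crit: "poly f z \<noteq> v" if "z \<in> Z" for z
    proof
      assume "poly f z = v"
      then have "v - poly f a \<in> T" using a(2) that by auto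
      then show False using P_not[OF va] by simp
    qed
    define g where "g = f - [:v:]"
    have gL: "Lpoly g" unfolding g_def using f(1) vL by (intro Lpoly_diff) (auto simp: Lpoly_pCons)
    have dg: "degree g = degree f" unfolding g_def using deg by (simp add: diff_conv_add_uminus degree_add_eq_left)
    have lg: "lead_coeff g = 1" unfolding dg using f(2) deg by (simp add: g_def coeff_pCons split: nat.split)
    have g0: "g \<noteq> 0" using lg by auto
    have g': "pderiv g = pderiv f" by (simp add: g_def pderiv_diff pderiv_pCons)
    define Y where "Y = {z\<in>L. poly g z = 0}"
    have Yfin: "finite Y" unfolding Y_def using poly_roots_finite[OF g0] by (rule rev_finite_subset) auto
    have simple: "poly (pderiv f) z \<noteq> 0" if "z \<in> Y" for z
      using crit[of z] that by (auto simp: Y_def Z_def g_def)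
    have cY: "c \<in> Y" using c by (simp add: Y_def g_def v_def)
    \<comment> \<open>The largest root, found as a minimum of the negated roots.\<close>
    obtain d where d: "d \<in> Y" "\<forall>z\<in>Y. d - z \<in> T"
      using finite_min[OF Yfin, of uminus] cY by (auto simp: Y_def L_minus)
    have dL: "d \<in> L" "poly g d = 0" using d by (auto simp: Y_def)
    obtain g1 where g1: "g = [:- d, 1:] * g1" "Lpoly g1" "lead_coeff g1 = lead_coeff g" "degree g = Suc (degree g1)"
      by (rule linear_factor[OF gL g0 dL])
    \<comment> \<open>The remaining factor has odd degree and hence a root; \<open>e\<close> below
      is the largest of its roots.\<close>
    have "odd (degree g1)" using g1(4) dg ev by simp
    then obtain e0 where e0: "e0 \<in> L" "poly g1 e0 = 0" using odd_root[OF g1(2)] by blast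
    define Y' where "Y' = {z\<in>L. poly g1 z = 0}"
    have g10: "g1 \<noteq> 0" using g0 g1(1) by auto
    have Y'fin: "finite Y'" unfolding Y'_def using poly_roots_finite[OF g10] by (rule rev_finite_subset) auto
    obtain e where e: "e \<in> Y'" "\<forall>z\<in>Y'. e - z \<in> T"
      using finite_min[OF Y'fin, of uminus] e0 by (auto simp: Y'_def L_minus)
    have eL: "e \<in> L" "poly g1 e = 0" using e by (auto simp: Y'_def)
    obtain k where k: "g1 = [:- e, 1:] * k" "Lpoly k" "lead_coeff k = lead_coeff g1" "degree g1 = Suc (degree k)"
      by (rule linear_factor[OF g1(2) g10 eL])
    have gk: "g = [:- d, 1:] * ([:- e, 1:] * k)" unfolding g1(1) k(1) ..
    have "pderiv [:- x, 1:] = 1" for x :: 'c by (simp add: pderiv_pCons)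
    then have g'x: "poly (pderiv f) x = (x - e) * poly k x + (x - d) * (poly k x + (x - e) * poly (pderiv k) x)" for x
      unfolding g'[symmetric] gk by (simp add: pderiv_mult algebra_simps del: mult_pCons_left mult_pCons_right)
    have "poly g e = 0" by (subst g1(1)) (simp add: eL)
    then have eY: "e \<in> Y" using eL by (simp add: Y_def)
    have ed: "e \<noteq> d" using simple[OF eY] g'x[of e] by auto
    have de: "d - e \<in> P" using d(2) eY ed by (auto simp: P_def)
    \<comment> \<open>From \<open>e\<close> on the last factor \<open>k\<close> has no roots: such a
      root would exceed \<open>e\<close>, or equal it and be a double root of
      \<open>g\<close>.\<close>
    have kpos: "poly k x \<in> P" if x: "x \<in> L" "x - e \<in> T" for x
    proof (rule monic_pos[OF k(2) _ x(1)])
      show "lead_coeff k = 1" using k(3) g1(3) lg by simp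
      fix z assume z: "z \<in> L" "z - x \<in> T"
      show "poly k z \<noteq> 0"
      proof
        assume kz: "poly k z = 0"
        have "poly g1 z = 0" by (subst k(1)) (simp add: kz)
        then have zY': "z \<in> Y'" using z by (simp add: Y'_def)
        have "z - e \<in> T" using T_add[OF z(2) x(2)] by simp
        moreover have "- (z - e) \<in> T" using e(2) zY' by simp
        ultimately have "z = e" using T_antisym by (metis eq_iff_diff_eq_0)
        then show False using simple[OF eY] g'x[of e] kz by simp
      qed
    qed
    \<comment> \<open>The derivative is \<open>(e - d) k(e)\<close> at \<open>e\<close> and
      \<open>(d - e) k(d)\<close> at \<open>d\<close>, with opposite signs. A critical point
      \<open>z\<close> between them has \<open>f(z) - v = (z - d) (z - e) k(z) < 0\<close>, below
      the least critical value.\<close>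
    have "poly (pderiv f) e * poly (pderiv f) d \<notin> P"
    proof
      assume A: "poly (pderiv f) e * poly (pderiv f) d \<in> P"
      have "(d - e) * poly k e * ((d - e) * poly k d) \<in> P"
        using kpos[OF eL(1)] kpos[OF dL(1) P_T[OF de]] de by (intro P_mult) auto
      moreover have "- (poly (pderiv f) e * poly (pderiv f) d) = (d - e) * poly k e * ((d - e) * poly k d)"
        unfolding g'x by (simp add: algebra_simps)
      ultimately have "- (poly (pderiv f) e * poly (pderiv f) d) \<in> P" by simp
      then show False using P_not[OF A] P_T by blast
    qed
    then obtain z where z: "z \<in> L" "z - e \<in> T" "d - z \<in> T" "poly (pderiv f) z = 0"
      using ivt[OF Lpoly_pderiv[OF f(1)] f'0 eL(1) dL(1) P_T[OF de]] by blast
    have "z \<noteq> e" "z \<noteq> d" using z(4) simple[OF eY] simple[OF d(1)] by auto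
    then have zz: "z - e \<in> P" "d - z \<in> P" using z by (auto simp: P_def)
    have "(z - e) * ((d - z) * poly k z) \<in> P" by (intro P_mult zz kpos z)
    moreover have "(z - e) * ((d - z) * poly k z) = v - poly f z"
    proof -
      have "poly f z - v = (z - d) * ((z - e) * poly k z)"
        using arg_cong[OF gk, of "\<lambda>q. poly q z"] by (simp add: g_def algebra_simps)
      then show ?thesis by (simp add: algebra_simps)
    qed
    ultimately have "v - poly f z \<in> P" by simp
    moreover have "poly f z - poly f a \<in> T" using a(2) z by (simp add: Z_def)
    ultimately have "v - poly f a \<in> P" using P_add_T[of "v - poly f z" "poly f z - poly f a"] by simp
    then show False using P_not[OF va] P_T by simp
  qed
  then show ?thesis using aL by blast
qed

text \<open>Subtracting the minimum, itself a square, produces a zero, which must be double. The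
  cofactor is nonnegative of smaller degree, and its summands are multiplied by the square of
  \<open>X - a\<close>.\<close>

lemma nonneg_sum_of_squares:
  assumes "Lpoly f" "lead_coeff f = 1" "\<And>x. x \<in> L \<Longrightarrow> poly f x \<in> T"
  shows "\<exists>gs. list_all Lpoly gs \<and> f = (\<Sum>g\<leftarrow>gs. g * g)"
  using assms
proof (induction "degree f" arbitrary: f rule: less_induct)
  case less
  show ?case
  proof (cases "degree f = 0")
    case True
    then obtain c where "f = [:c:]" using degree_eq_zeroE by blast
    then have "f = 1" using less.prems by (simp add: one_pCons)
    then show ?thesis by (intro exI[of _ "[1]"]) auto
  next
    case False
    have "\<exists>a\<in>L. \<exists>\<mu>\<in>L. poly f a = \<mu>\<^sup>2 \<and> (\<forall>x\<in>L. poly f x - \<mu>\<^sup>2 \<in> T)"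
    proof (cases "even (degree f)")
      case True
      obtain a where a: "a \<in> L" "\<forall>x\<in>L. poly f x - poly f a \<in> T"
        using global_minimum[OF less.prems(1,2)] False True by auto
      obtain \<mu> where "\<mu> \<in> L" "poly f a = \<mu>\<^sup>2" using less.prems(3)[OF a(1)] by (auto simp: T_def)
      then show ?thesis using a by metis
    next
      \<comment> \<open>In odd degree a root takes the role of the minimum, with value 0.\<close>
      case False
      then obtain a where a: "a \<in> L" "poly f a = 0" using odd_root[OF less.prems(1)] by blast
      then show ?thesis using less.prems(3) by (intro bexI[of _ a] bexI[of _ 0]) auto
    qed
    then obtain a \<mu> where a: "a \<in> L" "\<mu> \<in> L" "poly f a = \<mu>\<^sup>2" "\<And>x. x \<in> L \<Longrightarrow> poly f x - \<mu>\<^sup>2 \<in> T" by blast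
    define h where "h = f - [:\<mu>\<^sup>2:]"
    have hL: "Lpoly h" unfolding h_def using less.prems(1) a(2) by (intro Lpoly_diff) (auto simp: Lpoly_pCons L_power)
    have dh: "degree h = degree f" unfolding h_def using False by (simp add: diff_conv_add_uminus degree_add_eq_left)
    have lh: "lead_coeff h = 1" unfolding dh using less.prems(2) False by (simp add: h_def coeff_pCons split: nat.split)
    obtain t where t: "h = [:- a, 1:] * ([:- a, 1:] * t)" "Lpoly t" "lead_coeff t = 1" "degree h = Suc (Suc (degree t))"
        "\<And>x. x \<in> L \<Longrightarrow> poly t x \<in> T"
      by (rule nonneg_double_root[OF hL lh _ a(1)]) (use a in \<open>auto simp: h_def\<close>)
    have "degree t < degree f" using t(4) dh by simp
    then obtain gs where gs: "list_all Lpoly gs" "t = (\<Sum>g\<leftarrow>gs. g * g)" using less.hyps t(2,3,5) by blast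
    define g where "g = [:- a, 1:]"
    have "(\<Sum>q\<leftarrow>map ((*) g) gs'. q * q) = g * (g * (\<Sum>q\<leftarrow>gs'. q * q))" for gs'
      by (induction gs') (auto simp: algebra_simps)
    then have "h = (\<Sum>q\<leftarrow>map ((*) g) gs. q * q)" using t(1) gs(2) by (simp add: g_def)
    then have "f = (\<Sum>q\<leftarrow>[:\<mu>:] # map ((*) g) gs. q * q)" by (simp add: h_def power2_eq_square algebra_simps)
    moreover have "Lpoly (g * q)" if "Lpoly q" for q
      unfolding g_def using that a(1) by (intro Lpoly_mult) (auto simp: Lpoly_pCons L_minus)
    then have "list_all Lpoly ([:\<mu>:] # map ((*) g) gs)" using gs(1) a(2) by (auto simp: list_all_iff Lpoly_pCons)
    ultimately show ?thesis by blast
  qed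
qed

text \<open>With the positive minimum \<open>\<mu>^2\<close> of \<open>f\<close>, the polynomial
  \<open>f - \<mu>^2\<close> is a sum of squares; division by \<open>\<mu>^2\<close> turns it into
  -1 modulo \<open>f\<close>.\<close>

lemma rootless_minus_one_sum_of_squares:
  assumes f: "Lpoly f" "lead_coeff f = 1" and nr: "\<And>x. x \<in> L \<Longrightarrow> poly f x \<noteq> 0"
  shows "\<exists>gs h. list_all Lpoly gs \<and> Lpoly h \<and> (\<Sum>g\<leftarrow>gs. g * g) = - 1 + f * h"
proof (cases "degree f = 0")
  case True
  then obtain c where "f = [:c:]" using degree_eq_zeroE by blast
  then have "f = 1" using f by (simp add: one_pCons)
  then show ?thesis by (intro exI[of _ "[]"] exI[of _ 1]) auto
next
  case False
  have ev: "even (degree f)" using odd_root[OF f(1)] nr by blast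
  obtain a where a: "a \<in> L" "\<forall>x\<in>L. poly f x - poly f a \<in> T"
    using global_minimum[OF f] False ev by auto
  have "poly f a \<in> P" using monic_pos[OF f a(1)] nr by blast
  then obtain \<mu> where \<mu>: "\<mu> \<in> L" "poly f a = \<mu>\<^sup>2" "\<mu> \<noteq> 0" by (auto simp: P_def T_def)
  define k where "k = f - [:\<mu>\<^sup>2:]"
  have kL: "Lpoly k" unfolding k_def using f(1) \<mu>(1) by (intro Lpoly_diff) (auto simp: Lpoly_pCons L_power)
  have dk: "degree k = degree f" unfolding k_def using False by (simp add: diff_conv_add_uminus degree_add_eq_left)
  have lk: "lead_coeff k = 1" unfolding dk using f(2) False by (simp add: k_def coeff_pCons split: nat.split)
  obtain gs where gs: "list_all Lpoly gs" "k = (\<Sum>g\<leftarrow>gs. g * g)"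
    using nonneg_sum_of_squares[OF kL lk] a(2) \<mu>(2) by (auto simp: k_def)
  define e where "e = inverse \<mu>"
  have eL: "e \<in> L" using \<mu> by (simp add: e_def L_inverse)
  have "(\<Sum>q\<leftarrow>map (Polynomial.smult e) gs'. q * q) = Polynomial.smult (e * e) (\<Sum>q\<leftarrow>gs'. q * q)" for gs'
    by (induction gs') (auto simp: smult_add_right)
  then have "(\<Sum>q\<leftarrow>map (Polynomial.smult e) gs. q * q) = Polynomial.smult (e * e) k" using gs(2) by simp
  also have "\<dots> = - 1 + f * [:e * e:]"
  proof -
    have "e * e * \<mu>\<^sup>2 = 1" using \<mu>(3) by (simp add: e_def power2_eq_square field_simps)
    then show ?thesis unfolding k_def by (simp add: smult_diff_right one_pCons)
  qed
  finally show ?thesis using gs(1) eL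
    by (intro exI[of _ "map (Polynomial.smult e) gs"] exI[of _ "[:e * e:]"])
      (auto simp: list_all_iff Lpoly_smult Lpoly_pCons L_mult)
qed

end

sublocale maximal_nontorsion \<subseteq> rc_field L
proof unfold_locales
  show "(2::'c) \<noteq> 0" by (rule two)
  show "f j = 0" if "finite A" "\<And>i. i \<in> A \<Longrightarrow> f i \<in> L" "(\<Sum>i\<in>A. (f i)\<^sup>2) = 0" "j \<in> A" for A f and j :: nat
    using sum_squares_eq_0[OF that] .
qed (use euclidean minpoly_degree_and_sign minpoly_positive in auto)

section \<open>Dimension and signature\<close>

context lspace
begin

definition indep :: "'w set \<Rightarrow> bool" where
  "indep B \<longleftrightarrow> finite B \<and> B \<subseteq> W \<and>
     (\<forall>c. (\<forall>b\<in>B. c b \<in> L) \<and> (\<Sum>b\<in>B. s (c b) b) = 0 \<longrightarrow> (\<forall>b\<in>B. c b = 0))"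

lemma indepD:
  assumes "indep B" "\<And>b. b \<in> B \<Longrightarrow> c b \<in> L" "(\<Sum>b\<in>B. s (c b) b) = 0" "b \<in> B"
  shows "c b = 0"
  using assms unfolding indep_def by simp

lemma indep_card_le:
  assumes "gen_on L s W S" "indep B" shows "card B \<le> card S"
proof (rule ccontr)
  assume "\<not> card B \<le> card S"
  then have "card S < card B" by simp
  moreover have "\<And>x. x \<in> B \<Longrightarrow> x \<in> W" "finite B" using assms(2) by (auto simp: indep_def)
  ultimately obtain c where c: "\<forall>x. c x \<in> L" "\<exists>x\<in>B. c x \<noteq> 0" "(\<Sum>x\<in>B. s (c x) x) = 0"
    using gen_dependent[OF assms(1), of B "\<lambda>x. x"] by blast
  then have "\<forall>b\<in>B. c b = 0" using assms(2) unfolding indep_def by blast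
  then show False using c(2) by blast
qed

lemma basis_on_indep:
  assumes "basis_on L s W B" shows "indep B"
proof -
  have B: "finite B" "B \<subseteq> W" and u: "\<And>u. u \<in> W \<Longrightarrow> \<exists>!c. c \<in> B \<rightarrow>\<^sub>E L \<and> u = (\<Sum>b\<in>B. s (c b) b)"
    using assms by (auto simp: basis_on_def)
  have "\<forall>b\<in>B. c b = 0" if c: "\<forall>b\<in>B. c b \<in> L" "(\<Sum>b\<in>B. s (c b) b) = 0" for c
  proof -
    have "restrict c B \<in> B \<rightarrow>\<^sub>E L \<and> 0 = (\<Sum>b\<in>B. s (restrict c B b) b)"
      using c by (auto simp: restrict_PiE_iff)
    moreover have "restrict (\<lambda>_. 0) B \<in> B \<rightarrow>\<^sub>E L \<and> 0 = (\<Sum>b\<in>B. s (restrict (\<lambda>_. 0) B b) b)"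
      by (auto simp: restrict_PiE_iff)
    ultimately have "restrict c B = restrict (\<lambda>_. 0) B" using u[OF W_0] by blast
    then show ?thesis by (metis restrict_apply')
  qed
  then show ?thesis using B unfolding indep_def by blast
qed

lemma basis_on_gen:
  assumes "basis_on L s W B" shows "gen_on L s W B"
  unfolding gen_on_def
proof (intro conjI allI impI)
  show "finite B" "B \<subseteq> W" using assms by (auto simp: basis_on_def)
  fix U assume U: "subspace_on L s W U \<and> B \<subseteq> U"
  interpret U: lspace L s U using U subspace_lspace by blast
  show "U = W"
  proof
    show "U \<subseteq> W" using U by (auto simp: subspace_on_def)
    show "W \<subseteq> U"
    proof
      fix w assume "w \<in> W"
      then have "\<exists>!c. c \<in> B \<rightarrow>\<^sub>E L \<and> w = (\<Sum>b\<in>B. s (c b) b)"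
        using assms unfolding basis_on_def by blast
      then obtain c where "c \<in> B \<rightarrow>\<^sub>E L" "w = (\<Sum>b\<in>B. s (c b) b)"
        by (elim ex1E conjE)
      then show "w \<in> U" using U by (auto intro!: U.W_sum U.W_scale)
    qed
  qed
qed

lemma dim_on_eq: "basis_on L s W B \<Longrightarrow> dim_on L s W = card B"
  unfolding dim_on_def
  by (rule the_equality) (auto intro!: antisym indep_card_le basis_on_gen basis_on_indep)

lemma basis_exists:
  assumes bound: "\<And>B. indep B \<Longrightarrow> card B \<le> N"
  shows "\<exists>B. basis_on L s W B"
proof -
  define Q where "Q k \<longleftrightarrow> (\<exists>B. indep B \<and> card B = k)" for k
  have "Q 0" unfolding Q_def indep_def by (intro exI[of _ "{}"]) auto
  moreover have "\<forall>k. Q k \<longrightarrow> k \<le> N" using bound unfolding Q_def by blast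
  ultimately obtain k where "Q k" and max: "\<forall>k'. Q k' \<longrightarrow> k' \<le> k"
    using Nat.ex_has_greatest_nat[of Q 0 N] by blast
  then obtain B where B: "indep B" "card B = k" unfolding Q_def by blast
  then have fin: "finite B" "B \<subseteq> W" by (auto simp: indep_def)
  have ex: "\<exists>c. c \<in> B \<rightarrow>\<^sub>E L \<and> u = (\<Sum>b\<in>B. s (c b) b)" if u: "u \<in> W" for u
  proof (cases "u \<in> B")
    case True
    have "(\<Sum>b\<in>B. s (restrict (\<lambda>b. if b = u then 1 else 0) B b) b) = (\<Sum>b\<in>B. if b = u then b else 0)"
      by (intro sum.cong) auto
    then show ?thesis using True fin
      by (intro exI[of _ "restrict (\<lambda>b. if b = u then 1 else 0) B"]) (auto simp: restrict_PiE_iff)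
  next
    case False
    have "\<not> indep (insert u B)"
    proof
      assume "indep (insert u B)"
      then have "Q (card (insert u B))" unfolding Q_def by blast
      then have "card (insert u B) \<le> card B" using max B(2) by blast
      then show False using False fin by simp
    qed
    then obtain c where c: "\<forall>b\<in>insert u B. c b \<in> L" "(\<Sum>b\<in>insert u B. s (c b) b) = 0" "\<exists>b\<in>insert u B. c b \<noteq> 0"
      using fin u unfolding indep_def by blast
    have eq: "s (c u) u + (\<Sum>b\<in>B. s (c b) b) = 0" using c(2) False fin by simp
    have cu: "c u \<noteq> 0"
    proof
      assume "c u = 0"
      then have "\<forall>b\<in>B. c b = 0" using B(1) eq c(1) unfolding indep_def by simp
      then show False using c(3) \<open>c u = 0\<close> by blast
    qed
    define d where "d = restrict (\<lambda>b. - inverse (c u) * c b) B"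
    have "(\<Sum>b\<in>B. s (d b) b) = s (- inverse (c u)) (\<Sum>b\<in>B. s (c b) b)"
      unfolding scale_sum_right by (intro sum.cong) (auto simp: d_def)
    also have "(\<Sum>b\<in>B. s (c b) b) = - s (c u) u" using eq by (simp add: eq_neg_iff_add_eq_0 add.commute)
    also have "s (- inverse (c u)) (- s (c u) u) = u" using cu by simp
    finally have "u = (\<Sum>b\<in>B. s (d b) b)" by simp
    moreover have "- inverse (c u) * c b \<in> L" if "b \<in> B" for b
      using c(1) that by (intro L_mult L_minus L_inverse) auto
    then have "d \<in> B \<rightarrow>\<^sub>E L" unfolding d_def restrict_PiE_iff by blast
    ultimately show ?thesis by blast
  qed
  have uniq: "c = c'" if c: "c \<in> B \<rightarrow>\<^sub>E L" "c' \<in> B \<rightarrow>\<^sub>E L" "(\<Sum>b\<in>B. s (c b) b) = (\<Sum>b\<in>B. s (c' b) b)" for c c'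
  proof -
    have "(\<Sum>b\<in>B. s (c b - c' b) b) = 0" using c(3) by (simp add: scale_left_diff_distrib sum_subtractf)
    moreover have "c b - c' b \<in> L" if "b \<in> B" for b
      using PiE_mem[OF c(1) that] PiE_mem[OF c(2) that] by (rule L_diff)
    ultimately have "c b - c' b = 0" if "b \<in> B" for b
      using that by (intro indepD[OF B(1), of "\<lambda>b. c b - c' b"])
    then show ?thesis using c(1,2) by (intro PiE_ext[of c B "\<lambda>_. L" c']) auto
  qed
  have "basis_on L s W B" unfolding basis_on_def
  proof (intro conjI ballI fin)
    fix u assume "u \<in> W"
    then obtain c where c: "c \<in> B \<rightarrow>\<^sub>E L" "u = (\<Sum>b\<in>B. s (c b) b)" using ex by blast
    then show "\<exists>!c. c \<in> B \<rightarrow>\<^sub>E L \<and> u = (\<Sum>b\<in>B. s (c b) b)"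
      using uniq by (intro ex1I[of _ c]) auto
  qed
  then show ?thesis ..
qed

end

locale ordered_space = lspace L s W
  for L :: "'c::field set" and s :: "'c \<Rightarrow> 'w::ab_group_add \<Rightarrow> 'w" and W :: "'w set" +
  fixes T :: "'c set" and S :: "'w set"
  assumes ord: "field_ordering L T" and gen: "gen_on L s W S"
begin

text \<open>A positive definite subspace presented by \<open>k\<close> spanning vectors. If
  \<open>q 0 = 0\<close>, they are automatically independent, since nontrivial combinations have
  positive value. Such a subspace is enlarged by appending a vector.\<close>

definition posk :: "('w \<Rightarrow> 'c) \<Rightarrow> nat \<Rightarrow> bool" where
  "posk q k \<longleftrightarrow> (\<exists>v. (\<forall>i<k. v i \<in> W) \<and>
     (\<forall>c. (\<forall>i<k. c i \<in> L) \<and> (\<exists>i<k. c i \<noteq> 0) \<longrightarrow> q (\<Sum>i<k. s (c i) (v i)) \<in> T - {0}))"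

abbreviation posdims :: "('w \<Rightarrow> 'c) \<Rightarrow> nat set" where
  "posdims q \<equiv> {dim_on L s U | U. subspace_on L s W U \<and> (\<forall>x\<in>U. x \<noteq> 0 \<longrightarrow> q x \<in> T - {0})}"

lemma posdims_eq:
  assumes q0: "q 0 = 0"
  shows "posdims q = {k. posk q k}"
proof (intro equalityI subsetI)
  fix k assume "k \<in> posdims q"
  then obtain U where U: "k = dim_on L s U" "subspace_on L s W U" "\<forall>x\<in>U. x \<noteq> 0 \<longrightarrow> q x \<in> T - {0}" by blast
  interpret U: lspace L s U by (rule subspace_lspace[OF U(2)])
  have UW: "U \<subseteq> W" using U(2) by (simp add: subspace_on_def)
  have "card B \<le> card S" if "U.indep B" for B
    using that UW by (intro indep_card_le[OF gen]) (auto simp: indep_def U.indep_def)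
  then obtain B where B: "basis_on L s U B" using U.basis_exists by blast
  have Bi: "U.indep B" by (rule U.basis_on_indep[OF B])
  have fin: "finite B" "B \<subseteq> U" using Bi by (auto simp: U.indep_def)
  have k: "k = card B" using U(1) U.dim_on_eq[OF B] by simp
  obtain h where h: "bij_betw h {..<k} B" using ex_bij_betw_nat_finite[OF fin(1)] k by (auto simp: atLeast0LessThan)
  show "k \<in> {k. posk q k}"
    unfolding posk_def mem_Collect_eq
  proof (intro exI[of _ h] conjI allI impI)
    have hB: "h i \<in> B" if "i < k" for i using bij_betwE[OF h] that by simp
    then show "h i \<in> W" if "i < k" for i using that fin UW by blast
    fix c assume c: "(\<forall>i<k. c i \<in> L) \<and> (\<exists>i<k. c i \<noteq> 0)"
    define d where "d b = c (inv_into {..<k} h b)" for b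
    have dh: "d (h i) = c i" if "i < k" for i
      using h that by (simp add: d_def bij_betw_inv_into_left)
    have sum: "(\<Sum>i<k. s (c i) (h i)) = (\<Sum>b\<in>B. s (d b) b)"
      using sum.reindex_bij_betw[OF h, of "\<lambda>b. s (d b) b"] dh by simp
    have dL: "\<forall>b\<in>B. d b \<in> L" using c h dh unfolding bij_betw_def by fastforce
    have "(\<Sum>b\<in>B. s (d b) b) \<noteq> 0"
    proof
      assume "(\<Sum>b\<in>B. s (d b) b) = 0"
      then have "\<forall>b\<in>B. d b = 0" using Bi dL unfolding U.indep_def by blast
      then show False using c hB dh by metis
    qed
    moreover have "(\<Sum>b\<in>B. s (d b) b) \<in> U" using dL fin by (intro U.W_sum U.W_scale) auto
    ultimately show "q (\<Sum>i<k. s (c i) (h i)) \<in> T - {0}" using U(3) unfolding sum by blast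
  qed
next
  fix k assume "k \<in> {k. posk q k}"
  then obtain v where v: "\<And>i. i < k \<Longrightarrow> v i \<in> W"
    and pos: "\<And>c. (\<And>i. i < k \<Longrightarrow> c i \<in> L) \<Longrightarrow> (\<exists>i<k. c i \<noteq> 0) \<Longrightarrow> q (\<Sum>i<k. s (c i) (v i)) \<in> T - {0}"
    unfolding posk_def by blast
  define U where "U = {x. \<exists>c. (\<forall>i<k. c i \<in> L) \<and> x = (\<Sum>i<k. s (c i) (v i))}"
  have U: "subspace_on L s W U"
    unfolding subspace_on_def
  proof (intro conjI ballI subsetI)
    show "x \<in> W" if "x \<in> U" for x
      using that v unfolding U_def by (auto intro!: W_sum W_scale)
    show "0 \<in> U" unfolding U_def by (auto intro!: exI[of _ "\<lambda>_. 0"])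
    show "x + y \<in> U" if xy: "x \<in> U" "y \<in> U" for x y
    proof -
      obtain c d where "\<forall>i<k. c i \<in> L" "x = (\<Sum>i<k. s (c i) (v i))" "\<forall>i<k. d i \<in> L" "y = (\<Sum>i<k. s (d i) (v i))"
        using xy by (auto simp: U_def)
      then show ?thesis unfolding U_def
        by (auto intro!: exI[of _ "\<lambda>v. c v + d v"] L_add simp: scale_left_distrib sum.distrib)
    qed
    show "s a x \<in> U" if ax: "a \<in> L" "x \<in> U" for a x
    proof -
      obtain c where "\<forall>i<k. c i \<in> L" "x = (\<Sum>i<k. s (c i) (v i))"
        using ax by (auto simp: U_def)
      then show ?thesis unfolding U_def using ax
        by (auto intro!: exI[of _ "\<lambda>v. a * c v"] L_mult simp: scale_sum_right)
    qed
  qed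
  interpret U: lspace L s U by (rule subspace_lspace[OF U])
  have zero: "\<forall>i<k. c i = 0" if "\<And>i. i < k \<Longrightarrow> c i \<in> L" "(\<Sum>i<k. s (c i) (v i)) = 0" for c
    using pos[of c] that q0 by auto
  have unit: "v i = (\<Sum>j<k. s (if j = i then 1 else 0) (v j))" if "i < k" for i
  proof -
    have "(\<Sum>j<k. s (if j = i then 1 else 0) (v j)) = (\<Sum>j<k. if j = i then v j else 0)"
      by (intro sum.cong) auto
    then show ?thesis using that by simp
  qed
  have inj: "inj_on v {..<k}"
  proof (rule inj_onI, rule ccontr)
    fix i j assume ij: "i \<in> {..<k}" "j \<in> {..<k}" "v i = v j" "i \<noteq> j"
    have "(\<Sum>l<k. s ((if l = i then 1 else 0) - (if l = j then 1 else 0)) (v l)) = v i - v j"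
      using ij unit[of i] unit[of j] by (simp add: scale_left_diff_distrib sum_subtractf)
    then have "(\<Sum>l<k. s ((if l = i then 1 else 0) - (if l = j then 1 else 0)) (v l)) = 0" using ij by simp
    then have "\<forall>l<k. (if l = i then 1 else 0) - (if l = j then 1 else 0) = (0::'c)"
      by (rule zero[rotated]) (simp add: L_minus)
    then have "(if i = i then 1 else 0) - (if i = j then 1 else 0) = (0::'c)" using ij(1) by blast
    then show False using ij by simp
  qed
  let ?B = "v ` {..<k}"
  have sumB: "(\<Sum>b\<in>?B. s (c b) b) = (\<Sum>i<k. s (c (v i)) (v i))" for c
    by (simp add: sum.reindex[OF inj])
  have "basis_on L s U ?B"
    unfolding basis_on_def
  proof (intro conjI ballI)
    show "?B \<subseteq> U"
    proof
      fix x assume "x \<in> ?B"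
      then obtain i where "i < k" "x = v i" by auto
      then show "x \<in> U" unfolding U_def using unit[of i]
        by (auto intro!: exI[of _ "\<lambda>j. if j = i then 1 else 0"])
    qed
    fix u assume "u \<in> U"
    then obtain c where c: "\<forall>i<k. c i \<in> L" "u = (\<Sum>i<k. s (c i) (v i))" by (auto simp: U_def)
    define d where "d = restrict (\<lambda>b. c (inv_into {..<k} v b)) ?B"
    have dv: "d (v i) = c i" if "i < k" for i using that inj by (simp add: d_def)
    have dB: "d \<in> ?B \<rightarrow>\<^sub>E L"
    proof (rule PiE_I)
      show "d b \<in> L" if "b \<in> ?B" for b using that dv c(1) by auto
      show "d b = undefined" if "b \<notin> ?B" for b using that by (simp add: d_def)
    qed
    have "u = (\<Sum>b\<in>?B. s (d b) b)" unfolding sumB c(2) using dv by (intro sum.cong) auto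
    moreover have "e = d" if e: "e \<in> ?B \<rightarrow>\<^sub>E L" "u = (\<Sum>b\<in>?B. s (e b) b)" for e
    proof -
      have "(\<Sum>i<k. s (e (v i) - c i) (v i)) = 0"
        using trans[OF e(2)[symmetric] c(2)] unfolding sumB by (simp add: scale_left_diff_distrib sum_subtractf)
      moreover have "e (v i) - c i \<in> L" if "i < k" for i using e(1) c(1) that by (auto intro!: L_diff)
      ultimately have "\<forall>i<k. e (v i) - c i = 0" using zero[of "\<lambda>i. e (v i) - c i"] by blast
      then show ?thesis using dv by (intro PiE_ext[OF e(1) dB]) auto
    qed
    ultimately show "\<exists>!c. c \<in> ?B \<rightarrow>\<^sub>E L \<and> u = (\<Sum>b\<in>?B. s (c b) b)" using dB by (intro ex1I[of _ d]) auto
  qed auto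
  then have "dim_on L s U = k" using U.dim_on_eq card_image[OF inj] by simp
  moreover have "\<forall>x\<in>U. x \<noteq> 0 \<longrightarrow> q x \<in> T - {0}"
  proof (intro ballI impI)
    fix x assume "x \<in> U" "x \<noteq> 0"
    then obtain c where c: "\<forall>i<k. c i \<in> L" "x = (\<Sum>i<k. s (c i) (v i))" by (auto simp: U_def)
    have "\<exists>i<k. c i \<noteq> 0"
    proof (rule ccontr)
      assume "\<not> ?thesis"
      then have "x = 0" unfolding c(2) by (intro sum.neutral) auto
      then show False using \<open>x \<noteq> 0\<close> by simp
    qed
    then show "q x \<in> T - {0}" unfolding c(2) using c(1) by (intro pos) auto
  qed
  ultimately show "k \<in> posdims q" using U by blast
qed

lemma posk_bound:
  assumes "q 0 = 0" "posk q k" shows "k \<le> card S"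
proof (rule ccontr)
  assume "\<not> k \<le> card S"
  then have k: "card S < card {..<k}" by simp
  obtain v where v: "\<And>i. i < k \<Longrightarrow> v i \<in> W"
    and pos: "\<And>c. (\<And>i. i < k \<Longrightarrow> c i \<in> L) \<Longrightarrow> (\<exists>i<k. c i \<noteq> 0) \<Longrightarrow> q (\<Sum>i<k. s (c i) (v i)) \<in> T - {0}"
    using assms(2) unfolding posk_def by blast
  obtain c where "\<forall>x. c x \<in> L" "\<exists>x\<in>{..<k}. c x \<noteq> 0" "(\<Sum>x\<in>{..<k}. s (c x) (v x)) = 0"
    using gen_dependent[OF gen _ k, of v] v by auto
  then show False using pos[of c] assms(1) by auto
qed

text \<open>The \<open>Max\<close> in the signature is a true maximum: the dimensions are bounded by
  the size of a generating set, and the zero space contributes 0.\<close>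

lemma posk_Max:
  assumes "q 0 = 0"
  shows "posk q (Max (posdims q))" "\<And>k. posk q k \<Longrightarrow> k \<le> Max (posdims q)"
proof -
  note eq = posdims_eq[of q, OF assms]
  have fin: "finite {k. posk q k}"
  proof (rule finite_subset)
    show "{k. posk q k} \<subseteq> {..card S}"
      using posk_bound[of q, OF assms] by blast
  qed simp
  have "posk q 0" by (simp add: posk_def)
  then have ne: "{k. posk q k} \<noteq> {}" by blast
  show "posk q (Max (posdims q))" unfolding eq using Max_in[OF fin ne] by blast
  show "k \<le> Max (posdims q)" if "posk q k" for k
    unfolding eq by (rule Max_ge[OF fin]) (simp add: that)
qed

lemma signature_on_eq:
  "signature_on L T s W q = int (Max (posdims q)) - int (Max (posdims (\<lambda>x. - q x)))"
  by (simp add: signature_on_def)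

end

section \<open>Self-adjoint operators over a real closed field\<close>

text \<open>The pair over a real closed field, written as \<beta>(x, y) and \<beta>(x, A y).
  Linearity and self-adjointness hold on the whole type, so that identities between operators carry
  no side conditions.\<close>

locale pencil_space = rc_field L + lspace L s W
  for L :: "'c::alg_closed_field set" and s :: "'c \<Rightarrow> 'w::ab_group_add \<Rightarrow> 'w" and W :: "'w set" +
  fixes \<beta> :: "'w \<Rightarrow> 'w \<Rightarrow> 'c" and A :: "'w \<Rightarrow> 'w" and S :: "'w set"
  assumes \<beta>_sym: "\<beta> x y = \<beta> y x"
    and \<beta>_add_left: "\<beta> (x + y) z = \<beta> x z + \<beta> y z"
    and \<beta>_scale_left: "\<beta> (s a x) y = a * \<beta> x y"
    and A_add: "A (x + y) = A x + A y"
    and A_scale: "A (s a x) = s a (A x)"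
    and A_W: "x \<in> W \<Longrightarrow> A x \<in> W"
    and A_adj: "\<beta> (A x) y = \<beta> x (A y)"
    and \<beta>_L: "x \<in> W \<Longrightarrow> y \<in> W \<Longrightarrow> \<beta> x y \<in> L"
    and nondeg: "x \<in> W \<Longrightarrow> (\<And>y. y \<in> W \<Longrightarrow> \<beta> x y = 0) \<Longrightarrow> x = 0"
    and gen_W: "gen_on L s W S"
begin

sublocale ordered_space L s W T S
  by unfold_locales (rule ordering, rule gen_W)

definition sys :: "bool \<Rightarrow> 'w \<Rightarrow> 'w \<Rightarrow> 'c" where
  "sys t x y = (if t then \<beta> x (A y) else \<beta> x y)"

lemma \<beta>_form: "formspace L s W (\<lambda>_::unit. \<beta>)"
  by unfold_locales (rule \<beta>_sym, rule \<beta>_add_left, rule \<beta>_scale_left)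

sublocale \<beta>: formspace L s W "\<lambda>_::unit. \<beta>" by (rule \<beta>_form)

lemmas \<beta>_simps = \<beta>.b_simps \<beta>.b_sum_left \<beta>.b_sum_right

lemma sys_form: "formspace L s U sys" if "lspace L s U" for U
proof -
  interpret U: lspace L s U by (rule that)
  show ?thesis
  proof unfold_locales
    show "sys t x y = sys t y x" for t x y
      unfolding sys_def using \<beta>_sym[of x "A y"] A_adj[of y x] \<beta>_sym[of x y] by simp
  qed (auto simp: sys_def \<beta>_add_left \<beta>_scale_left)
qed

definition glin :: "('w \<Rightarrow> 'w) \<Rightarrow> bool" where
  "glin D \<longleftrightarrow> (\<forall>x y. D (x + y) = D x + D y) \<and> (\<forall>a x. D (s a x) = s a (D x))"

lemma glinD: assumes "glin D"
  shows "D (x + y) = D x + D y" "D (s a x) = s a (D x)" "D 0 = 0" "D (- x) = - D x" "D (x - y) = D x - D y"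
  using assms additive_facts[of D] by (auto simp: glin_def)

lemma glin_sum: assumes "glin D" shows "D (sum g I) = (\<Sum>i\<in>I. D (g i))"
  by (induction I rule: infinite_finite_induct) (auto simp: glinD[OF assms])

lemma glin_pow: assumes "glin D" shows "glin (D ^^ n)"
  by (induction n) (use assms in \<open>auto simp: glin_def\<close>)

lemma glin_A: "glin A" by (simp add: glin_def A_add A_scale)

text \<open>The operator \<open>p(A)\<close>, by Horner's scheme.\<close>

definition pT :: "'c poly \<Rightarrow> 'w \<Rightarrow> 'w" where
  "pT p = fold_coeffs (\<lambda>a f x. s a x + A (f x)) p (\<lambda>x. 0)"

lemma pT_0 [simp]: "pT 0 x = 0" by (simp add: pT_def)

lemma pT_pCons: "pT (pCons a p) x = s a x + A (pT p x)"
  by (cases "a = 0 \<and> p = 0") (auto simp: pT_def glinD[OF glin_A])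

lemma pT_1 [simp]: "pT 1 x = x"
  using pT_pCons[of 1 0 x] by (simp add: glinD[OF glin_A] one_pCons)

lemma pT_add: "pT (p + q) x = pT p x + pT q x"
  by (induction p q rule: poly_induct2) (auto simp: pT_pCons scale_left_distrib A_add)

lemma pT_smult: "pT (Polynomial.smult a p) x = s a (pT p x)"
  by (induction p) (auto simp: pT_pCons scale_right_distrib A_scale)

lemma glin_pT: "glin (pT p)"
proof (induction p)
  case (pCons a p)
  then show ?case by (auto simp: glin_def pT_pCons scale_right_distrib A_add A_scale mult.commute)
qed (simp add: glin_def)

lemma pT_comm:
  assumes "glin D" "\<And>x. D (A x) = A (D x)" shows "D (pT p x) = pT p (D x)"
  by (induction p) (auto simp: pT_pCons glinD[OF assms(1)] assms(2))

lemma pT_A: "pT p (A x) = A (pT p x)"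
  by (rule pT_comm[OF glin_A, symmetric]) simp

lemma pT_mult: "pT (p * q) x = pT p (pT q x)"
  by (induction p) (auto simp: pT_pCons pT_add pT_smult)

lemma pT_pT: "pT p (pT q x) = pT q (pT p x)"
  unfolding pT_mult[symmetric] by (simp add: mult.commute)

lemma pT_minus: "pT (- p) x = - pT p x"
  using pT_smult[of "- 1" p x] by simp

lemma pT_diff: "pT (p - q) x = pT p x - pT q x"
  using pT_add[of p "- q" x] by (simp add: pT_minus)

lemma pT_adj: "\<beta> (pT p x) y = \<beta> x (pT p y)"
  by (induction p arbitrary: x y) (auto simp: pT_pCons \<beta>_simps A_adj pT_A)

lemma pT_W: "Lpoly p \<Longrightarrow> x \<in> W \<Longrightarrow> pT p x \<in> W"
  by (induction p) (auto simp: pT_pCons Lpoly_pCons intro!: W_add W_scale A_W)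

lemma pT_monom: "pT (Polynomial.monom a n) x = s a ((A ^^ n) x)"
  by (induction n) (auto simp: monom_0 monom_Suc pT_pCons A_scale glinD[OF glin_A])

lemma pT_sum: "pT (sum g I) x = (\<Sum>i\<in>I. pT (g i) x)"
  by (induction I rule: infinite_finite_induct) (auto simp: pT_add)

lemma pT_pow: "pT (p ^ n) x = (pT p ^^ n) x"
  by (induction n) (auto simp: pT_mult)

lemma annihilator_vector:
  assumes v: "v \<in> W"
  shows "\<exists>p. Lpoly p \<and> lead_coeff p = 1 \<and> pT p v = 0"
proof -
  have pw: "(A ^^ i) v \<in> W" for i using v by (induction i) (auto intro: A_W)
  obtain c where c: "\<forall>i. c i \<in> L" "\<exists>i\<in>{..card S}. c i \<noteq> 0" "(\<Sum>i\<in>{..card S}. s (c i) ((A ^^ i) v)) = 0"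
    using gen_dependent[OF gen_W, of "{..card S}" "\<lambda>i. (A ^^ i) v"] pw by auto
  define g where "g = (\<Sum>i\<le>card S. Polynomial.monom (c i) i)"
  have co: "poly.coeff g i = (if i \<le> card S then c i else 0)" for i
    unfolding g_def by (simp add: coeff_sum)
  have g0: "g \<noteq> 0" using c(2) co by (metis atMost_iff coeff_0)
  have gL: "Lpoly g" using c(1) co by (simp add: Lpoly_def)
  have "pT g v = 0" unfolding g_def pT_sum pT_monom by (rule c(3))
  then have "pT (Polynomial.smult (inverse (lead_coeff g)) g) v = 0" by (simp add: pT_smult)
  moreover have "lead_coeff (Polynomial.smult (inverse (lead_coeff g)) g) = 1" using g0 by simp
  ultimately show ?thesis using gL by (blast intro: Lpoly_smult L_inverse lead_in_L)
qed

lemma annihilator: "\<exists>p. Lpoly p \<and> lead_coeff p = 1 \<and> (\<forall>x\<in>W. pT p x = 0)"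
proof -
  have S: "finite S" "S \<subseteq> W" using gen_W by (auto simp: gen_on_def)
  have "\<exists>p. Lpoly p \<and> lead_coeff p = 1 \<and> (\<forall>v\<in>S. pT p v = 0)"
    using S
  proof (induction S rule: finite_induct)
    case empty
    show ?case by (intro exI[of _ 1]) auto
  next
    case (insert v F)
    obtain p where p: "Lpoly p" "lead_coeff p = 1" "\<forall>v\<in>F. pT p v = 0" using insert by auto
    obtain q where q: "Lpoly q" "lead_coeff q = 1" "pT q v = 0" using annihilator_vector insert.prems by blast
    show ?case
    proof (intro exI[of _ "p * q"] conjI ballI)
      show "lead_coeff (p * q) = 1" unfolding lead_coeff_mult using p q by simp
      show "pT (p * q) w = 0" if "w \<in> insert v F" for w
      proof (cases "w = v")
        case True
        then show ?thesis using q(3) glinD(3)[OF glin_pT] by (simp add: pT_mult)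
      next
        case False
        then show ?thesis using that p(3) glinD(3)[OF glin_pT] unfolding pT_mult pT_pT[of p q] by auto
      qed
    qed (use p q Lpoly_mult in auto)
  qed
  then obtain p where p: "Lpoly p" "lead_coeff p = 1" "\<forall>v\<in>S. pT p v = 0" by blast
  have "subspace_on L s W {x\<in>W. pT p x = 0}"
    unfolding subspace_on_def using glinD[OF glin_pT[of p]] W_add W_scale by auto
  then have "{x\<in>W. pT p x = 0} = W" using gen_W p(3) S(2) unfolding gen_on_def by blast
  then show ?thesis using p by blast
qed

text \<open>
  A split part of \<open>W\<close>: the range of the projection \<open>\<pi>\<close>, together with an anti-isometry
  \<open>\<sigma>\<close> of that range commuting with \<open>A\<close>. The rest is \<open>ker \<pi>\<close>.
\<close>

definition split :: "('w \<Rightarrow> 'w) \<Rightarrow> ('w \<Rightarrow> 'w) \<Rightarrow> bool" where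
  "split \<pi> \<sigma> \<longleftrightarrow> glin \<pi> \<and> glin \<sigma> \<and> (\<forall>x\<in>W. \<pi> x \<in> W \<and> \<sigma> x \<in> W) \<and>
     (\<forall>x. \<pi> (\<pi> x) = \<pi> x \<and> \<pi> (A x) = A (\<pi> x) \<and> \<sigma> (A x) = A (\<sigma> x) \<and> \<pi> (\<sigma> x) = \<sigma> x \<and> \<sigma> (\<pi> x) = \<sigma> x) \<and>
     (\<forall>x y. \<beta> (\<pi> x) y = \<beta> x (\<pi> y) \<and> \<beta> (\<sigma> x) (\<sigma> y) = - \<beta> (\<pi> x) (\<pi> y))"

definition ker :: "('w \<Rightarrow> 'w) \<Rightarrow> 'w set" where "ker \<pi> = {x\<in>W. \<pi> x = 0}"

lemma splitD:
  assumes "split \<pi> \<sigma>"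
  shows "glin \<pi>" "glin \<sigma>" "x \<in> W \<Longrightarrow> \<pi> x \<in> W" "x \<in> W \<Longrightarrow> \<sigma> x \<in> W" "\<pi> (\<pi> x) = \<pi> x" "\<pi> (A x) = A (\<pi> x)"
    "\<sigma> (A x) = A (\<sigma> x)" "\<pi> (\<sigma> x) = \<sigma> x" "\<sigma> (\<pi> x) = \<sigma> x" "\<beta> (\<pi> x) y = \<beta> x (\<pi> y)"
    "\<beta> (\<sigma> x) (\<sigma> y) = - \<beta> (\<pi> x) (\<pi> y)"
  using assms by (auto simp: split_def)

lemma split_zero: "split (\<lambda>_. 0) (\<lambda>_. 0)"
  by (auto simp: split_def glin_def glinD[OF glin_A])

lemma ker_subspace:
  assumes "split \<pi> \<sigma>" shows "subspace_on L s W (ker \<pi>)"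
  unfolding subspace_on_def ker_def using glinD[OF splitD(1)[OF assms]] W_add W_scale by auto

lemma ker_pT:
  assumes "split \<pi> \<sigma>" "Lpoly p" "x \<in> ker \<pi>" shows "pT p x \<in> ker \<pi>"
  using assms(2,3) pT_W pT_comm[of \<pi> p x] splitD[OF assms(1)] glinD(3)[OF glin_pT] by (auto simp: ker_def)

text \<open>For a Jordan chain \<open>a\<close> of length \<open>k\<close> with anti-diagonal Gram
  matrix, \<open>a (k - 1 - i)\<close> is dual to \<open>a i\<close> up to sign. So up to sign this
  is the orthogonal projection onto the chain if \<open>b = a\<close>, and in general it carries the
  chain \<open>a\<close> to the chain \<open>b\<close>.\<close>

definition chain_map :: "nat \<Rightarrow> (nat \<Rightarrow> 'w) \<Rightarrow> (nat \<Rightarrow> 'w) \<Rightarrow> 'w \<Rightarrow> 'w" where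
  "chain_map k a b v = (\<Sum>i<k. s (\<beta> v (a (k - 1 - i))) (b i))"

lemma glin_chain_map: "glin (chain_map k a b)"
  unfolding glin_def chain_map_def
  by (auto simp: \<beta>_simps scale_left_distrib sum.distrib scale_sum_right)

lemma sum_flip: "(\<Sum>i<k. g i (k - 1 - i)) = (\<Sum>i<k. g (k - 1 - i) (i::nat))"
  by (rule sum.reindex_bij_witness[where i = "\<lambda>i. k - 1 - i" and j = "\<lambda>i. k - 1 - i"]) auto

lemma chain_map_adj: "\<beta> (chain_map k a b v) w = \<beta> v (chain_map k b a w)"
proof -
  have "\<beta> (chain_map k a b v) w = (\<Sum>i<k. \<beta> v (a (k - 1 - i)) * \<beta> (b i) w)"
    by (simp add: chain_map_def \<beta>_simps)
  also have "\<dots> = (\<Sum>i<k. \<beta> v (a i) * \<beta> (b (k - 1 - i)) w)"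
    using sum_flip[of "\<lambda>i j. \<beta> v (a j) * \<beta> (b i) w"] by simp
  also have "\<dots> = \<beta> v (chain_map k b a w)"
    by (simp add: chain_map_def \<beta>_simps \<beta>_sym[of "b _"] mult.commute)
  finally show ?thesis .
qed

lemma chain_map_W:
  assumes "v \<in> W" "\<And>i. a i \<in> W" "\<And>i. b i \<in> W" shows "chain_map k a b v \<in> W"
  unfolding chain_map_def using assms by (intro W_sum W_scale \<beta>_L)

lemma chain_map_comp:
  assumes "\<And>i j. i < k \<Longrightarrow> j < k \<Longrightarrow> \<beta> (d i) (a j) = (if i + j = k - 1 then \<epsilon> else 0)"
  shows "chain_map k a b (chain_map k c d v) = s \<epsilon> (chain_map k c b v)"
proof -
  have "\<beta> (chain_map k c d v) (a (k - 1 - i)) = \<epsilon> * \<beta> v (c (k - 1 - i))" if i: "i < k" for i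
  proof -
    have "\<beta> (chain_map k c d v) (a (k - 1 - i)) = (\<Sum>l<k. \<beta> v (c (k - 1 - l)) * \<beta> (d l) (a (k - 1 - i)))"
      by (simp add: chain_map_def \<beta>_simps)
    also have "\<dots> = (\<Sum>l<k. if l = i then \<epsilon> * \<beta> v (c (k - 1 - i)) else 0)"
      using i by (intro sum.cong) (auto simp: assms)
    finally show ?thesis using i by simp
  qed
  then show ?thesis unfolding chain_map_def by (simp add: scale_sum_right)
qed

text \<open>\<open>N\<close> shifts the chain \<open>b\<close>, and moved across \<beta> it shifts
  the chain \<open>a\<close> as well; the boundary terms vanish because both chains end at
  \<open>k\<close>.\<close>

lemma chain_map_shift:
  assumes "\<And>i. N (a i) = a (Suc i)" "\<And>i. N (b i) = b (Suc i)" "a k = 0" "b k = 0" and N: "glin N"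
    and adj: "\<And>x y. \<beta> (N x) y = \<beta> x (N y)"
  shows "chain_map k a b (N v) = N (chain_map k a b v)"
proof (cases k)
  case (Suc m)
  have "chain_map k a b (N v) = (\<Sum>i<Suc m. s (\<beta> v (a (Suc (m - i)))) (b i))"
    unfolding chain_map_def Suc by (intro sum.cong) (auto simp: adj assms)
  also have "\<dots> = s (\<beta> v (a (Suc m))) (b 0) + (\<Sum>i<m. s (\<beta> v (a (Suc (m - Suc i)))) (b (Suc i)))"
    by (simp add: sum.lessThan_Suc_shift del: sum.lessThan_Suc)
  also have "\<dots> = (\<Sum>i<m. s (\<beta> v (a (m - i))) (b (Suc i)))"
    using assms(3) Suc by (simp add: Suc_diff_Suc)
  also have "\<dots> = (\<Sum>i<Suc m. s (\<beta> v (a (m - i))) (b (Suc i)))"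
    using assms(4) Suc by simp
  also have "\<dots> = N (chain_map k a b v)"
    unfolding chain_map_def Suc glin_sum[OF N] by (intro sum.cong) (auto simp: glinD[OF N] assms)
  finally show ?thesis .
qed (simp add: chain_map_def glinD[OF N])

text \<open>Two Jordan chains of opposite sign join the split part: \<open>\<pi>1\<close> is the
  orthogonal projection onto their span, and \<open>\<sigma>1\<close> exchanges them. The last
  clause shows that the kernel really shrinks, since the end of the chain of \<open>x\<close> pairs
  to 1 with \<open>x\<close>.\<close>

lemma split_extend:
  assumes sp: "split \<pi> \<sigma>" and lam: "\<kappa> \<in> L" and k: "0 < k"
    and xy: "x \<in> ker \<pi>" "y \<in> ker \<pi>"
    and N: "N = (\<lambda>v. A v - s \<kappa> v)" and nil: "(N ^^ k) x = 0" "(N ^^ k) y = 0"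
    and xx: "\<And>i. i < k \<Longrightarrow> \<beta> x ((N ^^ i) x) = (if i = k - 1 then 1 else 0)"
    and yy: "\<And>i. i < k \<Longrightarrow> \<beta> y ((N ^^ i) y) = (if i = k - 1 then - 1 else 0)"
    and xyo: "\<And>i. \<beta> x ((N ^^ i) y) = 0"
  shows "\<exists>\<pi>' \<sigma>'. split \<pi>' \<sigma>' \<and> ker \<pi>' \<subseteq> ker \<pi> \<and> (\<forall>w\<in>ker \<pi>'. \<beta> w ((N ^^ (k - 1)) x) = 0)"
proof -
  note S = splitD[OF sp]
  have Nl: "glin N" unfolding N glin_def by (auto simp: A_add A_scale scale_right_distrib scale_right_diff_distrib mult.commute)
  have Nadj: "\<beta> (N u) v = \<beta> u (N v)" for u v unfolding N by (simp add: \<beta>_simps A_adj)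
  have Npadj: "\<beta> ((N ^^ i) u) v = \<beta> u ((N ^^ i) v)" for i u v
    by (induction i arbitrary: v) (simp_all add: Nadj, simp add: funpow_swap1)
  have NW: "(N ^^ i) v \<in> W" if "v \<in> W" for i v
    using that lam by (induction i) (auto simp: N intro!: W_diff A_W W_scale)
  have \<pi>N: "\<pi> ((N ^^ i) v) = (N ^^ i) (\<pi> v)" for i v
    by (induction i) (auto simp: N glinD[OF S(1)] S(6))
  define a b where "a i = (N ^^ i) x" and "b i = (N ^^ i) y" for i
  have aW: "a i \<in> W" and bW: "b i \<in> W" for i using xy NW by (auto simp: a_def b_def ker_def)
  have N0: "(N ^^ i) 0 = 0" for i by (rule glinD(3)[OF glin_pow[OF Nl]])
  have \<pi>a: "\<pi> (a i) = 0" and \<pi>b: "\<pi> (b i) = 0" for i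
    unfolding a_def b_def \<pi>N using xy N0 by (auto simp: ker_def)
  have big: "(N ^^ i) x = 0" "(N ^^ i) y = 0" if "k \<le> i" for i
  proof -
    have "N ^^ i = N ^^ (i - k) \<circ> N ^^ k" using that by (simp flip: funpow_add)
    then show "(N ^^ i) x = 0" "(N ^^ i) y = 0" using nil N0 by auto
  qed
  have add: "(N ^^ i) ((N ^^ j) v) = (N ^^ (i + j)) v" for i j v by (simp add: funpow_add)
  have aa: "\<beta> (a i) (a j) = (if i + j = k - 1 then 1 else 0)" for i j
    unfolding a_def Npadj add using xx[of "i + j"] big[of "i + j"] k by (cases "i + j < k") auto
  have bb: "\<beta> (b i) (b j) = (if i + j = k - 1 then - 1 else 0)" for i j
    unfolding b_def Npadj add using yy[of "i + j"] big[of "i + j"] k by (cases "i + j < k") auto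
  have ab: "\<beta> (a i) (b j) = 0" "\<beta> (b j) (a i) = 0" for i j
    using xyo[of "i + j"] \<beta>_sym[of "b j" "a i"] unfolding a_def b_def Npadj add by auto
  let ?m = "chain_map k"
  \<comment> \<open>The minus signs come from the negative Gram matrix of the chain
    \<open>b\<close>.\<close>
  define \<pi>1 where "\<pi>1 v = ?m a a v - ?m b b v" for v
  define \<sigma>1 where "\<sigma>1 v = ?m a b v - ?m b a v" for v
  note ml = glinD[OF glin_chain_map]
  have comp: "?m a u (?m v a w) = ?m v u w" "?m b u (?m v b w) = - ?m v u w"
    "?m a u (?m v b w) = 0" "?m b u (?m v a w) = 0" for u v w
    using chain_map_comp[where d = a and a = a and k = k and \<epsilon> = 1] chain_map_comp[where d = b and a = b and k = k and \<epsilon> = "- 1"]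
      chain_map_comp[where d = b and a = a and k = k and \<epsilon> = 0] chain_map_comp[where d = a and a = b and k = k and \<epsilon> = 0]
    by (auto simp: aa bb ab)
  have l1: "glin \<pi>1" "glin \<sigma>1" unfolding glin_def \<pi>1_def \<sigma>1_def by (auto simp: ml scale_right_diff_distrib)
  have W1: "\<pi>1 v \<in> W" "\<sigma>1 v \<in> W" if "v \<in> W" for v
    unfolding \<pi>1_def \<sigma>1_def using that aW bW by (auto intro!: W_diff chain_map_W)
  have p11: "\<pi>1 (\<pi>1 v) = \<pi>1 v" and s1p1: "\<sigma>1 (\<pi>1 v) = \<sigma>1 v" and p1s1: "\<pi>1 (\<sigma>1 v) = \<sigma>1 v"
    and s1s1: "\<sigma>1 (\<sigma>1 v) = \<pi>1 v" for v
    unfolding \<pi>1_def \<sigma>1_def by (simp_all add: ml comp)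
  have p1adj: "\<beta> (\<pi>1 v) w = \<beta> v (\<pi>1 w)" and s1adj: "\<beta> (\<sigma>1 v) w = - \<beta> v (\<sigma>1 w)" for v w
    unfolding \<pi>1_def \<sigma>1_def by (simp_all add: \<beta>_simps chain_map_adj)
  have shift: "?m u v (N w) = N (?m u v w)" if "u \<in> {a, b}" "v \<in> {a, b}" for u v w
    by (rule chain_map_shift) (use that nil Nl Nadj in \<open>auto simp: a_def b_def\<close>)
  have NA: "D (A v) = A (D v)" if "glin D" "\<And>w. D (N w) = N (D w)" for D v
  proof -
    have "D (A v) = D (N v) + s \<kappa> (D v)" by (simp add: N glinD[OF that(1)])
    also have "\<dots> = A (D v)" unfolding that(2) by (simp add: N)
    finally show ?thesis .
  qed
  have p1A: "\<pi>1 (A v) = A (\<pi>1 v)" and s1A: "\<sigma>1 (A v) = A (\<sigma>1 v)" for v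
    by (rule NA[OF l1(1)], simp add: \<pi>1_def shift glinD[OF Nl], rule NA[OF l1(2)], simp add: \<sigma>1_def shift glinD[OF Nl])
  have pm: "\<pi> (?m u v w) = 0" if "v \<in> {a, b}" for u v w
    unfolding chain_map_def glin_sum[OF S(1)] using that by (intro sum.neutral) (auto simp: glinD[OF S(1)] \<pi>a \<pi>b)
  have mp: "?m u v (\<pi> w) = 0" if "u \<in> {a, b}" for u v w
    unfolding chain_map_def S(10) using that by (intro sum.neutral) (auto simp: \<pi>a \<pi>b)
  have pp1: "\<pi> (\<pi>1 v) = 0" "\<pi> (\<sigma>1 v) = 0" "\<pi>1 (\<pi> v) = 0" "\<sigma>1 (\<pi> v) = 0" for v
    unfolding \<pi>1_def \<sigma>1_def by (auto simp: glinD[OF S(1)] pm mp)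
  have ss1: "\<sigma> (\<pi>1 v) = 0" "\<sigma> (\<sigma>1 v) = 0" "\<pi>1 (\<sigma> v) = 0" "\<sigma>1 (\<sigma> v) = 0" for v
    using S(9)[of "\<pi>1 v"] S(9)[of "\<sigma>1 v"] pp1(3)[of "\<sigma> v"] pp1(4)[of "\<sigma> v"] S(8)[of v]
    by (auto simp: pp1 glinD[OF S(2)])
  have cross: "\<beta> (\<sigma> v) (\<sigma>1 w) = 0" "\<beta> (\<sigma>1 v) (\<sigma> w) = 0" "\<beta> (\<pi> v) (\<pi>1 w) = 0" "\<beta> (\<pi>1 v) (\<pi> w) = 0" for v w
    using S(10)[of "\<sigma> v" "\<sigma>1 w"] S(10)[of "\<sigma> w" "\<sigma>1 v"] S(10)[of v "\<pi>1 w"] S(10)[of w "\<pi>1 v"]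
      \<beta>_sym[of "\<sigma>1 v" "\<sigma> w"] \<beta>_sym[of "\<pi>1 v" "\<pi> w"]
    by (auto simp: S(8) pp1)
  have anti1: "\<beta> (\<sigma>1 v) (\<sigma>1 w) = - \<beta> (\<pi>1 v) (\<pi>1 w)" for v w
    by (simp add: s1adj p1adj s1s1 p11)
  let ?\<pi> = "\<lambda>v. \<pi> v + \<pi>1 v" and ?\<sigma> = "\<lambda>v. \<sigma> v + \<sigma>1 v"
  have "split ?\<pi> ?\<sigma>"
    unfolding split_def
  proof (intro conjI allI ballI)
    show "glin ?\<pi>" "glin ?\<sigma>" using S(1,2) l1 unfolding glin_def by (auto simp: scale_right_distrib)
    show "?\<pi> v \<in> W" "?\<sigma> v \<in> W" if "v \<in> W" for v using that by (auto intro!: W_add S W1)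
    fix v w
    show "?\<pi> (?\<pi> v) = ?\<pi> v" "?\<pi> (?\<sigma> v) = ?\<sigma> v" "?\<sigma> (?\<pi> v) = ?\<sigma> v"
      by (simp_all add: glinD[OF S(1)] glinD[OF S(2)] glinD[OF l1(1)] glinD[OF l1(2)] S pp1 ss1 p11 s1p1 p1s1)
    show "?\<pi> (A v) = A (?\<pi> v)" "?\<sigma> (A v) = A (?\<sigma> v)" by (simp_all add: S A_add p1A s1A)
    show "\<beta> (?\<pi> v) w = \<beta> v (?\<pi> w)" by (simp add: \<beta>_simps S(10) p1adj)
    show "\<beta> (?\<sigma> v) (?\<sigma> w) = - \<beta> (?\<pi> v) (?\<pi> w)" by (simp add: \<beta>_simps cross S(11) anti1)
  qed
  moreover have sub: "\<pi> w = 0 \<and> \<pi>1 w = 0" if "w \<in> ker ?\<pi>" for w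
  proof -
    have 0: "\<pi> w + \<pi>1 w = 0" using that by (simp add: ker_def)
    then have "\<pi> (\<pi> w + \<pi>1 w) = 0" by (simp add: glinD[OF S(1)])
    then have "\<pi> w = 0" by (simp add: glinD[OF S(1)] S(5) pp1)
    then show ?thesis using 0 by simp
  qed
  then have "ker ?\<pi> \<subseteq> ker \<pi>" by (auto simp: ker_def)
  moreover have "\<beta> w (a (k - 1)) = 0" if "w \<in> ker ?\<pi>" for w
  proof -
    have "?m a a (a (k - 1)) = (\<Sum>i<k. if i = k - 1 then a i else 0)"
      unfolding chain_map_def using k by (intro sum.cong) (auto simp: aa)
    also have "\<dots> = a (k - 1)" using k by simp
    finally have "\<pi>1 (a (k - 1)) = a (k - 1)" by (simp add: \<pi>1_def chain_map_def[of k b] ab)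
    then show ?thesis using p1adj[of w "a (k - 1)"] sub[OF that] by simp
  qed
  ultimately show ?thesis unfolding a_def by blast
qed

end

section \<open>Vanishing signatures and the cancellation of Jordan chains\<close>

context pencil_space
begin

text \<open>For a basis \<open>v i\<close> of a maximal negative definite space, the vectors
  \<open>\<sigma> (v i)\<close> and \<open>w\<close> span a positive definite space of one dimension
  more: the value at \<open>\<sigma> x + c w\<close> is
  \<open>- q x + q (x - \<pi> x) + c^2 q w\<close>, where the last two terms are
  nonnegative.\<close>

lemma signature_nonzero:
  assumes sp: "split \<pi> \<sigma>" and p: "Lpoly p"
    and nn: "\<And>w. w \<in> ker \<pi> \<Longrightarrow> \<beta> w (pT p w) \<in> T"
    and w: "w \<in> ker \<pi>" "\<beta> w (pT p w) \<noteq> 0"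
  shows "signature_on L T s W (\<lambda>x. \<beta> x (pT p x)) \<noteq> 0"
proof -
  note S = splitD[OF sp]
  define q where "q x = \<beta> x (pT p x)" for x
  have q0: "q 0 = 0" "(\<lambda>x. - q x) 0 = 0" by (simp_all add: q_def)
  define m where "m = Max (posdims (\<lambda>x. - q x))"
  have "posk (\<lambda>x. - q x) m" unfolding m_def by (rule posk_Max(1)[where q = "\<lambda>x. - q x", OF q0(2)])
  then obtain v where v: "\<And>i. i < m \<Longrightarrow> v i \<in> W"
    and neg: "\<And>c. (\<And>i. i < m \<Longrightarrow> c i \<in> L) \<Longrightarrow> (\<exists>i<m. c i \<noteq> 0) \<Longrightarrow> - q (\<Sum>i<m. s (c i) (v i)) \<in> T - {0}"
    unfolding posk_def by blast
  have wW: "w \<in> W" "\<pi> w = 0" using w by (auto simp: ker_def)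
  define u where "u i = (if i < m then \<sigma> (v i) else w)" for i
  have "posk q (Suc m)"
    unfolding posk_def
  proof (intro exI[of _ u] conjI allI impI)
    show "u i \<in> W" for i using v S(4) wW by (auto simp: u_def)
    fix c assume c: "(\<forall>i<Suc m. c i \<in> L) \<and> (\<exists>i<Suc m. c i \<noteq> 0)"
    define x where "x = (\<Sum>i<m. s (c i) (v i))"
    have xW: "x \<in> W" unfolding x_def using c v by (intro W_sum W_scale) auto
    have "(\<Sum>i<Suc m. s (c i) (u i)) = \<sigma> x + s (c m) w"
      by (simp add: x_def glin_sum[OF S(2)] glinD[OF S(2)] u_def)
    moreover have "q (\<sigma> x + s (c m) w) = q (\<sigma> x) + c m * c m * q w"
    proof -
      have "pT p (\<sigma> x) = \<pi> (pT p (\<sigma> x))" using pT_comm[OF S(1) S(6), of p "\<sigma> x"] S(8) by simp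
      then have "\<beta> w (pT p (\<sigma> x)) = 0" using S(10)[of w "pT p (\<sigma> x)"] wW by simp
      then have "\<beta> w (pT p (\<sigma> x)) = 0" "\<beta> (\<sigma> x) (pT p w) = 0"
        using pT_adj[of p w "\<sigma> x"] \<beta>_sym by auto
      then show ?thesis by (simp add: q_def \<beta>_simps glinD[OF glin_pT] mult_ac)
    qed
    moreover have "q (\<sigma> x) = - q (\<pi> x)"
      unfolding q_def pT_comm[OF S(2) S(7), symmetric] pT_comm[OF S(1) S(6), symmetric] S(11) ..
    moreover have "q x = q (\<pi> x) + q (x - \<pi> x)"
    proof -
      have "\<beta> (\<pi> x) (pT p (x - \<pi> x)) = \<beta> x (pT p (\<pi> x - \<pi> (\<pi> x)))"
        unfolding S(10) pT_comm[OF S(1) S(6)] by (simp add: glinD[OF S(1)])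
      then have 1: "\<beta> (\<pi> x) (pT p (x - \<pi> x)) = 0" using S(5) glinD(3)[OF glin_pT] by simp
      then have 2: "\<beta> (x - \<pi> x) (pT p (\<pi> x)) = 0" using pT_adj \<beta>_sym by metis
      have "q x = q (\<pi> x + (x - \<pi> x))" by simp
      also have "\<dots> = q (\<pi> x) + q (x - \<pi> x)"
        unfolding q_def glinD(1)[OF glin_pT] \<beta>.b_add_left \<beta>.b_add_right 1 2 by simp
      finally show ?thesis .
    qed
    ultimately have eq: "q (\<Sum>i<Suc m. s (c i) (u i)) = (q (x - \<pi> x) + - q x) + c m * c m * q w"
      by simp
    have "x - \<pi> x \<in> ker \<pi>" using xW S(3,5) by (auto simp: ker_def glinD[OF S(1)] intro: W_diff)
    then have t1: "q (x - \<pi> x) \<in> T" unfolding q_def by (rule nn)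
    have t2: "c m * c m * q w \<in> T" using c nn[OF w(1)] by (auto simp: q_def intro: T_mult T_sq')
    have "(q (x - \<pi> x) + - q x) + c m * c m * q w \<in> P"
    proof (cases "\<exists>i<m. c i \<noteq> 0")
      case True
      then have "- q x \<in> P" unfolding x_def P_def using c by (intro neg) auto
      then show ?thesis using T_add_P[OF t1] P_add_T[OF _ t2] by blast
    next
      case False
      then have "x = 0" unfolding x_def by (intro sum.neutral) auto
      moreover have "c m \<noteq> 0" using False c by (metis less_Suc_eq)
      then have "c m * c m \<in> P" using c by (auto simp: P_def T_sq')
      moreover have "q w \<in> P" using nn[OF w(1)] w(2) by (auto simp: P_def q_def)
      ultimately show ?thesis using q0 glinD(3)[OF S(1)] by (simp add: P_mult)
    qed
    then show "q (\<Sum>i<Suc m. s (c i) (u i)) \<in> T - {0}" unfolding eq P_def .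
  qed
  then have "Suc m \<le> Max (posdims q)" by (rule posk_Max(2)[where q = q, OF q0(1)])
  then show ?thesis unfolding q_def[symmetric] signature_on_eq m_def by linarith
qed

text \<open>Scaling by a square root in \<open>L\<close> makes the top moment equal to \<epsilon>.
  The lower moments are removed from the top down by subtracting multiples of
  \<open>(N ^^ Suc j) x\<close>, which leave the higher ones unchanged.\<close>

lemma chain_normalize:
  assumes k: "0 < k" and Nl: "glin N" and Nadj: "\<And>u v. \<beta> (N u) v = \<beta> u (N v)"
    and Y: "Y \<subseteq> W" "\<And>y. y \<in> Y \<Longrightarrow> N y \<in> Y" "\<And>y z. y \<in> Y \<Longrightarrow> z \<in> Y \<Longrightarrow> y + z \<in> Y" "\<And>a y. a \<in> L \<Longrightarrow> y \<in> Y \<Longrightarrow> s a y \<in> Y"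
    and nil: "\<And>y. y \<in> Y \<Longrightarrow> (N ^^ k) y = 0"
    and x: "x \<in> Y" "\<beta> x ((N ^^ (k - 1)) x) \<in> P \<and> \<epsilon> = 1 \<or> - \<beta> x ((N ^^ (k - 1)) x) \<in> P \<and> \<epsilon> = - 1"
  shows "\<exists>x'\<in>Y. \<forall>i<k. \<beta> x' ((N ^^ i) x') = (if i = k - 1 then \<epsilon> else 0)"
proof -
  note Np = glinD[OF glin_pow[OF Nl]]
  have \<epsilon>\<epsilon>: "\<epsilon> * \<epsilon> = 1" and \<epsilon>L: "\<epsilon> \<in> L" using x(2) L_minus[OF L_1] by auto
  have Npadj: "\<beta> ((N ^^ i) u) v = \<beta> u ((N ^^ i) v)" for i u v
    by (induction i arbitrary: v) (simp_all add: Nadj, simp add: funpow_swap1)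
  have add: "(N ^^ i) ((N ^^ j) v) = (N ^^ (i + j)) v" for i j v by (simp add: funpow_add)
  have NY: "(N ^^ i) y \<in> Y" if "y \<in> Y" for i y using that by (induction i) (auto intro: Y)
  have big: "(N ^^ i) y = 0" if "y \<in> Y" "k \<le> i" for i y
  proof -
    have "N ^^ i = N ^^ (i - k) \<circ> N ^^ k" using that by (simp flip: funpow_add)
    then show ?thesis using nil[OF that(1)] Np by auto
  qed
  \<comment> \<open>At stage \<open>j\<close> all moments of index at least \<open>k - 1 - j\<close>
    vanish, except the top one.\<close>
  have ex: "\<exists>x\<in>Y. \<beta> x ((N ^^ (k - 1)) x) = \<epsilon> \<and> (\<forall>i. k - 1 \<le> i + j \<and> i < k - 1 \<longrightarrow> \<beta> x ((N ^^ i) x) = 0)" for j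
  proof (induction j)
    case 0
    obtain c where c: "c \<in> L" "c \<noteq> 0" "\<beta> x ((N ^^ (k - 1)) x) = \<epsilon> * c\<^sup>2"
    proof -
      have "\<epsilon> * \<beta> x ((N ^^ (k - 1)) x) \<in> P" using x(2) by auto
      then have "\<epsilon> * \<beta> x ((N ^^ (k - 1)) x) \<in> T" and nz: "\<epsilon> * \<beta> x ((N ^^ (k - 1)) x) \<noteq> 0"
        by (rule P_T, rule P_0)
      then obtain c where c: "c \<in> L" "\<epsilon> * \<beta> x ((N ^^ (k - 1)) x) = c\<^sup>2" unfolding T_def by blast
      have "\<beta> x ((N ^^ (k - 1)) x) = \<epsilon> * c\<^sup>2" unfolding c(2)[symmetric] using \<epsilon>\<epsilon> by (simp flip: mult.assoc)
      then show thesis using that[of c] c nz by auto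
    qed
    let ?x = "s (inverse c) x"
    have "\<beta> ?x ((N ^^ (k - 1)) ?x) = inverse c * (inverse c * (\<epsilon> * c\<^sup>2))"
      using c(3) by (simp add: \<beta>_simps Np)
    also have "\<dots> = \<epsilon>" using c(2) by (simp add: power2_eq_square field_simps)
    finally show ?case using x(1) c(1) by (intro bexI[of _ ?x]) (auto intro: Y L_inverse)
  next
    case (Suc j)
    then obtain x where x: "x \<in> Y" "\<beta> x ((N ^^ (k - 1)) x) = \<epsilon>"
      "\<And>i. k - 1 \<le> i + j \<Longrightarrow> i < k - 1 \<Longrightarrow> \<beta> x ((N ^^ i) x) = 0" by blast
    show ?case
    proof (cases "Suc j \<le> k - 1")
      case False
      then have "k - 1 \<le> i + j" for i by simp
      then show ?thesis using x by blast
    next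
      case True
      define l where "l = k - 1 - Suc j"
      have l: "l + Suc j = k - 1" using True by (simp add: l_def)
      \<comment> \<open>The correction changes the moment of index \<open>l\<close> by
        \<open>- 2 * e * \<epsilon>\<close>, and \<epsilon> is its own inverse.\<close>
      define e where "e = inverse 2 * \<epsilon> * \<beta> x ((N ^^ l) x)"
      have eL: "e \<in> L" unfolding e_def using x(1) NY Y(1) \<epsilon>L
        by (intro L_mult L_inverse L_numeral \<beta>_L) auto
      have 2: "2 * e * \<epsilon> = \<beta> x ((N ^^ l) x)"
      proof -
        have "2 * e * \<epsilon> = (2 * inverse 2) * (\<epsilon> * \<epsilon>) * \<beta> x ((N ^^ l) x)" by (simp add: e_def mult_ac)
        then show ?thesis using two \<epsilon>\<epsilon> by simp
      qed
      define x' where "x' = x - s e ((N ^^ Suc j) x)"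
      have x'Y: "x' \<in> Y"
        using Y(3)[OF x(1) Y(4)[OF L_minus[OF eL] NY[OF x(1), of "Suc j"]]] by (simp add: x'_def)
      have mom: "\<beta> x' ((N ^^ i) x') = \<beta> x ((N ^^ i) x) - 2 * e * \<beta> x ((N ^^ (i + Suc j)) x)
        + e * e * \<beta> x ((N ^^ (i + Suc j + Suc j)) x)" for i
        unfolding x'_def by (simp add: \<beta>_simps Np Npadj add algebra_simps del: funpow.simps)
      have z: "\<beta> x ((N ^^ i) x) = 0" if "k \<le> i" for i using big[OF x(1) that] by simp
      have "\<beta> x' ((N ^^ (k - 1)) x') = \<epsilon>"
        unfolding mom x(2) using z[of "k - 1 + Suc j"] z[of "k - 1 + Suc j + Suc j"] k by simp
      moreover have "\<beta> x' ((N ^^ i) x') = 0" if i: "k - 1 \<le> i + Suc j" "i < k - 1" for i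
      proof (cases "i = l")
        case True
        have "k \<le> i + Suc j + Suc j" using i by linarith
        then show ?thesis unfolding mom True l x(2) using 2 z[of "k - 1 + Suc j"] l True by simp
      next
        case False
        then have "k \<le> i + Suc j" "k - 1 \<le> i + j" using i l by linarith+
        then show ?thesis
            unfolding mom using z[of "i + Suc j"] z[of "i + Suc j + Suc j"] x(3)[of i] i by simp
      qed
      ultimately show ?thesis using x'Y by blast
    qed
  qed
  obtain x where "x \<in> Y" "\<beta> x ((N ^^ (k - 1)) x) = \<epsilon>" "\<And>i. i < k - 1 \<Longrightarrow> \<beta> x ((N ^^ i) x) = 0"
    using ex[of k] by auto
  then show ?thesis using k by (intro bexI[of _ x]) (auto simp: less_Suc_eq_le)
qed

text \<open>For a root \<kappa> of order \<open>k\<close> put \<open>p = f / (X - \<kappa>)\<close>.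
  As \<open>f\<close> has least degree, \<beta>(x, p(A) x) is not zero on the kernel, and as its
  signature vanishes it takes both signs there. On the \<kappa>-primary part it is a nonzero
  multiple of the form \<open>\<beta> x ((N ^^ (k - 1)) x)\<close> with
  \<open>N = A - \<kappa>\<close>. Vectors of both signs generate two chains that can be split off,
  against the minimality of \<open>ker \<pi>\<close>.\<close>

lemma minimal_rootless:
  assumes sig: "\<And>p. Lpoly p \<Longrightarrow> signature_on L T s W (\<lambda>x. \<beta> x (pT p x)) = 0"
    and sp: "split \<pi> \<sigma>"
    and minimal: "\<And>\<pi>' \<sigma>' x z. split \<pi>' \<sigma>' \<Longrightarrow> ker \<pi>' \<subseteq> ker \<pi> \<Longrightarrow> x \<in> ker \<pi> \<Longrightarrow>
      (\<forall>w\<in>ker \<pi>'. \<beta> w z = 0) \<Longrightarrow> \<beta> x z = 0"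
    and f: "Lpoly f" "lead_coeff f = 1" "\<And>x. x \<in> ker \<pi> \<Longrightarrow> pT f x = 0"
    and least: "\<And>g. Lpoly g \<Longrightarrow> g \<noteq> 0 \<Longrightarrow> (\<And>x. x \<in> ker \<pi> \<Longrightarrow> pT g x = 0) \<Longrightarrow> degree f \<le> degree g"
    and \<kappa>: "\<kappa> \<in> L"
  shows "poly f \<kappa> \<noteq> 0"
proof
  assume root: "poly f \<kappa> = 0"
  note S = splitD[OF sp]
  have f0: "f \<noteq> 0" using f(2) by auto
  let ?l = "[:- \<kappa>, 1:]"
  have lL: "Lpoly ?l" using \<kappa> by (simp add: Lpoly_pCons L_minus)
  define k where "k = order \<kappa> f"
  have k: "0 < k" using root f0 order_root[of f \<kappa>] by (simp add: k_def)
  obtain g where g: "f = ?l ^ k * g" "\<not> ?l dvd g" using order_decomp[OF f0, of \<kappa>] unfolding k_def by blast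
  have "Lpoly (?l ^ k * g)" using f(1) by (simp only: g(1)[symmetric])
  then have gL: "Lpoly g" by (rule Lpoly_cofactor) (use lL Lpoly_power in auto)
  define g0 where "g0 = poly g \<kappa>"
  have g0: "g0 \<noteq> 0" "g0 \<in> L" using g(2) gL \<kappa> by (auto simp: g0_def poly_eq_0_iff_dvd intro: poly_in_L)
  have gne: "g \<noteq> 0" using g(2) by auto
  define p where "p = ?l ^ (k - 1) * g"
  have pL: "Lpoly p" unfolding p_def using lL gL by (intro Lpoly_mult Lpoly_power)
  have fp: "f = ?l * p" unfolding p_def g(1) using k by (cases k) (simp_all del: mult_pCons_left)
  have p0: "p \<noteq> 0" using f0 fp by auto
  have "degree f = Suc (degree p)" unfolding fp using p0 by (subst degree_mult_eq) auto
  then obtain w where w: "w \<in> ker \<pi>" "pT p w \<noteq> 0" using least[OF pL p0] by fastforce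
  have kerW: "x \<in> ker \<pi> \<Longrightarrow> x \<in> W" and ker0: "x \<in> ker \<pi> \<Longrightarrow> \<pi> x = 0" for x by (auto simp: ker_def)
  interpret K: lspace L s "ker \<pi>" by (rule subspace_lspace[OF ker_subspace[OF sp]])
  define q where "q x = \<beta> x (pT p x)" for x
  have kpT: "pT h x \<in> ker \<pi>" if "Lpoly h" "x \<in> ker \<pi>" for h x by (rule ker_pT[OF sp that])
  have qL: "q x \<in> L" if "x \<in> ker \<pi>" for x unfolding q_def by (intro \<beta>_L kerW kpT pL that)
  \<comment> \<open>If \<open>q\<close> vanished on the kernel, polarisation and nondegeneracy of
    \<beta> would give \<open>pT p w = 0\<close>.\<close>
  have "\<exists>z\<in>ker \<pi>. q z \<noteq> 0"
  proof (rule ccontr)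
    assume "\<not> ?thesis"
    then have q0: "q z = 0" if "z \<in> ker \<pi>" for z using that by blast
    have "\<beta> y (pT p w) = 0" if y: "y \<in> W" for y
    proof -
      define y1 where "y1 = y - \<pi> y"
      have y1: "y1 \<in> ker \<pi>" using y S(3,5) by (auto simp: y1_def ker_def glinD[OF S(1)] intro: W_diff)
      have "\<beta> (\<pi> y) (pT p w) = 0" unfolding S(10) using ker0[OF kpT[OF pL w(1)]] by simp
      then have "\<beta> y (pT p w) = \<beta> y1 (pT p w)" by (simp add: y1_def \<beta>_simps)
      moreover have "q (y1 + w) = q y1 + q w + 2 * \<beta> y1 (pT p w)"
        unfolding q_def using pT_adj[of p w y1] \<beta>_sym[of "pT p w" y1]
        by (simp add: \<beta>_simps glinD[OF glin_pT])
      then have "2 * \<beta> y1 (pT p w) = 0" using q0 y1 w(1) K.W_add by simp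
      ultimately show ?thesis using two by simp
    qed
    then have "pT p w = 0" using nondeg[of "pT p w"] kerW[OF kpT[OF pL w(1)]] \<beta>_sym by metis
    then show False using w(2) by simp
  qed
  then obtain z where z: "z \<in> ker \<pi>" "q z \<noteq> 0" by blast
  \<comment> \<open>A nonzero semidefinite form on the kernel is excluded by
    \<open>signature_nonzero\<close>, applied to \<open>p\<close> here and to \<open>- p\<close>
    afterwards.\<close>
  have "\<exists>x\<in>ker \<pi>. q x \<notin> T"
  proof (rule ccontr)
    assume "\<not> ?thesis"
    then have "signature_on L T s W (\<lambda>x. \<beta> x (pT p x)) \<noteq> 0"
      using z by (intro signature_nonzero[OF sp pL _ z(1)]) (auto simp: q_def)
    then show False using sig[OF pL] by simp
  qed
  then obtain x where x: "x \<in> ker \<pi>" "- q x \<in> P" using not_T qL by blast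
  have "\<exists>y\<in>ker \<pi>. - q y \<notin> T"
  proof (rule ccontr)
    assume "\<not> ?thesis"
    then have "signature_on L T s W (\<lambda>x. \<beta> x (pT (- p) x)) \<noteq> 0"
      using z by (intro signature_nonzero[OF sp Lpoly_minus[OF pL] _ z(1)]) (auto simp: q_def pT_minus \<beta>_simps)
    then show False using sig[OF Lpoly_minus[OF pL]] by simp
  qed
  then obtain y where y: "y \<in> ker \<pi>" "q y \<in> P" using not_T[of "- q _"] qL L_minus by fastforce
  define N where "N = (\<lambda>v. A v - s \<kappa> v)"
  have Nl: "glin N" unfolding N_def glin_def by (auto simp: A_add A_scale scale_right_distrib scale_right_diff_distrib mult.commute)
  have Nadj: "\<beta> (N u) v = \<beta> u (N v)" for u v unfolding N_def by (simp add: \<beta>_simps A_adj)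
  have Npadj: "\<beta> ((N ^^ i) u) v = \<beta> u ((N ^^ i) v)" for i u v
    by (induction i arbitrary: v) (simp_all add: Nadj, simp add: funpow_swap1)
  have Nadd: "(N ^^ i) ((N ^^ j) v) = (N ^^ (i + j)) v" for i j v by (simp add: funpow_add)
  note Np = glinD[OF glin_pow[OF Nl]]
  have lN: "pT ?l v = N v" for v by (simp add: N_def pT_pCons glinD[OF glin_A])
  then have "pT ?l = N" by (intro ext)
  then have lNk: "pT (?l ^ i) v = (N ^^ i) v" for i v by (simp add: pT_pow)
  have fdvd: "pT (f * h) v = 0" if "v \<in> ker \<pi>" for h v
    using f(3)[OF that] glinD(3)[OF glin_pT] by (simp add: pT_mult pT_pT[of f h])
  \<comment> \<open>\<open>e\<close> is a multiple of \<open>g\<close> congruent to \<open>1\<close> modulo \<open>(X - \<kappa>)\<^sup>k\<close>: it projects onto the \<open>\<kappa>\<close>-primary part\<close>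
  define y0 where "y0 = 1 - Polynomial.smult (inverse g0) g"
  have y0L: "Lpoly y0" unfolding y0_def using gL g0 by (intro Lpoly_diff Lpoly_smult L_inverse) auto
  have "poly y0 \<kappa> = 0" using g0 by (simp add: y0_def g0_def)
  then have "?l dvd y0" by (simp only: poly_eq_0_iff_dvd)
  then obtain h where h: "y0 = ?l * h" by (rule dvdE)
  define e where "e = 1 - y0 ^ k"
  have eL: "Lpoly e" unfolding e_def using y0L by (intro Lpoly_diff Lpoly_power) auto
  have "1 - y0 dvd 1 - y0 ^ k" unfolding one_diff_power_eq by simp
  then have "Polynomial.smult (inverse g0) g dvd e" by (simp add: e_def y0_def)
  then obtain u where u: "e = g * u" by (metis dvd_def mult_smult_left mult_smult_right)
  define prj where "prj v = pT e v" for v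
  have prjK: "prj v \<in> ker \<pi>" if "v \<in> ker \<pi>" for v unfolding prj_def by (rule kpT[OF eL that])
  have prj_nil: "(N ^^ k) (prj v) = 0" if "v \<in> ker \<pi>" for v
  proof -
    have "(N ^^ k) (prj v) = pT (f * u) v" unfolding prj_def lNk[symmetric] pT_mult[symmetric] u g(1) by (simp only: mult.assoc)
    then show ?thesis using fdvd[OF that] by simp
  qed
  have pe: "pT p (pT e v) = pT p v" if "v \<in> ker \<pi>" for v
  proof -
    have "y0 ^ k = ?l * (?l ^ (k - 1) * h ^ k)"
      unfolding h power_mult_distrib using k by (cases k) (simp_all only: diff_Suc_1 power_Suc mult.assoc)
    then have "p * e = p - f * (?l ^ (k - 1) * h ^ k)"
      unfolding e_def fp by (simp only: right_diff_distrib mult_1_right mult_1_left mult_ac)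
    then have "pT (p * e) v = pT p v" using fdvd[OF that] by (simp add: pT_diff)
    then show ?thesis by (simp add: pT_mult)
  qed
  \<comment> \<open>\<open>g\<close> is congruent to its value \<open>g0\<close> at \<kappa> modulo
    \<open>X - \<kappa>\<close>, and the error term carries the factor
    \<open>(X - \<kappa>)^k\<close>, which kills \<open>v\<close>.\<close>
  have pg: "pT p v = s g0 ((N ^^ (k - 1)) v)" if v: "(N ^^ k) v = 0" for v
  proof -
    have "poly (g - [:g0:]) \<kappa> = 0" by (simp add: g0_def)
    then have "?l dvd g - [:g0:]" by (simp only: poly_eq_0_iff_dvd)
    then obtain r where r: "g - [:g0:] = ?l * r" by (rule dvdE)
    have "g = r * ?l + [:g0:]" using r by (simp only: mult.commute diff_eq_eq)
    then have "p = r * ?l ^ k + Polynomial.smult g0 (?l ^ (k - 1))"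
    proof -
      have "?l ^ k = ?l ^ (k - 1) * ?l" using k by (cases k) (simp_all only: diff_Suc_1 power_Suc2)
      moreover have "?l ^ (k - 1) * [:g0:] = Polynomial.smult g0 (?l ^ (k - 1))"
        by (simp add: mult.commute[of "?l ^ (k - 1)"])
      ultimately show ?thesis unfolding p_def \<open>g = _\<close> distrib_left by (simp only: mult_ac)
    qed
    then have "pT p v = pT r ((N ^^ k) v) + s g0 ((N ^^ (k - 1)) v)"
      by (simp only: pT_add pT_mult pT_smult lNk)
    then show ?thesis using v glinD(3)[OF glin_pT] by simp
  qed
  have qprj: "q v = g0 * \<beta> (prj v) ((N ^^ (k - 1)) (prj v))" if v: "v \<in> ker \<pi>" for v
  proof -
    have "q v = \<beta> v (pT p (prj (prj v)))" unfolding q_def prj_def using pe[OF v] pe[OF kpT[OF eL v]] by simp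
    also have "\<dots> = \<beta> (prj v) (pT p (prj v))" unfolding prj_def pT_pT[of p e "pT e v"] pT_adj[of e v] ..
    also have "\<dots> = g0 * \<beta> (prj v) ((N ^^ (k - 1)) (prj v))" unfolding pg[OF prj_nil[OF v]] by (simp add: \<beta>_simps)
    finally show ?thesis .
  qed
  define Z where "Z = {v \<in> ker \<pi>. (N ^^ k) v = 0}"
  define b0 where "b0 v = \<beta> v ((N ^^ (k - 1)) v)" for v
  have prjZ: "prj v \<in> Z" if "v \<in> ker \<pi>" for v using prjK prj_nil that by (simp add: Z_def)
  have qb: "q v = g0 * b0 (prj v)" if "v \<in> ker \<pi>" for v using qprj[OF that] by (simp add: b0_def)
  have div: "b0 v \<in> P" if "g0 * b0 v \<in> P" "g0 \<in> P" for v
    using P_mult[OF P_inverse[OF that(2)] that(1)] g0 by (simp flip: mult.assoc)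
  \<comment> \<open>Division by a negative \<open>g0\<close> exchanges the roles of \<open>x\<close>
    and \<open>y\<close>.\<close>
  have "\<exists>x1\<in>Z. \<exists>y1\<in>Z. b0 x1 \<in> P \<and> - b0 y1 \<in> P"
  proof (cases "g0 \<in> P")
    case True
    have "b0 (prj y) \<in> P" using y qb[OF y(1)] div True by simp
    moreover have "inverse g0 * (- q x) \<in> P" by (intro P_mult P_inverse True x)
    then have "- b0 (prj x) \<in> P" using qb[OF x(1)] g0 by (simp flip: mult.assoc)
    ultimately show ?thesis using prjZ x y by blast
  next
    case False
    then have g0P: "- g0 \<in> P" using P_cases[OF g0(2,1)] by blast
    have "inverse (- g0) * (- q x) \<in> P" by (intro P_mult P_inverse g0P x)
    then have "b0 (prj x) \<in> P" using qb[OF x(1)] g0 by (simp flip: mult.assoc)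
    moreover have "inverse (- g0) * q y \<in> P" by (intro P_mult P_inverse g0P y)
    then have "- b0 (prj y) \<in> P" using qb[OF y(1)] g0 by (simp flip: mult.assoc)
    ultimately show ?thesis using prjZ x y by blast
  qed
  then obtain x1 y1 where x1: "x1 \<in> Z" "b0 x1 \<in> P" and y1: "y1 \<in> Z" "- b0 y1 \<in> P" by blast
  have NK: "N v \<in> ker \<pi>" if "v \<in> ker \<pi>" for v using kpT[OF lL that] lN by simp
  have Z: "Z \<subseteq> W" "\<And>v. v \<in> Z \<Longrightarrow> N v \<in> Z" "\<And>v w. v \<in> Z \<Longrightarrow> w \<in> Z \<Longrightarrow> v + w \<in> Z" "\<And>a v. a \<in> L \<Longrightarrow> v \<in> Z \<Longrightarrow> s a v \<in> Z"
    "\<And>v. v \<in> Z \<Longrightarrow> (N ^^ k) v = 0"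
    using kerW NK Np K.W_add K.W_scale by (auto simp: Z_def funpow_swap1[symmetric] glinD[OF Nl])
  obtain x2 where x2: "x2 \<in> Z" "\<forall>i<k. \<beta> x2 ((N ^^ i) x2) = (if i = k - 1 then 1 else 0)"
    using chain_normalize[OF k Nl Nadj Z x1(1), of 1] x1(2) by (auto simp: b0_def)
  have NZ: "(N ^^ i) v \<in> Z" if "v \<in> Z" for i v using that by (induction i) (auto intro: Z)
  have x2m: "\<beta> x2 ((N ^^ i) x2) = (if i = k - 1 then 1 else 0)" for i
  proof (cases "i < k")
    case False
    then have "N ^^ i = N ^^ (i - k) \<circ> N ^^ k" by (simp flip: funpow_add)
    then show ?thesis using Z(5)[OF x2(1)] Np False k by simp
  qed (use x2 in auto)
  define a where "a i = (N ^^ i) x2" for i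
  have aa: "\<beta> (a i) (a j) = (if i + j = k - 1 then 1 else 0)" for i j
    unfolding a_def Npadj Nadd by (rule x2m)
  \<comment> \<open>Gram-Schmidt: the component of \<open>y1\<close> along the chain of
    \<open>x2\<close> is removed.\<close>
  define y2 where "y2 = y1 - chain_map k a a y1"
  define Z' where "Z' = {v \<in> Z. \<forall>i. \<beta> (a i) v = 0}"
  have y2Z: "y2 \<in> Z"
  proof -
    have "chain_map k a a y1 \<in> Z"
    proof -
      have summand: "s (\<beta> y1 (a (k - 1 - i))) (a i) \<in> Z" for i
        unfolding a_def using NZ[OF x2(1)] y1(1) Z(1) by (intro Z(4) \<beta>_L) auto
      have "0 \<in> Z" using Np K.W_0 by (simp add: Z_def)
      then have sumZ: "(\<Sum>i<n. h i) \<in> Z" if "\<And>i. h i \<in> Z" for h and n :: nat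
        using that Z(3) by (induction n) auto
      show ?thesis unfolding chain_map_def by (rule sumZ) (rule summand)
    qed
    then show ?thesis using Z(3)[OF y1(1) Z(4)[OF L_minus[OF L_1]]] by (simp add: y2_def)
  qed
  have ay2: "\<beta> (a j) y2 = 0" for j
  proof (cases "j < k")
    case True
    have "\<beta> (chain_map k a a y1) (a j) = (\<Sum>i<k. \<beta> y1 (a (k - 1 - i)) * \<beta> (a i) (a j))"
      by (simp add: chain_map_def \<beta>_simps)
    also have "\<dots> = (\<Sum>i<k. if i = k - 1 - j then \<beta> y1 (a j) else 0)"
      using True by (intro sum.cong) (auto simp: aa)
    also have "\<dots> = \<beta> y1 (a j)" using True by simp
    finally show ?thesis using \<beta>_sym[of "a j"] by (simp add: y2_def \<beta>_simps)
  next
    case False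
    then have "N ^^ j = N ^^ (j - k) \<circ> N ^^ k" by (simp flip: funpow_add)
    then have "a j = 0" using Z(5)[OF x2(1)] Np by (simp add: a_def)
    then show ?thesis by simp
  qed
  \<comment> \<open>The correction lowers the top moment from \<open>b0 y1\<close> to
    \<open>b0 y1 - c^2\<close>, so it stays negative.\<close>
  have b0y2: "- b0 y2 \<in> P"
  proof -
    define c where "c = \<beta> y1 (a (k - 1))"
    have cL: "c \<in> L" unfolding c_def a_def using NZ[OF x2(1)] y1(1) Z(1) by (intro \<beta>_L) auto
    have ch: "\<beta> (a (k - 1)) (chain_map k a a v) = \<beta> v (a (k - 1))" for v
    proof -
      have "\<beta> (chain_map k a a v) (a (k - 1)) = (\<Sum>i<k. \<beta> v (a (k - 1 - i)) * \<beta> (a i) (a (k - 1)))"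
        by (simp add: chain_map_def \<beta>_simps)
      also have "\<dots> = (\<Sum>i<k. if i = 0 then \<beta> v (a (k - 1)) else 0)"
        by (intro sum.cong) (auto simp: aa)
      finally show ?thesis using k \<beta>_sym by simp
    qed
    have Nch: "(N ^^ (k - 1)) (chain_map k a a y1) = s c (a (k - 1))"
    proof -
      have "(N ^^ (k - 1)) (chain_map k a a y1) = (\<Sum>i<k. s (\<beta> y1 (a (k - 1 - i))) (a (i + (k - 1))))"
        unfolding chain_map_def glin_sum[OF glin_pow[OF Nl]] by (simp add: Np a_def Nadd add.commute)
      also have "\<dots> = (\<Sum>i<k. if i = 0 then s c (a (k - 1)) else 0)"
      proof (intro sum.cong refl)
        fix i
        have "a (i + (k - 1)) = 0" if "i \<noteq> 0"
        proof -
          have "i + (k - 1) = (i - 1) + k" using that k by simp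
          then have "N ^^ (i + (k - 1)) = N ^^ (i - 1) \<circ> N ^^ k" by (simp only: funpow_add)
          then show ?thesis using Z(5)[OF x2(1)] Np by (simp add: a_def)
        qed
        then show "s (\<beta> y1 (a (k - 1 - i))) (a (i + (k - 1))) = (if i = 0 then s c (a (k - 1)) else 0)"
          by (simp add: c_def)
      qed
      finally show ?thesis using k by simp
    qed
    have "b0 y2 = \<beta> y2 ((N ^^ (k - 1)) y1) - c * \<beta> y2 (a (k - 1))"
      unfolding b0_def y2_def Np(5) Nch by (simp add: \<beta>_simps)
    also have "\<beta> y2 (a (k - 1)) = 0" using ay2[of "k - 1"] \<beta>_sym by simp
    also have "\<beta> y2 ((N ^^ (k - 1)) y1) = b0 y1 - c * c"
    proof -
      have "\<beta> y2 ((N ^^ (k - 1)) y1) = \<beta> ((N ^^ (k - 1)) y2) y1" by (simp only: Npadj)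
      also have "(N ^^ (k - 1)) y2 = (N ^^ (k - 1)) y1 - s c (a (k - 1))"
        unfolding y2_def Np(5) Nch ..
      also have "\<beta> \<dots> y1 = b0 y1 - c * c"
        unfolding \<beta>.b_diff_left \<beta>_scale_left Npadj b0_def \<beta>_sym[of "a (k - 1)" y1] c_def ..
      finally show ?thesis .
    qed
    finally have "- b0 y2 = - b0 y1 + c * c" by simp
    then show ?thesis using P_add_T[OF y1(2) T_sq'[OF cL]] by simp
  qed
  have Z': "Z' \<subseteq> W" "\<And>v. v \<in> Z' \<Longrightarrow> N v \<in> Z'" "\<And>v w. v \<in> Z' \<Longrightarrow> w \<in> Z' \<Longrightarrow> v + w \<in> Z'" "\<And>a v. a \<in> L \<Longrightarrow> v \<in> Z' \<Longrightarrow> s a v \<in> Z'"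
    "\<And>v. v \<in> Z' \<Longrightarrow> (N ^^ k) v = 0"
  proof -
    have "\<beta> (a i) (N v) = 0" if "v \<in> Z'" for i v
    proof -
      have "\<beta> (a i) (N v) = \<beta> (a (Suc i)) v" by (simp add: a_def Nadj)
      then show ?thesis using that by (simp add: Z'_def)
    qed
    then show "\<And>v. v \<in> Z' \<Longrightarrow> N v \<in> Z'" using Z(2) by (auto simp: Z'_def)
  qed (use Z in \<open>auto simp: Z'_def \<beta>_simps\<close>)
  have "y2 \<in> Z'" using y2Z ay2 by (simp add: Z'_def)
  then obtain y3 where y3: "y3 \<in> Z'" "\<forall>i<k. \<beta> y3 ((N ^^ i) y3) = (if i = k - 1 then - 1 else 0)"
    using chain_normalize[OF k Nl Nadj Z', of y2 "- 1"] b0y2 by (auto simp: b0_def)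
  have xy: "x2 \<in> ker \<pi>" "y3 \<in> ker \<pi>" "(N ^^ k) x2 = 0" "(N ^^ k) y3 = 0"
    using x2(1) y3(1) by (auto simp: Z_def Z'_def)
  have "\<beta> x2 ((N ^^ i) y3) = 0" for i
    using y3(1) unfolding Npadj[symmetric] by (simp add: Z'_def a_def)
  then obtain \<pi>' \<sigma>' where sp': "split \<pi>' \<sigma>'" "ker \<pi>' \<subseteq> ker \<pi>" "\<forall>w\<in>ker \<pi>'. \<beta> w ((N ^^ (k - 1)) x2) = 0"
    using split_extend[OF sp \<kappa> k xy(1,2) N_def xy(3,4)] x2(2) y3(2) by blast
  have "\<beta> x2 ((N ^^ (k - 1)) x2) = 0" by (rule minimal[OF sp'(1,2) xy(1) sp'(3)])
  then show False using x2m[of "k - 1"] by simp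
qed

text \<open>The kernel of least dimension is taken. Minimality is phrased through \<beta> to match
  the last clause of \<open>split_extend\<close>: if \<open>z\<close> is orthogonal to a smaller
  kernel but not to \<open>x\<close>, then \<open>x\<close> extends an independent set of that
  kernel.\<close>

lemma minimal_split_exists:
  "\<exists>\<pi> \<sigma>. split \<pi> \<sigma> \<and> (\<forall>\<pi>' \<sigma>' x z. split \<pi>' \<sigma>' \<longrightarrow> ker \<pi>' \<subseteq> ker \<pi> \<longrightarrow> x \<in> ker \<pi> \<longrightarrow>
      (\<forall>w\<in>ker \<pi>'. \<beta> w z = 0) \<longrightarrow> \<beta> x z = 0)"
proof -
  define D where "D \<pi> = {card B | B. indep B \<and> B \<subseteq> ker \<pi>}" for \<pi>
  have Dfin: "finite (D \<pi>)" for \<pi>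
    by (rule finite_subset[of _ "{..card S}"]) (auto simp: D_def intro: indep_card_le[OF gen_W])
  have D0: "D \<pi> \<noteq> {}" for \<pi>
  proof -
    have "indep {}" by (simp add: indep_def)
    then show ?thesis unfolding D_def by blast
  qed
  obtain \<pi> where "\<exists>\<sigma>. split \<pi> \<sigma>"
    and least: "\<forall>\<pi>'. (\<exists>\<sigma>. split \<pi>' \<sigma>) \<longrightarrow> Max (D \<pi>) \<le> Max (D \<pi>')"
    using ex_has_least_nat[of "\<lambda>\<pi>. \<exists>\<sigma>. split \<pi> \<sigma>" "\<lambda>_. 0" "\<lambda>\<pi>. Max (D \<pi>)"] split_zero by blast
  then obtain \<sigma> where sp: "split \<pi> \<sigma>" by blast
  have "\<beta> x z = 0"
    if sp': "split \<pi>' \<sigma>'" and sub: "ker \<pi>' \<subseteq> ker \<pi>" and x: "x \<in> ker \<pi>" and orth: "\<forall>w\<in>ker \<pi>'. \<beta> w z = 0" for \<pi>' \<sigma>' x z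
  proof (rule ccontr)
    assume nz: "\<beta> x z \<noteq> 0"
    obtain B where B: "indep B" "B \<subseteq> ker \<pi>'" "card B = Max (D \<pi>')"
      using Max_in[OF Dfin D0, of \<pi>'] unfolding D_def by auto
    have fin: "finite B" "B \<subseteq> W" using B(1) by (auto simp: indep_def)
    have xB: "x \<notin> B" using B(2) orth nz by auto
    have "indep (insert x B)"
      unfolding indep_def
    proof (intro conjI allI impI)
      show "finite (insert x B)" "insert x B \<subseteq> W" using fin x by (auto simp: ker_def)
      fix c assume c: "(\<forall>b\<in>insert x B. c b \<in> L) \<and> (\<Sum>b\<in>insert x B. s (c b) b) = 0"
      have eq: "s (c x) x + (\<Sum>b\<in>B. s (c b) b) = 0" using c fin xB by simp
      have "\<beta> (s (c x) x + (\<Sum>b\<in>B. s (c b) b)) z = c x * \<beta> x z + (\<Sum>b\<in>B. c b * \<beta> b z)"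
        by (simp add: \<beta>_simps)
      also have "(\<Sum>b\<in>B. c b * \<beta> b z) = 0" using orth B(2) by (intro sum.neutral) auto
      finally have cx: "c x = 0" using nz eq by simp
      then have "(\<Sum>b\<in>B. s (c b) b) = 0" using eq by simp
      then have "c b = 0" if "b \<in> B" for b using indepD[OF B(1)] c that by blast
      then show "\<forall>b\<in>insert x B. c b = 0" using cx by blast
    qed
    then have "card (insert x B) \<in> D \<pi>" unfolding D_def using B(2) sub x by blast
    then have "card (insert x B) \<le> Max (D \<pi>)" by (rule Max_ge[OF Dfin])
    moreover have "Max (D \<pi>) \<le> Max (D \<pi>')" using least sp' by blast
    ultimately show False using B(3) xB fin by simp
  qed
  then show ?thesis using sp by blast
qed

lemma anti_of_signatures:
  assumes sig: "\<And>p. Lpoly p \<Longrightarrow> signature_on L T s W (\<lambda>x. \<beta> x (pT p x)) = 0"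
  shows "\<exists>I :: bool list set. finite I \<and> I \<noteq> {} \<and> anti L s W sys I (\<lambda>_. 1)"
proof -
  obtain \<pi> \<sigma> where sp: "split \<pi> \<sigma>"
    and minimal: "\<And>\<pi>' \<sigma>' x z. split \<pi>' \<sigma>' \<Longrightarrow> ker \<pi>' \<subseteq> ker \<pi> \<Longrightarrow> x \<in> ker \<pi> \<Longrightarrow>
      (\<forall>w\<in>ker \<pi>'. \<beta> w z = 0) \<Longrightarrow> \<beta> x z = 0"
    using minimal_split_exists by blast
  note S = splitD[OF sp]
  define Q where "Q g \<longleftrightarrow> Lpoly g \<and> g \<noteq> 0 \<and> (\<forall>x\<in>ker \<pi>. pT g x = 0)" for g
  obtain f0 where f0: "Q f0"
    using annihilator unfolding Q_def ker_def by (metis (no_types, lifting) leading_coeff_0_iff mem_Collect_eq zero_neq_one)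
  obtain f1 where f1: "Q f1" "\<And>g. Q g \<Longrightarrow> degree f1 \<le> degree g"
    using ex_has_least_nat[of Q f0 degree] f0 by blast
  define f where "f = Polynomial.smult (inverse (lead_coeff f1)) f1"
  have f: "Lpoly f" "lead_coeff f = 1" "\<And>x. x \<in> ker \<pi> \<Longrightarrow> pT f x = 0" "degree f = degree f1"
    using f1(1) by (auto simp: f_def Q_def pT_smult intro!: Lpoly_smult L_inverse lead_in_L)
  have "poly f \<kappa> \<noteq> 0" if "\<kappa> \<in> L" for \<kappa>
    by (rule minimal_rootless[OF sig sp minimal f(1-3) _ that]) (use f1(2) f(4) in \<open>auto simp: Q_def\<close>)
  then obtain gs h where gs: "list_all Lpoly gs" "Lpoly h" "(\<Sum>g\<leftarrow>gs. g * g) = - 1 + f * h"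
    using rootless_minus_one_sum_of_squares[OF f(1,2)] by blast
  have Ks: "lspace L s (ker \<pi>)" by (rule subspace_lspace[OF ker_subspace[OF sp]])
  interpret K: formspace L s "ker \<pi>" sys by (rule sys_form[OF Ks])
  interpret W: formspace L s W sys by (rule sys_form) unfold_locales
  define I where "I = {l :: bool list. length l = length (map pT gs)}"
  have "anti L s (ker \<pi>) sys I (\<lambda>_. 1)"
    unfolding I_def
  proof (rule K.anti_sum_of_squares)
    fix c assume "c \<in> set (map pT gs)"
    then obtain g where g: "c = pT g" "Lpoly g" using gs(1) by (auto simp: list_all_iff)
    show "c (x + y) = c x + c y" "c (s a x) = s a (c x)" for a x y using glinD[OF glin_pT] by (auto simp: g)
    show "c x \<in> ker \<pi>" if "x \<in> ker \<pi>" for x unfolding g(1) by (rule ker_pT[OF sp g(2) that])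
    show "d (c x) = c (d x)" if "d \<in> set (map pT gs)" for d x using that g(1) pT_pT by auto
    show "sys t (c x) y = sys t x (c y)" for t x y by (simp add: sys_def g(1) pT_adj pT_A)
  next
    fix x assume x: "x \<in> ker \<pi>"
    have "(\<Sum>c\<leftarrow>map pT gs'. c (c x)) = pT (\<Sum>g\<leftarrow>gs'. g * g) x" for gs'
      by (induction gs') (auto simp: pT_add pT_mult)
    then have "(\<Sum>c\<leftarrow>map pT gs. c (c x)) = pT (- 1 + f * h) x" using gs(3) by simp
    also have "\<dots> = - x + pT h (pT f x)"
      unfolding pT_add pT_mult pT_pT[of h f] by (simp add: pT_minus)
    also have "\<dots> = - x" using f(3)[OF x] glinD(3)[OF glin_pT] by simp
    finally show "(\<Sum>c\<leftarrow>map pT gs. c (c x)) = - x" .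
  qed
  from anti_formD[OF this] obtain F where F: "linear_endo_on L (pscale s) (pspace I (ker \<pi>)) F" "\<And>x. x \<in> pspace I (ker \<pi>) \<Longrightarrow> F x \<in> pspace I (ker \<pi>)"
    "\<And>t x y. x \<in> pspace I (ker \<pi>) \<Longrightarrow> y \<in> pspace I (ker \<pi>) \<Longrightarrow> dform I (\<lambda>_. 1) sys t (F x) (F y) = - dform I (\<lambda>_. 1) sys t x y"
    by blast
  \<comment> \<open>\<open>r\<close> projects to the kernel of \<pi>, where the Clifford matrix
    \<open>F\<close> acts; on the range of \<pi> the map \<sigma> acts coordinatewise. The two parts
    are orthogonal for both forms of the system.\<close>
  define r where "r x = (\<lambda>l. x l - \<pi> (x l))" for x :: "bool list \<Rightarrow> 'w"
  define H where "H x = (\<lambda>l. \<sigma> (x l) + F (r x) l)" for x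
  have rK: "r x \<in> pspace I (ker \<pi>)" if "x \<in> pspace I W" for x
    using that S(3,5) glinD[OF S(1)] by (auto simp: r_def pspace_def ker_def intro: W_diff)
  have orth: "sys t u v = 0" "sys t v u = 0" if "\<pi> u = u" "\<pi> v = 0" for t u v
  proof -
    have 1: "\<beta> u w = \<beta> u (\<pi> w)" for w using S(10)[of u w] that(1) by simp
    have "\<beta> u (A v) = 0" "\<beta> u v = 0" using 1[of "A v"] 1[of v] that(2) S(6)[of v] glinD(3)[OF glin_A] by auto
    moreover have "\<beta> v (A u) = \<beta> u (A v)" using A_adj[of v u] \<beta>_sym by metis
    ultimately show "sys t u v = 0" "sys t v u = 0" using \<beta>_sym[of u v] by (auto simp: sys_def)
  qed
  have "anti L s W sys I (\<lambda>_. 1)"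
    unfolding anti_form_def
  proof (intro exI[of _ H] conjI allI ballI)
    show "linear_endo_on L (pscale s) (pspace I W) H"
      unfolding linear_endo_on_def
    proof (intro conjI ballI)
      fix x assume x: "x \<in> pspace I W"
      show "H x \<in> pspace I W"
        using F(2)[OF rK[OF x]] x S(4) glinD(3)[OF S(2)] by (auto simp: H_def pspace_def ker_def intro: W_add)
      show "H (x + y) = H x + H y" if y: "y \<in> pspace I W" for y
      proof -
        have "r (x + y) = r x + r y" by (auto simp: r_def glinD[OF S(1)])
        then have "F (r (x + y)) = F (r x) + F (r y)" using F(1) rK[OF x] rK[OF y] by (simp add: linear_endo_on_def)
        then show ?thesis by (auto simp: H_def glinD[OF S(2)])
      qed
      show "H (pscale s e x) = pscale s e (H x)" if e: "e \<in> L" for e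
      proof -
        have "r (pscale s e x) = pscale s e (r x)" by (auto simp: r_def pscale_def glinD[OF S(1)] scale_right_diff_distrib)
        then have "F (r (pscale s e x)) = pscale s e (F (r x))" using F(1) rK[OF x] e by (simp add: linear_endo_on_def)
        then show ?thesis by (auto simp: H_def pscale_def glinD[OF S(2)] scale_right_distrib)
      qed
    qed
    fix t x y assume x: "x \<in> pspace I W" and y: "y \<in> pspace I W"
    have Fk: "\<pi> (F (r u) l) = 0" if "u \<in> pspace I W" for u l
      using F(2)[OF rK[OF that]] glinD(3)[OF S(1)] by (cases "l \<in> I") (auto simp: pspace_def ker_def)
    have rk: "\<pi> (r u l) = 0" for u l by (simp add: r_def glinD[OF S(1)] S(5))
    have sys\<sigma>: "sys t (\<sigma> u) (\<sigma> v) = - sys t (\<pi> u) (\<pi> v)" for u v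
      by (simp add: sys_def S(11) flip: S(6,7))
    have "dform I (\<lambda>_. 1) sys t (H x) (H y)
      = (\<Sum>l\<in>I. - sys t (\<pi> (x l)) (\<pi> (y l))) + dform I (\<lambda>_. 1) sys t (F (r x)) (F (r y))"
      unfolding dform_def H_def sum.distrib[symmetric]
      by (intro sum.cong refl) (simp add: W.b_simps orth[OF S(8) Fk[OF x]] orth[OF S(8) Fk[OF y]] sys\<sigma>)
    also have "\<dots> = (\<Sum>l\<in>I. - sys t (\<pi> (x l)) (\<pi> (y l))) - dform I (\<lambda>_. 1) sys t (r x) (r y)"
      unfolding F(3)[OF rK[OF x] rK[OF y]] by simp
    also have "\<dots> = - (\<Sum>l\<in>I. sys t (\<pi> (x l) + r x l) (\<pi> (y l) + r y l))"
      unfolding dform_def by (simp add: W.b_simps orth[OF S(5) rk] sum.distrib sum_negf)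
    also have "\<dots> = - dform I (\<lambda>_. 1) sys t x y" unfolding dform_def by (simp add: r_def)
    finally show "dform I (\<lambda>_. 1) sys t (H x) (H y) = - dform I (\<lambda>_. 1) sys t x y" .
  qed
  moreover have "finite I" unfolding I_def using finite_lists_length_eq[of "UNIV :: bool set"] by simp
  moreover have "replicate (length (map pT gs)) True \<in> I" by (simp add: I_def)
  ultimately show ?thesis by blast
qed

end

section \<open>Hyperbolic multiples over the base field\<close>

context ordered_space
begin

lemma square_in_T: "a \<in> L \<Longrightarrow> a * a \<in> T"
  using ord unfolding field_ordering_def by (metis minus_mult_minus)

text \<open>
  Vectors \<open>x\<^sub>1, \<dots>, x\<^sub>n\<close> in a positive definite subspace of dimension \<open>p\<close> can be chosen such that the
  components of their image under \<open>(\<tau>\<^sub>i\<^sub>j)\<close> are orthogonal to a maximal negative definite subspace of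
  dimension \<open>m\<close>, provided that \<open>np > nm\<close>; then \<open>q\<close> is nonnegative on these components.
\<close>

lemma posdim_le:
  fixes \<phi> :: "'w \<Rightarrow> 'w \<Rightarrow> 'c"
  assumes \<phi>L: "\<And>x y. x \<in> W \<Longrightarrow> y \<in> W \<Longrightarrow> \<phi> x y \<in> L"
    and sym: "\<And>x y. \<phi> x y = \<phi> y x"
    and add: "\<And>x y z. x \<in> W \<Longrightarrow> y \<in> W \<Longrightarrow> z \<in> W \<Longrightarrow> \<phi> (x + y) z = \<phi> x z + \<phi> y z"
    and scl: "\<And>a x y. a \<in> L \<Longrightarrow> x \<in> W \<Longrightarrow> y \<in> W \<Longrightarrow> \<phi> (s a x) y = a * \<phi> x y"
    and q: "\<And>x. x \<in> W \<Longrightarrow> q x = \<phi> x x"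
    and \<tau>: "\<And>i j. i < n \<Longrightarrow> j < n \<Longrightarrow> linear_endo_on L s W (\<tau> i j)"
    and anti: "\<And>x. (\<And>j. j < n \<Longrightarrow> x j \<in> W) \<Longrightarrow> (\<Sum>i<n. q (\<Sum>j<n. \<tau> i j (x j))) = - (\<Sum>j<n. q (x j))"
    and n: "0 < (n::nat)"
  shows "Max (posdims q) \<le> Max (posdims (\<lambda>x. - q x))"
proof (rule ccontr)
  have Tadd: "\<And>x y. x \<in> T \<Longrightarrow> y \<in> T \<Longrightarrow> x + y \<in> T" and TL: "\<And>x. x \<in> T \<Longrightarrow> x \<in> L"
    and Ttot: "\<And>x. x \<in> L \<Longrightarrow> x \<in> T \<or> - x \<in> T" and Tanti: "\<And>x. x \<in> T \<Longrightarrow> - x \<in> T \<Longrightarrow> x = 0"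
    and Tmul: "\<And>x y. x \<in> T \<Longrightarrow> y \<in> T \<Longrightarrow> x * y \<in> T"
    using ord unfolding field_ordering_def by auto
  have T0: "0 \<in> T" using Ttot[of 0] by simp
  have Tsum: "sum g I \<in> T" if "\<And>i. i \<in> I \<Longrightarrow> g i \<in> T" for g and I :: "nat set"
    using that by (induction I rule: infinite_finite_induct) (auto simp: T0 intro: Tadd)
  have Tpos: "x + y \<in> T - {0}" if "x \<in> T - {0}" "y \<in> T" for x y
  proof -
    have "x + y \<noteq> 0"
    proof
      assume "x + y = 0"
      then have "- x = y" by (rule minus_unique)
      then show False using Tanti[of x] that by auto
    qed
    then show ?thesis using that Tadd by auto
  qed
  have zero: "\<phi> 0 y = 0" if "y \<in> W" for y using scl[of 0 0 y] that by simp
  have q0: "q 0 = 0" "(\<lambda>x. - q x) 0 = 0" using q[of 0] zero[of 0] by simp_all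
  have sum: "\<phi> (\<Sum>i\<in>I. s (c i) (u i)) y = (\<Sum>i\<in>I. c i * \<phi> (u i) y)"
    if "\<And>i. i \<in> I \<Longrightarrow> c i \<in> L \<and> u i \<in> W" "y \<in> W" for I :: "nat set" and c u y
    using that
  proof (induction I rule: infinite_finite_induct)
    case (insert i I)
    have "(\<Sum>i\<in>I. s (c i) (u i)) \<in> W" using insert by (intro W_sum W_scale) auto
    then show ?case using insert by (simp add: add scl W_scale)
  qed (auto simp: zero)
  have sum1: "\<phi> (\<Sum>i\<in>I. u i) y = (\<Sum>i\<in>I. \<phi> (u i) y)"
    if "\<And>i. i \<in> I \<Longrightarrow> u i \<in> W" "y \<in> W" for I :: "nat set" and u y
    using sum[of I "\<lambda>_. 1" u y] that by simp
  define p m where "p = Max (posdims q)" and "m = Max (posdims (\<lambda>x. - q x))"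
  assume "\<not> Max (posdims q) \<le> Max (posdims (\<lambda>x. - q x))"
  then have mp: "m < p" by (simp add: p_def m_def)
  have pp: "posk q p" unfolding p_def by (rule posk_Max(1)[where q = q, OF q0(1)])
  have pm: "posk (\<lambda>x. - q x) m" unfolding m_def by (rule posk_Max(1)[where q = "\<lambda>x. - q x", OF q0(2)])
  have mmax: "k \<le> m" if "posk (\<lambda>x. - q x) k" for k unfolding m_def by (rule posk_Max(2)[where q = "\<lambda>x. - q x", OF q0(2) that])
  obtain v where v: "\<And>i. i < p \<Longrightarrow> v i \<in> W"
    and vpos: "\<And>c. (\<And>i. i < p \<Longrightarrow> c i \<in> L) \<Longrightarrow> (\<exists>i<p. c i \<noteq> 0) \<Longrightarrow> q (\<Sum>i<p. s (c i) (v i)) \<in> T - {0}"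
    using pp unfolding posk_def by blast
  obtain u where u: "\<And>i. i < m \<Longrightarrow> u i \<in> W"
    and uneg: "\<And>c. (\<And>i. i < m \<Longrightarrow> c i \<in> L) \<Longrightarrow> (\<exists>i<m. c i \<noteq> 0) \<Longrightarrow> - q (\<Sum>i<m. s (c i) (u i)) \<in> T - {0}"
    using pm unfolding posk_def by blast
  \<comment> \<open>Otherwise \<open>w\<close> would extend the maximal negative definite
    space.\<close>
  have orth_nonneg: "q w \<in> T" if w: "w \<in> W" "\<And>i. i < m \<Longrightarrow> \<phi> w (u i) = 0" for w
  proof (rule ccontr)
    assume "q w \<notin> T"
    moreover have "q w \<in> L" using q \<phi>L w by simp
    ultimately have neg: "- q w \<in> T - {0}" using Ttot[of "q w"] by auto
    define u' where "u' i = (if i < m then u i else w)" for i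
    have "posk (\<lambda>x. - q x) (Suc m)"
      unfolding posk_def
    proof (intro exI[of _ u'] conjI allI impI)
      show "u' i \<in> W" for i using u w by (auto simp: u'_def)
      fix c assume c: "(\<forall>i<Suc m. c i \<in> L) \<and> (\<exists>i<Suc m. c i \<noteq> 0)"
      define x where "x = (\<Sum>i<m. s (c i) (u i))"
      have xW: "x \<in> W" unfolding x_def using c u by (intro W_sum W_scale) auto
      have cwW: "s (c m) w \<in> W" using c w by (intro W_scale) auto
      have "\<phi> x w = (\<Sum>i<m. c i * \<phi> (u i) w)" unfolding x_def using c u w by (intro sum) auto
      also have "\<dots> = 0" using w sym by (intro sum.neutral) auto
      finally have xw: "\<phi> x w = 0" .
      have "q (x + s (c m) w) = \<phi> x (x + s (c m) w) + \<phi> (s (c m) w) (x + s (c m) w)"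
        using q[OF W_add[OF xW cwW]] add[OF xW cwW W_add[OF xW cwW]] by simp
      also have "\<phi> x (x + s (c m) w) = q x + c m * \<phi> w x"
        using add[OF xW cwW xW] scl[of "c m" w x] c w xW q[OF xW] sym[of x "x + s (c m) w"] by simp
      also have "\<phi> (s (c m) w) (x + s (c m) w) = c m * \<phi> w (x + s (c m) w)"
        using c w W_add[OF xW cwW] by (intro scl) auto
      also have "\<phi> w (x + s (c m) w) = \<phi> x w + c m * \<phi> w w"
        using add[OF xW cwW w(1)] scl[of "c m" w w] c w sym[of w "x + s (c m) w"] by simp
      finally have e: "- q (x + s (c m) w) = - q x + c m * c m * (- q w)"
        using xw sym[of w x] q[OF w(1)] by (simp add: algebra_simps)
      have t: "c m * c m * (- q w) \<in> T" using neg c square_in_T[of "c m"] Tmul[of "c m * c m" "- q w"] by auto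
      have "- q x + c m * c m * (- q w) \<in> T - {0}"
      proof (cases "\<exists>i<m. c i \<noteq> 0")
        case True
        then have "- q x \<in> T - {0}" unfolding x_def using c by (intro uneg) auto
        then show ?thesis using t by (rule Tpos)
      next
        case False
        then have "x = 0" unfolding x_def by (intro sum.neutral) auto
        moreover have "c m \<noteq> 0" using False c by (metis less_Suc_eq)
        ultimately show ?thesis using t neg q0 by simp
      qed
      moreover have "(\<Sum>i<Suc m. s (c i) (u' i)) = x + s (c m) w" by (simp add: x_def u'_def)
      ultimately show "- q (\<Sum>i<Suc m. s (c i) (u' i)) \<in> T - {0}" using e by simp
    qed
    then show False using mmax[of "Suc m"] by simp
  qed
  have \<tau>W: "\<tau> i j x \<in> W" if "i < n" "j < n" "x \<in> W" for i j x using \<tau>[OF that(1,2)] that(3) by (auto simp: linear_endo_on_def)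
  have "card ({..<n} \<times> {..<m}) < card ({..<n} \<times> {..<p})" using mp n by simp
  \<comment> \<open>The unknown \<open>(j, a)\<close> is the coefficient of \<open>v a\<close> in
    \<open>x j\<close>; the equation \<open>(l, i)\<close> makes component \<open>l\<close> of the
    image orthogonal to \<open>u i\<close>.\<close>
  define M where "M e y = \<phi> (\<tau> (fst e) (fst y) (v (snd y))) (u (snd e))" for e y :: "nat \<times> nat"
  have "M e y \<in> L" if "e \<in> {..<n} \<times> {..<m}" "y \<in> {..<n} \<times> {..<p}" for e y
    unfolding M_def using that u v by (intro \<phi>L \<tau>W) auto
  then have "\<exists>c. (\<forall>y. c y \<in> L) \<and> (\<exists>y\<in>{..<n} \<times> {..<p}. c y \<noteq> 0) \<and>
      (\<forall>e\<in>{..<n} \<times> {..<m}. (\<Sum>y\<in>{..<n} \<times> {..<p}. M e y * c y) = 0)"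
    using \<open>card ({..<n} \<times> {..<m}) < card ({..<n} \<times> {..<p})\<close> by (intro homogeneous_system) auto
  then obtain c where c: "\<forall>y. c y \<in> L" "\<exists>y\<in>{..<n} \<times> {..<p}. c y \<noteq> 0"
    "\<forall>e\<in>{..<n} \<times> {..<m}. (\<Sum>y\<in>{..<n} \<times> {..<p}. M e y * c y) = 0" by blast
  define x where "x j = (\<Sum>a<p. s (c (j, a)) (v a))" for j
  have xW: "x j \<in> W" for j unfolding x_def using c v by (intro W_sum W_scale) auto
  have nonneg: "q (\<Sum>j<n. \<tau> l j (x j)) \<in> T" if l: "l < n" for l
  proof (rule orth_nonneg)
    show "(\<Sum>j<n. \<tau> l j (x j)) \<in> W" using l xW by (intro W_sum \<tau>W) auto
    fix i assume i: "i < m"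
    have "\<phi> (\<Sum>j<n. \<tau> l j (x j)) (u i) = (\<Sum>j<n. \<phi> (\<tau> l j (x j)) (u i))"
      using l xW u i by (intro sum1 \<tau>W) auto
    also have "\<dots> = (\<Sum>j<n. \<Sum>a<p. \<phi> (\<tau> l j (v a)) (u i) * c (j, a))"
    proof (intro sum.cong refl)
      fix j assume j: "j \<in> {..<n}"
      then have lin: "linear_endo_on L s W (\<tau> l j)" using \<tau> l by simp
      have "\<tau> l j (x j) = (\<Sum>a<p. \<tau> l j (s (c (j, a)) (v a)))"
        unfolding x_def using c v by (intro endo_sum[OF lin] W_scale) auto
      also have "\<dots> = (\<Sum>a<p. s (c (j, a)) (\<tau> l j (v a)))"
        using lin c v by (intro sum.cong) (auto simp: linear_endo_on_def)
      finally have "\<phi> (\<tau> l j (x j)) (u i) = (\<Sum>a<p. c (j, a) * \<phi> (\<tau> l j (v a)) (u i))"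
        using sum[of "{..<p}" "\<lambda>a. c (j, a)" "\<lambda>a. \<tau> l j (v a)" "u i"] c v u i \<tau>W l j by auto
      then show "\<phi> (\<tau> l j (x j)) (u i) = (\<Sum>a<p. \<phi> (\<tau> l j (v a)) (u i) * c (j, a))" by (simp add: mult.commute)
    qed
    also have "\<dots> = (\<Sum>y\<in>{..<n} \<times> {..<p}. M (l, i) y * c y)"
      unfolding sum.cartesian_product by (simp add: case_prod_beta M_def)
    also have "\<dots> = 0" using c(3) l i by blast
    finally show "\<phi> (\<Sum>j<n. \<tau> l j (x j)) (u i) = 0" .
  qed
  have 1: "(\<Sum>l<n. q (\<Sum>j<n. \<tau> l j (x j))) \<in> T" using nonneg by (intro Tsum) auto
  obtain j a where ja: "j < n" "a < p" "c (j, a) \<noteq> 0" using c(2) by auto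
  have qx: "q (x i) \<in> T" for i
  proof (cases "\<exists>a<p. c (i, a) \<noteq> 0")
    case True
    then show ?thesis unfolding x_def using vpos[of "\<lambda>a. c (i, a)"] c(1) by auto
  next
    case False
    then have "x i = 0" unfolding x_def by (intro sum.neutral) auto
    then show ?thesis using q0 T0 by simp
  qed
  have "q (x j) \<in> T - {0}" unfolding x_def using ja c(1) by (intro vpos) auto
  then have "q (x j) + (\<Sum>i\<in>{..<n} - {j}. q (x i)) \<in> T - {0}" using qx by (intro Tpos Tsum) auto
  then have 2: "(\<Sum>i<n. q (x i)) \<in> T - {0}" using ja by (simp add: sum.remove[of "{..<n}" j])
  have "(\<Sum>l<n. q (\<Sum>j<n. \<tau> l j (x j))) = - (\<Sum>i<n. q (x i))" using xW by (intro anti)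
  then show False using 1 2 Tanti[of "\<Sum>i<n. q (x i)"] by auto
qed

end

text \<open>The pair is indexed by \<open>bool\<close>, so that \<open>\<not> t\<close> names the
  other form.\<close>

locale quad_system = finite_dimensional_vector_space scale B
  for scale :: "'k::field \<Rightarrow> 'v::ab_group_add \<Rightarrow> 'v" and B :: "'v set" +
  fixes q :: "bool \<Rightarrow> 'v \<Rightarrow> 'k"
  assumes two_K: "(2::'k) \<noteq> 0"
    and quad: "\<And>t. quadratic_form_on UNIV scale UNIV (q t)"
begin

definition pol :: "bool \<Rightarrow> 'v \<Rightarrow> 'v \<Rightarrow> 'k" where "pol t = polar (q t)"

lemma q_pol: "q t x = pol t x x"
  unfolding pol_def using polar_self[OF two_K vector_space_axioms quad] by simp

sublocale V: formspace UNIV scale UNIV pol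
proof unfold_locales
  show "subfield_set (UNIV :: 'k set)" by (simp add: subfield_set_def)
  show "pol t x y = pol t y x" for t x y unfolding pol_def by (rule polar_sym)
  show "pol t (x + y) z = pol t x z + pol t y z" "pol t (scale a x) y = a * pol t x y" for t x y z a
    using quad[of t] by (auto simp: pol_def quadratic_form_on_def)
qed auto

lemma gen_UNIV: "gen_on UNIV scale UNIV B"
  unfolding gen_on_def
proof (intro conjI allI impI)
  fix U assume U: "subspace_on UNIV scale UNIV U \<and> B \<subseteq> U"
  then have "subspace U" by (auto simp: subspace_on_def subspace_def)
  then have "span B \<subseteq> U" using U by (intro span_minimal) auto
  then show "U = UNIV" using span_Basis by auto
qed (auto simp: finite_Basis)

definition rep :: "'v \<Rightarrow> 'v \<Rightarrow> 'k" where "rep v b = representation B v b"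

lemma rep_sum: "v = (\<Sum>b\<in>B. scale (rep v b) b)"
  unfolding rep_def using independent_Basis span_Basis finite_Basis
  by (intro sum_representation_eq[symmetric]) auto

lemma rep_outside: "b \<notin> B \<Longrightarrow> rep v b = 0"
  unfolding rep_def using representation_ne_zero by blast

lemma rep_add: "rep (v + w) b = rep v b + rep w b" and rep_scale: "rep (scale a v) b = a * rep v b"
  unfolding rep_def using independent_Basis span_Basis by (auto simp: representation_add representation_scale)

lemma rep_basis: "c \<in> B \<Longrightarrow> rep c b = (if b = c then 1 else 0)"
  unfolding rep_def using independent_Basis by (auto simp: representation_basis)

lemma rep_linear_comb: "rep (\<Sum>c\<in>C. scale (a c) (g c)) b = (\<Sum>c\<in>C. a c * rep (g c) b)"
proof (induction C rule: infinite_finite_induct)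
  case (insert c C)
  then show ?case by (simp add: rep_add rep_scale)
qed (auto simp: rep_def representation_zero)

lemma rep_comb_basis: "b \<in> B \<Longrightarrow> rep (\<Sum>c\<in>B. scale (a c) c) b = a b"
  unfolding rep_linear_comb using finite_Basis by (simp add: rep_basis if_distrib cong: if_cong)

lemma hyperbolic_of_anti:
  assumes anti: "anti UNIV scale UNIV pol {..<m::nat} (\<lambda>_. 1)" and m: "0 < m"
    and rad: "\<And>x. (\<And>t y. pol t x y = 0) \<Longrightarrow> x = 0"
  shows "hyperbolic_on UNIV (power_scale scale) (power_space (2 * m)) (power_form (2 * m) ` range q)"
proof -
  let ?P = "pspace {..<m} (UNIV :: 'v set)"
  interpret P: formspace UNIV "pscale scale" ?P "dform {..<m} (\<lambda>_. 1) pol" by (rule V.formspace_dform)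
  obtain f where f: "linear_endo_on UNIV (pscale scale) ?P f" "\<And>x. x \<in> ?P \<Longrightarrow> f x \<in> ?P"
    "\<And>t x y. x \<in> ?P \<Longrightarrow> y \<in> ?P \<Longrightarrow> dform {..<m} (\<lambda>_. 1) pol t (f x) (f y) = - dform {..<m} (\<lambda>_. 1) pol t x y"
    using anti_formD[OF anti] by blast
  have inj: "x = 0" if x: "x \<in> ?P" "f x = 0" for x
  proof
    fix i
    show "x i = 0 i"
    proof (cases "i < m")
      case True
      have "pol t (x i) y = 0" for t y
      proof -
        have sy: "single i y \<in> ?P" using True by (intro V.single_in) auto
        have "dform {..<m} (\<lambda>_. 1) pol t x (single i y) = (\<Sum>j<m. if j = i then pol t (x i) y else 0)"
          unfolding dform_def by (intro sum.cong) (auto simp: single_def)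
        then have "dform {..<m} (\<lambda>_. 1) pol t x (single i y) = pol t (x i) y" using True by simp
        moreover have "dform {..<m} (\<lambda>_. 1) pol t x (single i y) = 0"
          using f(3)[OF x(1) sy, of t] x(2) P.b_zero_left by simp
        ultimately show ?thesis by simp
      qed
      then show ?thesis using rad by simp
    qed (use x in \<open>auto simp: pspace_def\<close>)
  qed
  have surj: "\<exists>x\<in>?P. f x = y" if "y \<in> ?P" for y
    by (rule P.inj_imp_surj[OF V.gen_on_pspace[OF gen_UNIV] f(1) inj that]) auto
  define lo up where "lo z = restr {..<m} z" and "up z = restr {..<m} (\<lambda>i. z (m + i))" for z :: "nat \<Rightarrow> 'v"
  \<comment> \<open>The space of length \<open>2 * m\<close> is handled as two halves;
    \<open>glue\<close> inverts the pair of projections \<open>lo\<close> and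
    \<open>up\<close>.\<close>
  define glue where "glue x y = (\<lambda>i. if i < m then x i else if i < 2 * m then y (i - m) else 0)" for x y :: "nat \<Rightarrow> 'v"
  have loP: "lo z \<in> ?P" "up z \<in> ?P" for z by (auto simp: lo_def up_def restr_def pspace_def)
  have lo_add: "lo (z + w) = lo z + lo w" "up (z + w) = up z + up w" for z w by (auto simp: lo_def up_def restr_def)
  have lo_scl: "lo (power_scale scale a z) = pscale scale a (lo z)" "up (power_scale scale a z) = pscale scale a (up z)" for a z
    by (auto simp: lo_def up_def restr_def power_scale_def pscale_def)
  have lo_glue: "lo (glue x y) = x" "up (glue x y) = y" "glue x y \<in> power_space (2 * m)" if "x \<in> ?P" "y \<in> ?P" for x y
    using that by (auto simp: lo_def up_def restr_def glue_def pspace_def power_space_def)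
  have eqI: "z = w" if "z \<in> power_space (2 * m)" "w \<in> power_space (2 * m)" "lo z = lo w" "up z = up w" for z w
  proof
    fix i
    show "z i = w i"
    proof (cases "i < m")
      case True
      then show ?thesis using fun_cong[OF that(3), of i] by (simp add: lo_def restr_def)
    next
      case False
      show ?thesis
      proof (cases "i < 2 * m")
        case True
        then have "i - m < m" "m + (i - m) = i" using False by auto
        then show ?thesis using fun_cong[OF that(4), of "i - m"] by (simp add: up_def restr_def)
      qed (use that in \<open>auto simp: power_space_def\<close>)
    qed
  qed
  have form: "power_form (2 * m) (q t) z = dform {..<m} (\<lambda>_. 1) pol t (lo z) (lo z) + dform {..<m} (\<lambda>_. 1) pol t (up z) (up z)" for t z
  proof -
    have "(\<Sum>i<m + m. q t (z i)) = (\<Sum>i<m. q t (z i)) + (\<Sum>i<m. q t (z (m + i)))"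
    proof -
      have "{..<m + m} = {..<m} \<union> (+) m ` {..<m}"
      proof (intro equalityI subsetI)
        fix i assume "i \<in> {..<m + m}"
        then show "i \<in> {..<m} \<union> (+) m ` {..<m}" by (cases "i < m") (auto intro!: image_eqI[of i _ "i - m"])
      qed auto
      then have "(\<Sum>i<m + m. q t (z i)) = (\<Sum>i<m. q t (z i)) + (\<Sum>i\<in>(+) m ` {..<m}. q t (z i))"
        by (auto intro!: sum.union_disjoint)
      then show ?thesis by (simp add: sum.reindex)
    qed
    then show ?thesis
      by (simp add: power_form_def mult_2 dform_def lo_def up_def restr_def q_pol[symmetric])
  qed
  \<comment> \<open>The graph of \<open>e\<close> times \<open>f\<close>, used for
    \<open>e = 1\<close> and \<open>e = - 1\<close>.\<close>
  define U where "U e = {z \<in> power_space (2 * m). up z = pscale scale e (f (lo z))}" for e :: 'k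
  have fadd: "f (x + y) = f x + f y" and fscl: "f (pscale scale a x) = pscale scale a (f x)" if "x \<in> ?P" "y \<in> ?P" for x y a
    using f(1) that by (auto simp: linear_endo_on_def)
  have psp: "z + w \<in> power_space (2 * m)" "power_scale scale a z \<in> power_space (2 * m)"
    if "z \<in> power_space (2 * m)" "w \<in> power_space (2 * m)" for z w :: "nat \<Rightarrow> 'v" and a
    using that by (auto simp: power_space_def power_scale_def)
  have sub: "subspace_on UNIV (power_scale scale) (power_space (2 * m)) (U e)" for e
    unfolding subspace_on_def
  proof (intro conjI ballI)
    show "U e \<subseteq> power_space (2 * m)" by (auto simp: U_def)
    have "lo 0 = 0" "up 0 = 0" by (auto simp: lo_def up_def restr_def)
    then show "0 \<in> U e" using P.endo_0[OF f(1)] by (auto simp: U_def power_space_def P.scale_zero_right)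
    show "z + w \<in> U e" if "z \<in> U e" "w \<in> U e" for z w
      using that psp(1) fadd[OF loP(1) loP(1)] by (auto simp: U_def lo_add P.scale_right_distrib)
    show "power_scale scale a z \<in> U e" if "z \<in> U e" for a z
      using that psp(2) fscl[OF loP(1) loP(1)] by (auto simp: U_def lo_scl mult.commute)
  qed
  have van: "power_form (2 * m) (q t) z = 0" if "z \<in> U e" "e * e = 1" for t z e
    using that f(3)[OF loP(1) loP(1), of t z z] unfolding form by (simp add: U_def P.b_simps flip: mult.assoc)
  have inter: "U 1 \<inter> U (- 1) = {0}"
  proof (intro equalityI subsetI)
    fix z assume "z \<in> U 1 \<inter> U (- 1)"
    then have z: "z \<in> power_space (2 * m)" "up z = f (lo z)" "up z = - f (lo z)"
      by (auto simp: U_def pscale_def fun_eq_iff)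
    have fz: "f (lo z) = 0"
    proof
      fix i
      have "f (lo z) i = - f (lo z) i" using z by (metis uminus_apply)
      then have "scale 2 (f (lo z) i) = 0" using scale_left_distrib[of 1 1 "f (lo z) i"] by (simp add: eq_neg_iff_add_eq_0)
      then show "f (lo z) i = 0 i" using two_K by simp
    qed
    then have "lo z = 0" using inj[OF loP(1)] by blast
    moreover have "up z = 0" using z fz by simp
    moreover have "lo 0 = 0" "up 0 = 0" by (auto simp: lo_def up_def restr_def)
    ultimately show "z \<in> {0}" using eqI[OF z(1), of 0] by (auto simp: power_space_def)
  next
    show "z \<in> U 1 \<inter> U (- 1)" if "z \<in> {0}" for z using that sub[of 1] sub[of "- 1"] by (auto simp: subspace_on_def)
  qed
  have total: "{u + u' | u u'. u \<in> U 1 \<and> u' \<in> U (- 1)} = power_space (2 * m)"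
  proof (intro equalityI subsetI)
    fix z assume "z \<in> {u + u' | u u'. u \<in> U 1 \<and> u' \<in> U (- 1)}"
    then show "z \<in> power_space (2 * m)" using psp(1) by (auto simp: U_def)
  next
    fix z :: "nat \<Rightarrow> 'v" assume z: "z \<in> power_space (2 * m)"
    obtain x where x: "x \<in> ?P" "f x = up z" using surj[OF loP(2)] by blast
    let ?h = "pscale scale (inverse 2)"
    \<comment> \<open>With \<open>f x = up z\<close>, the equations \<open>a + b = lo z\<close> and
      \<open>f a - f b = up z\<close> are solved by half the sum and half the difference of
      \<open>lo z\<close> and \<open>x\<close>.\<close>
    define a b where "a = ?h (lo z + x)" and "b = ?h (lo z - x)"
    have ab: "a \<in> ?P" "b \<in> ?P" unfolding a_def b_def using loP(1)[of z] x(1) by (intro P.W_scale P.W_add P.W_diff; simp)+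
    have half: "?h w + ?h w = w" for w :: "nat \<Rightarrow> 'v"
      using two_K by (simp flip: P.scale_left_distrib)
    have "a + b = ?h (lo z) + ?h (lo z)" by (simp add: a_def b_def P.scale_right_distrib P.scale_right_diff_distrib)
    then have 1: "a + b = lo z" using half by simp
    have "a - b = ?h x + ?h x" by (simp add: a_def b_def P.scale_right_distrib P.scale_right_diff_distrib)
    then have 2: "a - b = x" using half by simp
    have up: "f a - f b = up z" using P.endo_diff[OF f(1) ab] 2 x by simp
    have fab: "f a \<in> ?P" "- f b \<in> ?P" using f(2)[OF ab(1)] P.W_minus[OF f(2)[OF ab(2)]] by auto
    note g = lo_glue[OF ab(1) fab(1)] lo_glue[OF ab(2) fab(2)]
    have "z = glue a (f a) + glue b (- f b)"
    proof (rule eqI[OF z psp(1)[OF g(3) g(6)]])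
      show "lo z = lo (glue a (f a) + glue b (- f b))" unfolding lo_add g using 1 by simp
      show "up z = up (glue a (f a) + glue b (- f b))" unfolding lo_add g using up by simp
    qed
    moreover have "glue a (f a) \<in> U 1" unfolding U_def using g(1-3) by simp
    moreover have "glue b (- f b) \<in> U (- 1)" unfolding U_def using g(4-6) by simp
    ultimately show "z \<in> {u + u' | u u'. u \<in> U 1 \<and> u' \<in> U (- 1)}" by blast
  qed
  show ?thesis unfolding hyperbolic_on_def
    using sub[of 1] sub[of "- 1"] inter total van[of _ 1] van[of _ "- 1"]
    by (intro exI[of _ "U 1"] exI[of _ "U (- 1)"]) auto
qed

end

section \<open>Dual bases and the existence of a maximal field\<close>

context gram
begin

lemma bf_single: "bf t x y = (\<Sum>b\<in>B. x b * bf t (single b 1) y)"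
proof -
  have "bf t (single b 1) y = (\<Sum>c\<in>B. G t b c * y c)" if "b \<in> B" for b
  proof -
    have "bf t (single b 1) y = (\<Sum>b'\<in>B. if b' = b then \<Sum>c\<in>B. G t b c * y c else 0)"
      unfolding gform_def by (intro sum.cong) (auto simp: single_def)
    then show ?thesis using that finite_B by simp
  qed
  then show ?thesis unfolding gform_def by (simp add: sum_distrib_left mult_ac)
qed

lemma bf_L:
  assumes "subfield_set L" "K0 \<subseteq> L" "x \<in> V L" "y \<in> V L" shows "bf t x y \<in> L"
proof -
  interpret field_carrier L by unfold_locales (rule assms(1))
  have "G t b c \<in> L" "x b \<in> L" "y c \<in> L" if "b \<in> B" "c \<in> B" for b c
    using G_K0[OF that] assms(2-4) that by (auto simp: pspace_def)
  then show ?thesis unfolding gform_def by (intro L_sum L_mult) auto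
qed

text \<open>Pairing with the unit vectors is an injective, hence surjective, map on coordinate
  vectors; \<open>H c\<close> is a preimage of a unit vector. The reproducing property refers to
  arbitrary coordinates, so a dual basis over a small field also serves the larger ones.\<close>

lemma dual_basis:
  assumes L: "subfield_set L" "K0 \<subseteq> L"
    and nondeg: "\<And>x. x \<in> V L \<Longrightarrow> (\<And>y. y \<in> V L \<Longrightarrow> bf t x y = 0) \<Longrightarrow> x = 0"
  shows "\<exists>H. \<forall>c\<in>B. H c \<in> V L \<and> (\<forall>x. bf t x (H c) = x c)"
proof -
  interpret V: formspace L sc "V L" bf by (rule formspace_V[OF L(1)])
  have single1: "single b 1 \<in> V L" if "b \<in> B" for b
    using that by (auto simp: single_def pspace_def)
  define \<phi> where "\<phi> y = (\<lambda>c. if c \<in> B then bf t (single c 1) y else 0)" for y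
  have lin: "linear_endo_on L sc (V L) \<phi>"
    unfolding linear_endo_on_def
  proof (intro conjI ballI)
    fix x assume x: "x \<in> V L"
    have "bf t (single c 1) x \<in> L" if "c \<in> B" for c using bf_L[OF L single1[OF that] x] .
    then show "\<phi> x \<in> V L" by (simp add: \<phi>_def pspace_def)
    show "\<phi> (x + y) = \<phi> x + \<phi> y" for y by (auto simp: \<phi>_def V.b_add_right fun_eq_iff)
    show "\<phi> (sc a x) = sc a (\<phi> x)" for a
      by (rule ext, simp add: \<phi>_def V.b_scale_right, simp add: pscale_def)
  qed
  have inj: "x = 0" if x: "x \<in> V L" "\<phi> x = 0" for x
  proof (rule nondeg[OF x(1)])
    fix y
    have "bf t (single b 1) x = 0" if "b \<in> B" for b using fun_cong[OF x(2), of b] that by (simp add: \<phi>_def)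
    then have "bf t y x = 0" by (subst bf_single) simp
    then show "bf t x y = 0" by (metis V.b_sym)
  qed
  obtain \<psi> where \<psi>: "linear_endo_on L sc (V L) \<psi>" "\<forall>y\<in>V L. \<phi> (\<psi> y) = y"
    using V.inj_imp_right_inverse[OF gen_V[OF L(1)] lin inj] by blast
  show ?thesis
  proof (intro exI[of _ "\<lambda>c. \<psi> (single c 1)"] ballI conjI allI)
    fix c x assume c: "c \<in> B"
    show "\<psi> (single c 1) \<in> V L" using \<psi>(1) single1[OF c] by (simp add: linear_endo_on_def)
    have "bf t (single b 1) (\<psi> (single c 1)) = (if b = c then 1 else 0)" if "b \<in> B" for b
      using fun_cong[OF \<psi>(2)[rule_format, OF single1[OF c]], of b] that
      by (simp add: \<phi>_def single_def)
    then have "bf t x (\<psi> (single c 1)) = (\<Sum>b\<in>B. if b = c then x b else 0)"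
      by (subst bf_single) (auto intro!: sum.cong)
    then show "bf t x (\<psi> (single c 1)) = x c" using c finite_B by simp
  qed
qed

text \<open>The inverse Gram matrix of \<open>t\<close> times the Gram matrix of \<open>t'\<close>,
  written by means of the dual basis.\<close>

lemma transition_map:
  assumes L: "subfield_set L" "K0 \<subseteq> L" and H: "\<forall>c\<in>B. H c \<in> V L \<and> (\<forall>x. bf t x (H c) = x c)"
  shows "\<exists>A. (\<forall>x y. A (x + y) = A x + A y) \<and> (\<forall>a x. A (sc a x) = sc a (A x)) \<and>
    (\<forall>x\<in>V L. A x \<in> V L) \<and> (\<forall>x y. bf t x (A y) = bf t' x y)"
proof -
  interpret V: formspace L sc "V L" bf by (rule formspace_V[OF L(1)])
  define A where "A y = (\<Sum>c\<in>B. sc (bf t' (single c 1) y) (H c))" for y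
  have "A (x + y) = A x + A y" for x y
    by (simp add: A_def V.b_add_right V.scale_left_distrib sum.distrib)
  moreover have "A (sc a x) = sc a (A x)" for a x
    by (simp add: A_def V.b_scale_right V.scale_sum_right)
  moreover have "A x \<in> V L" if "x \<in> V L" for x
    unfolding A_def
  proof (rule V.W_sum)
    fix c assume c: "c \<in> B"
    have "single c 1 \<in> V L" using c by (auto simp: single_def pspace_def)
    then show "sc (bf t' (single c 1) x) (H c) \<in> V L" using H c that by (intro V.W_scale bf_L[OF L]) auto
  qed
  moreover have "bf t x (A y) = bf t' x y" for x y
  proof -
    have "bf t x (A y) = (\<Sum>c\<in>B. x c * bf t' (single c 1) y)"
      unfolding A_def V.b_sum_right V.b_scale_right using H by (intro sum.cong) (auto simp: mult.commute)
    also have "\<dots> = bf t' x y" by (rule bf_single[symmetric])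
    finally show ?thesis .
  qed
  ultimately show ?thesis by blast
qed

text \<open>An anti-isometry has finitely many matrix entries, so it is defined over a member of the chain.\<close>

lemma maximal_nontorsion_exists:
  assumes "\<not> tor K0"
  shows "\<exists>L. subfield_set L \<and> K0 \<subseteq> L \<and> \<not> tor L \<and> (\<forall>E. subfield_set E \<longrightarrow> L \<subset> E \<longrightarrow> tor E)"
proof -
  define \<A> where "\<A> = {L. subfield_set L \<and> K0 \<subseteq> L \<and> \<not> tor L}"
  have "\<exists>M\<in>\<A>. \<forall>E\<in>\<A>. M \<subseteq> E \<longrightarrow> E = M"
  proof (rule subset_Zorn_nonempty)
    show "\<A> \<noteq> {}" using assms subfield_K0 by (auto simp: \<A>_def)
    fix C assume C: "C \<noteq> {}" "subset.chain \<A> C"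
    have CA: "\<And>L. L \<in> C \<Longrightarrow> subfield_set L \<and> K0 \<subseteq> L \<and> \<not> tor L" using C(2) by (auto simp: subset.chain_def \<A>_def)
    have two: "\<exists>L\<in>C. x \<in> L \<and> y \<in> L" if xy: "x \<in> \<Union>C" "y \<in> \<Union>C" for x y
    proof -
      obtain L where "L \<in> C" "{x, y} \<subseteq> L"
        by (rule finite_subset_Union_chain[of "{x, y}" C \<A>]) (use C xy in auto)
      then show ?thesis by blast
    qed
    have sub: "subfield_set (\<Union>C)"
      unfolding subfield_set_def
    proof (intro conjI ballI)
      show "0 \<in> \<Union>C" "1 \<in> \<Union>C" using C(1) CA by (auto simp: subfield_set_def)
      show "x + y \<in> \<Union>C" "x * y \<in> \<Union>C" if xy: "x \<in> \<Union>C" "y \<in> \<Union>C" for x y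
      proof -
        obtain L where L: "L \<in> C" "x \<in> L" "y \<in> L" using two[OF xy] by blast
        then have "x + y \<in> L" "x * y \<in> L" using CA[OF L(1)] unfolding subfield_set_def by blast+
        then show "x + y \<in> \<Union>C" "x * y \<in> \<Union>C" using L(1) by blast+
      qed
      show "- x \<in> \<Union>C" "inverse x \<in> \<Union>C" if x: "x \<in> \<Union>C" for x
      proof -
        obtain L where L: "L \<in> C" "x \<in> L" using x by blast
        then have "- x \<in> L" "inverse x \<in> L" using CA[OF L(1)] unfolding subfield_set_def by blast+
        then show "- x \<in> \<Union>C" "inverse x \<in> \<Union>C" using L(1) by blast+
      qed
    qed
    have "\<not> tor (\<Union>C)"
    proof
      assume "tor (\<Union>C)"
      then obtain I :: "nat set" where I: "finite I" "I \<noteq> {}" and anti: "anti (\<Union>C) sc (V (\<Union>C)) bf I (\<lambda>_. 1)"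
        unfolding tor_def by blast
      obtain f where f: "linear_endo_on (\<Union>C) (pscale sc) (pspace I (V (\<Union>C))) f"
        "\<And>x. x \<in> pspace I (V (\<Union>C)) \<Longrightarrow> f x \<in> pspace I (V (\<Union>C))"
        "\<And>t x y. x \<in> pspace I (V (\<Union>C)) \<Longrightarrow> y \<in> pspace I (V (\<Union>C)) \<Longrightarrow> dform I (\<lambda>_. 1) bf t (f x) (f y) = - dform I (\<lambda>_. 1) bf t x y"
        using anti_formD[OF anti] by blast
      define F where "F = (\<lambda>(i, b, j, c). f (single i (single b 1)) j c) ` (I \<times> B \<times> I \<times> B)"
      have s1: "single i (single b 1) \<in> pspace I (V L)" if "i \<in> I" "b \<in> B" "subfield_set L" for i b L
        using that by (auto simp: single_def pspace_def subfield_set_def)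
      have fin: "finite F" unfolding F_def using I finite_B by auto
      have "F \<subseteq> \<Union>C" unfolding F_def using f(2)[OF s1[OF _ _ sub]] by (auto simp: pspace_def)
      then obtain L where L: "L \<in> C" "F \<subseteq> L"
        by (rule finite_subset_Union_chain[OF fin _ C])
      have sL: "subfield_set L" using CA L by blast
      interpret VL: formspace L sc "V L" bf by (rule formspace_V[OF sL])
      interpret PL: lspace L "pscale sc" "pspace I (V L)" by (rule VL.lspace_pspace)
      have up: "pspace I (V L) \<subseteq> pspace I (V (\<Union>C))" using L by (auto simp: pspace_def)
      \<comment> \<open>An \<open>L\<close>-subspace that contains the unit vectors, because the
        matrix entries of \<open>f\<close> lie in \<open>L\<close>; hence \<open>f\<close> preserves
        the vectors over \<open>L\<close>.\<close>
      let ?U = "{x \<in> pspace I (V L). f x \<in> pspace I (V L)}"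
      have "f 0 = 0"
      proof -
        interpret VC: formspace "\<Union>C" sc "V (\<Union>C)" bf by (rule formspace_V[OF sub])
        interpret PC: lspace "\<Union>C" "pscale sc" "pspace I (V (\<Union>C))" by (rule VC.lspace_pspace)
        show ?thesis by (rule PC.endo_0[OF f(1)])
      qed
      moreover have "f (x + y) = f x + f y" if "x \<in> pspace I (V L)" "y \<in> pspace I (V L)" for x y
        using f(1) subsetD[OF up that(1)] subsetD[OF up that(2)] unfolding linear_endo_on_def by blast
      moreover have "f (pscale sc a x) = pscale sc a (f x)" if "a \<in> L" "x \<in> pspace I (V L)" for x a
      proof -
        have "a \<in> \<Union>C" "x \<in> pspace I (V (\<Union>C))" using that up L by auto
        then show ?thesis using f(1) unfolding linear_endo_on_def by blast
      qed
      ultimately have U: "subspace_on L (pscale sc) (pspace I (V L)) ?U"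
        unfolding subspace_on_def by (auto intro: PL.W_add PL.W_scale)
      have gens: "(\<Union>i\<in>I. single i ` (\<Union>b\<in>B. single b ` {1})) \<subseteq> ?U"
      proof
        fix x :: "nat \<Rightarrow> 'v \<Rightarrow> 'c" assume "x \<in> (\<Union>i\<in>I. single i ` (\<Union>b\<in>B. single b ` {1}))"
        then obtain i b where ib: "i \<in> I" "b \<in> B" "x = single i (single b 1)" by auto
        have fx: "f x \<in> pspace I (V (\<Union>C))" unfolding ib(3) by (rule f(2)[OF s1[OF ib(1,2) sub]])
        have "f x j c \<in> L" if "j \<in> I" "c \<in> B" for j c
          using L(2) that ib unfolding F_def by (auto simp: image_subset_iff)
        then have "f x \<in> pspace I (V L)" using fx by (auto simp: pspace_def)
        then show "x \<in> ?U" using s1[OF ib(1,2) sL] ib(3) by simp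
      qed
      have "?U = pspace I (V L)"
        using VL.gen_on_pspace[OF gen_V[OF sL] I(1)] U gens unfolding gen_on_def by blast
      then have fL: "\<And>x. x \<in> pspace I (V L) \<Longrightarrow> f x \<in> pspace I (V L)" by blast
      have "anti L sc (V L) bf I (\<lambda>_. 1)" unfolding anti_form_def
      proof (intro exI[of _ f] conjI allI ballI)
        show "linear_endo_on L (pscale sc) (pspace I (V L)) f"
          unfolding linear_endo_on_def
        proof (intro conjI ballI)
          show "f x \<in> pspace I (V L)" if "x \<in> pspace I (V L)" for x by (rule fL[OF that])
        qed fact+
        show "dform I (\<lambda>_. 1) bf t (f x) (f y) = - dform I (\<lambda>_. 1) bf t x y"
          if "x \<in> pspace I (V L)" "y \<in> pspace I (V L)" for t x y using that up by (intro f(3)) auto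
      qed
      then have "tor L" unfolding tor_def using I by blast
      then show False using CA L by blast
    qed
    moreover have "K0 \<subseteq> \<Union>C" using C(1) CA by blast
    ultimately show "\<Union>C \<in> \<A>" using sub by (simp add: \<A>_def)
  qed
  then obtain L where L: "L \<in> \<A>" "\<forall>E\<in>\<A>. L \<subseteq> E \<longrightarrow> E = L" by blast
  have "tor E" if "subfield_set E" "L \<subset> E" for E
  proof (rule ccontr)
    assume "\<not> tor E"
    then have "E \<in> \<A>" using that L(1) unfolding \<A>_def by blast
    then show False using L(2) that(2) by blast
  qed
  then show ?thesis using L(1) unfolding \<A>_def by blast
qed

end

section \<open>Base change\<close>

locale base_change = quad_system scale B q
  for scale :: "'k::field \<Rightarrow> 'v::ab_group_add \<Rightarrow> 'v" and B :: "'v set" and q +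
  fixes \<iota> :: "'k \<Rightarrow> 'l::field"
  assumes emb: "field_embedding \<iota>"
begin

lemma emb_0 [simp]: "\<iota> 0 = 0" and emb_1 [simp]: "\<iota> 1 = 1"
  and emb_add: "\<iota> (x + y) = \<iota> x + \<iota> y" and emb_mult: "\<iota> (x * y) = \<iota> x * \<iota> y"
  using emb field_embedding_0[OF emb] by (auto simp: field_embedding_def)

lemma emb_minus: "\<iota> (- x) = - \<iota> x"
  using emb_add[of x "- x"] by (simp add: eq_neg_iff_add_eq_0 add.commute)

lemma emb_inverse: "\<iota> (inverse x) = inverse (\<iota> x)"
proof (cases "x = 0")
  case False
  then have "\<iota> x * \<iota> (inverse x) = 1" by (simp flip: emb_mult)
  then show ?thesis by (metis inverse_unique)
qed simp

lemma emb_eq_0 [simp]: "\<iota> x = 0 \<longleftrightarrow> x = 0"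
proof
  assume "\<iota> x = 0"
  then have "\<iota> (x * inverse x) = 0" by (simp add: emb_mult)
  then show "x = 0" by (metis right_inverse emb_1 zero_neq_one)
qed simp

lemma emb_inj: "\<iota> x = \<iota> y \<Longrightarrow> x = y"
  using emb_add[of x "- y"] emb_eq_0[of "x - y"] by (simp add: emb_minus)

lemma two_L: "(2::'l) \<noteq> 0"
  using emb_eq_0[of "1 + 1"] two_K emb_add[of 1 1] by (simp del: emb_eq_0)

definition E :: "bool \<Rightarrow> 'v \<Rightarrow> 'v \<Rightarrow> 'l" where "E t b c = \<iota> (pol t b c)"

sublocale ext: gram B E "range \<iota>"
proof unfold_locales
  show "finite B" by (rule finite_Basis)
  show "E t b c = E t c b" for t b c by (simp add: E_def V.b_sym[of t b])
  show "E t b c \<in> range \<iota>" for t b c by (simp add: E_def)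
  show "subfield_set (range \<iota>)"
    unfolding subfield_set_def by (auto simp flip: emb_add emb_mult emb_minus emb_inverse) (metis emb_0 emb_1 rangeI)+
qed

lemma UNIV_subfield: "subfield_set (UNIV :: 'l set)" by (simp add: subfield_set_def)

lemma formspace_UNIV: "formspace UNIV ext.sc (ext.V UNIV) ext.bf"
  by (rule ext.formspace_V[OF UNIV_subfield])

sublocale U: formspace UNIV ext.sc "ext.V UNIV" ext.bf by (rule formspace_UNIV)

text \<open>The map \<open>v \<mapsto> v \<otimes> 1\<close> in the coordinates given by
  \<open>B\<close>.\<close>

definition ev :: "'v \<Rightarrow> 'v \<Rightarrow> 'l" where "ev v = (\<lambda>b. \<iota> (rep v b))"

lemma ev_add: "ev (v + w) = ev v + ev w" and ev_scale: "ev (scale a v) = ext.sc (\<iota> a) (ev v)"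
  by (auto simp: ev_def rep_add rep_scale emb_add emb_mult pscale_def)

lemma ev_in: "ev v \<in> ext.V (range \<iota>)"
  by (auto simp: ev_def pspace_def rep_outside)

lemma ev_in_UNIV: "ev v \<in> ext.V UNIV"
  by (auto simp: ev_def pspace_def rep_outside)

lemma ev_inj: "ev v = ev w \<Longrightarrow> v = w"
proof -
  assume "ev v = ev w"
  then have "rep v b = rep w b" for b using emb_inj unfolding ev_def by metis
  then show "v = w" using rep_sum[of v] rep_sum[of w] by simp
qed

lemma ev_eq_0: "ev v = 0 \<Longrightarrow> v = 0"
proof -
  assume "ev v = 0"
  moreover have "ev 0 = 0" using ev_add[of 0 0] by simp
  ultimately show "v = 0" by (metis ev_inj)
qed

lemma ev_surj:
  assumes "x \<in> ext.V (range \<iota>)" shows "\<exists>v. ev v = x"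
proof -
  have "\<forall>b\<in>B. \<exists>a. x b = \<iota> a" using assms by (auto simp: pspace_def)
  then obtain a where a: "\<And>b. b \<in> B \<Longrightarrow> x b = \<iota> (a b)" by metis
  have "ev (\<Sum>c\<in>B. scale (a c) c) b = x b" for b
    using a assms by (cases "b \<in> B") (auto simp: ev_def rep_comb_basis rep_outside pspace_def)
  then show ?thesis by blast
qed

lemma pol_comb: "pol t v w = (\<Sum>b\<in>B. rep v b * pol t b w)"
proof -
  have "pol t (\<Sum>b\<in>B. scale (rep v b) b) w = (\<Sum>b\<in>B. rep v b * pol t b w)"
    by (simp add: V.b_sum_left V.b_scale_left)
  then show ?thesis by (simp flip: rep_sum)
qed

lemma bf_ev: "ext.bf t (ev v) y = (\<Sum>c\<in>B. \<iota> (pol t v c) * y c)"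
proof -
  have "ext.bf t (ev v) y = (\<Sum>c\<in>B. \<Sum>b\<in>B. \<iota> (rep v b * pol t b c) * y c)"
    unfolding gform_def by (subst sum.swap) (simp add: E_def ev_def emb_mult mult.commute)
  also have "\<dots> = (\<Sum>c\<in>B. \<iota> (\<Sum>b\<in>B. rep v b * pol t b c) * y c)"
    by (simp add: field_embedding_sum[OF emb] sum_distrib_right)
  finally show ?thesis by (simp flip: pol_comb)
qed

lemma bf_ev_ev: "ext.bf t (ev v) (ev w) = \<iota> (pol t v w)"
proof -
  have "ext.bf t (ev v) (ev w) = \<iota> (\<Sum>c\<in>B. rep w c * pol t c v)"
    unfolding bf_ev by (simp add: ev_def field_embedding_sum[OF emb] emb_mult V.b_sym[of t v] mult.commute)
  then show ?thesis by (simp add: V.b_sym[of t v] flip: pol_comb)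
qed

lemma ext_form_eq: "ext_form \<iota> B (q t) x = ext.bf t x x"
  by (simp add: ext_form_def gform_def E_def pol_def)

lemma polar_ext_form: "polar (ext_form \<iota> B (q t)) x y = ext.bf t x y"
proof -
  have "ext_form \<iota> B (q t) (x + y) - ext_form \<iota> B (q t) x - ext_form \<iota> B (q t) y = 2 * ext.bf t x y"
    unfolding ext_form_eq U.b_simps U.b_sym[of t y x] by (simp add: algebra_simps)
  then show ?thesis using two_L by (simp add: polar_def)
qed

lemma nonsingular_combination:
  assumes "nonsingular_over \<iota> B (range q)"
  shows "\<exists>\<alpha>. \<forall>x\<in>ext.V UNIV. (\<forall>y\<in>ext.V UNIV. \<alpha> True * ext.bf True x y + \<alpha> False * ext.bf False x y = 0) \<longrightarrow> x = 0"
proof -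
  interpret F: Modules.module "\<lambda>c (h :: ('v \<Rightarrow> 'l) \<Rightarrow> 'l) x. c * h x" by unfold_locales (auto simp: fun_eq_iff algebra_simps)
  obtain h where h: "h \<in> F.span (ext_form \<iota> B ` range q)" "unimodular_on (ext_space B UNIV) h"
    using assms unfolding nonsingular_over_def by blast
  let ?P = "\<lambda>h. \<exists>\<alpha>. \<forall>x. h x = \<alpha> True * ext.bf True x x + \<alpha> False * ext.bf False x x"
  have "?P h"
    using h(1)
  proof (rule F.span_induct)
    show "F.subspace (Collect ?P)"
      unfolding F.subspace_def
    proof (intro conjI ballI allI)
      show "0 \<in> Collect ?P" by (auto intro: exI[of _ "\<lambda>_. 0"])
      show "g + h \<in> Collect ?P" if gh: "g \<in> Collect ?P" "h \<in> Collect ?P" for g h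
      proof -
        obtain \<alpha> \<beta> where "\<And>x. g x = \<alpha> True * ext.bf True x x + \<alpha> False * ext.bf False x x"
          "\<And>x. h x = \<beta> True * ext.bf True x x + \<beta> False * ext.bf False x x" using gh by auto
        then show ?thesis
          unfolding mem_Collect_eq by (intro exI[of _ "\<lambda>t. \<alpha> t + \<beta> t"]) (simp add: algebra_simps)
      qed
      show "(\<lambda>x. c * h x) \<in> Collect ?P" if hP: "h \<in> Collect ?P" for c h
      proof -
        obtain \<alpha> where "\<And>x. h x = \<alpha> True * ext.bf True x x + \<alpha> False * ext.bf False x x" using hP by auto
        then show ?thesis
          unfolding mem_Collect_eq by (intro exI[of _ "\<lambda>t. c * \<alpha> t"]) (simp add: algebra_simps)
      qed
    qed
    show "?P g" if g: "g \<in> ext_form \<iota> B ` range q" for g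
    proof -
      obtain t where t: "g = ext_form \<iota> B (q t)" using g by blast
      show ?thesis by (rule exI[of _ "\<lambda>u. if u = t then 1 else 0"]) (cases t; simp add: t ext_form_eq)
    qed
  qed
  then obtain \<alpha> where \<alpha>: "\<And>x. h x = \<alpha> True * ext.bf True x x + \<alpha> False * ext.bf False x x" by blast
  have pol: "polar h x y = \<alpha> True * ext.bf True x y + \<alpha> False * ext.bf False x y" for x y
  proof -
    have "h (x + y) - h x - h y = 2 * (\<alpha> True * ext.bf True x y + \<alpha> False * ext.bf False x y)"
      unfolding \<alpha> U.b_simps U.b_sym[of _ y x] by (simp add: algebra_simps)
    then show ?thesis using two_L by (simp add: polar_def)
  qed
  have "ext_space B UNIV = ext.V UNIV" by (simp add: ext_space_def pspace_def)
  then show ?thesis using h(2) unfolding unimodular_on_def pol by auto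
qed

text \<open>A vector in the radical of both forms stays in the radical of every combination after
  base change.\<close>

lemma joint_radical:
  assumes "nonsingular_over \<iota> B (range q)" "\<And>t y. pol t x y = 0" shows "x = 0"
proof (rule ev_eq_0)
  obtain \<alpha> where \<alpha>: "\<forall>x\<in>ext.V UNIV. (\<forall>y\<in>ext.V UNIV. \<alpha> True * ext.bf True x y + \<alpha> False * ext.bf False x y = 0) \<longrightarrow> x = 0"
    using nonsingular_combination[OF assms(1)] by blast
  show "ev x = 0" using \<alpha> ev_in_UNIV[of x] by (simp add: bf_ev assms(2))
qed

text \<open>Over the extension a combination \<open>M0 = b0 + r b1\<close> is regular. With
  \<open>Y\<close> the quotient of \<open>b1\<close> by \<open>M0\<close>, the form
  \<open>b0 + \<tau> b1\<close> is regular as soon as \<open>1 - (r - \<tau>) Y\<close> is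
  injective. This excludes only finitely many \<tau>, and \<open>K\<close> is infinite.\<close>

lemma regular_member:
  assumes ns: "nonsingular_over \<iota> B (range q)" and inf: "infinite (UNIV :: 'k set)"
  shows "\<exists>t0 \<tau>. \<forall>x. (\<forall>y. pol t0 x y + \<tau> * pol (\<not> t0) x y = 0) \<longrightarrow> x = 0"
proof -
  obtain \<alpha> where \<alpha>: "\<forall>x\<in>ext.V UNIV. (\<forall>y\<in>ext.V UNIV. \<alpha> True * ext.bf True x y + \<alpha> False * ext.bf False x y = 0) \<longrightarrow> x = 0"
    using nonsingular_combination[OF ns] by blast
  \<comment> \<open>The combination is divided by the coefficient at \<open>True\<close> if that is
    nonzero; otherwise \<open>t0\<close> is the other form and \<open>r = 0\<close>.\<close>
  define t0 where "t0 \<longleftrightarrow> \<alpha> True \<noteq> 0"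
  define r where "r = \<alpha> (\<not> t0) / \<alpha> t0"
  define M where "M u b c = (if u then E (\<not> t0) b c else E t0 b c + r * E (\<not> t0) b c)" for u b c
  interpret M: gram B M UNIV
    by unfold_locales (auto simp: M_def finite_Basis UNIV_subfield ext.G_sym)
  interpret MV: formspace UNIV ext.sc "ext.V UNIV" M.bf by (rule M.formspace_V[OF UNIV_subfield])
  have M1: "M.bf True x y = ext.bf (\<not> t0) x y" for x y by (simp add: gform_def M_def)
  have M0: "M.bf False x y = ext.bf t0 x y + r * ext.bf (\<not> t0) x y" for x y
    by (simp add: gform_def M_def distrib_right sum.distrib sum_distrib_left mult.assoc)
  have "\<alpha> True * ext.bf True x y + \<alpha> False * ext.bf False x y = \<alpha> t0 * M.bf False x y" for x y
    unfolding M0 r_def by (cases "\<alpha> True = 0"; cases "\<alpha> False = 0") (auto simp: t0_def algebra_simps)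
  then have "x = 0" if "x \<in> ext.V UNIV" "\<And>y. y \<in> ext.V UNIV \<Longrightarrow> M.bf False x y = 0" for x
    using \<alpha> that by simp
  then obtain H where H: "\<forall>c\<in>B. H c \<in> ext.V UNIV \<and> (\<forall>x. M.bf False x (H c) = x c)"
    using M.dual_basis[OF UNIV_subfield, of False] by auto
  obtain Y where Y: "\<And>x y. Y (x + y) = Y x + Y y" "\<And>a x. Y (ext.sc a x) = ext.sc a (Y x)"
    "\<And>x. x \<in> ext.V UNIV \<Longrightarrow> Y x \<in> ext.V UNIV" "\<And>x y. M.bf False x (Y y) = M.bf True x y"
    using M.transition_map[OF UNIV_subfield subset_UNIV H, of True] by blast
  have "inj (\<lambda>k. r - \<iota> k)" by (rule injI) (simp add: emb_inj)
  then have "infinite (range (\<lambda>k. r - \<iota> k))" using inf by (simp add: finite_image_iff)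
  then have "\<exists>\<mu>\<in>range (\<lambda>k. r - \<iota> k). \<forall>v\<in>ext.V UNIV. v = ext.sc \<mu> (Y v) \<longrightarrow> v = 0"
    by (intro U.pencil_regular_value[OF ext.gen_V[OF UNIV_subfield], where Z = "\<lambda>v. v"])
       (auto simp: linear_endo_on_def Y)
  then obtain \<tau> where \<tau>: "\<And>v. v \<in> ext.V UNIV \<Longrightarrow> v = ext.sc (r - \<iota> \<tau>) (Y v) \<Longrightarrow> v = 0" by blast
  have "x = 0" if x: "\<forall>y. pol t0 x y + \<tau> * pol (\<not> t0) x y = 0" for x
  proof (rule ev_eq_0, rule \<tau>[OF ev_in_UNIV], rule ext)
    fix c
    have z: "ext.bf t0 (ev x) y + \<iota> \<tau> * ext.bf (\<not> t0) (ev x) y = 0" for y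
    proof -
      have "ext.bf t0 (ev x) y + \<iota> \<tau> * ext.bf (\<not> t0) (ev x) y = (\<Sum>c\<in>B. \<iota> (pol t0 x c + \<tau> * pol (\<not> t0) x c) * y c)"
        by (simp add: bf_ev emb_add emb_mult distrib_right sum.distrib sum_distrib_left mult.assoc)
      then show ?thesis using x by simp
    qed
    show "ev x c = ext.sc (r - \<iota> \<tau>) (Y (ev x)) c"
    proof (cases "c \<in> B")
      case True
      have "M.bf False (ev x) (H c) = (r - \<iota> \<tau>) * M.bf True (ev x) (H c)"
        using z[of "H c"] unfolding M0 M1 by (simp add: algebra_simps eq_neg_iff_add_eq_0)
      also have "M.bf True (ev x) (H c) = M.bf False (Y (ev x)) (H c)"
        using MV.b_sym[of True "ev x" "H c"] MV.b_sym[of False "Y (ev x)" "H c"] Y(4)[of "H c" "ev x"] by simp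
      finally show ?thesis using H True by (simp add: pscale_def)
    next
      case False
      then show ?thesis using ev_in_UNIV[of x] Y(3)[OF ev_in_UNIV[of x]] by (simp add: pspace_def pscale_def)
    qed
  qed
  then show ?thesis by blast
qed

text \<open>\<open>ev\<close> is a bijection between \<open>V\<close> and the coordinate vectors
  over the image of \<open>K\<close>, along which the anti-isometry is carried back.\<close>

lemma anti_descent:
  assumes "ext.tor (range \<iota>)"
  shows "\<exists>m>0. anti UNIV scale UNIV pol {..<m::nat} (\<lambda>_. 1)"
proof -
  let ?K = "range \<iota>"
  obtain I :: "nat set" where I: "finite I" "I \<noteq> {}" and anti: "anti ?K ext.sc (ext.V ?K) ext.bf I (\<lambda>_. 1)"
    using assms unfolding ext.tor_def by blast
  let ?P = "pspace I (ext.V ?K)"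
  obtain f where f: "linear_endo_on ?K (pscale ext.sc) ?P f" "\<And>x. x \<in> ?P \<Longrightarrow> f x \<in> ?P"
    "\<And>t x y. x \<in> ?P \<Longrightarrow> y \<in> ?P \<Longrightarrow> dform I (\<lambda>_. 1) ext.bf t (f x) (f y) = - dform I (\<lambda>_. 1) ext.bf t x y"
    using anti_formD[OF anti] by blast
  define up where "up x = (\<lambda>i::nat. ev (x i))" for x
  have ev0: "ev 0 = 0" using ev_add[of 0 0] by simp
  have upP: "up x \<in> ?P" if "x \<in> pspace I UNIV" for x
    using that ev_in ev0 unfolding pspace_def[of I] by (simp add: up_def)
  have up_add: "up (x + y) = up x + up y" for x y by (auto simp: up_def ev_add)
  have up_scl: "up (pscale scale a x) = pscale ext.sc (\<iota> a) (up x)" for a x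
    by (simp add: up_def pscale_def[of scale] pscale_def[of ext.sc] ev_scale)
  have up_inj: "x = y" if "up x = up y" for x y
    using that ev_inj unfolding up_def by (metis ext)
  have "\<exists>x\<in>pspace I UNIV. up x = y" if y: "y \<in> ?P" for y
  proof -
    have "\<exists>v. ev v = y i" for i
      using y ev_surj ev0 unfolding pspace_def[of I] by (cases "i \<in> I") auto
    then obtain x where x: "\<And>i. ev (x i) = y i" by metis
    have "x i = 0" if "i \<notin> I" for i using x[of i] y that ev_eq_0 unfolding pspace_def[of I] by simp
    then have "x \<in> pspace I UNIV" by (simp add: pspace_def)
    moreover have "up x = y" using x by (auto simp: up_def)
    ultimately show ?thesis by blast
  qed
  then obtain dn where dn: "\<And>y. y \<in> ?P \<Longrightarrow> dn y \<in> pspace I UNIV \<and> up (dn y) = y" by metis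
  define g where "g x = dn (f (up x))" for x
  have g: "g x \<in> pspace I UNIV" "up (g x) = f (up x)" if "x \<in> pspace I UNIV" for x
    unfolding g_def using dn[OF f(2)[OF upP[OF that]]] by auto
  have form: "\<iota> (dform I (\<lambda>_. 1) pol t x y) = dform I (\<lambda>_. 1) ext.bf t (up x) (up y)" for t x y
    by (simp add: dform_def up_def bf_ev_ev field_embedding_sum[OF emb])
  interpret PV: lspace UNIV "pscale scale" "pspace I (UNIV :: 'v set)" by (rule V.lspace_pspace)
  have "anti UNIV scale UNIV pol I (\<lambda>_. 1)"
    unfolding anti_form_def
  proof (intro exI[of _ g] conjI allI ballI)
    show "linear_endo_on UNIV (pscale scale) (pspace I UNIV) g"
      unfolding linear_endo_on_def
    proof (intro conjI ballI)
      fix x assume x: "x \<in> pspace I (UNIV :: 'v set)"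
      show "g x \<in> pspace I UNIV" by (rule g(1)[OF x])
      show "g (x + y) = g x + g y" if y: "y \<in> pspace I UNIV" for y
        using f(1) upP[OF x] upP[OF y]
        by (intro up_inj) (simp add: g PV.W_add x y up_add linear_endo_on_def)
      show "g (pscale scale a x) = pscale scale a (g x)" for a
        using f(1) upP[OF x]
        by (intro up_inj) (simp add: g PV.W_scale x up_scl linear_endo_on_def)
    qed
    show "dform I (\<lambda>_. 1) pol t (g x) (g y) = - dform I (\<lambda>_. 1) pol t x y"
      if "x \<in> pspace I UNIV" "y \<in> pspace I UNIV" for t x y
      using f(3)[OF upP[OF that(1)] upP[OF that(2)]]
      by (intro emb_inj) (simp add: form emb_minus g that)
  qed
  moreover obtain h where h: "bij_betw h {0..<card I} I" using ex_bij_betw_nat_finite[OF I(1)] by blast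
  ultimately have "anti UNIV scale UNIV pol {0..<card I} (\<lambda>_. 1)"
    by (rule V.anti_reindex[where c = "\<lambda>_. 1"]) auto
  then show ?thesis using I by (intro exI[of _ "card I"]) (auto simp: atLeast0LessThan card_gt_0_iff)
qed

end

section \<open>The two implications\<close>

lemma power_space_eq: "power_space n = pspace {..<n} UNIV" "power_scale s = pscale s"
  by (auto simp: power_space_def pspace_def power_scale_def pscale_def fun_eq_iff)

lemma ext_space_eq: "ext_space B L = pspace B L" "ext_scale = pscale (*)"
  by (auto simp: ext_space_def pspace_def ext_scale_def pscale_def fun_eq_iff)

locale ac_system = base_change scale B q "to_ac :: 'k \<Rightarrow> 'k alg_closure"
  for scale :: "'k::field \<Rightarrow> 'v::ab_group_add \<Rightarrow> 'v" and B :: "'v set" and q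
begin

text \<open>Nonsingularity enters through \<open>rad\<close> and \<open>reg\<close>, which speak of
  \<open>K\<close> only: it is given over an unrelated extension, while the argument takes place in
  the algebraic closure.\<close>

lemma hyperbolic_of_signatures:
  assumes rad: "\<And>x. (\<And>t y. pol t x y = 0) \<Longrightarrow> x = 0"
    and reg: "infinite (UNIV :: 'k set) \<Longrightarrow> \<exists>t0 \<tau>. \<forall>x. (\<forall>y. pol t0 x y + \<tau> * pol (\<not> t0) x y = 0) \<longrightarrow> x = 0"
    and sig: "\<And>P R T h. field_ordering UNIV P \<Longrightarrow> is_real_closure P R T \<Longrightarrow>
      h \<in> Cl_on R ext.sc (ext.V R) (ext_form to_ac B ` range q) \<Longrightarrow> signature_on R T ext.sc (ext.V R) h = 0"
  shows "\<exists>n>0. hyperbolic_on UNIV (power_scale scale) (power_space n) (power_form n ` range q)"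
proof -
  have "ext.tor (range to_ac)"
  proof (rule ccontr)
    assume "\<not> ext.tor (range to_ac)"
    then obtain L where L: "subfield_set L" "range to_ac \<subseteq> L" "\<not> ext.tor L"
      "\<And>E. subfield_set E \<Longrightarrow> L \<subset> E \<Longrightarrow> ext.tor E"
      using ext.maximal_nontorsion_exists by blast
    interpret M: maximal_nontorsion B E "range to_ac" L
      using L two_L by unfold_locales auto
    \<comment> \<open>Characteristic 0 of the maximal field makes \<open>K\<close> infinite, so that
      \<open>reg\<close> applies.\<close>
    have "inj (of_nat :: nat \<Rightarrow> 'k)"
    proof (rule linorder_injI)
      fix m n :: nat assume mn: "m < n"
      show "of_nat m \<noteq> (of_nat n :: 'k)"
      proof
        assume "of_nat m = (of_nat n :: 'k)"
        then have "of_nat m = (of_nat n :: 'k alg_closure)" by (metis to_ac_of_nat)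
        moreover have "of_nat m + of_nat (n - m) = (of_nat n :: 'k alg_closure)"
          using mn by (simp flip: of_nat_add)
        ultimately have "of_nat (n - m) = (0 :: 'k alg_closure)" by (metis add_cancel_left_right)
        then show False using M.char_0[of "n - m"] mn by simp
      qed
    qed
    then have "infinite (UNIV :: 'k set)" by (metis finite_UNIV_inj_surj finite_subset infinite_UNIV_nat range_inj_infinite subset_UNIV)
    then obtain t0 \<tau> where t0: "\<And>x. (\<And>y. pol t0 x y + \<tau> * pol (\<not> t0) x y = 0) \<Longrightarrow> x = 0"
      using reg by blast
    \<comment> \<open>The pair is replaced by its regular combination over \<open>K\<close> and the
      form \<open>\<not> t0\<close>; \<open>bs\<close> below returns to the original pair.\<close>
    define N where "N u b c = (if u then E (\<not> t0) b c else E t0 b c + to_ac \<tau> * E (\<not> t0) b c)" for u b c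
    interpret N: gram B N "range to_ac"
    proof unfold_locales
      show "N u b c \<in> range to_ac" for u b c
        by (auto simp: N_def E_def simp flip: to_ac_add to_ac_mult)
      show "N u b c = N u c b" if "b \<in> B" "c \<in> B" for u b c
        using ext.G_sym[OF that] by (simp add: N_def)
    qed (rule finite_Basis ext.subfield_K0)+
    interpret NV: formspace L ext.sc "ext.V L" N.bf by (rule N.formspace_V[OF L(1)])
    have N1: "N.bf True x y = ext.bf (\<not> t0) x y" for x y by (simp add: gform_def N_def)
    have N0: "N.bf False x y = ext.bf t0 x y + to_ac \<tau> * ext.bf (\<not> t0) x y" for x y
      by (simp add: gform_def N_def distrib_right sum.distrib sum_distrib_left mult.assoc)
    have nd: "x = 0" if x: "x \<in> ext.V (range to_ac)" "\<And>y. y \<in> ext.V (range to_ac) \<Longrightarrow> N.bf False x y = 0" for x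
    proof -
      obtain v where v: "ev v = x" using ev_surj[OF x(1)] by blast
      have "v = 0"
      proof (rule t0)
        fix w
        have "to_ac (pol t0 v w + \<tau> * pol (\<not> t0) v w) = N.bf False x (ev w)"
          unfolding N0 v[symmetric] bf_ev_ev by simp
        also have "N.bf False x (ev w) = 0" by (rule x(2)[OF ev_in])
        finally show "pol t0 v w + \<tau> * pol (\<not> t0) v w = 0" by (simp only: to_ac_eq_0_iff)
      qed
      then show ?thesis using v ev_add[of 0 0] by simp
    qed
    obtain H where H: "\<forall>c\<in>B. H c \<in> ext.V (range to_ac) \<and> (\<forall>x. N.bf False x (H c) = x c)"
      using N.dual_basis[OF ext.subfield_K0 subset_refl nd] by blast
    have HL: "\<forall>c\<in>B. H c \<in> ext.V L \<and> (\<forall>x. N.bf False x (H c) = x c)"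
      using H L(2) by (auto simp: pspace_def)
    obtain A where A: "\<And>x y. A (x + y) = A x + A y" "\<And>a x. A (ext.sc a x) = ext.sc a (A x)"
      "\<And>x. x \<in> ext.V L \<Longrightarrow> A x \<in> ext.V L" "\<And>x y. N.bf False x (A y) = N.bf True x y"
      using N.transition_map[OF L(1,2) HL, of True] by blast
    have adj: "N.bf False (A x) y = N.bf False x (A y)" for x y
      unfolding A(4) NV.b_sym[of False "A x"] by (rule NV.b_sym)
    interpret Q: pencil_space L ext.sc "ext.V L" "N.bf False" A "\<Union>b\<in>B. single b ` {1}"
    proof (unfold_locales, goal_cases)
      case (1 x y) show ?case by (rule NV.b_sym)
    next case (2 x y z) show ?case by (rule NV.b_add_left)
    next case (3 a x y) show ?case by (rule NV.b_scale_left)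
    next case (4 x y) show ?case by (rule A(1))
    next case (5 a x) show ?case by (rule A(2))
    next case (6 x) then show ?case by (rule A(3))
    next case (7 x y) show ?case by (rule adj)
    next case (8 x y) then show ?case by (rule N.bf_L[OF L(1,2)])
    next case (9 x)
      show ?case
      proof
        fix c
        show "x c = 0 c"
        proof (cases "c \<in> B")
          case True
          then show ?thesis using HL 9(2)[of "H c"] by simp
        qed (use 9(1) in \<open>auto simp: pspace_def\<close>)
      qed
    next case 10 show ?case by (rule N.gen_V[OF L(1)])
    qed
    define P where "P = {a. to_ac a \<in> M.T}"
    have P: "field_ordering UNIV P"
      unfolding field_ordering_def P_def
    proof (intro conjI ballI impI)
      show "x \<in> {a. to_ac a \<in> M.T} \<or> - x \<in> {a. to_ac a \<in> M.T}" for x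
        using M.T_total[of "to_ac x"] L(2) by auto
      show "x = 0" if "x \<in> {a. to_ac a \<in> M.T}" "- x \<in> {a. to_ac a \<in> M.T}" for x
        using that M.T_antisym[of "to_ac x"] by auto
    qed (auto intro: M.T_add M.T_mult)
    have rc: "is_real_closure P L M.T"
      unfolding is_real_closure_def real_closed_def
    proof (intro conjI allI impI ballI)
      show "\<exists>y\<in>L. x = y\<^sup>2" if "x \<in> M.T" for x using that by (auto simp: M.T_def)
      show "\<exists>x\<in>L. poly p x = 0" if "(\<forall>i. poly.coeff p i \<in> L) \<and> odd (degree p)" for p
        using M.odd_root[of p] that by (simp add: M.Lpoly_def)
    qed (use L M.ordering in \<open>auto simp: P_def\<close>)
    have "signature_on L M.T ext.sc (ext.V L) (\<lambda>x. N.bf False x (Q.pT p x)) = 0" if p: "M.Lpoly p" for p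
    proof (rule sig[OF P rc])
      let ?h = "\<lambda>x. N.bf False x (Q.pT p x)"
      note pT = Q.glinD[OF Q.glin_pT[of p]]
      have two_L': "(2 :: 'k alg_closure) \<in> L" by (rule M.L_numeral)
      have h_polar: "polar ?h x y = N.bf False x (Q.pT p y)" for x y
      proof -
        have "?h (x + y) - ?h x - ?h y = 2 * N.bf False x (Q.pT p y)"
          using Q.pT_adj[of p x y] NV.b_sym[of False "Q.pT p x" y]
          by (simp add: pT NV.b_simps algebra_simps)
        then show ?thesis using two_L by (simp add: polar_def)
      qed
      have quadh: "quadratic_form_on L ext.sc (ext.V L) ?h"
        unfolding quadratic_form_on_def h_polar
        by (auto simp: NV.b_simps pT power2_eq_square intro!: N.bf_L[OF L(1,2)] Q.pT_W[OF p])
      let ?S = "ext_form to_ac B ` range q"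
      have "\<forall>x\<in>ext.V L. \<forall>y\<in>ext.V L. polar ?h (\<psi> x) y = polar ?h x (\<phi> y)"
        if "(\<phi>, \<psi>) \<in> adjoints_on L ext.sc (ext.V L) ?S" for \<phi> \<psi>
      proof (intro ballI)
        have \<phi>: "linear_endo_on L ext.sc (ext.V L) \<phi>" and \<psi>: "linear_endo_on L ext.sc (ext.V L) \<psi>"
          and e: "\<And>t x y. x \<in> ext.V L \<Longrightarrow> y \<in> ext.V L \<Longrightarrow> ext.bf t (\<psi> x) y = ext.bf t x (\<phi> y)"
          using that unfolding adjoints_on_def by (auto simp: polar_ext_form)
        have \<phi>W: "\<phi> x \<in> ext.V L" if "x \<in> ext.V L" for x using \<phi> that by (simp add: linear_endo_on_def)
        have b: "N.bf u (\<psi> x) y = N.bf u x (\<phi> y)" if "x \<in> ext.V L" "y \<in> ext.V L" for u x y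
          using e[OF that] by (cases u) (simp_all add: N0 N1)
        \<comment> \<open>An adjoint pair respects both forms and hence their quotient
          \<open>A\<close>: the two sides have the same pairing with every \<open>x\<close>.\<close>
        have \<phi>A: "\<phi> (A y) = A (\<phi> y)" if y: "y \<in> ext.V L" for y
        proof -
          have "N.bf False (\<phi> (A y) - A (\<phi> y)) x = 0" if x: "x \<in> ext.V L" for x
          proof -
            have "N.bf False x (\<phi> (A y)) = N.bf True (\<psi> x) y" using b[OF x A(3)[OF y], of False] A(4) by simp
            also have "\<dots> = N.bf False x (A (\<phi> y))" using b[OF x y, of True] A(4) by simp
            finally show ?thesis by (simp add: NV.b_diff_left NV.b_sym[of False x])
          qed
          then have "\<phi> (A y) - A (\<phi> y) = 0" using y by (intro Q.nondeg) (auto intro!: NV.W_diff \<phi>W A(3))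
          then show ?thesis by simp
        qed
        have \<phi>p: "\<phi> (Q.pT p y) = Q.pT p (\<phi> y)" if y: "y \<in> ext.V L" for y
          using p
        proof (induction p)
          case 0
          then show ?case using NV.endo_0[OF \<phi>] by (simp add: zero_fun_def)
        next
          case (pCons a p)
          then have a: "a \<in> L" and p: "M.Lpoly p" by (auto simp: M.Lpoly_pCons)
          have py: "Q.pT p y \<in> ext.V L" by (rule Q.pT_W[OF p y])
          have "\<phi> (Q.pT (pCons a p) y) = \<phi> (ext.sc a y) + \<phi> (A (Q.pT p y))"
            unfolding Q.pT_pCons using \<phi> NV.W_scale[OF a y] A(3)[OF py] unfolding linear_endo_on_def by blast
          also have "\<phi> (ext.sc a y) = ext.sc a (\<phi> y)" using \<phi> a y unfolding linear_endo_on_def by blast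
          also have "\<phi> (A (Q.pT p y)) = A (Q.pT p (\<phi> y))" using \<phi>A[OF py] pCons.IH[OF p] by simp
          finally show ?case by (simp add: Q.pT_pCons)
        qed
        fix x y assume xy: "x \<in> ext.V L" "y \<in> ext.V L"
        show "polar ?h (\<psi> x) y = polar ?h x (\<phi> y)"
          unfolding h_polar b[OF xy(1) Q.pT_W[OF p xy(2)]] \<phi>p[OF xy(2)] ..
      qed
      then have "adjoints_on L ext.sc (ext.V L) (insert ?h ?S) = adjoints_on L ext.sc (ext.V L) ?S"
        unfolding adjoints_on_def by blast
      then show "?h \<in> Cl_on L ext.sc (ext.V L) ?S" using quadh by (simp add: Cl_on_def)
    qed
    then obtain I :: "bool list set" where I: "finite I" "I \<noteq> {}" "anti L ext.sc (ext.V L) Q.sys I (\<lambda>_. 1)"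
      using Q.anti_of_signatures by blast
    let ?W = "pspace I (ext.V L)"
    obtain f where f: "linear_endo_on L (pscale ext.sc) ?W f"
      "\<And>u x y. x \<in> ?W \<Longrightarrow> y \<in> ?W \<Longrightarrow> dform I (\<lambda>_. 1) Q.sys u (f x) (f y) = - dform I (\<lambda>_. 1) Q.sys u x y"
      using anti_formD[OF I(3)] by blast
    have bs: "ext.bf t x y = (if t = t0 then Q.sys False x y - to_ac \<tau> * Q.sys True x y else Q.sys True x y)" for t x y
    proof -
      have "Q.sys True x y = ext.bf (\<not> t0) x y" by (simp add: Q.sys_def A(4) N1)
      moreover have "Q.sys False x y = ext.bf t0 x y + to_ac \<tau> * ext.bf (\<not> t0) x y" by (simp add: Q.sys_def N0)
      ultimately show ?thesis by (cases t; cases t0) simp_all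
    qed
    have ds: "dform I (\<lambda>_. 1) ext.bf t x y = (if t = t0
        then dform I (\<lambda>_. 1) Q.sys False x y - to_ac \<tau> * dform I (\<lambda>_. 1) Q.sys True x y
        else dform I (\<lambda>_. 1) Q.sys True x y)" for t x y
      by (simp add: dform_def bs sum_subtractf sum_distrib_left)
    have "anti L ext.sc (ext.V L) ext.bf I (\<lambda>_. 1)"
      unfolding anti_form_def using f by (intro exI[of _ f]) (simp add: ds algebra_simps)
    then have "ext.tor L" using I by (intro ext.tor_of_anti[OF L(1)]) auto
    then show False using L(3) by blast
  qed
  then obtain m :: nat where m: "m > 0" "anti UNIV scale UNIV pol {..<m} (\<lambda>_. 1)"
    using anti_descent by blast
  show ?thesis using hyperbolic_of_anti[OF m(2,1) rad] m(1) by (intro exI[of _ "2 * m"]) auto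
qed

end

section \<open>From a hyperbolic splitting to vanishing signatures\<close>

context quad_system
begin

text \<open>The involution that is 1 on \<open>U\<close> and -1 on \<open>U'\<close> is anti-adjoint
  to itself, since every form pairs \<open>U\<close> nontrivially only with \<open>U'\<close>. It is
  written as a matrix of endomorphisms of \<open>V\<close> so that it can be extended to other
  fields entry by entry.\<close>

lemma anti_adjoint_matrix:
  assumes "hyperbolic_on UNIV (power_scale scale) (power_space n) (power_form n ` range q)"
  shows "\<exists>\<sigma>. (\<forall>i j x y. \<sigma> i j (x + y) = \<sigma> i j x + \<sigma> i j y) \<and> (\<forall>i j a x. \<sigma> i j (scale a x) = scale a (\<sigma> i j x)) \<and>
    (\<forall>t i j x y. i < n \<longrightarrow> j < n \<longrightarrow> pol t (\<sigma> j i x) y = - pol t x (\<sigma> i j y)) \<and>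
    (\<forall>j k x. j < n \<longrightarrow> k < n \<longrightarrow> (\<Sum>i<n. \<sigma> j i (\<sigma> i k x)) = (if j = k then x else 0))"
proof -
  let ?W = "pspace {..<n} (UNIV :: 'v set)" and ?s = "pscale scale"
  let ?b = "dform {..<n} (\<lambda>_. 1) pol"
  interpret P: formspace UNIV ?s ?W ?b by (rule V.formspace_dform)
  obtain U U' where U: "subspace_on UNIV ?s ?W U" and U': "subspace_on UNIV ?s ?W U'"
    and int: "U \<inter> U' = {0}" and tot: "{u + u' | u u'. u \<in> U \<and> u' \<in> U'} = ?W"
    and van: "\<And>t x. x \<in> U \<Longrightarrow> power_form n (q t) x = 0" "\<And>t x. x \<in> U' \<Longrightarrow> power_form n (q t) x = 0"
    using assms unfolding hyperbolic_on_def power_space_eq by auto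
  interpret U: lspace UNIV ?s U by (rule P.subspace_lspace[OF U])
  interpret U': lspace UNIV ?s U' by (rule P.subspace_lspace[OF U'])
  have UW: "U \<subseteq> ?W" "U' \<subseteq> ?W" using U U' by (auto simp: subspace_on_def)
  have pf: "power_form n (q t) x = ?b t x x" for t x
    by (simp add: power_form_def dform_def q_pol)
  have iso: "?b t x y = 0" if "?b t x x = 0" "?b t y y = 0" "?b t (x + y) (x + y) = 0" for t x y
  proof -
    have "2 * ?b t x y = 0" using that by (simp add: P.b_simps P.b_sym[of t y x])
    then show ?thesis using two_K by simp
  qed
  have isoU: "?b t x y = 0" if "x \<in> U" "y \<in> U" for t x y
    by (rule iso; unfold pf[symmetric]; intro van(1) U.W_add that)
  have isoU': "?b t x y = 0" if "x \<in> U'" "y \<in> U'" for t x y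
    by (rule iso; unfold pf[symmetric]; intro van(2) U'.W_add that)
  have uniq: "u = v \<and> u' = v'" if "u \<in> U" "v \<in> U" "u' \<in> U'" "v' \<in> U'" "u + u' = v + v'" for u v u' v'
  proof -
    have "u - v = v' - u'" using that(5) by (simp add: algebra_simps)
    then have "u - v \<in> U \<inter> U'" using U.W_diff[OF that(1,2)] U'.W_diff[OF that(4,3)] by simp
    then have "u - v = 0" using int by blast
    then show ?thesis using that(5) by simp
  qed
  \<comment> \<open>A choice of components; by \<open>uniq\<close> it agrees with any given
    decomposition.\<close>
  define D where "D z = (SOME p. fst p \<in> U \<and> snd p \<in> U' \<and> z = fst p + snd p)" for z
  define \<sigma> where "\<sigma> z = fst (D z) - snd (D z)" for z
  have \<sigma>: "\<sigma> (u + u') = u - u'" if u: "u \<in> U" "u' \<in> U'" for u u'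
  proof -
    have "fst (D (u + u')) \<in> U \<and> snd (D (u + u')) \<in> U' \<and> u + u' = fst (D (u + u')) + snd (D (u + u'))"
      unfolding D_def by (rule someI[of _ "(u, u')"]) (use u in auto)
    then show ?thesis using uniq[OF u(1) _ u(2)] unfolding \<sigma>_def by metis
  qed
  have dec: "\<exists>u\<in>U. \<exists>u'\<in>U'. z = u + u'" if "z \<in> ?W" for z using tot that by blast
  have \<sigma>W: "\<sigma> z \<in> ?W" if z: "z \<in> ?W" for z
  proof -
    obtain u u' where u: "u \<in> U" "u' \<in> U'" "z = u + u'" using dec[OF z] by blast
    have "u - u' \<in> ?W" using u UW by (intro P.W_diff) auto
    then show ?thesis using \<sigma>[OF u(1,2)] u(3) by simp
  qed
  have \<sigma>_add: "\<sigma> (z + w) = \<sigma> z + \<sigma> w" if zw: "z \<in> ?W" "w \<in> ?W" for z w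
  proof -
    obtain u u' where u: "u \<in> U" "u' \<in> U'" "z = u + u'" using dec[OF zw(1)] by blast
    obtain v v' where v: "v \<in> U" "v' \<in> U'" "w = v + v'" using dec[OF zw(2)] by blast
    have "z + w = (u + v) + (u' + v')" using u v by (simp add: algebra_simps)
    then have "\<sigma> (z + w) = (u + v) - (u' + v')" using \<sigma>[OF U.W_add[OF u(1) v(1)] U'.W_add[OF u(2) v(2)]] by simp
    also have "\<dots> = \<sigma> z + \<sigma> w" unfolding u(3) v(3) \<sigma>[OF u(1,2)] \<sigma>[OF v(1,2)] by (simp add: algebra_simps)
    finally show ?thesis .
  qed
  have \<sigma>_scl: "\<sigma> (?s a z) = ?s a (\<sigma> z)" if z: "z \<in> ?W" for z a
  proof -
    obtain u u' where u: "u \<in> U" "u' \<in> U'" "z = u + u'" using dec[OF z] by blast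
    have "\<sigma> (?s a u + ?s a u') = ?s a u - ?s a u'" using U.W_scale[of a] U'.W_scale[of a] u by (intro \<sigma>) auto
    then show ?thesis unfolding u(3) \<sigma>[OF u(1,2)] by (simp add: P.scale_right_distrib P.scale_right_diff_distrib)
  qed
  have \<sigma>\<sigma>: "\<sigma> (\<sigma> z) = z" if z: "z \<in> ?W" for z
  proof -
    obtain u u' where u: "u \<in> U" "u' \<in> U'" "z = u + u'" using dec[OF z] by blast
    then show ?thesis using \<sigma>[OF u(1,2)] \<sigma>[OF u(1) U'.W_minus[OF u(2)]] by simp
  qed
  have \<sigma>_anti: "?b t (\<sigma> z) w = - ?b t z (\<sigma> w)" if zw: "z \<in> ?W" "w \<in> ?W" for t z w
  proof -
    obtain u u' where u: "u \<in> U" "u' \<in> U'" "z = u + u'" using dec[OF zw(1)] by blast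
    obtain v v' where v: "v \<in> U" "v' \<in> U'" "w = v + v'" using dec[OF zw(2)] by blast
    show ?thesis unfolding u(3) v(3) \<sigma>[OF u(1,2)] \<sigma>[OF v(1,2)]
      by (simp add: P.b_simps P.b_diff_left P.b_diff_right isoU[OF u(1) v(1)] isoU'[OF u(2) v(2)])
  qed
  have sW: "single i x \<in> ?W" if "i < n" for i x using that by (auto simp: single_def pspace_def)
  have b1: "?b t z (single j y) = pol t (z j) y" if "j < n" for t z j y
  proof -
    have "?b t z (single j y) = (\<Sum>i<n. if i = j then pol t (z i) y else 0)"
      unfolding dform_def by (intro sum.cong) (auto simp: single_def)
    then show ?thesis using that by simp
  qed
  \<comment> \<open>Columns from \<open>n\<close> on are set to 0, so that linearity of the entries
    holds for all indices.\<close>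
  define \<tau> where "\<tau> i j x = (if j < n then \<sigma> (single j x) i else 0)" for i j x
  have "\<tau> i j (x + y) = \<tau> i j x + \<tau> i j y" for i j x y
    by (simp add: \<tau>_def single_add \<sigma>_add sW)
  moreover have "\<tau> i j (scale a x) = scale a (\<tau> i j x)" for i j a x
  proof (cases "j < n")
    case True
    have "single j (scale a x) = ?s a (single j x)" by (auto simp: single_def pscale_def)
    then show ?thesis using \<sigma>_scl[OF sW[OF True], of a x] True by (simp add: \<tau>_def pscale_def)
  qed (simp add: \<tau>_def)
  moreover have "pol t (\<tau> j i x) y = - pol t x (\<tau> i j y)" if ij: "i < n" "j < n" for t i j x y
  proof -
    have "pol t (\<tau> j i x) y = ?b t (\<sigma> (single i x)) (single j y)" using b1[OF ij(2)] ij by (simp add: \<tau>_def)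
    also have "\<dots> = - ?b t (\<sigma> (single j y)) (single i x)" using \<sigma>_anti[OF sW[OF ij(1)] sW[OF ij(2)]] P.b_sym by metis
    also have "\<dots> = - pol t x (\<tau> i j y)" using b1[OF ij(1)] ij V.b_sym[of t x] by (simp add: \<tau>_def)
    finally show ?thesis .
  qed
  moreover have "(\<Sum>i<n. \<tau> j i (\<tau> i k x)) = (if j = k then x else 0)" if jk: "j < n" "k < n" for j k x
  proof -
    let ?z = "\<sigma> (single k x)"
    have z: "?z \<in> ?W" by (rule \<sigma>W[OF sW[OF jk(2)]])
    have sum: "\<sigma> (\<Sum>i\<in>I. single i (?z i)) = (\<Sum>i\<in>I. \<sigma> (single i (?z i)))" if "I \<subseteq> {..<n}" for I
    proof -
      have "finite I" using that finite_subset by blast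
      then show ?thesis using that
      proof (induction I)
        case empty
        have "\<sigma> (0 + 0) = 0 - 0" by (rule \<sigma>) auto
        then show ?case by (simp only: sum.empty add_0_left diff_0_right)
      next
        case (insert i I)
        have "(\<Sum>i\<in>I. single i (?z i)) \<in> ?W" using insert.prems by (intro P.W_sum sW) auto
        moreover have "i < n" "I \<subseteq> {..<n}" using insert.prems by auto
        ultimately show ?case by (simp only: sum.insert[OF insert.hyps] \<sigma>_add[OF sW] insert.IH)
      qed
    qed
    have "single k x = \<sigma> ?z" using \<sigma>\<sigma>[OF sW[OF jk(2)]] by simp
    also have "\<dots> = \<sigma> (\<Sum>i<n. single i (?z i))" using pspace_eq_sum_single[OF _ z] by simp
    also have "\<dots> = (\<Sum>i<n. \<sigma> (single i (?z i)))" by (rule sum) simp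
    finally have "single k x j = (\<Sum>i<n. \<sigma> (single i (?z i))) j" by simp
    also have "(\<Sum>i<n. \<sigma> (single i (?z i))) j = (\<Sum>i<n. \<sigma> (single i (?z i)) j)"
      by (induction n) auto
    finally have "single k x j = (\<Sum>i<n. \<sigma> (single i (?z i)) j)" .
    then show ?thesis using jk by (simp add: \<tau>_def single_def)
  qed
  ultimately show ?thesis by blast
qed

end

context base_change
begin

text \<open>The base change of a linear map \<open>g\<close>, determined by its values on the
  basis.\<close>

definition ex :: "('v \<Rightarrow> 'v) \<Rightarrow> ('v \<Rightarrow> 'l) \<Rightarrow> 'v \<Rightarrow> 'l" where
  "ex g x = (\<Sum>c\<in>B. ext.sc (x c) (ev (g c)))"

lemma ex_add: "ex g (x + y) = ex g x + ex g y" and ex_scale: "ex g (ext.sc a x) = ext.sc a (ex g x)"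
  by (simp_all add: ex_def U.scale_left_distrib sum.distrib U.scale_sum_right) (simp add: pscale_def)

lemma ex_sum: "ex g (sum h I) = (\<Sum>i\<in>I. ex g (h i))"
proof (induction I rule: infinite_finite_induct)
  case (insert i I)
  then show ?case by (simp only: sum.insert[OF insert.hyps] ex_add insert.IH)
qed (simp_all add: ex_def)

lemma ex_endo:
  assumes "subfield_set L" "range \<iota> \<subseteq> L" shows "linear_endo_on L ext.sc (ext.V L) (ex g)"
proof -
  interpret VL: formspace L ext.sc "ext.V L" ext.bf by (rule ext.formspace_V[OF assms(1)])
  have "ev v \<in> ext.V L" for v using ev_in[of v] assms(2) by (auto simp: pspace_def)
  then have "ex g x \<in> ext.V L" if "x \<in> ext.V L" for x
    unfolding ex_def using that by (intro VL.W_sum VL.W_scale) (auto simp: pspace_def)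
  then show ?thesis by (auto simp: linear_endo_on_def ex_add ex_scale)
qed

lemma ev_sum: "ev (sum h I) = (\<Sum>i\<in>I. ev (h i))"
proof -
  have "ev 0 = 0" using ev_add[of 0 0] by simp
  then show ?thesis by (induction I rule: infinite_finite_induct) (auto simp: ev_add)
qed

lemma ev_basis: "c \<in> B \<Longrightarrow> ev c = single c 1"
  by (auto simp: ev_def rep_basis single_def)

lemma ex_id: "x \<in> ext.V L \<Longrightarrow> ex (\<lambda>v. v) x = x"
proof -
  assume x: "x \<in> ext.V L"
  have "ex (\<lambda>v. v) x = (\<Sum>c\<in>B. single c (x c))"
    unfolding ex_def by (intro sum.cong) (auto simp: ev_basis single_def pscale_def)
  then show ?thesis using pspace_eq_sum_single[OF finite_Basis x] by simp
qed

lemma ex_ev: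
  assumes "\<And>x y. g (x + y) = g x + g y" "\<And>a x. g (scale a x) = scale a (g x)"
  shows "ex g (ev v) = ev (g v)"
proof -
  have "g 0 = 0" using assms(1)[of 0 0] by simp
  then have "g (\<Sum>b\<in>A. scale (rep v b) b) = (\<Sum>b\<in>A. scale (rep v b) (g b))" for A
    by (induction A rule: infinite_finite_induct) (auto simp: assms)
  then have "g v = (\<Sum>b\<in>B. scale (rep v b) (g b))" by (metis rep_sum)
  then show ?thesis by (simp add: ex_def ev_sum ev_scale) (simp add: ev_def)
qed

lemma ex_comp:
  assumes "\<And>x y. g (x + y) = g x + g y" "\<And>a x. g (scale a x) = scale a (g x)"
  shows "ex g (ex h x) = ex (\<lambda>v. g (h v)) x"
  by (simp add: ex_def[of h] ex_sum ex_scale ex_ev[OF assms]) (simp add: ex_def)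

lemma ex_sum_maps: "(\<Sum>i\<in>I. ex (h i) x) = ex (\<lambda>v. \<Sum>i\<in>I. h i v) x"
  unfolding ex_def by (subst sum.swap) (simp add: ev_sum U.scale_sum_right)

lemma ex_adjoint:
  assumes "\<And>x y. pol t (g x) y = - pol t x (h y)"
  shows "ext.bf t (ex g x) y = - ext.bf t x (ex h y)"
proof -
  have "ext.bf t (ex g x) y = (\<Sum>c\<in>B. x c * (\<Sum>b\<in>B. \<iota> (pol t (g c) b) * y b))"
    by (simp add: ex_def U.b_sum_left U.b_scale_left bf_ev)
  also have "\<dots> = (\<Sum>c\<in>B. \<Sum>b\<in>B. - (y b * (\<iota> (pol t (h b) c) * x c)))"
    by (simp add: assms emb_minus sum_distrib_left V.b_sym[of t _ "h _"] mult_ac)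
  also have "\<dots> = - (\<Sum>b\<in>B. y b * ext.bf t (ev (h b)) x)"
    by (subst sum.swap) (simp add: bf_ev sum_negf sum_distrib_left)
  also have "\<dots> = - ext.bf t (ex h y) x"
    by (simp add: ex_def U.b_sum_left U.b_scale_left)
  finally show ?thesis by (simp add: U.b_sym[of t x])
qed

end

context ac_system
begin

text \<open>The pairs \<open>(\<lambda>x. - \<tau> i j x, \<tau> j i)\<close> belong to the algebra
  of adjoints over \<open>R\<close>, so by the definition of the closure they are adjoint for
  \<open>h\<close> as well. Hence the involution reverses the sign of the multiple of
  \<open>h\<close>.\<close>

lemma signature_of_hyperbolic:
  assumes n: "0 < n" and hyp: "hyperbolic_on UNIV (power_scale scale) (power_space n) (power_form n ` range q)"
    and R: "subfield_set R" "field_ordering R T" "range to_ac \<subseteq> R"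
    and h: "h \<in> Cl_on R ext.sc (ext.V R) (ext_form to_ac B ` range q)"
  shows "signature_on R T ext.sc (ext.V R) h = 0"
proof -
  obtain \<sigma> where \<sigma>: "\<And>i j x y. \<sigma> i j (x + y) = \<sigma> i j x + \<sigma> i j y" "\<And>i j a x. \<sigma> i j (scale a x) = scale a (\<sigma> i j x)"
    and \<sigma>_anti: "\<And>t i j x y. i < n \<Longrightarrow> j < n \<Longrightarrow> pol t (\<sigma> j i x) y = - pol t x (\<sigma> i j y)"
    and \<sigma>\<sigma>: "\<And>j k x. j < n \<Longrightarrow> k < n \<Longrightarrow> (\<Sum>i<n. \<sigma> j i (\<sigma> i k x)) = (if j = k then x else 0)"
    using anti_adjoint_matrix[OF hyp] by blast
  interpret VR: formspace R ext.sc "ext.V R" ext.bf by (rule ext.formspace_V[OF R(1)])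
  interpret O: ordered_space R ext.sc "ext.V R" T "\<Union>b\<in>B. single b ` {1}"
    by unfold_locales (rule R(2) ext.gen_V[OF R(1)])+
  let ?V = "ext.V R" and ?S = "ext_form to_ac B ` range q"
  define \<tau> where "\<tau> i j = ex (\<sigma> i j)" for i j
  have \<tau>_endo: "linear_endo_on R ext.sc ?V (\<tau> i j)" for i j unfolding \<tau>_def by (rule ex_endo[OF R(1,3)])
  have \<tau>W: "\<tau> i j x \<in> ?V" if "x \<in> ?V" for i j x using \<tau>_endo that by (simp add: linear_endo_on_def)
  have quadh: "quadratic_form_on R ext.sc ?V h" and adj: "adjoints_on R ext.sc ?V (insert h ?S) = adjoints_on R ext.sc ?V ?S"
    using h by (auto simp: Cl_on_def)
  have hR: "h x \<in> R" if "x \<in> ?V" for x using quadh that by (simp add: quadratic_form_on_def)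
  have h_scl: "h (ext.sc a x) = a\<^sup>2 * h x" if "a \<in> R" "x \<in> ?V" for a x using quadh that by (simp add: quadratic_form_on_def)
  define \<phi> where "\<phi> = polar h"
  have \<phi>_sym: "\<phi> x y = \<phi> y x" for x y unfolding \<phi>_def by (rule polar_sym)
  have \<phi>_add: "\<phi> (x + y) z = \<phi> x z + \<phi> y z" if "x \<in> ?V" "y \<in> ?V" "z \<in> ?V" for x y z
    using quadh that by (simp add: quadratic_form_on_def \<phi>_def)
  have \<phi>_scl: "\<phi> (ext.sc a x) y = a * \<phi> x y" if "a \<in> R" "x \<in> ?V" "y \<in> ?V" for a x y
    using quadh that by (simp add: quadratic_form_on_def \<phi>_def)
  have \<phi>R: "\<phi> x y \<in> R" if "x \<in> ?V" "y \<in> ?V" for x y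
    unfolding \<phi>_def polar_def using that hR VR.W_add by (intro VR.L_divide VR.L_diff VR.L_numeral) auto
  have h\<phi>: "h x = \<phi> x x" if x: "x \<in> ?V" for x
  proof -
    have "x + x = ext.sc 2 x" using U.scale_left_distrib[of 1 1 x] by simp
    then have "h (x + x) = 4 * h x" using h_scl[OF VR.L_numeral x] by simp
    then show ?thesis using two_L by (simp add: \<phi>_def polar_def)
  qed
  have \<phi>_0: "\<phi> 0 y = 0" if "y \<in> ?V" for y using \<phi>_scl[OF VR.L_0 VR.W_0 that] by simp
  have \<phi>_sum: "\<phi> (\<Sum>i\<in>I. g i) y = (\<Sum>i\<in>I. \<phi> (g i) y)" if "\<And>i. i \<in> I \<Longrightarrow> g i \<in> ?V" "y \<in> ?V" for g y and I :: "nat set"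
    using that
  proof (induction I rule: infinite_finite_induct)
    case (insert i I)
    then have "(\<Sum>i\<in>I. g i) \<in> ?V" by (intro VR.W_sum) auto
    then have "\<phi> (g i + (\<Sum>i\<in>I. g i)) y = \<phi> (g i) y + \<phi> (\<Sum>i\<in>I. g i) y" using insert.prems by (intro \<phi>_add) auto
    moreover have "\<phi> (\<Sum>i\<in>I. g i) y = (\<Sum>i\<in>I. \<phi> (g i) y)" using insert.prems by (intro insert.IH) auto
    ultimately show ?case by (simp only: sum.insert[OF insert.hyps])
  qed (auto simp: \<phi>_0)
  have \<phi>_anti: "\<phi> (\<tau> j i x) y = - \<phi> x (\<tau> i j y)" if ij: "i < n" "j < n" and xy: "x \<in> ?V" "y \<in> ?V" for i j x y
  proof -
    have "linear_endo_on R ext.sc ?V (\<lambda>x. - \<tau> i j x)"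
      using \<tau>_endo[of i j] VR.W_minus by (auto simp: linear_endo_on_def)
    moreover have "ext.bf t (\<tau> j i x) y = ext.bf t x (- \<tau> i j y)" for t x y
      unfolding \<tau>_def VR.b_minus_right by (rule ex_adjoint[OF \<sigma>_anti[OF ij]])
    ultimately have "(\<lambda>x. - \<tau> i j x, \<tau> j i) \<in> adjoints_on R ext.sc ?V ?S"
      using \<tau>_endo[of j i] by (auto simp: adjoints_on_def polar_ext_form)
    then have "(\<lambda>x. - \<tau> i j x, \<tau> j i) \<in> adjoints_on R ext.sc ?V (insert h ?S)" unfolding adj .
    then have "\<phi> (\<tau> j i x) y = \<phi> x (- \<tau> i j y)" using xy unfolding adjoints_on_def \<phi>_def by blast
    moreover have "\<phi> (- \<tau> i j y) x = - \<phi> (\<tau> i j y) x"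
      using \<phi>_scl[OF VR.L_minus[OF VR.L_1] \<tau>W[OF xy(2)] xy(1), of i j] by simp
    ultimately show ?thesis by (metis \<phi>_sym)
  qed
  have \<tau>\<tau>: "(\<Sum>i<n. \<tau> j i (\<tau> i k x)) = (if j = k then x else 0)" if "j < n" "k < n" "x \<in> ?V" for j k x
  proof -
    have "(\<Sum>i<n. \<tau> j i (\<tau> i k x)) = ex (\<lambda>v. \<Sum>i<n. \<sigma> j i (\<sigma> i k v)) x"
    proof -
      have "\<tau> j i (\<tau> i k x) = ex (\<lambda>v. \<sigma> j i (\<sigma> i k v)) x" for i unfolding \<tau>_def by (rule ex_comp[OF \<sigma>])
      then show ?thesis by (simp only: ex_sum_maps)
    qed
    also have "\<dots> = (if j = k then x else 0)"
    proof (cases "j = k")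
      case True
      then show ?thesis using ex_id[OF that(3)] \<sigma>\<sigma>[OF that(1,2)] by simp
    next
      case False
      have "ev 0 = 0" using ev_add[of 0 0] by simp
      then show ?thesis using False \<sigma>\<sigma>[OF that(1,2)] by (simp add: ex_def)
    qed
    finally show ?thesis .
  qed
  have anti: "(\<Sum>i<n. h (\<Sum>j<n. \<tau> i j (x j))) = - (\<Sum>j<n. h (x j))" if x: "\<And>j. j < n \<Longrightarrow> x j \<in> ?V" for x
  proof -
    define y where "y i = (\<Sum>j<n. \<tau> i j (x j))" for i
    have y: "y i \<in> ?V" for i unfolding y_def using x by (intro VR.W_sum \<tau>W) auto
    \<comment> \<open>The matrix is an involution, so it brings the image \<open>y\<close> back to
      \<open>x\<close>.\<close>
    have return: "(\<Sum>i<n. \<tau> j i (y i)) = x j" if j: "j < n" for j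
    proof -
      have "(\<Sum>i<n. \<tau> j i (y i)) = (\<Sum>k<n. \<Sum>i<n. \<tau> j i (\<tau> i k (x k)))"
        unfolding y_def \<tau>_def ex_sum by (rule sum.swap)
      also have "\<dots> = (\<Sum>k<n. if j = k then x k else 0)" using \<tau>\<tau> j x by (intro sum.cong) auto
      finally show ?thesis using j by simp
    qed
    have "(\<Sum>i<n. h (y i)) = (\<Sum>i<n. \<Sum>j<n. \<phi> (\<tau> i j (x j)) (y i))"
    proof (intro sum.cong refl)
      fix i
      have "\<phi> (y i) (y i) = (\<Sum>j<n. \<phi> (\<tau> i j (x j)) (y i))"
      proof -
        have "\<phi> (\<Sum>j<n. \<tau> i j (x j)) (y i) = (\<Sum>j<n. \<phi> (\<tau> i j (x j)) (y i))"
          by (rule \<phi>_sum) (use x y in \<open>auto intro: \<tau>W\<close>)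
        then show ?thesis by (simp only: y_def[symmetric])
      qed
      then show "h (y i) = (\<Sum>j<n. \<phi> (\<tau> i j (x j)) (y i))" using h\<phi>[OF y] by simp
    qed
    also have "\<dots> = (\<Sum>j<n. \<Sum>i<n. - \<phi> (\<tau> j i (y i)) (x j))"
    proof (subst sum.swap, intro sum.cong refl)
      fix i j assume "i \<in> {..<n}" "j \<in> {..<n}"
      then have "\<phi> (\<tau> i j (x j)) (y i) = - \<phi> (x j) (\<tau> j i (y i))" using x y by (intro \<phi>_anti) auto
      also have "\<phi> (x j) (\<tau> j i (y i)) = \<phi> (\<tau> j i (y i)) (x j)" by (rule \<phi>_sym)
      finally show "\<phi> (\<tau> i j (x j)) (y i) = - \<phi> (\<tau> j i (y i)) (x j)" .
    qed
    also have "\<dots> = (\<Sum>j<n. - h (x j))"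
    proof (intro sum.cong refl)
      fix j assume j: "j \<in> {..<n}"
      have "\<phi> (\<Sum>i<n. \<tau> j i (y i)) (x j) = (\<Sum>i<n. \<phi> (\<tau> j i (y i)) (x j))"
        by (rule \<phi>_sum) (use x y j in \<open>auto intro: \<tau>W\<close>)
      then show "(\<Sum>i<n. - \<phi> (\<tau> j i (y i)) (x j)) = - h (x j)"
        using return[of j] h\<phi>[of "x j"] x j by (simp add: sum_negf)
    qed
    finally show ?thesis by (simp add: y_def sum_negf)
  qed
  \<comment> \<open>The bound is applied to \<open>h\<close> and to its negative, which gives both
    inequalities between the two dimensions.\<close>
  have "Max (O.posdims h) \<le> Max (O.posdims (\<lambda>x. - h x))"
  proof (rule O.posdim_le[where \<phi> = \<phi> and \<tau> = \<tau> and n = n])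
    show "(\<Sum>i<n. h (\<Sum>j<n. \<tau> i j (x j))) = - (\<Sum>j<n. h (x j))" if "\<And>j. j < n \<Longrightarrow> x j \<in> ?V" for x
      by (rule anti[OF that])
    show "\<phi> x y = \<phi> y x" for x y by (rule \<phi>_sym)
  qed (auto simp: \<phi>_add \<phi>_scl h\<phi> \<phi>R \<tau>_endo n)
  moreover have "Max (O.posdims (\<lambda>x. - h x)) \<le> Max (O.posdims (\<lambda>x. - (- h x)))"
  proof (rule O.posdim_le[where \<phi> = "\<lambda>x y. - \<phi> x y" and \<tau> = \<tau> and n = n])
    show "(\<Sum>i<n. - h (\<Sum>j<n. \<tau> i j (x j))) = - (\<Sum>j<n. - h (x j))" if "\<And>j. j < n \<Longrightarrow> x j \<in> ?V" for x
      using anti[OF that] by (simp add: sum_negf)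
    show "- \<phi> x y = - \<phi> y x" for x y using \<phi>_sym by simp
  qed (auto simp: \<phi>_add \<phi>_scl h\<phi> \<phi>R VR.L_minus \<tau>_endo n)
  ultimately show ?thesis unfolding O.signature_on_eq by simp
qed

end

theorem corollary3:
  fixes scale :: "'k::field \<Rightarrow> 'v::ab_group_add \<Rightarrow> 'v"
    and B :: "'v set"
    and q1 q2 :: "'v \<Rightarrow> 'k"
    and \<iota> :: "'k \<Rightarrow> 'l::field"
  assumes "(2::'k) \<noteq> 0"
    and "finite_dimensional_vector_space scale B"
    and "quadratic_form_on UNIV scale UNIV q1"
    and "quadratic_form_on UNIV scale UNIV q2"
    and "nonsingular_over \<iota> B {q1, q2}"
  shows "(\<exists>n>0. hyperbolic_on UNIV (power_scale scale) (power_space n) (power_form n ` {q1, q2}))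
     \<longleftrightarrow>
     (\<forall>P R T. field_ordering UNIV P \<and> is_real_closure P R T \<longrightarrow>
        (\<forall>q \<in> Cl_on R ext_scale (ext_space B R) (ext_form to_ac B ` {q1, q2}).
           signature_on R T ext_scale (ext_space B R) q = 0))"
proof -
  interpret finite_dimensional_vector_space scale B by fact
  define q where "q t = (if t then q1 else q2)" for t
  have range: "{q1, q2} = range q" by (auto simp: q_def UNIV_bool)
  interpret quad_system scale B q
    by unfold_locales (use assms(1,3,4) in \<open>auto simp: q_def\<close>)
  \<comment> \<open>Two base changes of the same system: along \<iota> for nonsingularity, and into
    the algebraic closure for the real closures.\<close>
  interpret L: base_change scale B q \<iota>
    by unfold_locales (use assms(5) in \<open>simp add: nonsingular_over_def\<close>)
  interpret ac_system scale B q
    by unfold_locales (rule field_embedding_to_ac)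
  note ns = assms(5)[unfolded range]
  show ?thesis unfolding range ext_space_eq
  proof (intro iffI allI impI ballI)
    fix P R T h
    assume "\<exists>n>0. hyperbolic_on UNIV (power_scale scale) (power_space n) (power_form n ` range q)"
      and "field_ordering UNIV P \<and> is_real_closure P R T"
      and "h \<in> Cl_on R (pscale (*)) (pspace B R) (ext_form to_ac B ` range q)"
    then show "signature_on R T (pscale (*)) (pspace B R) h = 0"
      using signature_of_hyperbolic unfolding is_real_closure_def real_closed_def by blast
  qed (intro hyperbolic_of_signatures L.joint_radical[OF ns] L.regular_member[OF ns]; blast)
qed

end
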